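(* Let $C$ be a non-hyperelliptic trigonal smooth complex projective curve of genus $7$ with Maroni degree $1$ and trigonal line bundle $L$. Let $s_1,s_2$ be a basis of $H^0(L)$, let $t$ complete $s_1^3,s_1^2s_2,s_1s_2^2,s_2^3$ to a basis of $H^0(L^{\otimes3})$, and set $x=\frac{s_1}{s_2}$, $y=\frac{t}{s_2^3}$. Then $C$ is described by an equation in $x,y$ of the form $$y^3+y^2\psi_3(x)+y\,\psi_6(x)+\psi_9(x)=0,$$ where $\psi_3,\psi_6,\psi_9$ are polynomials of degree $\le3,6,9$ respectively; that is, $x$ and $y$ generate the function field of $C$ and satisfy such an equation.
   Context: Maroni degree: for a trigonal non-hyperelliptic curve $C$ of genus $g\ge5$ with (unique) trigonal line bundle $L$ (degree $3$, $h^0(L)=2$), it is the unique $k\in\mathbb N$ with $h^0(C,L^{\otimes k+1})=k+2$ and $h^0(C,L^{\otimes k+2})>k+3$. For $g=7$, $k=1$ one has $K_C\cong L^{\otimes4}$ and $h^0(L^{\otimes3})=5$. *)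

theory Defs
  imports
    "HOL-Analysis.Finite_Cartesian_Product"
    "HOL-Analysis.Cartesian_Space"
    "HOL-Library.Function_Algebras"
    "HOL-Computational_Algebra.Polynomial"
    "HOL-Algebra.Algebra"
begin

section \<open>Projective space and its Zariski topology\<close>

text \<open>
  A point of the projective space of dimension \<open>CARD('n) - 1\<close> is a line through the
  origin of \<open>complex ^ 'n\<close>, with the origin removed.
\<close>

type_synonym 'n ppoint = "(complex ^ 'n) set"

definition ppoint :: "complex ^ 'n::finite \<Rightarrow> 'n ppoint" where
  "ppoint v = {c *s v | c. c \<noteq> 0}"

definition proj_space :: "('n::finite) ppoint set" where
  "proj_space = {ppoint v | v. v \<noteq> 0}"

text \<open>
  Homogeneous forms of degree \<open>d\<close>, taken as functions; this loses nothing because the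
  complex field is infinite.
\<close>

definition forms :: "nat \<Rightarrow> (complex ^ 'n::finite \<Rightarrow> complex) set" where
  "forms d = {F. \<exists>c. F = (\<lambda>v. \<Sum>m\<in>{m :: 'n \<Rightarrow> nat. (\<Sum>i\<in>UNIV. m i) = d}.
                                c m * (\<Prod>i\<in>UNIV. (v $ i) ^ m i))}"

definition zclosed :: "('n::finite) ppoint set \<Rightarrow> bool" where
  "zclosed Z \<longleftrightarrow> (\<exists>T \<subseteq> (\<Union>d. forms d). Z = {P \<in> proj_space. \<forall>F\<in>T. \<forall>v\<in>P. F v = 0})"

definition zopen :: "('n::finite) ppoint set \<Rightarrow> 'n ppoint set \<Rightarrow> bool" where
  "zopen C U \<longleftrightarrow> (\<exists>Z. zclosed Z \<and> U = C - Z)"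

definition zirreducible :: "('n::finite) ppoint set \<Rightarrow> bool" where
  "zirreducible C \<longleftrightarrow> C \<noteq> {} \<and>
     (\<forall>Z1 Z2. zclosed Z1 \<longrightarrow> zclosed Z2 \<longrightarrow> C \<subseteq> Z1 \<union> Z2 \<longrightarrow> C \<subseteq> Z1 \<or> C \<subseteq> Z2)"

section \<open>Regular and rational functions\<close>

text \<open>Only the values of \<open>f\<close> on \<open>U\<close> matter here.\<close>

definition regular_on ::
    "('n::finite) ppoint set \<Rightarrow> 'n ppoint set \<Rightarrow> ('n ppoint \<Rightarrow> complex) \<Rightarrow> bool" where
  "regular_on C U f \<longleftrightarrow> zopen C U \<and>
     (\<forall>P\<in>U. \<exists>W d. \<exists>F\<in>forms d. \<exists>G\<in>forms d. zopen C W \<and> P \<in> W \<and> W \<subseteq> U \<and>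
        (\<forall>Q\<in>W. \<forall>v\<in>Q. G v \<noteq> 0 \<and> f Q = F v / G v))"

text \<open>
  A rational function on an irreducible \<open>C\<close> is an equivalence class of pairs \<open>(U, f)\<close> with
  \<open>f\<close> regular on the nonempty open set \<open>U\<close>, two pairs being equivalent if the functions
  agree on the common domain.  \<open>rat C U f\<close> is the class of \<open>(U, f)\<close>.
\<close>

type_synonym 'n rat_fun = "('n ppoint set \<times> ('n ppoint \<Rightarrow> complex)) set"

definition rat :: "('n::finite) ppoint set \<Rightarrow> 'n ppoint set \<Rightarrow> ('n ppoint \<Rightarrow> complex) \<Rightarrow> 'n rat_fun"
  where
  "rat C U f = {(V, g). V \<noteq> {} \<and> regular_on C V g \<and> (\<forall>P\<in>U \<inter> V. f P = g P)}"

definition function_field :: "('n::finite) ppoint set \<Rightarrow> 'n rat_fun ring" where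
  "function_field C =
     \<lparr>carrier = {rat C U f | U f. U \<noteq> {} \<and> regular_on C U f},
      monoid.mult = (\<lambda>a b. \<Union>(U, f)\<in>a. \<Union>(V, g)\<in>b. rat C (U \<inter> V) (\<lambda>P. f P * g P)),
      one = rat C C (\<lambda>_. 1),
      ring.zero = rat C C (\<lambda>_. 0),
      ring.add = (\<lambda>a b. \<Union>(U, f)\<in>a. \<Union>(V, g)\<in>b. rat C (U \<inter> V) (\<lambda>P. f P + g P))\<rparr>"

definition const :: "('n::finite) ppoint set \<Rightarrow> complex \<Rightarrow> 'n rat_fun" where
  "const C c = rat C C (\<lambda>_. c)"

definition poly_at :: "('n::finite) ppoint set \<Rightarrow> complex poly \<Rightarrow> 'n rat_fun \<Rightarrow> 'n rat_fun" where
  "poly_at C p a = (\<Oplus>\<^bsub>function_field C\<^esub> i\<in>{..Polynomial.degree p}.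
      const C (poly.coeff p i) \<otimes>\<^bsub>function_field C\<^esub> a [^]\<^bsub>function_field C\<^esub> i)"

section \<open>Smooth projective curves\<close>

text \<open>The dimension of a variety is the transcendence degree of its function field.\<close>

definition dimension_one :: "('n::finite) ppoint set \<Rightarrow> bool" where
  "dimension_one C \<longleftrightarrow>
     (\<exists>x\<in>carrier (function_field C). ring.transcendental (function_field C) (range (const C)) x \<and>
        (\<forall>y\<in>carrier (function_field C).
           \<not> ring.transcendental (function_field C)
               (generate_field (function_field C) (range (const C) \<union> {x})) y))"

definition local_ring :: "('n::finite) ppoint set \<Rightarrow> 'n ppoint \<Rightarrow> 'n rat_fun set" where
  "local_ring C P = {rat C U f | U f. P \<in> U \<and> regular_on C U f}"

definition maximal_ideal_at :: "('n::finite) ppoint set \<Rightarrow> 'n ppoint \<Rightarrow> 'n rat_fun set" where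
  "maximal_ideal_at C P = {rat C U f | U f. P \<in> U \<and> regular_on C U f \<and> f P = 0}"

definition uniformizer :: "('n::finite) ppoint set \<Rightarrow> 'n ppoint \<Rightarrow> 'n rat_fun \<Rightarrow> bool" where
  "uniformizer C P t \<longleftrightarrow>
     maximal_ideal_at C P = {a \<otimes>\<^bsub>function_field C\<^esub> t | a. a \<in> local_ring C P}"

text \<open>
  A local ring of dimension \<open>d\<close> is regular if its maximal ideal is generated by \<open>d\<close> elements;
  the local rings of a curve at its points have dimension 1.  Irreducibility is part of the
  notion of a curve.
\<close>

definition smooth_projective_curve :: "('n::finite) ppoint set \<Rightarrow> bool" where
  "smooth_projective_curve C \<longleftrightarrow>
     zclosed C \<and> zirreducible C \<and> dimension_one C \<and> (\<forall>P\<in>C. \<exists>t. uniformizer C P t)"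

section \<open>Spaces of functions of two arguments as complex vector spaces\<close>

text \<open>
  Sections of line bundles and differential forms are both functions of two arguments, with
  pointwise operations from \<open>HOL-Library.Function_Algebras\<close>.
\<close>

definition fscale :: "complex \<Rightarrow> ('a \<Rightarrow> 'b \<Rightarrow> complex) \<Rightarrow> 'a \<Rightarrow> 'b \<Rightarrow> complex" where
  "fscale c s = (\<lambda>a b. c * s a b)"

global_interpretation fvs: vector_space fscale
  by unfold_locales (simp_all add: fscale_def fun_eq_iff algebra_simps)

definition is_basis :: "('a \<Rightarrow> 'b \<Rightarrow> complex) list \<Rightarrow> ('a \<Rightarrow> 'b \<Rightarrow> complex) set \<Rightarrow> bool" where
  "is_basis bs V \<longleftrightarrow> distinct bs \<and> fvs.independent (set bs) \<and> fvs.span (set bs) = V"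

section \<open>The genus\<close>

text \<open>
  The tangent space at \<open>P\<close> consists of the point derivations of the local ring at \<open>P\<close>
  (extended by 0), and the differential of a germ at \<open>P\<close> is evaluation on tangent vectors.
  A regular differential form assigns to each point a cotangent vector and is locally a
  finite sum of terms \<open>f dg\<close> with \<open>f\<close> and \<open>g\<close> regular.
\<close>

definition tangent_space ::
    "('n::finite) ppoint set \<Rightarrow> 'n ppoint \<Rightarrow> ('n rat_fun \<Rightarrow> complex) set" where
  "tangent_space C P = {D.
     (\<forall>a. a \<notin> local_ring C P \<longrightarrow> D a = 0) \<and>
     (\<forall>c U f. P \<in> U \<longrightarrow> regular_on C U f \<longrightarrow> D (rat C U (\<lambda>Q. c * f Q)) = c * D (rat C U f)) \<and>
     (\<forall>U f V g. P \<in> U \<longrightarrow> regular_on C U f \<longrightarrow> P \<in> V \<longrightarrow> regular_on C V g \<longrightarrow>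
        D (rat C (U \<inter> V) (\<lambda>Q. f Q + g Q)) = D (rat C U f) + D (rat C V g) \<and>
        D (rat C (U \<inter> V) (\<lambda>Q. f Q * g Q)) = f P * D (rat C V g) + g P * D (rat C U f))}"

definition differential_at ::
    "('n::finite) ppoint set \<Rightarrow> 'n ppoint \<Rightarrow> 'n rat_fun \<Rightarrow> ('n rat_fun \<Rightarrow> complex) \<Rightarrow> complex" where
  "differential_at C P a = (\<lambda>D. if D \<in> tangent_space C P then D a else 0)"

definition regular_differentials ::
    "('n::finite) ppoint set \<Rightarrow> ('n ppoint \<Rightarrow> ('n rat_fun \<Rightarrow> complex) \<Rightarrow> complex) set" where
  "regular_differentials C = {\<omega>.
     (\<forall>P. P \<notin> C \<longrightarrow> \<omega> P = (\<lambda>_. 0)) \<and>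
     (\<forall>P\<in>C. \<exists>W fgs. zopen C W \<and> P \<in> W \<and>
        (\<forall>(f, g)\<in>set fgs. regular_on C W f \<and> regular_on C W g) \<and>
        (\<forall>Q\<in>W. \<omega> Q = (\<lambda>D. \<Sum>(f, g)\<leftarrow>fgs. f Q * differential_at C Q (rat C W g) D)))}"

definition genus :: "('n::finite) ppoint set \<Rightarrow> nat" where
  "genus C = fvs.dim (regular_differentials C)"

section \<open>Hyperelliptic curves\<close>

definition morphism ::
    "('n::finite) ppoint set \<Rightarrow> ('m::finite) ppoint set \<Rightarrow> ('n ppoint \<Rightarrow> 'm ppoint) \<Rightarrow> bool" where
  "morphism C Y h \<longleftrightarrow> h ` C \<subseteq> Y \<and>
     (\<forall>P\<in>C. \<exists>W d F. zopen C W \<and> P \<in> W \<and> (\<forall>k. F k \<in> forms d) \<and>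
        (\<forall>Q\<in>W. \<forall>v\<in>Q. (\<chi> k. F k v) \<noteq> 0 \<and> h Q = ppoint (\<chi> k. F k v)))"

text \<open>
  The pullbacks to \<open>C\<close> of the rational functions on \<open>Y\<close> (those whose domain meets the image).
  The degree of \<open>h\<close> is the degree of the function field of \<open>C\<close> over this subfield.
\<close>

definition pullback_field ::
    "('n::finite) ppoint set \<Rightarrow> ('m::finite) ppoint set \<Rightarrow> ('n ppoint \<Rightarrow> 'm ppoint) \<Rightarrow> 'n rat_fun set"
  where
  "pullback_field C Y h =
     {rat C {P\<in>C. h P \<in> V} (f \<circ> h) | V f. regular_on Y V f \<and> (\<exists>P\<in>C. h P \<in> V)}"

text \<open>
  A constant morphism cannot occur below: the function field has infinite degree over the
  constants.
\<close>

definition hyperelliptic :: "('n::finite) ppoint set \<Rightarrow> bool" where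
  "hyperelliptic C \<longleftrightarrow> genus C \<ge> 2 \<and>
     (\<exists>h :: 'n ppoint \<Rightarrow> 2 ppoint. morphism C proj_space h \<and>
        ring.dimension (function_field C) 2 (pullback_field C proj_space h)
          (carrier (function_field C)))"

section \<open>Line bundles\<close>

text \<open>
  A line bundle is given by a trivialising open cover and transition functions;
  a section by its local expressions \<open>s i = g i j * s j\<close>, which are
  extended by 0 outside \<open>cover L i\<close>.  With this convention the product of sections of two
  bundles with the same cover (in particular of two powers of a bundle) is the pointwise
  product.
\<close>

record ('i, 'n) line_bundle =
  cover :: "'i \<Rightarrow> 'n ppoint set"
  transition :: "'i \<Rightarrow> 'i \<Rightarrow> 'n ppoint \<Rightarrow> complex"

definition is_line_bundle :: "('n::finite) ppoint set \<Rightarrow> ('i, 'n) line_bundle \<Rightarrow> bool" where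
  "is_line_bundle C L \<longleftrightarrow>
     (\<forall>i. zopen C (cover L i) \<and> cover L i \<noteq> {}) \<and> (\<Union>i. cover L i) = C \<and>
     (\<forall>i j. regular_on C (cover L i \<inter> cover L j) (transition L i j) \<and>
        (\<forall>P\<in>cover L i \<inter> cover L j. transition L i j P \<noteq> 0)) \<and>
     (\<forall>i j k. \<forall>P\<in>cover L i \<inter> cover L j \<inter> cover L k.
        transition L i k P = transition L i j P * transition L j k P)"

definition tensor_power :: "('i, 'n::finite) line_bundle \<Rightarrow> nat \<Rightarrow> ('i, 'n) line_bundle" where
  "tensor_power L k = \<lparr>cover = cover L, transition = (\<lambda>i j P. transition L i j P ^ k)\<rparr>"

definition H0 ::
    "('n::finite) ppoint set \<Rightarrow> ('i, 'n) line_bundle \<Rightarrow> ('i \<Rightarrow> 'n ppoint \<Rightarrow> complex) set" where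
  "H0 C L = {s.
     (\<forall>i. regular_on C (cover L i) (s i) \<and> (\<forall>P. P \<notin> cover L i \<longrightarrow> s i P = 0)) \<and>
     (\<forall>i j. \<forall>P\<in>cover L i \<inter> cover L j. s i P = transition L i j P * s j P)}"

definition h0 :: "('n::finite) ppoint set \<Rightarrow> ('i, 'n) line_bundle \<Rightarrow> nat" where
  "h0 C L = fvs.dim (H0 C L)"

text \<open>The order at \<open>P\<close> of a nonzero rational function.\<close>

definition ord_at :: "('n::finite) ppoint set \<Rightarrow> 'n ppoint \<Rightarrow> 'n rat_fun \<Rightarrow> int" where
  "ord_at C P a = (THE k. \<exists>t u. uniformizer C P t \<and> u \<in> local_ring C P - maximal_ideal_at C P \<and>
      a = u \<otimes>\<^bsub>function_field C\<^esub> t [^]\<^bsub>function_field C\<^esub> k)"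

definition nonzero_rational_section ::
    "('n::finite) ppoint set \<Rightarrow> ('i, 'n) line_bundle \<Rightarrow> ('i \<Rightarrow> 'n rat_fun) \<Rightarrow> bool" where
  "nonzero_rational_section C L \<sigma> \<longleftrightarrow>
     (\<forall>i. \<sigma> i \<in> carrier (function_field C) \<and> \<sigma> i \<noteq> \<zero>\<^bsub>function_field C\<^esub>) \<and>
     (\<forall>i j. \<sigma> i = rat C (cover L i \<inter> cover L j) (transition L i j) \<otimes>\<^bsub>function_field C\<^esub> \<sigma> j)"

text \<open>An index of the cover at \<open>P\<close>; nothing below depends on the choice.\<close>

definition chart_at :: "('i, 'n::finite) line_bundle \<Rightarrow> 'n ppoint \<Rightarrow> 'i" where
  "chart_at L P = (SOME i. P \<in> cover L i)"

definition divisor_degree ::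
    "('n::finite) ppoint set \<Rightarrow> ('i, 'n) line_bundle \<Rightarrow> ('i \<Rightarrow> 'n rat_fun) \<Rightarrow> int" where
  "divisor_degree C L \<sigma> =
     (\<Sum>P\<in>{P\<in>C. ord_at C P (\<sigma> (chart_at L P)) \<noteq> 0}. ord_at C P (\<sigma> (chart_at L P)))"

text \<open>
  The degree is that of the divisor of any nonzero rational section; the choice does
  not matter because principal divisors on a projective curve have degree 0.
\<close>

definition line_bundle_degree :: "('n::finite) ppoint set \<Rightarrow> ('i, 'n) line_bundle \<Rightarrow> int" where
  "line_bundle_degree C L = divisor_degree C L (SOME \<sigma>. nonzero_rational_section C L \<sigma>)"

definition trigonal_line_bundle :: "('n::finite) ppoint set \<Rightarrow> ('i, 'n) line_bundle \<Rightarrow> bool" where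
  "trigonal_line_bundle C L \<longleftrightarrow> is_line_bundle C L \<and> line_bundle_degree C L = 3 \<and> h0 C L = 2"

definition maroni_degree :: "('n::finite) ppoint set \<Rightarrow> ('i, 'n) line_bundle \<Rightarrow> nat" where
  "maroni_degree C L =
     (THE k. h0 C (tensor_power L (k + 1)) = k + 2 \<and> h0 C (tensor_power L (k + 2)) > k + 3)"

text \<open>
  The rational function \<open>s / t\<close>, for \<open>s\<close> and \<open>t \<noteq> 0\<close> sections of the same bundle, of which
  only the cover is needed.
\<close>

definition section_quotient ::
    "('n::finite) ppoint set \<Rightarrow> ('i, 'n) line_bundle \<Rightarrow>
     ('i \<Rightarrow> 'n ppoint \<Rightarrow> complex) \<Rightarrow> ('i \<Rightarrow> 'n ppoint \<Rightarrow> complex) \<Rightarrow> 'n rat_fun" where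
  "section_quotient C L s t =
     rat C {P\<in>C. t (chart_at L P) P \<noteq> 0} (\<lambda>P. s (chart_at L P) P / t (chart_at L P) P)"

end

theory Submission
  imports Defs "HOL-Computational_Algebra.Computational_Algebra"
    "HOL-Computational_Algebra.Field_as_Ring"
begin

text \<open>
  Let \<open>D\<close> be the divisor of zeros of \<open>s2\<close>. It has degree 3, the poles of \<open>x\<close> are bounded by \<open>D\<close> and
  those of \<open>y\<close> by \<open>3 D\<close>. A nonconstant function \<open>z\<close> has as many zeros as poles, and this number is the
  degree of the function field \<open>K\<close> over \<open>\<complex>(z)\<close>; so \<open>[K : \<complex>(x)] \<le> 3\<close>. Degree 2 would make \<open>x\<close> a map of
  degree 2 to the projective line, and degree 1 would make \<open>x\<^sup>2\<close> such a map; both are impossible on a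
  curve of genus at least 2 that is not hyperelliptic. Hence \<open>[K : \<complex>(x)] = 3\<close>, and \<open>D\<close> is exactly the
  divisor of poles of \<open>x\<close>.

  Consequently \<open>y\<close> is regular wherever \<open>x\<close> is, and \<open>y / x\<^sup>3\<close> is regular wherever \<open>1 / x\<close> is. If \<open>y\<close> were in
  \<open>\<complex>(x)\<close>, the first fact would make it a polynomial in \<open>x\<close> and the second would bound its degree by 3;
  then \<open>t\<close> would be a combination of the cubic monomials in \<open>s1\<close> and \<open>s2\<close>. So \<open>y\<close> generates the cubic
  extension \<open>K\<close> of \<open>\<complex>(x)\<close>. A function that is regular wherever \<open>x\<close> is, is integral over \<open>\<complex>[x]\<close>; by the
  Gauss lemma the cubic equation of \<open>y\<close> over \<open>\<complex>(x)\<close> can be taken monic with coefficients in \<open>\<complex>[x]\<close>. In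
  the same way \<open>y / x\<^sup>3\<close> satisfies a monic cubic equation over \<open>\<complex>[1 / x]\<close>. The two equations are
  proportional, and comparing their coefficients gives the degrees 3, 6 and 9.

  The field theory (\<open>trigonal_cubic_equation\<close>, \<open>pole_number_eq_zeros\<close>, \<open>sum_val_eq_0\<close>) is carried out in
  the locale \<open>point_field\<close>, for a subfield \<open>K\<close> of a type of class \<open>field\<close> with a set of points, each
  with a discrete valuation ring. The geometric inputs are that any two elements of \<open>K\<close> are algebraically
  dependent, that every valuation ring of \<open>K\<close> with residue field \<open>\<complex>\<close> has a centre among the points, and
  that points are separated by functions. Integrality of regular functions then follows by
  Chevalley's construction of a place (\<open>exists_point_off_integral_closure\<close>), and the equality of zeros,
  poles and degree from linear algebra in the spaces of functions with bounded poles.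

  A smooth projective curve provides such a structure. Its rational functions are expanded into
  Laurent series at one chosen point, which identifies the function field with a subfield of
  \<open>complex fls\<close>; algebraic dependence comes from the transcendence degree by a count of monomials
  (\<open>dependence_by_counting\<close>), centres from the projective coordinates (\<open>center_exists\<close>). Finally
  morphisms to the projective line, orders and sections of line bundles are translated into this
  language (\<open>hyperelliptic_if_quadratic\<close>, \<open>ord_at_eq_val\<close>, \<open>degree_eq_sum_zero_order\<close>).
\<close>

section \<open>Evaluating polynomials along ring homomorphisms\<close>

text \<open>
  The map on coefficients may itself be an evaluation; polynomials in two variables are evaluated in
  this way.
\<close>

definition peval :: "('a::zero \<Rightarrow> 'b::comm_semiring_0) \<Rightarrow> 'a poly \<Rightarrow> 'b \<Rightarrow> 'b" where
  "peval h p b = poly (map_poly h p) b"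

locale comm_ring_map =
  fixes h :: "'a::comm_ring_1 \<Rightarrow> 'b::comm_ring_1"
  assumes map_0 [simp]: "h 0 = 0" and map_1 [simp]: "h 1 = 1"
    and map_add: "h (a + b) = h a + h b" and map_mult: "h (a * b) = h a * h b"
begin

lemma map_uminus: "h (- a) = - h a"
  by (metis add.right_inverse add_eq_0_iff map_0 map_add)

lemma map_diff: "h (a - b) = h a - h b"
  using map_add[of a "- b"] by (simp add: map_uminus)

lemma peval_0 [simp]: "peval h 0 b = 0"
  by (simp add: peval_def)

lemma peval_pCons [simp]: "peval h (pCons a p) b = h a + b * peval h p b"
  by (simp add: peval_def map_poly_pCons)

lemma peval_1 [simp]: "peval h 1 b = 1"
  by (simp add: peval_def)

lemma peval_add: "peval h (p + q) b = peval h p b + peval h q b"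
proof -
  have "map_poly h (p + q) = map_poly h p + map_poly h q"
    by (intro poly_eqI) (simp add: coeff_map_poly map_add)
  then show ?thesis by (simp add: peval_def)
qed

lemma peval_smult: "peval h (Polynomial.smult c p) b = h c * peval h p b"
  by (induction p) (auto simp: map_mult algebra_simps)

lemma peval_uminus: "peval h (- p) b = - peval h p b"
  using peval_smult[of "- 1" p b] by (simp add: map_uminus)

lemma peval_diff: "peval h (p - q) b = peval h p b - peval h q b"
  using peval_add[of p "- q" b] by (simp add: peval_uminus)

lemma peval_mult: "peval h (p * q) b = peval h p b * peval h q b"
  by (induction p) (auto simp: peval_add peval_smult algebra_simps)

lemma peval_power: "peval h (p ^ n) b = peval h p b ^ n"
  by (induction n) (auto simp: peval_mult)

lemma peval_sum: "peval h (sum f A) b = (\<Sum>i\<in>A. peval h (f i) b)"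
  by (induction A rule: infinite_finite_induct) (auto simp: peval_add)

lemma peval_monom: "peval h (Polynomial.monom c n) b = h c * b ^ n"
  by (induction n) (auto simp: monom_0 monom_Suc mult_ac)

lemma peval_altdef:
  assumes "Polynomial.degree p \<le> n"
  shows "peval h p b = (\<Sum>i\<le>n. h (poly.coeff p i) * b ^ i)"
proof -
  have "peval h p b = peval h (\<Sum>i\<le>n. Polynomial.monom (poly.coeff p i) i) b"
    using poly_as_sum_of_monoms'[OF assms] by simp
  then show ?thesis by (simp add: peval_sum peval_monom)
qed

lemma comm_ring_map_peval: "comm_ring_map (\<lambda>p. peval h p b)"
  by unfold_locales (simp_all add: peval_add peval_mult)

end

text \<open>
  Fields of functions, local rings and valuation rings are all handled as such subsets of one type,
  which allows Zorn's lemma to be applied to them.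
\<close>

definition subrg :: "'a::comm_ring_1 set \<Rightarrow> bool" where
  "subrg V \<longleftrightarrow> 1 \<in> V \<and> (\<forall>a\<in>V. \<forall>b\<in>V. a - b \<in> V \<and> a * b \<in> V)"

lemma subrgD:
  assumes "subrg V"
  shows "0 \<in> V" "1 \<in> V" "a \<in> V \<Longrightarrow> b \<in> V \<Longrightarrow> a + b \<in> V" "a \<in> V \<Longrightarrow> b \<in> V \<Longrightarrow> a - b \<in> V"
    "a \<in> V \<Longrightarrow> - a \<in> V" "a \<in> V \<Longrightarrow> b \<in> V \<Longrightarrow> a * b \<in> V" "a \<in> V \<Longrightarrow> a ^ n \<in> V"
proof -
  show *: "0 \<in> V" "1 \<in> V" using assms unfolding subrg_def by (metis diff_self) (use assms subrg_def in blast)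
  show **: "a \<in> V \<Longrightarrow> b \<in> V \<Longrightarrow> a - b \<in> V" "a \<in> V \<Longrightarrow> b \<in> V \<Longrightarrow> a * b \<in> V" for a b
    using assms unfolding subrg_def by auto
  show ***: "a \<in> V \<Longrightarrow> - a \<in> V" for a using **(1)[of 0 a] * by simp
  show "a \<in> V \<Longrightarrow> b \<in> V \<Longrightarrow> a + b \<in> V" using **(1)[of a "- b"] *** by simp
  show "a \<in> V \<Longrightarrow> a ^ n \<in> V" by (induction n) (auto simp: * **)
qed

lemma subrg_sum:
  assumes "subrg V" and "\<And>i. i \<in> A \<Longrightarrow> f i \<in> V"
  shows "sum f A \<in> V"
  using assms(2) by (induction A rule: infinite_finite_induct) (auto intro: subrgD[OF assms(1)])

lemma (in comm_ring_map) peval_in: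
  assumes "subrg V" "range h \<subseteq> V" "b \<in> V"
  shows "peval h p b \<in> V"
  using assms(2,3) by (induction p) (auto intro!: subrgD[OF assms(1)])

text \<open>
  Two equal members of a family give a linear relation as well. The families counted below are given by
  formulas, and their members may coincide.
\<close>

lemma (in vector_space) family_dependent:
  assumes "finite A" "finite G" "f ` A \<subseteq> span G" "card G < card A"
  shows "\<exists>a. (\<exists>i\<in>A. a i \<noteq> 0) \<and> (\<Sum>i\<in>A. scale (a i) (f i)) = 0"
proof (cases "inj_on f A")
  case True
  have "dependent (f ` A)"
  proof (rule ccontr)
    assume "\<not> dependent (f ` A)"
    then have "card (f ` A) \<le> card G"
      using independent_span_bound[OF assms(2) _ assms(3)] by auto
    then show False using assms(4) card_image[OF True] by simp
  qed
  then obtain u where u: "\<exists>v\<in>f ` A. u v \<noteq> 0" "(\<Sum>v\<in>f ` A. scale (u v) v) = 0"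
    using dependent_finite[of "f ` A"] assms(1) by auto
  then show ?thesis
    by (intro exI[of _ "u \<circ> f"]) (auto simp: sum.reindex[OF True])
next
  case False
  then obtain i j where ij: "i \<in> A" "j \<in> A" "i \<noteq> j" "f i = f j" by (auto simp: inj_on_def)
  define a where "a = (\<lambda>k. if k = i then 1 else if k = j then - 1 else 0 :: 'a)"
  have "(\<Sum>k\<in>A. scale (a k) (f k)) = (\<Sum>k\<in>{i, j}. scale (a k) (f k))"
    using assms(1) ij by (intro sum.mono_neutral_right) (auto simp: a_def)
  also have "\<dots> = 0" using ij by (simp add: a_def)
  finally show ?thesis using ij(1) by (intro exI[of _ a]) (auto simp: a_def)
qed

section \<open>Function fields with points\<close>

text \<open>
  The functions of a smooth projective curve: \<open>K\<close> is the function field with constants \<open>\<iota>\<close>, and \<open>Loc P\<close>,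
  \<open>ev P\<close> and \<open>t P\<close> are the local ring, the evaluation and a uniformizer at \<open>P\<close>. Dimension one enters
  through \<open>relation\<close>, completeness through \<open>center\<close>: a valuation ring \<open>V\<close> with residue map \<open>\<kappa>\<close> dominates
  the local ring of some point. The assumption \<open>charts\<close>, by which on finitely many
  pieces the points are told apart by finitely many regular functions, makes the zeros of a function finite
  in number.
\<close>

locale point_field =
  fixes K :: "'k::field set" and \<iota> :: "complex \<Rightarrow> 'k" and Pts :: "'p set"
    and Loc :: "'p \<Rightarrow> 'k set" and ev :: "'p \<Rightarrow> 'k \<Rightarrow> complex" and t :: "'p \<Rightarrow> 'k"
  assumes iota: "comm_ring_map \<iota>"
    and K_subrg: "subrg K"
    and K_inverse: "a \<in> K \<Longrightarrow> inverse a \<in> K"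
    and relation: "a \<in> K \<Longrightarrow> b \<in> K \<Longrightarrow> \<exists>p. p \<noteq> 0 \<and> peval (\<lambda>c. peval \<iota> c a) p b = 0"
    and Loc_subrg: "P \<in> Pts \<Longrightarrow> subrg (Loc P)"
    and Loc_K: "P \<in> Pts \<Longrightarrow> Loc P \<subseteq> K"
    and Pts_nonempty: "Pts \<noteq> {}"
    and iota_Loc: "P \<in> Pts \<Longrightarrow> \<iota> c \<in> Loc P"
    and ev_iota: "P \<in> Pts \<Longrightarrow> ev P (\<iota> c) = c"
    and ev_add: "P \<in> Pts \<Longrightarrow> a \<in> Loc P \<Longrightarrow> b \<in> Loc P \<Longrightarrow> ev P (a + b) = ev P a + ev P b"
    and ev_mult: "P \<in> Pts \<Longrightarrow> a \<in> Loc P \<Longrightarrow> b \<in> Loc P \<Longrightarrow> ev P (a * b) = ev P a * ev P b"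
    and Loc_inverse: "P \<in> Pts \<Longrightarrow> a \<in> Loc P \<Longrightarrow> ev P a \<noteq> 0 \<Longrightarrow> inverse a \<in> Loc P"
    and t_Loc: "P \<in> Pts \<Longrightarrow> t P \<in> Loc P" and t_nz: "P \<in> Pts \<Longrightarrow> t P \<noteq> 0"
    and ev_t: "P \<in> Pts \<Longrightarrow> ev P (t P) = 0"
    and dvr: "P \<in> Pts \<Longrightarrow> a \<in> K \<Longrightarrow> a \<noteq> 0 \<Longrightarrow>
      \<exists>n. \<exists>u\<in>Loc P. ev P u \<noteq> 0 \<and> a = u * t P powi n"
    and center: "subrg V \<Longrightarrow> V \<subseteq> K \<Longrightarrow> range \<iota> \<subseteq> V \<Longrightarrow>
      (\<And>z. z \<in> K \<Longrightarrow> z \<in> V \<or> inverse z \<in> V) \<Longrightarrow>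
      (\<And>a. \<kappa> (\<iota> a) = a) \<Longrightarrow>
      (\<And>a b. a \<in> V \<Longrightarrow> b \<in> V \<Longrightarrow> \<kappa> (a + b) = \<kappa> a + \<kappa> b \<and> \<kappa> (a * b) = \<kappa> a * \<kappa> b) \<Longrightarrow>
      (\<And>z. z \<in> V \<Longrightarrow> \<kappa> z \<noteq> 0 \<Longrightarrow> inverse z \<in> V) \<Longrightarrow>
      \<exists>P\<in>Pts. \<forall>a\<in>Loc P. a \<in> V \<and> \<kappa> a = ev P a"
    and separation: "finite S \<Longrightarrow> S \<subseteq> Pts \<Longrightarrow> P \<in> S \<Longrightarrow>
      \<exists>a. (\<forall>Q\<in>S. a \<in> Loc Q \<and> ev Q a = (if Q = P then 1 else 0))"
    and charts: "\<exists>Xs. finite Xs \<and> Pts = \<Union>Xs \<and> (\<forall>Y\<in>Xs. \<exists>\<Xi>. finite \<Xi> \<and> \<Xi> \<subseteq> K \<and>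
      (\<forall>P\<in>Y. \<Xi> \<subseteq> Loc P) \<and> (\<forall>P\<in>Y. \<forall>Q\<in>Y. (\<forall>\<xi>\<in>\<Xi>. ev P \<xi> = ev Q \<xi>) \<longrightarrow> P = Q))"
begin

sublocale iota: comm_ring_map \<iota> by (rule iota)

abbreviation ap :: "complex poly \<Rightarrow> 'k \<Rightarrow> 'k" where "ap \<equiv> peval \<iota>"

lemma ap_map: "comm_ring_map (\<lambda>c. ap c x)"
  by (rule iota.comm_ring_map_peval)

lemma iota_K: "\<iota> c \<in> K"
  using Pts_nonempty iota_Loc Loc_K by blast

lemma iota_eq_0 [simp]: "\<iota> c = 0 \<longleftrightarrow> c = 0"
  by (metis Pts_nonempty all_not_in_conv ev_iota iota.map_0)

lemma ap_K: "x \<in> K \<Longrightarrow> ap p x \<in> K"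
  using iota.peval_in[OF K_subrg] iota_K by blast

lemmas K_rg = subrgD[OF K_subrg]

lemma K_divide: "a \<in> K \<Longrightarrow> b \<in> K \<Longrightarrow> a / b \<in> K"
  by (simp add: divide_inverse K_rg K_inverse)

lemma K_powi: "a \<in> K \<Longrightarrow> a powi n \<in> K"
  by (simp add: power_int_def K_rg K_inverse)

sublocale vs: vector_space "\<lambda>c v. \<iota> c * v"
  by unfold_locales (simp_all add: iota.map_add iota.map_mult algebra_simps)

subsection \<open>Orders\<close>

definition val :: "'p \<Rightarrow> 'k \<Rightarrow> int" where
  "val P a = (THE n. \<exists>u\<in>Loc P. ev P u \<noteq> 0 \<and> a = u * t P powi n)"

context
  fixes P
  assumes P: "P \<in> Pts"
begin

lemmas rg = subrgD[OF Loc_subrg[OF P]]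

lemma ev_0: "ev P 0 = 0" using ev_iota[OF P, of 0] by simp

lemma ev_1: "ev P 1 = 1" using ev_iota[OF P, of 1] by simp

lemma ev_uminus: "a \<in> Loc P \<Longrightarrow> ev P (- a) = - ev P a"
  using ev_add[OF P, of a "- a"] by (simp add: rg ev_0 eq_neg_iff_add_eq_0 add.commute)

lemma ev_diff: "a \<in> Loc P \<Longrightarrow> b \<in> Loc P \<Longrightarrow> ev P (a - b) = ev P a - ev P b"
  using ev_add[OF P, of a "- b"] by (simp add: rg ev_uminus)

lemma ev_power: "a \<in> Loc P \<Longrightarrow> ev P (a ^ n) = ev P a ^ n"
  by (induction n) (simp_all add: ev_1 ev_mult[OF P] rg)

lemma ap_Loc: "x \<in> Loc P \<Longrightarrow> ap p x \<in> Loc P"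
  using iota.peval_in[OF Loc_subrg[OF P]] iota_Loc[OF P] by blast

lemma ev_ap: "x \<in> Loc P \<Longrightarrow> ev P (ap p x) = poly p (ev P x)"
  by (induction p) (simp_all add: ev_0 ev_add[OF P] ev_mult[OF P] ev_iota[OF P] iota_Loc[OF P] ap_Loc rg)

lemma order_unique:
  assumes "u \<in> Loc P" "ev P u \<noteq> 0" "u' \<in> Loc P" "ev P u' \<noteq> 0"
    and "u * t P powi n = u' * t P powi m"
  shows "n = m"
proof -
  have aux: False if "u \<in> Loc P" "ev P u \<noteq> 0" "u' \<in> Loc P"
    "u * t P powi n = u' * t P powi m" "n < m" for u u' n m
  proof -
    have "t P powi m = t P powi n * t P ^ nat (m - n)"
      using power_int_add[of "t P" n "m - n"] t_nz[OF P] that(5) by (simp add: power_int_def)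
    then have "u = u' * t P ^ nat (m - n)"
      using that(4) t_nz[OF P] by (simp add: mult.left_commute[of u'])
    then have "ev P u = 0"
      using that(3,5) by (simp add: ev_mult[OF P] ev_power t_Loc[OF P] rg ev_t[OF P])
    then show False using that(2) by simp
  qed
  show ?thesis
    using aux[of u u' n m] aux[of u' u m n] assms by (metis linorder_neqE)
qed

lemma val_eqI: "u \<in> Loc P \<Longrightarrow> ev P u \<noteq> 0 \<Longrightarrow> a = u * t P powi n \<Longrightarrow> val P a = n"
  unfolding val_def using order_unique by blast

lemma val_rep:
  assumes "a \<in> K" "a \<noteq> 0"
  obtains u n where "u \<in> Loc P" "ev P u \<noteq> 0" "a = u * t P powi n" "val P a = n"
  using dvr[OF P assms] val_eqI by metis

lemma val_mult:
  assumes "a \<in> K" "b \<in> K" "a \<noteq> 0" "b \<noteq> 0"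
  shows "val P (a * b) = val P a + val P b"
proof -
  obtain u n where u: "u \<in> Loc P" "ev P u \<noteq> 0" "a = u * t P powi n" "val P a = n"
    using val_rep assms by blast
  obtain w m where w: "w \<in> Loc P" "ev P w \<noteq> 0" "b = w * t P powi m" "val P b = m"
    using val_rep assms by blast
  have "a * b = (u * w) * t P powi (n + m)"
    using u w by (simp add: power_int_add t_nz[OF P])
  then have "val P (a * b) = n + m"
    using u(1,2) w(1,2) by (intro val_eqI[of "u * w"]) (auto simp: rg ev_mult[OF P])
  then show ?thesis using u w by simp
qed

lemma val_1: "val P 1 = 0"
  by (rule val_eqI[of 1]) (auto simp: rg ev_1)

lemma val_inverse: "a \<in> K \<Longrightarrow> a \<noteq> 0 \<Longrightarrow> val P (inverse a) = - val P a"
  using val_mult[of a "inverse a"] by (simp add: K_inverse val_1)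

lemma val_power: "a \<in> K \<Longrightarrow> a \<noteq> 0 \<Longrightarrow> val P (a ^ n) = int n * val P a"
  by (induction n) (simp_all add: val_1 val_mult K_rg algebra_simps)

text \<open>
  Membership in the fractional ideal generated by the \<open>n\<close>-th power of the uniformizer.
\<close>

definition vge :: "int \<Rightarrow> 'k \<Rightarrow> bool" where
  "vge n a \<longleftrightarrow> a \<in> K \<and> (a = 0 \<or> n \<le> val P a)"

lemma vge_iff: "vge n a \<longleftrightarrow> (\<exists>b\<in>Loc P. a = b * t P powi n)"
proof
  assume A: "vge n a"
  show "\<exists>b\<in>Loc P. a = b * t P powi n"
  proof (cases "a = 0")
    case True then show ?thesis using rg by (intro bexI[of _ 0]) auto
  next
    case False
    then obtain u m where u: "u \<in> Loc P" "ev P u \<noteq> 0" "a = u * t P powi m" "val P a = m"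
      using val_rep A vge_def by blast
    have le: "n \<le> m" using A False u(4) by (simp add: vge_def)
    then have "t P powi m = t P ^ nat (m - n) * t P powi n"
      using power_int_add[of "t P" "m - n" n] t_nz[OF P] by (simp add: power_int_def)
    then have "a = (u * t P ^ nat (m - n)) * t P powi n" using u(3) by (simp add: mult.assoc)
    then show ?thesis using u(1) t_Loc[OF P] by (intro bexI[of _ "u * t P ^ nat (m - n)"]) (auto intro: rg)
  qed
next
  assume "\<exists>b\<in>Loc P. a = b * t P powi n"
  then obtain b where b: "b \<in> Loc P" "a = b * t P powi n" by blast
  have bK: "b \<in> K" and tK: "t P \<in> K" using b Loc_K[OF P] t_Loc[OF P] by auto
  have aK: "a \<in> K" using b bK tK by (simp add: K_rg K_powi)
  show "vge n a"
  proof (cases "b = 0")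
    case True then show ?thesis using b aK by (simp add: vge_def)
  next
    case False
    obtain u m where u: "u \<in> Loc P" "ev P u \<noteq> 0" "b = u * t P powi m" "val P b = m"
      using val_rep[OF bK False] by blast
    have nn: "0 \<le> m"
    proof (rule ccontr)
      assume neg: "\<not> 0 \<le> m"
      have "u = b * t P ^ nat (- m)"
        using u(3) neg t_nz[OF P] by (simp add: power_int_def power_inverse)
      then have "ev P u = 0"
        using b(1) neg by (simp add: ev_mult[OF P] ev_power t_Loc[OF P] rg ev_t[OF P])
      then show False using u(2) by simp
    qed
    have "a = u * t P powi (m + n)"
      using b(2) u(3) by (simp add: power_int_add t_nz[OF P])
    then have "val P a = m + n" using val_eqI u(1,2) by blast
    then show ?thesis using nn aK by (simp add: vge_def)
  qed
qed

lemma vge_0: "vge 0 a \<longleftrightarrow> a \<in> Loc P"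
  by (simp add: vge_iff)

lemma vge_1: "vge 1 a \<longleftrightarrow> a \<in> Loc P \<and> ev P a = 0"
proof
  assume "vge 1 a" then show "a \<in> Loc P \<and> ev P a = 0"
    unfolding vge_iff by (auto simp: rg t_Loc[OF P] ev_mult[OF P] ev_t[OF P])
next
  assume A: "a \<in> Loc P \<and> ev P a = 0"
  show "vge 1 a"
  proof (rule ccontr)
    assume "\<not> vge 1 a"
    then have nz: "a \<noteq> 0" and v: "val P a = 0"
      using A vge_0[of a] Loc_K[OF P] by (auto simp: vge_def)
    obtain u n where "u \<in> Loc P" "ev P u \<noteq> 0" "a = u * t P powi n" "val P a = n"
      using val_rep[OF _ nz] A Loc_K[OF P] by blast
    then show False using A v by simp
  qed
qed

lemma vge_zero: "vge n 0" by (simp add: vge_def K_rg)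

lemma vge_mono: "vge n a \<Longrightarrow> m \<le> n \<Longrightarrow> vge m a"
  by (auto simp: vge_def)

lemma vge_add: "vge n a \<Longrightarrow> vge n b \<Longrightarrow> vge n (a + b)"
  unfolding vge_iff using rg(3) by (metis distrib_right)

lemma vge_uminus: "vge n a \<Longrightarrow> vge n (- a)"
  unfolding vge_iff using rg(5) by (metis minus_mult_left)

lemma vge_diff: "vge n a \<Longrightarrow> vge n b \<Longrightarrow> vge n (a - b)"
  using vge_add[of n a "- b"] vge_uminus by simp

lemma vge_mult: "vge n a \<Longrightarrow> vge m b \<Longrightarrow> vge (n + m) (a * b)"
  unfolding vge_def by (auto simp: K_rg val_mult)

lemma vge_mult_Loc: "vge n a \<Longrightarrow> b \<in> Loc P \<Longrightarrow> vge n (a * b)"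
  using vge_mult[of n a 0 b] by (simp add: vge_0)

lemma vge_power: "vge n a \<Longrightarrow> vge (int k * n) (a ^ k)"
proof (induction k)
  case 0 then show ?case by (simp add: vge_0 rg)
next
  case (Suc k) then show ?case using vge_mult[of n a "int k * n" "a ^ k"] by (simp add: algebra_simps)
qed

lemma vge_sum: "(\<And>i. i \<in> A \<Longrightarrow> vge n (f i)) \<Longrightarrow> vge n (sum f A)"
  by (induction A rule: infinite_finite_induct) (auto simp: vge_zero vge_add)

lemma Loc_iff_val: "a \<in> K \<Longrightarrow> a \<noteq> 0 \<Longrightarrow> a \<in> Loc P \<longleftrightarrow> 0 \<le> val P a"
  using vge_0[of a] by (simp add: vge_def)

lemma not_Loc: "a \<in> K \<Longrightarrow> a \<notin> Loc P \<Longrightarrow> inverse a \<in> Loc P \<and> ev P (inverse a) = 0"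
  using rg(1) Loc_iff_val[of a] vge_1[of "inverse a"] by (auto simp: vge_def K_inverse val_inverse)

text \<open>
  The coefficients are recovered one after the other: once the earlier ones vanish, dividing by \<open>t P ^ j\<close>
  and evaluating at \<open>P\<close> leaves \<open>c j\<close>.
\<close>

lemma truncated_expansion_eq_0:
  assumes "vge (int e) (\<Sum>j<e. \<iota> (c j) * t P ^ j)" "j < e"
  shows "c j = 0"
  using assms(2)
proof (induction j rule: less_induct)
  case (less j)
  define s where "s = (\<Sum>i\<in>{Suc j..<e}. \<iota> (c i) * t P ^ (i - Suc j))"
  have "(\<Sum>j<e. \<iota> (c j) * t P ^ j) = (\<Sum>i\<in>{j..<e}. \<iota> (c i) * t P ^ i)"
    using less by (intro sum.mono_neutral_right) auto
  also have "\<dots> = \<iota> (c j) * t P ^ j + (\<Sum>i\<in>{Suc j..<e}. \<iota> (c i) * t P ^ i)"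
    using less.prems by (simp add: sum.atLeast_Suc_lessThan)
  also have "(\<Sum>i\<in>{Suc j..<e}. \<iota> (c i) * t P ^ i) = t P ^ j * (t P * s)"
    unfolding s_def sum_distrib_left
    by (intro sum.cong) (auto simp flip: power_Suc power_add simp: mult_ac)
  finally have eq: "(\<Sum>j<e. \<iota> (c j) * t P ^ j) = (\<iota> (c j) + t P * s) * t P powi int j"
    by (simp add: algebra_simps)
  have sL: "s \<in> Loc P"
    unfolding s_def by (intro subrg_sum[OF Loc_subrg[OF P]]) (auto simp: rg iota_Loc P t_Loc)
  have "vge (int (Suc j)) ((\<iota> (c j) + t P * s) * t P powi int j)"
    using assms(1) vge_mono less.prems unfolding eq[symmetric] by simp
  then obtain b where b: "b \<in> Loc P" "(\<iota> (c j) + t P * s) * t P powi int j = b * t P powi (int (Suc j))"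
    unfolding vge_iff by blast
  then have "\<iota> (c j) + t P * s = b * t P"
    using t_nz[OF P] by (simp add: mult_ac del: of_nat_Suc)
  then have "ev P (\<iota> (c j) + t P * s) = ev P (b * t P)" by simp
  then show ?case
    using b(1) sL by (simp add: ev_add[OF P] ev_mult[OF P] rg iota_Loc P t_Loc ev_t ev_iota)
qed

end

end

subsection \<open>Places and integrality\<close>

context point_field
begin

text \<open>
  Complex polynomials split into linear factors, so a multiplicative property of \<open>ap p x\<close> only has to be
  checked for the elements \<open>x - \<iota> c\<close>.
\<close>

lemma peval_product_induct:
  assumes "\<And>c. c \<noteq> 0 \<Longrightarrow> S (\<iota> c)" and "\<And>c. S (x - \<iota> c)" and "\<And>a b. S a \<Longrightarrow> S b \<Longrightarrow> S (a * b)"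
  shows "p \<noteq> 0 \<Longrightarrow> S (ap p x)"
proof (induction "Polynomial.degree p" arbitrary: p)
  case 0
  then obtain c where "p = [:c:]" by (metis degree_eq_zeroE)
  then show ?case using 0 assms(1) by simp
next
  case (Suc n)
  then have "\<not> constant (poly p)" by (simp add: constant_degree)
  then obtain z where "poly p z = 0" using fundamental_theorem_of_algebra by blast
  then obtain q where q: "p = [:- z, 1:] * q" by (metis dvdE poly_eq_0_iff_dvd)
  then have "q \<noteq> 0" using Suc.prems by auto
  then have "Polynomial.degree p = Suc (Polynomial.degree q)"
    unfolding q by (subst degree_mult_eq) auto
  then have "S (ap q x)" using Suc \<open>q \<noteq> 0\<close> by simp
  moreover have "ap p x = (x - \<iota> z) * ap q x"
    by (simp only: q iota.peval_mult) (simp add: iota.map_uminus)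
  ultimately show ?case using assms(2,3) by metis
qed

lemma transcendental:
  assumes "x \<notin> range \<iota>" "p \<noteq> 0"
  shows "ap p x \<noteq> 0"
  by (rule peval_product_induct[of "\<lambda>a. a \<noteq> 0"]) (use assms in auto)

text \<open>
  A relation between \<open>a\<close> and \<open>b\<close> can be divided by \<open>b\<close> until its part \<open>q\<close> free of \<open>b\<close> is nonzero. So if \<open>b\<close>
  lies in a maximal ideal, then so does \<open>q(a)\<close>: the residue of \<open>a\<close> is a root of \<open>q\<close>.
\<close>

lemma relation_at_0:
  assumes "a \<in> K" "b \<in> K" "b \<noteq> 0"
  shows "\<exists>q s. q \<noteq> 0 \<and> ap q a = - (b * peval (\<lambda>c. ap c a) s b)"
proof -
  interpret A: comm_ring_map "\<lambda>c. ap c a" by (rule ap_map)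
  obtain p where p: "p \<noteq> 0" "peval (\<lambda>c. ap c a) p b = 0" using relation assms by blast
  obtain r where r: "p = [:- 0, 1:] ^ Polynomial.order 0 p * r" "\<not> [:- 0, 1:] dvd r"
    using order_decomp[OF p(1)] by blast
  have "peval (\<lambda>c. ap c a) [:- 0, 1:] b = b" by simp
  then have "peval (\<lambda>c. ap c a) r b = 0"
    using p(2) assms(3) by (subst (asm) r(1)) (simp add: A.peval_mult A.peval_power)
  moreover obtain q s where qs: "r = pCons q s" by (metis pCons_cases)
  moreover have "q \<noteq> 0" using r(2) unfolding qs poly_eq_0_iff_dvd[symmetric] by simp
  ultimately show ?thesis
    by (intro exI[of _ q] exI[of _ s]) (auto simp: eq_neg_iff_add_eq_0)
qed

text \<open>
  Chevalley's theorem on places. If \<open>f\<close> is not integral over the ring \<open>A\<close> (the range of \<open>h\<close>), then \<open>f\<close> is not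
  in \<open>A[1 / f]\<close>. Among the rings that contain \<open>A[1 / f]\<close> but not \<open>f\<close> there is a maximal one, \<open>V\<close>. It is a
  valuation ring, because for \<open>z\<close> and \<open>1 / z\<close> both outside \<open>V\<close> one could write \<open>f\<close> as a polynomial in either,
  and these two expressions shorten each other for ever. Its residue field is \<open>\<complex>\<close> because every \<open>z\<close> is
  algebraically dependent on \<open>1 / f\<close>, which has residue 0. The centre of \<open>V\<close> is the required point.
\<close>

lemma exists_point_off_integral_closure:
  fixes h :: "'a::comm_ring_1 \<Rightarrow> 'k"
  assumes h: "comm_ring_map h" and hK: "range \<iota> \<subseteq> range h" "range h \<subseteq> K" and f: "f \<in> K"
    and not_integral: "\<And>H. Polynomial.lead_coeff H = 1 \<Longrightarrow> peval h H f \<noteq> 0"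
  shows "\<exists>P\<in>Pts. range h \<subseteq> Loc P \<and> f \<notin> Loc P"
proof -
  interpret h: comm_ring_map h by (rule h)
  define g where "g = inverse f"
  have "f \<noteq> 0" using not_integral[of "[:0, 1:]"] by auto
  then have gf: "g * f = 1" and g: "g \<in> K" "g \<noteq> 0" using f by (auto simp: g_def K_inverse)
  define A where "A = {V. subrg V \<and> V \<subseteq> K \<and> range h \<subseteq> V \<and> g \<in> V \<and> f \<notin> V}"
  have "range (\<lambda>p. peval h p g) \<in> A"
  proof -
    have "f \<noteq> peval h p g" for p
    proof
      assume eq: "f = peval h p g"
      define n where "n = Polynomial.degree p"
      define H where "H = Polynomial.monom 1 (Suc n) - (\<Sum>i\<le>n. Polynomial.monom (poly.coeff p i) (n - i))"
      have dg: "Polynomial.degree (\<Sum>i\<le>n. Polynomial.monom (poly.coeff p i) (n - i)) \<le> n"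
        by (intro degree_sum_le) (auto intro: order_trans[OF degree_monom_le])
      have c1: "poly.coeff H (Suc n) = 1"
        using dg by (simp add: H_def coeff_eq_0)
      have "Polynomial.degree H \<le> Suc n"
        unfolding H_def using dg by (intro degree_diff_le) (auto intro: degree_monom_le)
      then have "Polynomial.degree H = Suc n" using c1 by (metis le_antisym le_degree zero_neq_one)
      then have lc: "Polynomial.lead_coeff H = 1" using c1 by simp
      have "f ^ n * f = (\<Sum>i\<le>n. f ^ n * (h (poly.coeff p i) * g ^ i))"
        by (subst (2) eq) (simp add: h.peval_altdef[of p n] n_def sum_distrib_left)
      also have "\<dots> = (\<Sum>i\<le>n. h (poly.coeff p i) * f ^ (n - i))"
      proof (intro sum.cong refl)
        fix i assume "i \<in> {..n}"
        then have "f ^ n = f ^ (n - i) * f ^ i" by (simp flip: power_add)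
        then show "f ^ n * (h (poly.coeff p i) * g ^ i) = h (poly.coeff p i) * f ^ (n - i)"
          using gf by (simp add: mult_ac flip: power_mult_distrib)
      qed
      finally have "peval h H f = 0"
        by (simp add: H_def h.peval_diff h.peval_sum h.peval_monom mult.commute)
      then show False using not_integral[OF lc] by simp
    qed
    moreover have "subrg (range (\<lambda>p. peval h p g))"
      unfolding subrg_def
      by (auto simp flip: h.peval_diff h.peval_mult intro: rev_image_eqI[of 1])
    moreover have "range (\<lambda>p. peval h p g) \<subseteq> K"
      using h.peval_in[OF K_subrg hK(2) g(1)] by auto
    moreover have "range h \<subseteq> range (\<lambda>p. peval h p g)"
      by (auto intro: rev_image_eqI[of "[:a:]" for a])
    moreover have "g \<in> range (\<lambda>p. peval h p g)"
      by (rule rev_image_eqI[of "[:0, 1:]"]) auto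
    ultimately show ?thesis unfolding A_def by auto
  qed
  moreover have "\<Union>C \<in> A" if C: "C \<noteq> {}" "subset.chain A C" for C
  proof -
    have CA: "V \<in> A" if "V \<in> C" for V using C that by (auto simp: subset.chain_def)
    have "subrg (\<Union>C)"
      unfolding subrg_def
    proof (intro conjI ballI)
      obtain V where "V \<in> C" using C(1) by blast
      then show "1 \<in> \<Union>C" using CA subrgD(2)[of V] by (auto simp: A_def)
    next
      fix a b assume "a \<in> \<Union>C" "b \<in> \<Union>C"
      then obtain V where V: "V \<in> C" "a \<in> V" "b \<in> V"
        using C(2) unfolding subset_chain_def by (meson UnionE in_mono)
      then have "subrg V" using CA by (auto simp: A_def)
      then show "a - b \<in> \<Union>C" "a * b \<in> \<Union>C" using V by (auto intro: subrgD)
    qed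
    then show ?thesis using CA C(1) unfolding A_def by blast
  qed
  ultimately obtain V where VA: "V \<in> A" and max: "\<And>W. W \<in> A \<Longrightarrow> V \<subseteq> W \<Longrightarrow> W = V"
    using subset_Zorn_nonempty[of A] by blast
  have V: "subrg V" "V \<subseteq> K" "range h \<subseteq> V" "g \<in> V" "f \<notin> V" using VA by (auto simp: A_def)
  note rV = subrgD[OF V(1)]
  have maxD: "f \<in> W" if "subrg W" "W \<subseteq> K" "V \<subseteq> W" "\<not> W \<subseteq> V" for W
    using max[of W] that V unfolding A_def by blast
  \<comment> \<open>\<open>g\<close> lies in the Jacobson radical: otherwise the localisation at \<open>1 - g v\<close> would be larger
    than \<open>V\<close> and hence contain \<open>f\<close>, but then \<open>f\<close> would already be in \<open>V\<close>.\<close>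
  have units: "inverse (1 - g * v) \<in> V" if v: "v \<in> V" for v
  proof (rule ccontr)
    define u where "u = 1 - g * v"
    assume notin: "inverse (1 - g * v) \<notin> V"
    have uV: "u \<in> V" using v V rV by (simp add: u_def)
    have "u \<noteq> 0"
    proof
      assume "u = 0"
      then have "f = v" using gf by (metis eq_iff_diff_eq_0 g(2) mult_left_cancel u_def)
      then show False using v V by simp
    qed
    define W where "W = {a * inverse u ^ n | a n. a \<in> V}"
    have "subrg W"
      unfolding subrg_def
    proof (intro conjI ballI)
      show "1 \<in> W" unfolding W_def
        using rV(2) by (intro CollectI exI[of _ "1::'k"] exI[of _ "0::nat"]) simp
    next
      fix x y assume "x \<in> W" "y \<in> W"
      then obtain a n b m where ab: "a \<in> V" "b \<in> V" "x = a * inverse u ^ n" "y = b * inverse u ^ m"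
        unfolding W_def by auto
      have "x - y = (a * u ^ m - b * u ^ n) * inverse u ^ (n + m)"
        using \<open>u \<noteq> 0\<close> unfolding ab by (simp add: field_simps power_add)
      moreover have "a * u ^ m - b * u ^ n \<in> V" using ab uV rV by simp
      ultimately show "x - y \<in> W" unfolding W_def by blast
      have "x * y = (a * b) * inverse u ^ (n + m)" unfolding ab by (simp add: power_add)
      then show "x * y \<in> W" unfolding W_def using ab rV(6) by blast
    qed
    moreover have "W \<subseteq> K"
    proof
      fix x assume "x \<in> W"
      then obtain a n where "a \<in> V" "x = a * inverse u ^ n" unfolding W_def by auto
      then show "x \<in> K" using uV V(2) K_rg(6,7) K_inverse by (metis in_mono)
    qed
    moreover have "V \<subseteq> W"
    proof
      fix a assume "a \<in> V"
      then show "a \<in> W" unfolding W_def by (intro CollectI exI[of _ a] exI[of _ "0::nat"]) simp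
    qed
    moreover have "inverse u \<in> W"
      unfolding W_def using rV(2) by (intro CollectI exI[of _ "1::'k"] exI[of _ "1::nat"]) simp
    ultimately have "f \<in> W" using maxD[of W] notin unfolding u_def by blast
    then obtain a n where a: "a \<in> V" "f = a * inverse u ^ n" unfolding W_def by auto
    have "\<exists>w\<in>V. u ^ n = 1 - g * w"
    proof (induction n)
      case 0 then show ?case using rV(1) by (intro bexI[of _ 0]) auto
    next
      case (Suc n)
      then obtain w where w: "w \<in> V" "u ^ n = 1 - g * w" by blast
      have "u ^ Suc n = u * (1 - g * w)" by (simp add: w(2))
      then have "u ^ Suc n = 1 - g * (v + w - g * v * w)" by (simp add: u_def algebra_simps)
      moreover have "v + w - g * v * w \<in> V" using v w V rV by simp
      ultimately show ?case by blast
    qed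
    then obtain w where w: "w \<in> V" "u ^ n = 1 - g * w" by blast
    have "f * u ^ n = a" using a(2) \<open>u \<noteq> 0\<close> by (simp add: field_simps)
    then have "f = a + (g * f) * w" unfolding w(2) by (simp add: algebra_simps)
    then have "f = a + w" using gf by simp
    then show False using a(1) w(1) V(5) rV(3) by simp
  qed
  \<comment> \<open>\<open>p\<close> represents \<open>f\<close> as a polynomial in \<open>z\<close> over \<open>V\<close>\<close>
  define rp where "rp z p \<longleftrightarrow> (\<forall>i. poly.coeff p i \<in> V) \<and> poly p z = f" for z p
  have rp_ex: "\<exists>p. rp z p" if z: "z \<in> K" "z \<notin> V" for z
  proof -
    define W where "W = {poly p z | p. \<forall>i. poly.coeff p i \<in> V}"
    have "subrg W"
      unfolding subrg_def
    proof (intro conjI ballI)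
      show "1 \<in> W" unfolding W_def using rV by (auto intro!: exI[of _ 1] simp: coeff_1)
    next
      fix x y assume "x \<in> W" "y \<in> W"
      then obtain p q where pq: "\<forall>i. poly.coeff p i \<in> V" "\<forall>i. poly.coeff q i \<in> V"
        "x = poly p z" "y = poly q z" unfolding W_def by auto
      show "x - y \<in> W" unfolding W_def using pq rV
        by (auto intro!: exI[of _ "p - q"])
      show "x * y \<in> W" unfolding W_def using pq rV
        by (auto intro!: exI[of _ "p * q"] subrg_sum[OF V(1)] simp: coeff_mult)
    qed
    moreover have "W \<subseteq> K"
    proof
      fix x assume "x \<in> W"
      then obtain p where p: "\<forall>i. poly.coeff p i \<in> V" "x = poly p z" unfolding W_def by auto
      then show "x \<in> K" unfolding p(2) poly_altdef
        using V(2) z(1) by (intro subrg_sum[OF K_subrg] K_rg(6,7)) auto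
    qed
    moreover have "V \<subseteq> W"
    proof
      fix a assume "a \<in> V"
      then show "a \<in> W" unfolding W_def using rV(1)
        by (auto intro!: exI[of _ "[:a:]"] simp: coeff_pCons split: nat.splits)
    qed
    moreover have "z \<in> W" unfolding W_def using rV(1,2)
      by (auto intro!: exI[of _ "[:0, 1:]"] simp: coeff_pCons split: nat.splits)
    ultimately show ?thesis using maxD[of W] z(2) unfolding W_def rp_def by blast
  qed
  have rp_deg: "Polynomial.degree p > 0" if "rp z p" for z p
  proof (rule ccontr)
    assume "\<not> 0 < Polynomial.degree p"
    then obtain c where "p = [:c:]" by (metis degree_eq_zeroE gr0I)
    then show False using that V(5) unfolding rp_def by (metis coeff_pCons_0 mult_zero_right pCons_0_0 poly_0 poly_pCons add.right_neutral)
  qed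
  \<comment> \<open>Multiplying \<open>q(1 / z) = f\<close> by \<open>g z\<^sup>k\<close> gives a relation \<open>r(z) = 0\<close> whose leading coefficient
    is the unit \<open>1 - g q\<^sub>0\<close>; it serves to cancel the leading term of \<open>p\<close>.\<close>
  have reduce: "\<exists>p'. rp z p' \<and> Polynomial.degree p' < Polynomial.degree p"
    if p: "rp z p" and q: "rp (inverse z) q" and z: "z \<noteq> 0"
      and le: "Polynomial.degree q \<le> Polynomial.degree p" for z p q
  proof -
    define k where "k = Polynomial.degree q"
    define n where "n = Polynomial.degree p"
    define u where "u = 1 - g * poly.coeff q 0"
    have iu: "inverse u \<in> V" unfolding u_def using units q by (auto simp: rp_def)
    have "u \<noteq> 0"
    proof
      assume "u = 0"
      then have "f = poly.coeff q 0" using gf by (metis eq_iff_diff_eq_0 g(2) mult_left_cancel u_def)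
      then show False using q V(5) unfolding rp_def by metis
    qed
    define r where "r = Polynomial.smult (inverse u) (Polynomial.monom 1 k - Polynomial.smult g (reflect_poly q))"
    have rV': "poly.coeff r i \<in> V" for i
      using q V(4) rV iu unfolding r_def rp_def
      by (auto simp: coeff_reflect_poly intro!: rV(6) rV(4))
    have "poly.coeff (reflect_poly q) k = poly.coeff q 0"
      by (simp add: coeff_reflect_poly k_def)
    then have rk: "poly.coeff r k = 1" using \<open>u \<noteq> 0\<close> by (simp add: r_def u_def)
    have rd: "Polynomial.degree r \<le> k"
      unfolding r_def k_def
      by (intro order_trans[OF degree_smult_le] degree_diff_le) (auto simp: degree_monom_le degree_reflect_poly_le intro: order_trans[OF degree_smult_le])
    have "poly (reflect_poly q) z = z ^ k * f"
      using q z by (simp add: poly_reflect_poly_nz k_def rp_def)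
    then have r0: "poly r z = 0" using gf by (simp add: r_def poly_monom)
    define p' where "p' = p - Polynomial.smult (Polynomial.lead_coeff p) (Polynomial.monom 1 (n - k) * r)"
    have "poly p' z = f" using p r0 by (simp add: p'_def rp_def)
    moreover have "poly.coeff p' i \<in> V" for i
      using p rV' rV unfolding p'_def rp_def by (auto simp: coeff_monom_mult)
    moreover have "poly.coeff p' n = 0"
      using rk le by (simp add: p'_def coeff_monom_mult n_def k_def)
    moreover have "Polynomial.degree (Polynomial.monom (1::'k) (n - k) * r) \<le> n"
      using order_trans[OF degree_mult_le add_mono[OF degree_monom_le rd], of 1 "n - k"] le
      by (simp add: n_def k_def)
    then have "Polynomial.degree p' \<le> n"
      unfolding p'_def n_def by (intro degree_diff_le order_trans[OF degree_smult_le]) auto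
    ultimately have "rp z p'" "Polynomial.degree p' < n"
      using rp_deg[OF p] unfolding rp_def n_def[symmetric]
      by (auto simp: le_less)
    then show ?thesis unfolding n_def by blast
  qed
  have valuation: "z \<in> V \<or> inverse z \<in> V" if zK: "z \<in> K" for z
  proof (rule ccontr)
    assume notV: "\<not> (z \<in> V \<or> inverse z \<in> V)"
    then have nz: "z \<noteq> 0" using rV(1) by auto
    obtain p where p: "rp z p" "\<And>p'. rp z p' \<Longrightarrow> Polynomial.degree p \<le> Polynomial.degree p'"
      using rp_ex[OF zK] notV ex_has_least_nat[of "rp z" _ Polynomial.degree] by blast
    obtain q where q: "rp (inverse z) q" "\<And>p'. rp (inverse z) p' \<Longrightarrow> Polynomial.degree q \<le> Polynomial.degree p'"
      using rp_ex[of "inverse z"] K_inverse[OF zK] notV ex_has_least_nat[of "rp (inverse z)" _ Polynomial.degree] by blast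
    show False
    proof (cases "Polynomial.degree q \<le> Polynomial.degree p")
      case True then show False using reduce[OF p(1) q(1) nz] p(2) by (meson leD)
    next
      case False
      have "rp (inverse (inverse z)) p" using p(1) by simp
      then show False using reduce[OF q(1) _ _] False nz q(2) by (meson leD nle_le inverse_nonzero_iff_nonzero)
    qed
  qed
  \<comment> \<open>the maximal ideal of \<open>V\<close>\<close>
  define m where "m = {z \<in> V. z = 0 \<or> inverse z \<notin> V}"
  have m_mult: "z * a \<in> m" if "z \<in> V" "a \<in> m" for z a
  proof -
    have "inverse a \<in> V" if "z * a \<noteq> 0" "inverse (z * a) \<in> V"
    proof -
      have "inverse a = z * inverse (z * a)" using that(1) by (simp add: field_simps)
      then show ?thesis using that \<open>z \<in> V\<close> rV(6) by metis
    qed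
    then show ?thesis using that rV(6) unfolding m_def by auto
  qed
  have m_add: "a + b \<in> m" if ab: "a \<in> m" "b \<in> m" for a b
  proof -
    have aux: "a + b \<in> m" if "a \<in> m" "b \<in> m" "a / b \<in> V" "b \<noteq> 0" for a b
    proof -
      have "a + b = (a / b + 1) * b" using that by (simp add: field_simps)
      then show ?thesis using m_mult[of "a / b + 1" b] that rV by simp
    qed
    show ?thesis
    proof (cases "a = 0 \<or> b = 0")
      case True then show ?thesis using ab by auto
    next
      case False
      have "a / b \<in> V \<or> b / a \<in> V"
        using valuation[of "a / b"] ab V(2) K_divide[of a b] by (auto simp: m_def)
      then show ?thesis using aux[of a b] aux[of b a] ab False by (auto simp: add.commute)
    qed
  qed
  have one_m: "1 \<notin> m" using rV(2) by (simp add: m_def)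
  have iV: "\<iota> c \<in> V" for c using hK(1) V(3) by blast
  have iota_m: "c = 0" if "\<iota> c \<in> m" for c
  proof (rule ccontr)
    assume "c \<noteq> 0"
    have "\<iota> (inverse c) * \<iota> c = 1" using \<open>c \<noteq> 0\<close> by (simp flip: iota.map_mult)
    then show False using m_mult[OF iV that] one_m by metis
  qed
  \<comment> \<open>If no \<open>z - \<iota> c\<close> were in \<open>m\<close>, then \<open>ap q z\<close> would be a unit for every \<open>q\<close>, in contradiction to
    the relation between \<open>z\<close> and \<open>g \<in> m\<close>.\<close>
  have res: "\<exists>c. z - \<iota> c \<in> m" if zV: "z \<in> V" for z
  proof (rule ccontr)
    assume none: "\<nexists>c. z - \<iota> c \<in> m"
    have zc: "z - \<iota> c \<in> V" for c using zV iV rV by simp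
    obtain q s where qs: "q \<noteq> 0" "ap q z = - (g * peval (\<lambda>c. ap c z) s g)"
      using relation_at_0[of z g] zV V(2) g by blast
    interpret Z: comm_ring_map "\<lambda>c. ap c z" by (rule ap_map)
    have sV: "peval (\<lambda>c. ap c z) s g \<in> V"
      using iV by (intro Z.peval_in[OF V(1)] V(4)) (auto intro: iota.peval_in[OF V(1)] zV)
    have "ap q z \<noteq> 0 \<and> inverse (ap q z) \<in> V"
    proof (rule peval_product_induct[of "\<lambda>a. a \<noteq> 0 \<and> inverse a \<in> V"])
      fix c :: complex assume "c \<noteq> 0"
      then have "inverse (\<iota> c) = \<iota> (inverse c)"
        by (intro inverse_unique) (simp flip: iota.map_mult)
      then show "\<iota> c \<noteq> 0 \<and> inverse (\<iota> c) \<in> V" using iV \<open>c \<noteq> 0\<close> by simp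
    next
      show "z - \<iota> c \<noteq> 0 \<and> inverse (z - \<iota> c) \<in> V" for c
        using none zc[of c] by (auto simp: m_def)
    qed (use qs(1) rV(6) in \<open>auto simp: mult.commute\<close>)
    moreover have "f * ap q z = - peval (\<lambda>c. ap c z) s g"
      using qs(2) gf by (simp add: mult_ac)
    moreover have "f = f * ap q z * inverse (ap q z)" using calculation(1) by simp
    ultimately have "f = - (peval (\<lambda>c. ap c z) s g) * inverse (ap q z)" by simp
    then show False using \<open>ap q z \<noteq> 0 \<and> inverse (ap q z) \<in> V\<close> sV rV(5,6) V(5) by metis
  qed
  define c where "c z = (THE c. z - \<iota> c \<in> m)" for z
  have c_eq: "c z = a" if "z - \<iota> a \<in> m" for z a
    unfolding c_def
  proof (rule the_equality)
    fix b assume "z - \<iota> b \<in> m"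
    then have "(z - \<iota> b) + (- 1) * (z - \<iota> a) \<in> m" using that m_add m_mult rV(2,5) by blast
    then have "\<iota> (a - b) \<in> m" by (simp add: iota.map_diff)
    then show "b = a" using iota_m by fastforce
  qed (use that in auto)
  have c_m: "z - \<iota> (c z) \<in> m" if "z \<in> V" for z using res[OF that] c_eq by metis
  have mV: "z \<in> V" if "z \<in> m" for z using that by (simp add: m_def)
  have m_0: "0 \<in> m" using rV(1) by (simp add: m_def)
  have "\<exists>P\<in>Pts. \<forall>a\<in>Loc P. a \<in> V \<and> c a = ev P a"
  proof (rule center[OF V(1,2) _ valuation])
    show "range \<iota> \<subseteq> V" using iV by auto
    show "c (\<iota> a) = a" for a by (rule c_eq) (simp add: m_0)
    show "c (a + b) = c a + c b \<and> c (a * b) = c a * c b" if "a \<in> V" "b \<in> V" for a b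
    proof
      have "(a - \<iota> (c a)) + (b - \<iota> (c b)) \<in> m" using that c_m m_add by blast
      then show "c (a + b) = c a + c b" by (intro c_eq) (simp add: iota.map_add algebra_simps)
      have "a * (b - \<iota> (c b)) + \<iota> (c b) * (a - \<iota> (c a)) \<in> m"
        using that c_m m_add m_mult iV by blast
      then show "c (a * b) = c a * c b" by (intro c_eq) (simp add: iota.map_mult algebra_simps)
    qed
    show "inverse z \<in> V" if "z \<in> V" "c z \<noteq> 0" for z
      using that c_m[OF that(1)] c_eq[of z 0] by (auto simp: m_def)
  qed
  then obtain P where P: "P \<in> Pts" "\<And>a. a \<in> Loc P \<Longrightarrow> a \<in> V \<and> c a = ev P a" by blast
  have "V \<subseteq> Loc P"
  proof
    fix z assume zV: "z \<in> V"
    show "z \<in> Loc P"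
    proof (rule ccontr)
      assume "z \<notin> Loc P"
      then have iz: "inverse z \<in> V" "c (inverse z) = 0"
        using not_Loc[OF P(1)] zV V(2) P(2) by (metis in_mono)+
      have nz: "z \<noteq> 0" using \<open>z \<notin> Loc P\<close> rg(1)[OF P(1)] by auto
      have "inverse z \<in> m" using c_m[OF iz(1)] iz(2) by simp
      then have "z * inverse z \<in> m" using m_mult zV by blast
      then show False using nz one_m by simp
    qed
  qed
  then show ?thesis using P V(3,5) by blast
qed

lemma integral_if_regular:
  assumes "x \<in> K" "f \<in> K" and "\<And>P. P \<in> Pts \<Longrightarrow> x \<in> Loc P \<Longrightarrow> f \<in> Loc P"
  shows "\<exists>H. Polynomial.lead_coeff H = 1 \<and> peval (\<lambda>c. ap c x) H f = 0"
proof (rule ccontr)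
  assume A: "\<not> ?thesis"
  interpret A: comm_ring_map "\<lambda>c. ap c x" by (rule ap_map)
  have "range \<iota> \<subseteq> range (\<lambda>c. ap c x)"
    by (auto intro: rev_image_eqI[of "[:a:]" for a])
  moreover have "range (\<lambda>c. ap c x) \<subseteq> K" using ap_K assms(1) by auto
  ultimately obtain P where P: "P \<in> Pts" "range (\<lambda>c. ap c x) \<subseteq> Loc P" "f \<notin> Loc P"
    using exists_point_off_integral_closure[OF ap_map _ _ assms(2), of x] A by blast
  have "ap [:0, 1:] x \<in> Loc P" using P(2) by blast
  then show False using assms(3) P by simp
qed

text \<open>
  A nonconstant element is transcendental over the constants, hence not integral over them.
\<close>

lemma exists_pole:
  assumes "f \<in> K" "f \<notin> range \<iota>"
  shows "\<exists>P\<in>Pts. f \<notin> Loc P"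
proof -
  have ne: "peval \<iota> H f \<noteq> 0" if "Polynomial.lead_coeff H = 1" for H
    using transcendental[OF assms(2), of H] that by (cases "H = 0") auto
  show ?thesis
    using exists_point_off_integral_closure[OF iota _ _ assms(1) ne] iota_K by blast
qed

end

subsection \<open>Zeros, poles and degrees\<close>

context point_field
begin

text \<open>
  Let \<open>\<xi>\<close> be one of the functions that separate points on a chart. The relation between \<open>\<xi>\<close> and \<open>f\<close> takes at a
  zero of \<open>f\<close> the form \<open>q(\<xi>) = 0\<close>, so \<open>\<xi>\<close> has only finitely many values at the zeros of \<open>f\<close>.
\<close>

lemma finite_zeros:
  assumes f: "f \<in> K" "f \<noteq> 0"
  shows "finite {P \<in> Pts. f \<in> Loc P \<and> ev P f = 0}"
proof -
  obtain Xs where Xs: "finite Xs" "Pts = \<Union>Xs" and ch: "\<And>Y. Y \<in> Xs \<Longrightarrow> \<exists>\<Xi>. finite \<Xi> \<and> \<Xi> \<subseteq> K \<and>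
      (\<forall>P\<in>Y. \<Xi> \<subseteq> Loc P) \<and> (\<forall>P\<in>Y. \<forall>Q\<in>Y. (\<forall>\<xi>\<in>\<Xi>. ev P \<xi> = ev Q \<xi>) \<longrightarrow> P = Q)"
    using charts by (elim exE conjE) (rule that, assumption, assumption, erule bspec)
  have "finite {P \<in> Y. f \<in> Loc P \<and> ev P f = 0}" (is "finite ?Z") if Y: "Y \<in> Xs" for Y
  proof -
    obtain \<Xi> where \<Xi>: "finite \<Xi>" "\<Xi> \<subseteq> K" "\<And>P. P \<in> Y \<Longrightarrow> \<Xi> \<subseteq> Loc P"
      "\<And>P Q. P \<in> Y \<Longrightarrow> Q \<in> Y \<Longrightarrow> (\<forall>\<xi>\<in>\<Xi>. ev P \<xi> = ev Q \<xi>) \<Longrightarrow> P = Q"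
      using ch[OF Y] by metis
    have "\<exists>q. q \<noteq> 0 \<and> (\<forall>P\<in>?Z. poly q (ev P \<xi>) = 0)" if \<xi>: "\<xi> \<in> \<Xi>" for \<xi>
    proof -
      obtain q s where qs: "q \<noteq> 0" "ap q \<xi> = - (f * peval (\<lambda>c. ap c \<xi>) s f)"
        using relation_at_0[of \<xi> f] f \<xi> \<Xi>(2) by blast
      interpret Z: comm_ring_map "\<lambda>c. ap c \<xi>" by (rule ap_map)
      have "poly q (ev P \<xi>) = 0" if P: "P \<in> ?Z" for P
      proof -
        have PP: "P \<in> Pts" using P Y Xs(2) by auto
        have \<xi>L: "\<xi> \<in> Loc P" using P \<xi> \<Xi>(3) by auto
        have sL: "peval (\<lambda>c. ap c \<xi>) s f \<in> Loc P"
          using ap_Loc[OF PP \<xi>L] P by (intro Z.peval_in[OF Loc_subrg[OF PP]]) auto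
        have "poly q (ev P \<xi>) = ev P (ap q \<xi>)" using ev_ap[OF PP \<xi>L] by simp
        also have "\<dots> = 0"
          using P sL PP unfolding qs(2) by (simp add: ev_uminus ev_mult rg)
        finally show ?thesis .
      qed
      then show ?thesis using qs(1) by blast
    qed
    then obtain q where q: "\<And>\<xi>. \<xi> \<in> \<Xi> \<Longrightarrow> q \<xi> \<noteq> 0"
      "\<And>\<xi> P. \<xi> \<in> \<Xi> \<Longrightarrow> P \<in> ?Z \<Longrightarrow> poly (q \<xi>) (ev P \<xi>) = 0" by metis
    have "inj_on (\<lambda>P. restrict (\<lambda>\<xi>. ev P \<xi>) \<Xi>) ?Z"
      by (rule inj_onI) (metis (mono_tags, lifting) \<Xi>(4) mem_Collect_eq restrict_apply')
    moreover have "(\<lambda>P. restrict (\<lambda>\<xi>. ev P \<xi>) \<Xi>) ` ?Z \<subseteq> (\<Pi>\<^sub>E \<xi>\<in>\<Xi>. {a. poly (q \<xi>) a = 0})"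
      using q(2) by auto
    moreover have "finite (\<Pi>\<^sub>E \<xi>\<in>\<Xi>. {a. poly (q \<xi>) a = 0})"
      using \<Xi>(1) q(1) by (intro finite_PiE) (auto intro: poly_roots_finite)
    ultimately show ?thesis by (meson finite_imageD finite_subset)
  qed
  then have "finite (\<Union>Y\<in>Xs. {P \<in> Y. f \<in> Loc P \<and> ev P f = 0})" using Xs(1) by blast
  moreover have "{P \<in> Pts. f \<in> Loc P \<and> ev P f = 0} = (\<Union>Y\<in>Xs. {P \<in> Y. f \<in> Loc P \<and> ev P f = 0})"
    using Xs(2) by auto
  ultimately show ?thesis by simp
qed

lemma finite_poles:
  assumes "f \<in> K"
  shows "finite {P \<in> Pts. f \<notin> Loc P}"
proof (cases "f = 0")
  case True
  then have "{P \<in> Pts. f \<notin> Loc P} = {}" using rg(1) by auto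
  then show ?thesis by (simp only: finite.emptyI)
next
  case False
  then have "finite {P \<in> Pts. inverse f \<in> Loc P \<and> ev P (inverse f) = 0}"
    using finite_zeros[of "inverse f"] assms K_inverse by simp
  moreover have "{P \<in> Pts. f \<notin> Loc P} \<subseteq> {P \<in> Pts. inverse f \<in> Loc P \<and> ev P (inverse f) = 0}"
    using not_Loc[OF _ assms] by blast
  ultimately show ?thesis by (rule finite_subset[rotated])
qed

lemma finite_val_nonzero:
  assumes "f \<in> K" "f \<noteq> 0"
  shows "finite {P \<in> Pts. val P f \<noteq> 0}"
proof (rule finite_subset)
  show "{P \<in> Pts. val P f \<noteq> 0} \<subseteq> {P \<in> Pts. f \<notin> Loc P} \<union> {P \<in> Pts. f \<in> Loc P \<and> ev P f = 0}"
  proof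
    fix P assume "P \<in> {P \<in> Pts. val P f \<noteq> 0}"
    then have P: "P \<in> Pts" "val P f \<noteq> 0" by auto
    show "P \<in> {P \<in> Pts. f \<notin> Loc P} \<union> {P \<in> Pts. f \<in> Loc P \<and> ev P f = 0}"
      using P Loc_iff_val[OF P(1) assms] vge_1[OF P(1), of f] by (auto simp: vge_def[OF P(1)] assms)
  qed
qed (use assms finite_zeros finite_poles in auto)

text \<open>
  Functions without poles are constant. Allowing one more pole at one point \<open>Q\<close> enlarges the space by at
  most one dimension, since two functions with that pole have proportional leading terms at \<open>Q\<close>.
\<close>

lemma sections_finite_dimensional:
  assumes "finite S" "S \<subseteq> Pts"
  shows "(\<Sum>P\<in>S. D P) = n \<Longrightarrow>
    \<exists>G. finite G \<and> card G \<le> Suc n \<and>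
      {f \<in> K. \<forall>P\<in>Pts. vge P (if P \<in> S then - int (D P) else 0) f} \<subseteq> vs.span G"
proof (induction n arbitrary: D)
  case 0
  then have D0: "D P = 0" if "P \<in> S" for P using that assms(1) by simp
  have "f \<in> vs.span {1}" if f: "f \<in> K" "\<forall>P\<in>Pts. vge P (if P \<in> S then - int (D P) else 0) f" for f
  proof -
    have "\<forall>P\<in>Pts. f \<in> Loc P"
      using f(2) D0 by (auto simp: vge_0 split: if_splits)
    then obtain c where "f = \<iota> c" using exists_pole[OF f(1)] by auto
    then show ?thesis using vs.span_scale[OF vs.span_base[of 1 "{1}"], of c] by simp
  qed
  then show ?case by (intro exI[of _ "{1}"]) auto
next
  case (Suc n)
  then obtain Q where Q: "Q \<in> S" "D Q > 0" by (metis gr0I sum.neutral nat.distinct(1))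
  have QP: "Q \<in> Pts" using Q assms by auto
  define E where "E = D(Q := D Q - 1)"
  have "(\<Sum>P\<in>S. E P) = (\<Sum>P\<in>S. D P) - 1"
    using assms(1) Q by (simp add: E_def sum.remove[of S Q])
  then have sE: "(\<Sum>P\<in>S. E P) = n" using Suc.prems by simp
  define LD where "LD = {f \<in> K. \<forall>P\<in>Pts. vge P (if P \<in> S then - int (D P) else 0) f}"
  define LE where "LE = {f \<in> K. \<forall>P\<in>Pts. vge P (if P \<in> S then - int (E P) else 0) f}"
  obtain G where G: "finite G" "card G \<le> Suc n" "LE \<subseteq> vs.span G"
    using Suc.IH[OF sE] unfolding LE_def by blast
  show ?case
  proof (cases "LD \<subseteq> LE")
    case True
    then show ?thesis using G unfolding LD_def by (intro exI[of _ G]) auto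
  next
    case False
    then obtain f0 where f0: "f0 \<in> LD" "f0 \<notin> LE" by blast
    have f0K: "f0 \<in> K" using f0(1) by (simp add: LD_def)
    have in_LE: "f \<in> LE" if "f \<in> LD" "vge Q (- int (D Q) + 1) f" for f
      using that Q by (auto simp: LD_def LE_def E_def)
    have f0n: "\<not> vge Q (- int (D Q) + 1) f0" using in_LE f0 by blast
    have f0v: "vge Q (- int (D Q)) f0" using f0(1) Q QP by (auto simp: LD_def)
    have nz: "f0 \<noteq> 0" using f0n vge_zero[OF QP] by auto
    have v0: "val Q f0 = - int (D Q)"
      using f0n f0v nz f0K by (auto simp: vge_def[OF QP])
    have "f \<in> vs.span (insert f0 G)" if f: "f \<in> LD" for f
    proof -
      have fv: "vge Q (- int (D Q)) f" using f Q QP by (auto simp: LD_def)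
      have iv: "vge Q (int (D Q)) (inverse f0)"
        using nz f0K v0 by (simp add: vge_def[OF QP] val_inverse[OF QP] K_inverse)
      have q: "f * inverse f0 \<in> Loc Q"
        using vge_mult[OF QP fv iv] by (simp add: vge_0[OF QP])
      define c where "c = ev Q (f * inverse f0)"
      have "vge Q 1 (f * inverse f0 - \<iota> c)"
        using q QP by (simp add: vge_1 rg ev_diff iota_Loc ev_iota c_def)
      then have "vge Q (1 + - int (D Q)) ((f * inverse f0 - \<iota> c) * f0)"
        using vge_mult[OF QP] f0v by blast
      then have "vge Q (- int (D Q) + 1) (f - \<iota> c * f0)"
        using nz by (simp add: left_diff_distrib mult.assoc add.commute)
      moreover have "f - \<iota> c * f0 \<in> LD"
        using f f0(1) unfolding LD_def
        by (auto simp: K_rg iota_K vge_diff mult.commute[of "\<iota> c"] iota_Loc intro!: vge_diff vge_mult_Loc)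
      ultimately have "f - \<iota> c * f0 \<in> vs.span (insert f0 G)"
        using in_LE G(3) vs.span_mono[of G "insert f0 G"] by blast
      moreover have "\<iota> c * f0 \<in> vs.span (insert f0 G)"
        by (intro vs.span_scale vs.span_base) simp
      ultimately show ?thesis using vs.span_add by fastforce
    qed
    then show ?thesis using G(1,2) unfolding LD_def
      by (intro exI[of _ "insert f0 G"]) (auto simp: card_insert_if)
  qed
qed

text \<open>
  Linear independence over \<open>\<complex>(x)\<close>, with denominators cleared.
\<close>

definition indep :: "'k \<Rightarrow> 'j set \<Rightarrow> ('j \<Rightarrow> 'k) \<Rightarrow> bool" where
  "indep x J u \<longleftrightarrow> (\<forall>p. (\<Sum>j\<in>J. ap (p j) x * u j) = 0 \<longrightarrow> (\<forall>j\<in>J. p j = 0))"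

text \<open>
  At a pole \<open>P\<close> of \<open>u\<close> where \<open>x\<close> is regular, a power of \<open>x - x(P)\<close> cancels the pole.
\<close>

lemma clear_poles:
  assumes x: "x \<in> K" and u: "u \<in> K"
  shows "\<exists>c. c \<noteq> 0 \<and> (\<forall>P\<in>Pts. x \<in> Loc P \<longrightarrow> ap c x * u \<in> Loc P)"
proof (cases "u = 0")
  case True then show ?thesis using rg(1) by (intro exI[of _ 1]) auto
next
  case False
  define B where "B = {P \<in> Pts. u \<notin> Loc P \<and> x \<in> Loc P}"
  have finB: "finite B" unfolding B_def by (rule finite_subset[OF _ finite_poles[OF u]]) auto
  define k where "k P = nat (- val P u)" for P
  define c where "c = (\<Prod>P\<in>B. [:- ev P x, 1:] ^ k P)"
  have "c \<noteq> 0" using finB by (simp add: c_def)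
  moreover have "ap c x * u \<in> Loc P" if P: "P \<in> Pts" "x \<in> Loc P" for P
  proof (cases "P \<in> B")
    case False
    then have "u \<in> Loc P" using P by (auto simp: B_def)
    then show ?thesis using ap_Loc[OF P] rg[OF P(1)] by simp
  next
    case True
    define d where "d = (\<Prod>P\<in>B-{P}. [:- ev P x, 1:] ^ k P)"
    have cd: "c = [:- ev P x, 1:] ^ k P * d"
      unfolding c_def d_def by (rule prod.remove[OF finB True])
    have "ap [:- ev P x, 1:] x = x - \<iota> (ev P x)" by (simp add: iota.map_uminus)
    moreover have "vge P 1 (x - \<iota> (ev P x))"
      using P by (simp add: vge_1 rg ev_diff iota_Loc ev_iota)
    ultimately have "vge P (int (k P) * 1) (ap ([:- ev P x, 1:] ^ k P) x)"
      using vge_power[OF P(1)] by (simp only: iota.peval_power)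
    then have "vge P (int (k P)) (ap c x)"
      unfolding cd iota.peval_mult using vge_mult_Loc[OF P(1)] ap_Loc[OF P] by simp
    moreover have "vge P (- int (k P)) u"
      using u by (auto simp: vge_def[OF P(1)] k_def)
    ultimately have "vge P (int (k P) + - int (k P)) (ap c x * u)"
      by (rule vge_mult[OF P(1)])
    then show ?thesis by (simp add: vge_0[OF P(1)])
  qed
  ultimately show ?thesis by blast
qed

lemma ex_nat_bound:
  fixes f :: "'c \<Rightarrow> int"
  assumes "finite A"
  shows "\<exists>N::nat. \<forall>a\<in>A. f a \<le> int N"
  using assms
proof induction
  case (insert a A)
  then obtain N where "\<forall>a\<in>A. f a \<le> int N" by blast
  then have "\<forall>b\<in>insert a A. f b \<le> int (N + nat (f a))" by auto
  then show ?case by blast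
qed auto

text \<open>
  The degree of the divisor of poles.
\<close>

definition pole_number :: "'k \<Rightarrow> nat" where
  "pole_number x = (\<Sum>P | P \<in> Pts \<and> x \<notin> Loc P. nat (- val P x))"

text \<open>
  Let \<open>d\<close> be the pole number of \<open>x\<close>, and let \<open>w j\<close> be the members of the family, multiplied by polynomials
  in \<open>x\<close> so that their poles are poles of \<open>x\<close>. The products \<open>x ^ i * w j\<close> with \<open>i \<le> k\<close> are linearly
  independent over \<open>\<complex>\<close>, and they lie in a space of dimension at most \<open>(k + N) d + 1\<close> for a constant \<open>N\<close>. For
  large \<open>k\<close> this leaves no room for more than \<open>d\<close> indices \<open>j\<close>.
\<close>

lemma card_indep_le:
  assumes x: "x \<in> K" "x \<notin> range \<iota>" and J: "finite J" "u ` J \<subseteq> K" "indep x J u"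
  shows "card J \<le> pole_number x"
proof (rule ccontr)
  assume "\<not> card J \<le> pole_number x"
  then have gt: "pole_number x + 1 \<le> card J" by simp
  define S where "S = {P \<in> Pts. x \<notin> Loc P}"
  have S: "finite S" "S \<subseteq> Pts" using finite_poles[OF x(1)] by (auto simp: S_def)
  have xnz: "x \<noteq> 0" using x(2) by (metis iota.map_0 rangeI)
  have vx: "val P x < 0" if "P \<in> S" for P
    using that Loc_iff_val[OF _ x(1) xnz] by (auto simp: S_def)
  have "\<exists>c. \<forall>j\<in>J. c j \<noteq> 0 \<and> (\<forall>P\<in>Pts. x \<in> Loc P \<longrightarrow> ap (c j) x * u j \<in> Loc P)"
    using clear_poles[OF x(1)] J(2) by (intro bchoice) blast
  then obtain c where c: "\<And>j. j \<in> J \<Longrightarrow> c j \<noteq> 0"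
    "\<And>j P. j \<in> J \<Longrightarrow> P \<in> Pts \<Longrightarrow> x \<in> Loc P \<Longrightarrow> ap (c j) x * u j \<in> Loc P" by blast
  define w where "w j = ap (c j) x * u j" for j
  have wK: "w j \<in> K" if "j \<in> J" for j using that J(2) ap_K[OF x(1)] K_rg by (auto simp: w_def)
  obtain N :: nat where N': "\<forall>a\<in>S \<times> J. - val (fst a) (w (snd a)) \<le> int N"
    using ex_nat_bound[OF finite_cartesian_product[OF S(1) J(1)], of "\<lambda>a. - val (fst a) (w (snd a))"] by blast
  have N: "- val P (w j) \<le> int N" if "P \<in> S" "j \<in> J" for P j
    using bspec[OF N', of "(P, j)"] that by simp
  define d where "d = pole_number x"
  \<comment> \<open>large enough for \<open>(k + N) d + 1 < (k + 1) (d + 1)\<close>\<close>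
  define k where "k = N * d + 1"
  define D where "D P = (k + N) * nat (- val P x)" for P
  have sD: "(\<Sum>P\<in>S. D P) = (k + N) * d"
    by (simp add: D_def d_def pole_number_def S_def sum_distrib_left)
  obtain G where G: "finite G" "card G \<le> Suc ((k + N) * d)"
    "{f \<in> K. \<forall>P\<in>Pts. vge P (if P \<in> S then - int (D P) else 0) f} \<subseteq> vs.span G"
    using sections_finite_dimensional[OF S sD] by blast
  define F where "F = (\<lambda>(i::nat, j). x ^ i * w j)"
  have "F ` ({..k} \<times> J) \<subseteq> vs.span G"
  proof
    fix f assume "f \<in> F ` ({..k} \<times> J)"
    then obtain i j where ij: "i \<le> k" "j \<in> J" "f = x ^ i * w j" by (auto simp: F_def)
    have "vge P (if P \<in> S then - int (D P) else 0) f" if P: "P \<in> Pts" for P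
    proof (cases "P \<in> S")
      case True
      have "vge P (int i * val P x) (x ^ i)"
        by (intro vge_power[OF P]) (simp add: vge_def[OF P] x)
      moreover have "vge P (- int N) (w j)"
        using N[OF True ij(2)] wK[OF ij(2)] by (simp add: vge_def[OF P])
      ultimately have "vge P (int i * val P x + - int N) f"
        unfolding ij(3) by (rule vge_mult[OF P])
      moreover have "- int (D P) \<le> int i * val P x + - int N"
      proof -
        define e where "e = - val P x"
        have "e \<ge> 1" using vx[OF True] by (simp add: e_def)
        have "int i * e \<le> int k * e" using ij(1) \<open>e \<ge> 1\<close> by (intro mult_right_mono) auto
        moreover have "int N * 1 \<le> int N * e" using \<open>e \<ge> 1\<close> by (intro mult_left_mono) auto
        moreover have "int (D P) = (int k + int N) * e" using \<open>e \<ge> 1\<close> by (simp add: D_def e_def)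
        ultimately show ?thesis by (simp add: e_def algebra_simps)
      qed
      ultimately show ?thesis using vge_mono[OF P] True by simp
    next
      case False
      then have "x \<in> Loc P" using P by (simp add: S_def)
      then have "f \<in> Loc P" using c(2)[OF ij(2) P] rg[OF P] unfolding ij(3) w_def by simp
      then show ?thesis using False vge_0[OF P] by simp
    qed
    moreover have "f \<in> K" using ij wK x K_rg by simp
    ultimately show "f \<in> vs.span G" using G(3) by blast
  qed
  moreover have "card G < card ({..k} \<times> J)"
  proof -
    have "card G \<le> (k + N) * d + 1" using G(2) by simp
    also have "\<dots> < (k + 1) * (d + 1)" by (simp add: k_def algebra_simps)
    also have "\<dots> \<le> (k + 1) * card J" using gt unfolding d_def by (intro mult_left_mono) auto
    finally show ?thesis by (simp add: card_cartesian_product)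
  qed
  ultimately obtain a where a: "\<exists>i\<in>{..k} \<times> J. a i \<noteq> 0" "(\<Sum>i\<in>{..k} \<times> J. \<iota> (a i) * F i) = 0"
    using vs.family_dependent[of "{..k} \<times> J" G F] G(1) J(1) by auto
  define p where "p j = (\<Sum>i\<le>k. Polynomial.monom (a (i, j)) i)" for j
  have "0 = (\<Sum>i\<le>k. \<Sum>j\<in>J. \<iota> (a (i, j)) * (x ^ i * w j))"
    using a(2) by (simp add: sum.cartesian_product F_def case_prod_unfold)
  also have "\<dots> = (\<Sum>j\<in>J. \<Sum>i\<le>k. \<iota> (a (i, j)) * (x ^ i * w j))" by (rule sum.swap)
  also have "\<dots> = (\<Sum>j\<in>J. ap (p j * c j) x * u j)"
    by (intro sum.cong refl)
      (simp add: iota.peval_mult p_def iota.peval_sum iota.peval_monom w_def sum_distrib_right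
        sum_distrib_left mult_ac)
  finally have "\<forall>j\<in>J. p j * c j = 0" using J(3) unfolding indep_def by metis
  then have p0: "p j = 0" if "j \<in> J" for j using c(1) that by auto
  have "a (i, j) = 0" if "i \<le> k" "j \<in> J" for i j
  proof -
    have "poly.coeff (p j) i = a (i, j)" using that(1) by (simp add: p_def coeff_sum)
    then show ?thesis using p0[OF that(2)] by simp
  qed
  then show False using a(1) by auto
qed

text \<open>
  If \<open>a\<close> has the value 1 at \<open>P\<close> and 0 at the other points, then \<open>1 - (1 - a ^ N) ^ N\<close> agrees with these values
  to order \<open>N\<close>.
\<close>

lemma approximation:
  assumes S: "finite S" "S \<subseteq> Pts" and P: "P \<in> S"
  shows "\<exists>f\<in>K. vge P (int N) (f - 1) \<and> (\<forall>Q\<in>S - {P}. vge Q (int N) f)"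
proof -
  obtain a where a: "\<And>Q. Q \<in> S \<Longrightarrow> a \<in> Loc Q \<and> ev Q a = (if Q = P then 1 else 0)"
    using separation[OF S P] by blast
  have PP: "P \<in> Pts" using S P by auto
  have aK: "a \<in> K" using a[OF P] Loc_K[OF PP] by auto
  define f where "f = 1 - (1 - a ^ N) ^ N"
  have "vge P 1 (1 - a ^ N)"
    using a[OF P] PP by (simp add: vge_1 rg ev_diff ev_power ev_1)
  then have "vge P (int N * 1) (- ((1 - a ^ N) ^ N))"
    using vge_uminus[OF PP] vge_power[OF PP] by blast
  then have 1: "vge P (int N) (f - 1)" by (simp add: f_def)
  have 2: "vge Q (int N) f" if Q: "Q \<in> S - {P}" for Q
  proof -
    have QP: "Q \<in> Pts" using Q S by auto
    have aL: "a \<in> Loc Q" using a Q by auto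
    have "vge Q 1 a" using a[of Q] Q QP by (simp add: vge_1)
    then have v: "vge Q (int N * 1) (a ^ N)" by (rule vge_power[OF QP])
    have "f = (1 - (1 - a ^ N)) * (\<Sum>i<N. (1 - a ^ N) ^ i)"
      unfolding f_def by (rule one_diff_power_eq)
    then have "f = a ^ N * (\<Sum>i<N. (1 - a ^ N) ^ i)" by simp
    moreover have "(\<Sum>i<N. (1 - a ^ N) ^ i) \<in> Loc Q"
      using aL rg[OF QP] by (intro subrg_sum[OF Loc_subrg[OF QP]]) simp
    ultimately show ?thesis using vge_mult_Loc[OF QP v] by simp
  qed
  show ?thesis using 1 2 aK K_rg by (intro bexI[of _ f]) (auto simp: f_def)
qed

lemma pCons_poly_shift: "p = pCons (poly.coeff p 0) (poly_shift 1 p)"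
  by (rule poly_eqI) (simp add: coeff_pCons coeff_poly_shift split: nat.split)

text \<open>
  For a zero \<open>P\<close> of order \<open>e\<close> the family contains \<open>e\<close> functions that approximate \<open>1, t, \<dots>, t ^ (e - 1)\<close> at
  \<open>P\<close> and 0 at the other zeros. In a relation with coefficients in \<open>\<complex>[z]\<close>, the constant terms of the
  coefficients give a combination that is divisible by \<open>z\<close>, so its expansion at \<open>P\<close> vanishes to order \<open>e\<close>
  and all these constant terms are 0. Then the relation can be divided by \<open>z\<close>, and so on.
\<close>

lemma indep_family_of_zeros:
  assumes z: "z \<in> K" "z \<noteq> 0" and S: "finite S" "S \<subseteq> Pts" and pos: "\<And>P. P \<in> S \<Longrightarrow> val P z > 0"
  shows "\<exists>u. u ` (SIGMA P:S. {..<nat (val P z)}) \<subseteq> K \<and> indep z (SIGMA P:S. {..<nat (val P z)}) u"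
proof -
  define e where "e P = nat (val P z)" for P
  define J where "J = (SIGMA P:S. {..<e P})"
  have finJ: "finite J" using S by (simp add: J_def)
  have tK: "t P \<in> K" if "P \<in> S" for P using that S Loc_K t_Loc by blast
  obtain N1 :: nat where N1': "\<forall>a\<in>S \<times> J. int (e (fst a)) - int (snd (snd a)) * val (fst a) (t (fst (snd a))) \<le> int N1"
    using ex_nat_bound[OF finite_cartesian_product[OF S(1) finJ],
        of "\<lambda>a. int (e (fst a)) - int (snd (snd a)) * val (fst a) (t (fst (snd a)))"] by blast
  have N1: "int (e Q) - int j * val Q (t P) \<le> int N1" if "Q \<in> S" "(P, j) \<in> J" for Q P j
    using bspec[OF N1', of "(Q, (P, j))"] that by simp
  obtain N2 :: nat where N2: "\<And>Q. Q \<in> S \<Longrightarrow> int (e Q) \<le> int N2"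
    using ex_nat_bound[OF S(1), of "\<lambda>Q. int (e Q)"] by auto
  \<comment> \<open>\<open>N1\<close> compensates for poles of the uniformizers at other points, \<open>N2\<close> exceeds all orders\<close>
  define N where "N = N1 + N2"
  have "\<exists>f. \<forall>P\<in>S. f P \<in> K \<and> vge P (int N) (f P - 1) \<and> (\<forall>Q\<in>S - {P}. vge Q (int N) (f P))"
    using approximation[OF S] by (intro bchoice) blast
  then obtain f where f: "\<And>P. P \<in> S \<Longrightarrow> f P \<in> K" "\<And>P. P \<in> S \<Longrightarrow> vge P (int N) (f P - 1)"
    "\<And>P Q. P \<in> S \<Longrightarrow> Q \<in> S \<Longrightarrow> Q \<noteq> P \<Longrightarrow> vge Q (int N) (f P)" by blast
  define u where "u = (\<lambda>(P, j). f P * t P ^ j)"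
  have uK: "u i \<in> K" if "i \<in> J" for i using that f(1) tK K_rg by (auto simp: u_def J_def)
  have off: "vge Q (int (e Q)) (u (P, j))" if "Q \<in> S" "(P, j) \<in> J" "Q \<noteq> P" for Q P j
  proof -
    have QP: "Q \<in> Pts" and PP: "P \<in> S" using that S by (auto simp: J_def)
    have "vge Q (int j * val Q (t P)) (t P ^ j)"
      using tK[OF PP] by (intro vge_power[OF QP]) (simp add: vge_def[OF QP])
    then have "vge Q (int N + int j * val Q (t P)) (u (P, j))"
      unfolding u_def using vge_mult[OF QP f(3)[OF PP that(1,3)]] by simp
    moreover have "int (e Q) \<le> int N + int j * val Q (t P)" using N1[OF that(1,2)] by (simp add: N_def)
    ultimately show ?thesis using vge_mono[OF QP] by blast
  qed
  have on: "vge Q (int (e Q)) (u (Q, j) - t Q ^ j)" if "(Q, j) \<in> J" for Q j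
  proof -
    have QS: "Q \<in> S" and QP: "Q \<in> Pts" using that S by (auto simp: J_def)
    have "vge Q (int N) ((f Q - 1) * t Q ^ j)"
      using vge_mult_Loc[OF QP f(2)[OF QS]] t_Loc[OF QP] rg[OF QP] by simp
    then show ?thesis using vge_mono[OF QP] N2[OF QS] by (simp add: u_def N_def algebra_simps)
  qed
  have uL: "u (P, j) \<in> Loc Q" if "Q \<in> S" "(P, j) \<in> J" for Q P j
  proof -
    have QP: "Q \<in> Pts" using that S by auto
    show ?thesis
    proof (cases "Q = P")
      case True
      then have "(Q, j) \<in> J" using that by simp
      from vge_mono[OF QP on[OF this], of 0] have "u (Q, j) - t Q ^ j \<in> Loc Q"
        by (simp add: vge_0[OF QP])
      then have "(u (Q, j) - t Q ^ j) + t Q ^ j \<in> Loc Q"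
        by (rule rg(3)[OF QP]) (intro rg(7)[OF QP] t_Loc[OF QP])
      then show ?thesis using True by simp
    next
      case False
      then show ?thesis using vge_mono[OF QP off[OF that False], of 0] by (simp add: vge_0[OF QP])
    qed
  qed
  have zv: "vge Q (int (e Q)) z" if "Q \<in> S" for Q
    using that S pos[OF that] z by (subst vge_def) (auto simp: e_def)
  have zL: "z \<in> Loc Q" if "Q \<in> S" for Q
    using vge_mono[OF _ zv[OF that], of 0] that S by (auto simp: vge_0)
  have const_0: "poly.coeff (p i) 0 = 0" if p: "(\<Sum>i\<in>J. ap (p i) z * u i) = 0" and i: "i \<in> J" for p i
  proof -
    obtain Q j0 where Qj: "i = (Q, j0)" "Q \<in> S" "j0 < e Q" using i by (auto simp: J_def)
    have QP: "Q \<in> Pts" using Qj S by auto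
    define c where "c i = poly.coeff (p i) 0" for i
    define q where "q i = poly_shift 1 (p i)" for i
    have pq: "p i = pCons (c i) (q i)" for i
      unfolding q_def c_def by (rule pCons_poly_shift)
    have "(\<Sum>i\<in>J. \<iota> (c i) * u i) = - (z * (\<Sum>i\<in>J. ap (q i) z * u i))"
      using p unfolding pq
      by (simp add: distrib_right sum.distrib sum_distrib_left mult.assoc add_eq_0_iff2)
    moreover have "vge Q (int (e Q)) (- (z * (\<Sum>i\<in>J. ap (q i) z * u i)))"
      using zv[OF Qj(2)] uL[OF Qj(2)] ap_Loc[OF QP zL[OF Qj(2)]] rg[OF QP]
      by (intro vge_uminus[OF QP] vge_mult_Loc[OF QP] subrg_sum[OF Loc_subrg[OF QP]]) auto
    ultimately have all: "vge Q (int (e Q)) (\<Sum>i\<in>J. \<iota> (c i) * u i)" by simp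
    have v1: "vge Q (int (e Q)) (\<Sum>P\<in>S - {Q}. \<Sum>j<e P. \<iota> (c (P, j)) * u (P, j))"
    proof (intro vge_sum[OF QP])
      fix P j assume "P \<in> S - {Q}" "j \<in> {..<e P}"
      then have "vge Q (int (e Q)) (u (P, j))" by (intro off Qj(2)) (auto simp: J_def)
      from vge_mult_Loc[OF QP this iota_Loc[OF QP, of "c (P, j)"]]
      show "vge Q (int (e Q)) (\<iota> (c (P, j)) * u (P, j))" by (simp only: mult.commute)
    qed
    have v2: "vge Q (int (e Q)) (\<Sum>j<e Q. \<iota> (c (Q, j)) * (u (Q, j) - t Q ^ j))"
    proof (intro vge_sum[OF QP])
      fix j assume "j \<in> {..<e Q}"
      then have "vge Q (int (e Q)) (u (Q, j) - t Q ^ j)" using Qj(2) by (intro on) (auto simp: J_def)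
      from vge_mult_Loc[OF QP this iota_Loc[OF QP, of "c (Q, j)"]]
      show "vge Q (int (e Q)) (\<iota> (c (Q, j)) * (u (Q, j) - t Q ^ j))" by (simp only: mult.commute)
    qed
    have "(\<Sum>i\<in>J. \<iota> (c i) * u i) = (\<Sum>P\<in>S. \<Sum>j<e P. \<iota> (c (P, j)) * u (P, j))"
      using S by (simp add: J_def sum.Sigma)
    also have "\<dots> = (\<Sum>j<e Q. \<iota> (c (Q, j)) * u (Q, j)) + (\<Sum>P\<in>S - {Q}. \<Sum>j<e P. \<iota> (c (P, j)) * u (P, j))"
      by (rule sum.remove[OF S(1) Qj(2)])
    finally have "(\<Sum>j<e Q. \<iota> (c (Q, j)) * t Q ^ j) = (\<Sum>i\<in>J. \<iota> (c i) * u i)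
        - (\<Sum>P\<in>S - {Q}. \<Sum>j<e P. \<iota> (c (P, j)) * u (P, j)) - (\<Sum>j<e Q. \<iota> (c (Q, j)) * (u (Q, j) - t Q ^ j))"
      by (simp add: sum_subtractf right_diff_distrib)
    then have "vge Q (int (e Q)) (\<Sum>j<e Q. \<iota> (c (Q, j)) * t Q ^ j)"
      using all v1 v2 vge_diff[OF QP] by simp
    from truncated_expansion_eq_0[OF QP this Qj(3)] show ?thesis by (simp add: c_def Qj(1))
  qed
  have "\<forall>i\<in>J. poly.coeff (p i) n = 0" if p: "(\<Sum>i\<in>J. ap (p i) z * u i) = 0" for p n
    using p
  proof (induction n arbitrary: p)
    case 0 then show ?case using const_0 by blast
  next
    case (Suc n)
    define q where "q i = poly_shift 1 (p i)" for i
    have pq: "p i = pCons 0 (q i)" if "i \<in> J" for i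
      using const_0[OF Suc.prems that] pCons_poly_shift[of "p i"] by (simp add: q_def)
    have "z * (\<Sum>i\<in>J. ap (q i) z * u i) = (\<Sum>i\<in>J. ap (p i) z * u i)"
      unfolding sum_distrib_left by (intro sum.cong refl) (simp add: pq mult.assoc)
    then have "(\<Sum>i\<in>J. ap (q i) z * u i) = 0" using Suc.prems z by simp
    then show ?case using Suc.IH pq by simp
  qed
  then have "indep z J u" unfolding indep_def by (metis coeff_0 poly_eqI)
  then show ?thesis using uK unfolding J_def e_def by (intro exI[of _ u]) auto
qed

end

context point_field
begin

lemma inverse_nonconstant:
  assumes "x \<notin> range \<iota>"
  shows "inverse x \<notin> range \<iota>"
proof
  assume "inverse x \<in> range \<iota>"
  then obtain c where c: "inverse x = \<iota> c" by auto
  have "x \<noteq> 0" using assms by (metis iota.map_0 rangeI)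
  then have "c \<noteq> 0" using c by auto
  then have "\<iota> c * \<iota> (inverse c) = 1" by (simp flip: iota.map_mult)
  then have "x = \<iota> (inverse c)" using c by (metis inverse_inverse_eq inverse_unique)
  then show False using assms by auto
qed

lemma nonzero_if_nonconstant: "x \<notin> range \<iota> \<Longrightarrow> x \<noteq> 0"
  by (metis iota.map_0 rangeI)

text \<open>
  The zeros of \<open>x\<close> give an independent family over \<open>\<complex>(x)\<close>, so there are at most as many zeros as poles. For
  \<open>1 / x\<close> this is the opposite inequality. The family is then a basis of \<open>K\<close> over \<open>\<complex>(x)\<close>.
\<close>

lemma pole_number_eq_zeros:
  assumes x: "x \<in> K" "x \<notin> range \<iota>"
  shows "pole_number x = (\<Sum>P | P \<in> Pts \<and> 0 < val P x. nat (val P x))" (is "_ = ?z x")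
    and "\<exists>J::('p \<times> nat) set. \<exists>u. finite J \<and> card J = pole_number x \<and> u ` J \<subseteq> K \<and> indep x J u"
proof -
  have p_eq: "pole_number x = ?z (inverse x)" if "x \<in> K" "x \<notin> range \<iota>" for x
    unfolding pole_number_def
  proof (rule sum.cong)
    note nz = nonzero_if_nonconstant[OF that(2)]
    show "{P. P \<in> Pts \<and> x \<notin> Loc P} = {P. P \<in> Pts \<and> 0 < val P (inverse x)}"
      using Loc_iff_val[OF _ that(1) nz] val_inverse[OF _ that(1) nz] by auto
    show "nat (- val P x) = nat (val P (inverse x))" if "P \<in> {P. P \<in> Pts \<and> 0 < val P (inverse x)}" for P
      using val_inverse[OF _ \<open>x \<in> K\<close> nz] that by auto
  qed
  have z_family: "\<exists>J::('p \<times> nat) set. \<exists>u. finite J \<and> card J = ?z x \<and> u ` J \<subseteq> K \<and> indep x J u"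
    if xK: "x \<in> K" and xn: "x \<notin> range \<iota>" for x
  proof -
    note nz = nonzero_if_nonconstant[OF xn]
    define S where "S = {P. P \<in> Pts \<and> 0 < val P x}"
    have S: "finite S" "S \<subseteq> Pts"
      by (rule finite_subset[OF _ finite_val_nonzero[OF xK nz]]) (auto simp: S_def)
    obtain u where "u ` (SIGMA P:S. {..<nat (val P x)}) \<subseteq> K" "indep x (SIGMA P:S. {..<nat (val P x)}) u"
      using indep_family_of_zeros[OF xK nz S] by (auto simp: S_def)
    moreover have "card (SIGMA P:S. {..<nat (val P x)}) = ?z x"
      using S by (simp add: card_SigmaI S_def)
    ultimately show ?thesis using S(1)
      by (intro exI[of _ "SIGMA P:S. {..<nat (val P x)}"] exI[of _ u]) auto
  qed
  have le: "?z x \<le> pole_number x" if "x \<in> K" "x \<notin> range \<iota>" for x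
    using z_family[OF that] card_indep_le[OF that] by metis
  note ix = K_inverse[OF x(1)] inverse_nonconstant[OF x(2)]
  have "pole_number x = ?z (inverse x)" by (rule p_eq[OF x])
  also have "\<dots> \<le> pole_number (inverse x)" by (rule le[OF ix])
  also have "\<dots> = ?z x" using p_eq[OF ix] by simp
  finally show eq: "pole_number x = ?z x" using le[OF x] by simp
  show "\<exists>J::('p \<times> nat) set. \<exists>u. finite J \<and> card J = pole_number x \<and> u ` J \<subseteq> K \<and> indep x J u"
    using z_family[OF x] eq by simp
qed

lemma pole_number_inverse:
  assumes x: "x \<in> K" "x \<notin> range \<iota>"
  shows "pole_number (inverse x) = pole_number x"
proof -
  note nz = nonzero_if_nonconstant[OF x(2)]
  have "pole_number (inverse x) = (\<Sum>P | P \<in> Pts \<and> 0 < val P x. nat (val P x))"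
    unfolding pole_number_def
  proof (rule sum.cong)
    show "{P. P \<in> Pts \<and> inverse x \<notin> Loc P} = {P. P \<in> Pts \<and> 0 < val P x}"
      using Loc_iff_val[OF _ K_inverse[OF x(1)]] val_inverse[OF _ x(1) nz] nz by auto
    show "nat (- val P (inverse x)) = nat (val P x)" if "P \<in> {P. P \<in> Pts \<and> 0 < val P x}" for P
      using val_inverse[OF _ x(1) nz] that by auto
  qed
  then show ?thesis using pole_number_eq_zeros(1)[OF x] by simp
qed

theorem sum_val_eq_0:
  assumes f: "f \<in> K" "f \<noteq> 0"
  shows "(\<Sum>P | P \<in> Pts \<and> val P f \<noteq> 0. val P f) = 0"
proof (cases "f \<in> range \<iota>")
  case True
  then obtain c where c: "f = \<iota> c" by auto
  have "val P f = 0" if "P \<in> Pts" for P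
    by (rule val_eqI[OF that, of f]) (use c f that in \<open>auto simp: ev_iota iota_Loc\<close>)
  then show ?thesis by (intro sum.neutral) auto
next
  case False
  have fin: "finite {P. P \<in> Pts \<and> val P f \<noteq> 0}" using finite_val_nonzero[OF f] by simp
  have "(\<Sum>P | P \<in> Pts \<and> val P f \<noteq> 0. val P f)
      = (\<Sum>P | P \<in> Pts \<and> val P f \<noteq> 0. int (nat (val P f)) - int (nat (- val P f)))"
    by (intro sum.cong) auto
  also have "\<dots> = int (\<Sum>P | P \<in> Pts \<and> val P f \<noteq> 0. nat (val P f))
      - int (\<Sum>P | P \<in> Pts \<and> val P f \<noteq> 0. nat (- val P f))"
    by (simp add: sum_subtractf)
  also have "(\<Sum>P | P \<in> Pts \<and> val P f \<noteq> 0. nat (val P f)) = (\<Sum>P | P \<in> Pts \<and> 0 < val P f. nat (val P f))"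
    by (rule sum.mono_neutral_right[OF fin]) auto
  also have "(\<Sum>P | P \<in> Pts \<and> val P f \<noteq> 0. nat (- val P f)) = pole_number f"
    unfolding pole_number_def
    by (rule sum.mono_neutral_right[OF fin]) (use Loc_iff_val[OF _ f] in auto)
  finally show ?thesis using pole_number_eq_zeros(1)[OF f(1) False] by simp
qed

lemma dependent_powers:
  assumes x: "x \<in> K" "x \<notin> range \<iota>" and "\<And>i. i < n \<Longrightarrow> u i \<in> K" and "pole_number x < n"
  shows "\<exists>p. (\<exists>i<n. p i \<noteq> 0) \<and> (\<Sum>i<n. ap (p i) x * u i) = 0"
proof -
  have "\<not> indep x {..<n} u"
  proof
    assume "indep x {..<n} u"
    then have "card {..<n} \<le> pole_number x"
      using assms(3) by (intro card_indep_le[OF x, of "{..<n}" u]) auto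
    then show False using assms(4) by simp
  qed
  then show ?thesis unfolding indep_def by auto
qed

subsection \<open>Quadratic function fields\<close>

text \<open>
  \<open>K\<close> is a quadratic extension of \<open>\<complex>(z)\<close> with basis \<open>1, u\<close>, expressed without denominators.
\<close>

definition quadratic_over :: "'k \<Rightarrow> 'k \<Rightarrow> bool" where
  "quadratic_over z u \<longleftrightarrow> (\<forall>w\<in>K. \<exists>p q r. r \<noteq> 0 \<and> ap r z * w = ap p z + ap q z * u) \<and>
     (\<forall>p r. r \<noteq> 0 \<longrightarrow> ap r z * u \<noteq> ap p z)"

text \<open>
  The two independent elements provided by the zeros of \<open>x\<close> cannot both be in \<open>\<complex>(x)\<close>, and one outside
  \<open>\<complex>(x)\<close> spans \<open>K\<close> together with 1, as any three elements are dependent.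
\<close>

lemma quadratic_if_pole_number_2:
  assumes x: "x \<in> K" "x \<notin> range \<iota>" and 2: "pole_number x = 2"
  shows "\<exists>u\<in>K. quadratic_over x u"
proof -
  have "\<exists>u\<in>K. \<forall>p r. r \<noteq> 0 \<longrightarrow> ap r x * u \<noteq> ap p x"
  proof (rule ccontr)
    assume "\<not> ?thesis"
    then have rat: "\<exists>p r. r \<noteq> 0 \<and> ap r x * u = ap p x" if "u \<in> K" for u using that by blast
    obtain J :: "('p \<times> nat) set" and u where J: "finite J" "card J = 2" "u ` J \<subseteq> K" "indep x J u"
      using pole_number_eq_zeros(2)[OF x] 2 by auto
    then obtain i j where ij: "J = {i, j}" "i \<noteq> j" by (auto simp: card_2_iff)
    obtain p r where pr: "r \<noteq> 0" "ap r x * u i = ap p x" using rat[of "u i"] J(3) ij by blast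
    obtain p' r' where pr': "r' \<noteq> 0" "ap r' x * u j = ap p' x" using rat[of "u j"] J(3) ij by blast
    have dep: "a = 0 \<and> b = 0" if "ap a x * u i + ap b x * u j = 0" for a b
    proof -
      have "(\<Sum>k\<in>J. ap (if k = i then a else b) x * u k) = 0" using that ij by simp
      then have "\<forall>k\<in>J. (if k = i then a else b) = 0"
        using J(4)[unfolded indep_def, rule_format, of "\<lambda>k. if k = i then a else b"] by blast
      then show ?thesis using ij by auto
    qed
    have "ap (p' * r) x * u i + ap (- (p * r')) x * u j = ap p' x * (ap r x * u i) - ap p x * (ap r' x * u j)"
      by (simp add: iota.peval_mult iota.peval_uminus)
    also have "\<dots> = 0" unfolding pr pr' by simp
    finally have "p' * r = 0 \<and> - (p * r') = 0" by (rule dep)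
    then have "p' = 0" "p = 0" using pr pr' by auto
    then have "u i = 0" "u j = 0" using pr pr' transcendental[OF x(2)] by auto
    then show False using dep[of 1 1] by simp
  qed
  then obtain u where u: "u \<in> K" "\<And>p r. r \<noteq> 0 \<Longrightarrow> ap r x * u \<noteq> ap p x" by blast
  have "\<exists>p q r. r \<noteq> 0 \<and> ap r x * w = ap p x + ap q x * u" if w: "w \<in> K" for w
  proof -
    have "\<exists>p. (\<exists>i<3. p i \<noteq> 0) \<and> (\<Sum>i<(3::nat). ap (p i) x * ([1, u, w] ! i)) = 0"
      by (rule dependent_powers[OF x]) (use u w K_rg 2 in \<open>auto simp: less_Suc_eq numeral_3_eq_3\<close>)
    then obtain p where p: "\<exists>i<3::nat. p i \<noteq> 0" "ap (p 0) x + ap (p 1) x * u + ap (p 2) x * w = 0"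
      by (auto simp: numeral_3_eq_3 numeral_2_eq_2)
    have "p 2 \<noteq> 0"
    proof
      assume 0: "p 2 = 0"
      have "p 1 = 0"
      proof (rule ccontr)
        assume "p 1 \<noteq> 0"
        moreover have "ap (p 1) x * u = ap (- p 0) x" using p(2) 0 by (simp add: iota.peval_uminus eq_neg_iff_add_eq_0 add.commute)
        ultimately show False using u(2) by blast
      qed
      then have "p 0 = 0" using p(2) 0 transcendental[OF x(2), of "p 0"] by auto
      then show False using p(1) 0 \<open>p 1 = 0\<close> by (auto simp: numeral_3_eq_3 less_Suc_eq numeral_2_eq_2)
    qed
    moreover have "ap (p 2) x * w = ap (- p 0) x + ap (- p 1) x * u"
      using p(2) by (simp add: iota.peval_uminus algebra_simps eq_neg_iff_add_eq_0)
    ultimately show ?thesis by blast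
  qed
  then show ?thesis using u unfolding quadratic_over_def by blast
qed

text \<open>
  This reduces functions with a single pole to functions with two poles: if \<open>K = \<complex>(x)\<close>, then \<open>K\<close> is
  quadratic over \<open>\<complex>(x\<^sup>2)\<close>.
\<close>

lemma pole_number_square:
  assumes x: "x \<in> K" "x \<notin> range \<iota>"
  shows "pole_number (x ^ 2) = 2 * pole_number x"
proof -
  note nz = nonzero_if_nonconstant[OF x(2)]
  have v: "val P (x ^ 2) = 2 * val P x" if "P \<in> Pts" for P using val_power[OF that x(1) nz, of 2] by simp
  have "pole_number (x ^ 2) = (\<Sum>P | P \<in> Pts \<and> x \<notin> Loc P. 2 * nat (- val P x))"
    unfolding pole_number_def
  proof (rule sum.cong)
    show "{P. P \<in> Pts \<and> x\<^sup>2 \<notin> Loc P} = {P. P \<in> Pts \<and> x \<notin> Loc P}"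
      using Loc_iff_val[OF _ x(1) nz] Loc_iff_val[OF _ K_rg(7)[OF x(1)], of _ 2] nz v by auto
    show "nat (- val P (x\<^sup>2)) = 2 * nat (- val P x)" if "P \<in> {P. P \<in> Pts \<and> x \<notin> Loc P}" for P
      using v that by auto
  qed
  also have "\<dots> = 2 * pole_number x" unfolding pole_number_def sum_distrib_left ..
  finally show ?thesis .
qed

lemma square_nonconstant:
  assumes x: "x \<notin> range \<iota>"
  shows "x ^ 2 \<notin> range \<iota>"
proof
  assume "x ^ 2 \<in> range \<iota>"
  then obtain c where "x ^ 2 = \<iota> c" by auto
  then have "ap [:- c, 0, 1:] x = 0" by (simp add: iota.map_uminus power2_eq_square)
  then show False using transcendental[OF x, of "[:- c, 0, 1:]"] by simp
qed

end

subsection \<open>The cubic equation\<close>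

context point_field
begin

text \<open>
  The polynomial \<open>x ^ n * p (1 / x)\<close> for \<open>n\<close> at least the degree of \<open>p\<close>.
\<close>

definition reversal :: "nat \<Rightarrow> complex poly \<Rightarrow> complex poly" where
  "reversal n p = (\<Sum>i\<le>n. Polynomial.monom (poly.coeff p i) (n - i))"

lemma ap_reversal:
  assumes "x \<noteq> 0" "Polynomial.degree p \<le> n"
  shows "ap (reversal n p) x = x ^ n * ap p (inverse x)"
  unfolding reversal_def iota.peval_sum iota.peval_monom iota.peval_altdef[OF assms(2)] sum_distrib_left
proof (intro sum.cong refl)
  fix i assume "i \<in> {..n}"
  then have "x ^ n = x ^ (n - i) * x ^ i" by (simp flip: power_add)
  then show "\<iota> (poly.coeff p i) * x ^ (n - i) = x ^ n * (\<iota> (poly.coeff p i) * inverse x ^ i)"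
    using assms(1) by (simp add: field_simps)
qed

lemma degree_reversal: "Polynomial.degree (reversal n p) \<le> n"
  unfolding reversal_def by (rule degree_sum_le) (auto intro: order_trans[OF degree_monom_le])

lemma coeff_reversal: "i \<le> n \<Longrightarrow> poly.coeff (reversal n p) (n - i) = poly.coeff p i"
proof -
  assume i: "i \<le> n"
  have "poly.coeff (reversal n p) (n - i) = (\<Sum>j\<le>n. if j = i then poly.coeff p j else 0)"
    unfolding reversal_def coeff_sum by (intro sum.cong refl) (use i in auto)
  then show ?thesis using i by simp
qed

lemma reversal_eq_0:
  assumes "reversal n p = 0" "Polynomial.degree p \<le> n"
  shows "p = 0"
proof (rule poly_eqI)
  fix i show "poly.coeff p i = poly.coeff 0 i"
    using coeff_reversal[of i n p] assms by (cases "i \<le> n") (auto simp: coeff_eq_0)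
qed

definition indep3 :: "'k \<Rightarrow> 'k \<Rightarrow> bool" where
  "indep3 x y \<longleftrightarrow> (\<forall>a b c. ap a x + ap b x * y + ap c x * y ^ 2 = 0 \<longrightarrow> a = 0 \<and> b = 0 \<and> c = 0)"

lemma indep3D: "indep3 x y \<Longrightarrow> ap a x + ap b x * y + ap c x * y ^ 2 = 0 \<Longrightarrow> a = 0 \<and> b = 0 \<and> c = 0"
  unfolding indep3_def by blast

lemma four_dependent:
  assumes x: "x \<in> K" "x \<notin> range \<iota>" and "pole_number x \<le> 3"
    and u: "u0 \<in> K" "u1 \<in> K" "u2 \<in> K" "u3 \<in> K"
  shows "\<exists>a b c d. \<not> (a = 0 \<and> b = 0 \<and> c = 0 \<and> d = 0) \<and>
    ap a x * u0 + ap b x * u1 + ap c x * u2 + ap d x * u3 = 0"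
proof -
  have "\<exists>p. (\<exists>i<4. p i \<noteq> 0) \<and> (\<Sum>i<(4::nat). ap (p i) x * ([u0, u1, u2, u3] ! i)) = 0"
    by (rule dependent_powers[OF x]) (use u assms(3) in \<open>auto simp: less_Suc_eq eval_nat_numeral\<close>)
  then obtain p where p: "\<exists>i<4::nat. p i \<noteq> 0" "(\<Sum>i<(4::nat). ap (p i) x * ([u0, u1, u2, u3] ! i)) = 0"
    by blast
  have "ap (p 0) x * u0 + ap (p 1) x * u1 + ap (p 2) x * u2 + ap (p 3) x * u3 = 0"
    using p(2) by (simp add: eval_nat_numeral)
  moreover have "\<not> (p 0 = 0 \<and> p 1 = 0 \<and> p 2 = 0 \<and> p 3 = 0)"
    using p(1) by (auto simp: eval_nat_numeral less_Suc_eq)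
  ultimately show ?thesis by blast
qed

text \<open>
  The Gauss lemma. A primitive cubic polynomial \<open>p\<close> over \<open>\<complex>[x]\<close> that annihilates \<open>y\<close> is minimal by the
  independence of \<open>1, y, y\<^sup>2\<close>, so it divides every polynomial that annihilates \<open>y\<close>. As \<open>y\<close> is integral over
  \<open>\<complex>[x]\<close>, one of these is monic, and the leading coefficient of \<open>p\<close> has to be a unit.
\<close>

lemma monic_cubic:
  assumes x: "x \<in> K" "x \<notin> range \<iota>" and y: "y \<in> K" and m: "pole_number x \<le> 3"
    and ind: "indep3 x y" and reg: "\<And>P. P \<in> Pts \<Longrightarrow> x \<in> Loc P \<Longrightarrow> y \<in> Loc P"
  shows "\<exists>d0 d1 d2. y ^ 3 + ap d2 x * y ^ 2 + ap d1 x * y + ap d0 x = 0"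
proof -
  interpret E: comm_ring_map "\<lambda>c. ap c x" by (rule ap_map)
  let ?E = "\<lambda>p. peval (\<lambda>c. ap c x) p y"
  obtain a b c d where nz: "\<not> (a = 0 \<and> b = 0 \<and> c = 0 \<and> d = 0)"
    and rel: "ap a x * 1 + ap b x * y + ap c x * y ^ 2 + ap d x * y ^ 3 = 0"
    using four_dependent[OF x m K_rg(2) y K_rg(7)[OF y] K_rg(7)[OF y]] by blast
  have "d \<noteq> 0" using nz rel indep3D[OF ind, of a b c] by auto
  define C where "C = [:a, b, c, d:]"
  define p where "p = primitive_part C"
  have C: "C \<noteq> 0" "Polynomial.degree C = 3" using \<open>d \<noteq> 0\<close> by (auto simp: C_def)
  have "?E C = 0" using rel by (simp add: C_def algebra_simps power2_eq_square power3_eq_cube)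
  moreover have "C = Polynomial.smult (content C) p" by (simp add: p_def)
  ultimately have "ap (content C) x * ?E p = 0" by (metis E.peval_smult)
  then have Ep: "?E p = 0" using transcendental[OF x(2), of "content C"] C(1) by auto
  have p: "Polynomial.degree p = 3" "content p = 1" "p \<noteq> 0"
    using C unfolding p_def by (simp_all del: primitive_part_eq_0_iff) (metis primitive_part_eq_0_iff)
  obtain H where H: "Polynomial.lead_coeff H = 1" "?E H = 0"
    using integral_if_regular[OF x(1) y reg] by blast
  obtain q r where qr: "pseudo_divmod H p = (q, r)" by (metis surj_pair)
  define e where "e = poly.coeff p (Polynomial.degree p) ^ (Suc (Polynomial.degree H) - Polynomial.degree p)"
  have e0: "e \<noteq> 0" using p(3) by (simp add: e_def)
  have div: "Polynomial.smult e H = p * q + r" and dr: "r = 0 \<or> Polynomial.degree r < 3"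
    using pseudo_divmod[OF p(3) qr] by (auto simp: e_def p(1))
  have "?E (Polynomial.smult e H) = ?E (p * q + r)" using div by simp
  then have Er: "?E r = 0" using H(2) Ep by (simp add: E.peval_add E.peval_mult E.peval_smult)
  \<comment> \<open>the remainder has degree at most 2 and annihilates \<open>y\<close>\<close>
  have "r = 0"
  proof -
    have dr2: "Polynomial.degree r \<le> 2" using dr by auto
    have "?E r = ap (poly.coeff r 0) x + ap (poly.coeff r 1) x * y + ap (poly.coeff r 2) x * y ^ 2"
      unfolding E.peval_altdef[OF dr2] by (simp add: numeral_2_eq_2)
    then have z: "poly.coeff r 0 = 0 \<and> poly.coeff r 1 = 0 \<and> poly.coeff r 2 = 0"
      using indep3D[OF ind] Er by metis
    show ?thesis
    proof (rule poly_eqI)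
      fix n :: nat
      have "n = 0 \<or> n = 1 \<or> n = 2 \<or> 2 < n" by auto
      then show "poly.coeff r n = poly.coeff 0 n" using z dr2 by (auto simp: coeff_eq_0)
    qed
  qed
  have "content H dvd Polynomial.lead_coeff H" by (rule content_dvd_coeff)
  then have "content H dvd 1" using H(1) by simp
  then have cH: "content H = 1" by (metis content_def dvd_1_iff_1 is_unit_gcd_iff is_unit_normalize normalize_content)
  \<comment> \<open>both contents are computed up to units; \<open>p\<close> is primitive, so \<open>e\<close> divides \<open>q\<close>\<close>
  have "content (Polynomial.smult e H) = content q"
    using div \<open>r = 0\<close> p(2) content_mult[of p q] by simp
  then have "normalize e = content q" using cH by simp
  then have "e dvd content q" by (metis dvd_normalize_iff dvd_refl normalize_dvd_iff)
  then have "[:e:] dvd q" by (simp add: const_poly_dvd_iff_dvd_content)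
  then obtain q' where q': "q = Polynomial.smult e q'" by (auto elim!: dvdE)
  have "Polynomial.smult e (H - p * q') = 0" using div \<open>r = 0\<close> q' by (simp add: smult_diff_right)
  then have Hp: "H = p * q'" using e0 by simp
  have "1 = Polynomial.lead_coeff p * Polynomial.lead_coeff q'"
    using H(1) Hp lead_coeff_mult[of p q'] by simp
  then have "Polynomial.lead_coeff p dvd 1" by (rule dvdI)
  then obtain k where k: "Polynomial.lead_coeff p = [:k:]" "k dvd 1"
    by (auto simp: is_unit_poly_iff)
  then have k0: "k \<noteq> 0" by auto
  have d3: "Polynomial.degree p \<le> 3" using p(1) by simp
  have "?E p = ap (poly.coeff p 0) x + ap (poly.coeff p 1) x * y + ap (poly.coeff p 2) x * y ^ 2 + \<iota> k * y ^ 3"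
    unfolding E.peval_altdef[OF d3] using k(1) p(1) by (simp add: eval_nat_numeral)
  then have "\<iota> (inverse k) * (ap (poly.coeff p 0) x + ap (poly.coeff p 1) x * y + ap (poly.coeff p 2) x * y ^ 2 + \<iota> k * y ^ 3) = 0"
    using Ep by simp
  moreover have "\<iota> (inverse k) * (ap (poly.coeff p 0) x + ap (poly.coeff p 1) x * y + ap (poly.coeff p 2) x * y ^ 2 + \<iota> k * y ^ 3)
      = (\<iota> (inverse k) * \<iota> k) * y ^ 3 + \<iota> (inverse k) * ap (poly.coeff p 2) x * y ^ 2
        + \<iota> (inverse k) * ap (poly.coeff p 1) x * y + \<iota> (inverse k) * ap (poly.coeff p 0) x"
    by (simp add: algebra_simps)
  moreover have "\<iota> (inverse k) * \<iota> k = 1" using k0 by (simp flip: iota.map_mult)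
  ultimately have "y ^ 3 + \<iota> (inverse k) * ap (poly.coeff p 2) x * y ^ 2
      + \<iota> (inverse k) * ap (poly.coeff p 1) x * y + \<iota> (inverse k) * ap (poly.coeff p 0) x = 0"
    using k0 by simp
  then show ?thesis
    by (intro exI[of _ "Polynomial.smult (inverse k) (poly.coeff p 0)"]
        exI[of _ "Polynomial.smult (inverse k) (poly.coeff p 1)"]
        exI[of _ "Polynomial.smult (inverse k) (poly.coeff p 2)"]) (simp add: iota.peval_smult)
qed

text \<open>
  Write \<open>y\<close> as a reduced fraction in \<open>x\<close>. A root \<open>a\<close> of the denominator is a value of \<open>x\<close>, because \<open>1 / (x - a)\<close>
  has a pole; where \<open>x\<close> has this value, the numerator vanishes too.
\<close>

lemma regular_rational_is_polynomial:
  assumes x: "x \<in> K" "x \<notin> range \<iota>" and r: "r \<noteq> 0" "ap r x * y = ap p x"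
    and reg: "\<And>P. P \<in> Pts \<Longrightarrow> x \<in> Loc P \<Longrightarrow> y \<in> Loc P"
  shows "\<exists>q. y = ap q x"
proof -
  define g where "g = gcd r p"
  obtain r' p' where rp: "r = g * r'" "p = g * p'" "coprime r' p'"
    unfolding g_def by (metis gcd_coprime_exists gcd_eq_0_iff mult.commute r(1))
  have "ap g x * (ap r' x * y) = ap g x * ap p' x" using r(2) unfolding rp by (simp add: iota.peval_mult)
  moreover have "ap g x \<noteq> 0" using rp(1) r(1) transcendental[OF x(2), of g] by auto
  ultimately have eq: "ap r' x * y = ap p' x" by simp
  have "Polynomial.degree r' = 0"
  proof (rule ccontr)
    assume "Polynomial.degree r' \<noteq> 0"
    then have "\<not> constant (poly r')" by (simp add: constant_degree)
    then obtain a where a: "poly r' a = 0" using fundamental_theorem_of_algebra by blast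
    have "x - \<iota> a \<notin> range \<iota>"
    proof
      assume "x - \<iota> a \<in> range \<iota>"
      then obtain b where "x - \<iota> a = \<iota> b" by auto
      then have "x = \<iota> (a + b)" by (simp add: iota.map_add algebra_simps)
      then show False using x(2) by auto
    qed
    then have "inverse (x - \<iota> a) \<notin> range \<iota>" by (rule inverse_nonconstant)
    moreover have xaK: "x - \<iota> a \<in> K" using x(1) iota_K K_rg by simp
    ultimately obtain P where P: "P \<in> Pts" "inverse (x - \<iota> a) \<notin> Loc P"
      using exists_pole K_inverse by blast
    have xa: "x - \<iota> a \<in> Loc P" "ev P (x - \<iota> a) = 0"
      using not_Loc[OF P(1) K_inverse[OF xaK] P(2)] by auto
    have "(x - \<iota> a) + \<iota> a \<in> Loc P" by (rule rg(3)[OF P(1) xa(1) iota_Loc[OF P(1)]])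
    then have xL: "x \<in> Loc P" by simp
    then have evx: "ev P x = a" using xa(2) P(1) by (simp add: ev_diff iota_Loc ev_iota)
    have "ev P (ap r' x * y) = ev P (ap p' x)" using eq by simp
    then have "poly p' a = 0"
      using a evx P(1) xL reg by (simp add: ev_mult ev_ap ap_Loc)
    then show False
      using a rp(3) coprime_common_divisor[of r' p' "[:- a, 1:]"] by (auto simp: poly_eq_0_iff_dvd is_unit_poly_iff)
  qed
  then obtain k where k: "r' = [:k:]" by (metis degree_eq_zeroE)
  have k0: "k \<noteq> 0" using k rp(1) r(1) by auto
  have "\<iota> (inverse k) * (\<iota> k * y) = \<iota> (inverse k) * ap p' x" using eq k by simp
  moreover have "\<iota> (inverse k) * \<iota> k = 1" using k0 by (simp flip: iota.map_mult)
  ultimately have "y = ap (Polynomial.smult (inverse k) p') x"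
    by (simp add: iota.peval_smult mult.assoc[symmetric])
  then show ?thesis by blast
qed

text \<open>
  At a pole of \<open>x\<close> the function \<open>q(x) / x ^ n\<close>, with \<open>n\<close> the degree of \<open>q\<close>, has as its value the leading
  coefficient of \<open>q\<close>. For \<open>n > 3\<close> it is also a positive power of \<open>1 / x\<close> times a regular function, so it is 0.
\<close>

lemma degree_le_if_regular_at_poles:
  assumes x: "x \<in> K" "x \<notin> range \<iota>"
    and reg: "\<And>P. P \<in> Pts \<Longrightarrow> inverse x \<in> Loc P \<Longrightarrow> ap q x * inverse x ^ 3 \<in> Loc P"
  shows "Polynomial.degree q \<le> 3"
proof (rule ccontr)
  assume gt: "\<not> Polynomial.degree q \<le> 3"
  define n where "n = Polynomial.degree q"
  have n: "n > 3" using gt by (simp add: n_def)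
  obtain P where P: "P \<in> Pts" "x \<notin> Loc P" using exists_pole[OF x] by blast
  have ix: "inverse x \<in> Loc P" "ev P (inverse x) = 0" using not_Loc[OF P(1) x(1) P(2)] by auto
  have xnz: "x \<noteq> 0" by (rule nonzero_if_nonconstant[OF x(2)])
  have "ap (reversal n q) (inverse x) = inverse x ^ n * ap q x"
    using ap_reversal[of "inverse x" q n] xnz by (simp add: n_def)
  also have "inverse x ^ n = inverse x ^ (n - 3) * inverse x ^ 3" using n by (simp flip: power_add)
  finally have "ap (reversal n q) (inverse x) = inverse x ^ (n - 3) * (ap q x * inverse x ^ 3)" by (simp add: mult_ac)
  then have "ev P (ap (reversal n q) (inverse x)) = ev P (inverse x ^ (n - 3) * (ap q x * inverse x ^ 3))" by simp
  also have "\<dots> = 0"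
    using ix reg[OF P(1) ix(1)] n by (simp add: ev_mult[OF P(1)] ev_power[OF P(1)] rg[OF P(1)])
  finally have "poly (reversal n q) 0 = 0" using ev_ap[OF P(1) ix(1)] ix(2) by simp
  then have "poly.coeff (reversal n q) (n - n) = 0" by (simp add: poly_0_coeff_0)
  then show False using coeff_reversal[of n n q] n by (auto simp: n_def)
qed

text \<open>
  The hypothesis on quadratic extensions excludes functions with exactly two poles and, by squaring, with
  exactly one. So the bound \<open>D\<close> on the poles of \<open>x\<close> is attained, which makes \<open>y\<close> regular where \<open>x\<close> is and
  \<open>y / x ^ 3\<close> regular where \<open>1 / x\<close> is. The same hypothesis shows that \<open>y\<close> has degree 3 over \<open>\<complex>(x)\<close>: if it had
  degree 2, then \<open>K\<close>, of degree at most 3 over \<open>\<complex>(x)\<close>, would coincide with \<open>\<complex>(x, y)\<close>.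
\<close>

theorem trigonal_cubic_equation:
  assumes x: "x \<in> K" "x \<notin> range \<iota>" and y: "y \<in> K"
    and D: "finite {P \<in> Pts. D P \<noteq> 0}" "(\<Sum>P | P \<in> Pts \<and> D P \<noteq> 0. D P) = (3::nat)"
    and xD: "\<And>P. P \<in> Pts \<Longrightarrow> vge P (- int (D P)) x"
    and yD: "\<And>P. P \<in> Pts \<Longrightarrow> vge P (- 3 * int (D P)) y"
    and y_new: "\<And>q. Polynomial.degree q \<le> 3 \<Longrightarrow> y \<noteq> ap q x"
    and not_quadratic: "\<And>z u. z \<in> K \<Longrightarrow> z \<notin> range \<iota> \<Longrightarrow> u \<in> K \<Longrightarrow> \<not> quadratic_over z u"
  shows "\<forall>w\<in>K. \<exists>a b c d. d \<noteq> 0 \<and> ap d x * w = ap a x + ap b x * y + ap c x * y ^ 2"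
    and "\<exists>d0 d1 d2. Polynomial.degree d2 \<le> 3 \<and> Polynomial.degree d1 \<le> 6 \<and> Polynomial.degree d0 \<le> 9 \<and>
      y ^ 3 + ap d2 x * y ^ 2 + ap d1 x * y + ap d0 x = 0"
proof -
  note nz = nonzero_if_nonconstant[OF x(2)]
  define S where "S = {P. P \<in> Pts \<and> D P \<noteq> 0}"
  have S: "finite S" "(\<Sum>P\<in>S. D P) = 3" using D by (simp_all add: S_def)
  have xle: "nat (- val P x) \<le> D P" if "P \<in> Pts" for P
    using xD[OF that] nz by (auto simp: vge_def[OF that])
  have pn: "pole_number x = (\<Sum>P\<in>S. nat (- val P x))"
    unfolding pole_number_def
  proof (rule sum.mono_neutral_left[OF S(1)])
    show "{P. P \<in> Pts \<and> x \<notin> Loc P} \<subseteq> S"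
      using xle Loc_iff_val[OF _ x(1) nz] by (force simp: S_def)
    show "\<forall>P\<in>S - {P. P \<in> Pts \<and> x \<notin> Loc P}. nat (- val P x) = 0"
      using Loc_iff_val[OF _ x(1) nz] by (auto simp: S_def)
  qed
  also have "\<dots> \<le> (\<Sum>P\<in>S. D P)" using xle by (intro sum_mono) (auto simp: S_def)
  finally have le3: "pole_number x \<le> 3" using S(2) by simp
  have not2: "pole_number z \<noteq> 2" if "z \<in> K" "z \<notin> range \<iota>" for z
    using quadratic_if_pole_number_2[OF that] not_quadratic[OF that] by blast
  have "pole_number x \<noteq> 0"
  proof
    assume 0: "pole_number x = 0"
    obtain P where P: "P \<in> Pts" "x \<notin> Loc P" using exists_pole[OF x] by blast
    have "nat (- val P x) = 0"
      using 0 P finite_poles[OF x(1)] unfolding pole_number_def by auto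
    then show False using Loc_iff_val[OF P(1) x(1) nz] P(2) by simp
  qed
  moreover have "pole_number x \<noteq> 1"
    using pole_number_square[OF x] not2[OF K_rg(7)[OF x(1)] square_nonconstant[OF x(2)]] by auto
  ultimately have m3: "pole_number x = 3" using le3 not2[OF x] by linarith
  have DS: "nat (- val P x) = D P" if "P \<in> S" for P
    by (rule sum_mono_inv[of "\<lambda>P. nat (- val P x)" S D]) (use that S pn m3 xle in \<open>auto simp: S_def\<close>)
  have D_eq: "D P = nat (- val P x)" if "P \<in> Pts" for P
    using DS[of P] xle[OF that] that by (cases "P \<in> S") (auto simp: S_def)
  have reg: "y \<in> Loc P" if "P \<in> Pts" "x \<in> Loc P" for P
  proof -
    have "D P = 0" using D_eq[OF that(1)] Loc_iff_val[OF that(1) x(1) nz] that(2) by simp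
    then show ?thesis using yD[OF that(1)] vge_0[OF that(1)] by simp
  qed
  have reg': "y * inverse x ^ 3 \<in> Loc P" if P: "P \<in> Pts" and ix: "inverse x \<in> Loc P" for P
  proof -
    have v: "val P x \<le> 0"
      using Loc_iff_val[OF P K_inverse[OF x(1)]] nz ix val_inverse[OF P x(1) nz] by simp
    have "vge P (3 * int (D P)) (inverse x ^ 3)"
      using val_power[OF P K_inverse[OF x(1)], of 3] val_inverse[OF P x(1) nz] nz v D_eq[OF P]
      by (simp add: vge_def[OF P] K_rg K_inverse x)
    then have "vge P (- 3 * int (D P) + 3 * int (D P)) (y * inverse x ^ 3)"
      by (rule vge_mult[OF P yD[OF P]])
    then show ?thesis by (simp add: vge_0[OF P])
  qed
  have y_irr: "ap r x * y \<noteq> ap p x" if r0: "r \<noteq> 0" for r p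
  proof
    assume "ap r x * y = ap p x"
    then obtain q where q: "y = ap q x" using regular_rational_is_polynomial[OF x r0 _ reg] by blast
    then have "Polynomial.degree q \<le> 3" using degree_le_if_regular_at_poles[OF x] reg' by blast
    then show False using y_new q by blast
  qed
  have indep2: "a = 0 \<and> b = 0" if "ap a x + ap b x * y = 0" for a b
  proof -
    have "ap b x * y = ap (- a) x" using that by (simp add: iota.peval_uminus add_eq_0_iff)
    then have "b = 0" using y_irr by blast
    then show ?thesis using that transcendental[OF x(2), of a] by auto
  qed
  have ind: "indep3 x y"
    unfolding indep3_def
  proof (intro allI impI, rule ccontr)
    fix c0 c1 c2 assume rel: "ap c0 x + ap c1 x * y + ap c2 x * y ^ 2 = 0"
      and "\<not> (c0 = 0 \<and> c1 = 0 \<and> c2 = 0)"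
    then have c2: "c2 \<noteq> 0" using indep2[of c0 c1] by auto
    have "\<exists>a b c. c \<noteq> 0 \<and> ap c x * w = ap a x + ap b x * y" if w: "w \<in> K" for w
    proof -
      obtain a b c d where abcd: "\<not> (a = 0 \<and> b = 0 \<and> c = 0 \<and> d = 0)"
        "ap a x * 1 + ap b x * y + ap c x * w + ap d x * (y * w) = 0"
        using four_dependent[OF x le3 K_rg(2) y w K_rg(6)[OF y w]] by blast
      \<comment> \<open>conjugate of \<open>c + d y\<close>, up to the factor \<open>c2\<close>\<close>
      define e where "e = c * c2 - d * c1"
      define g where "g = c * e + d * d * c0"
      have conj: "(ap c x + ap d x * y) * (ap e x - ap (d * c2) x * y) = ap g x"
      proof -
        have sq: "ap c2 x * y ^ 2 = - ap c0 x - ap c1 x * y" using rel by (simp add: algebra_simps eq_neg_iff_add_eq_0)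
        have "(ap c x + ap d x * y) * (ap e x - ap (d * c2) x * y)
            = ap c x * ap e x + (ap d x * ap e x - ap c x * ap d x * ap c2 x) * y
              - ap d x * ap d x * (ap c2 x * y ^ 2)"
          by (simp add: iota.peval_mult algebra_simps power2_eq_square)
        also have "\<dots> = ap g x"
          unfolding sq by (simp add: g_def e_def iota.peval_mult iota.peval_add iota.peval_diff algebra_simps)
        finally show ?thesis .
      qed
      have cd: "\<not> (c = 0 \<and> d = 0)" using abcd indep2[of a b] by auto
      have "ap c x + ap d x * y \<noteq> 0" using cd indep2 by blast
      moreover have "ap e x - ap (d * c2) x * y \<noteq> 0"
      proof
        assume "ap e x - ap (d * c2) x * y = 0"
        then have "ap e x + ap (- (d * c2)) x * y = 0" by (simp add: iota.peval_uminus)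
        then have "e = 0 \<and> - (d * c2) = 0" by (rule indep2)
        then show False using cd c2 by (auto simp: e_def)
      qed
      ultimately have "g \<noteq> 0" using conj by (metis iota.peval_0 mult_eq_0_iff)
      have cw: "(ap c x + ap d x * y) * w = - (ap a x + ap b x * y)"
        using abcd(2) by (simp add: algebra_simps eq_neg_iff_add_eq_0)
      have "ap g x * w = ((ap c x + ap d x * y) * w) * (ap e x - ap (d * c2) x * y)"
        unfolding conj[symmetric] by (simp only: mult_ac)
      also have "\<dots> = - ((ap a x + ap b x * y) * (ap e x - ap (d * c2) x * y))"
        unfolding cw by (simp only: mult_minus_left)
      also have "\<dots> = - (ap a x * ap e x) - (ap b x * ap e x - ap a x * ap d x * ap c2 x) * y
          + ap b x * ap d x * (ap c2 x * y ^ 2)"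
        by (simp add: iota.peval_mult algebra_simps power2_eq_square)
      also have "ap c2 x * y ^ 2 = - ap c0 x - ap c1 x * y" using rel by (simp add: algebra_simps eq_neg_iff_add_eq_0)
      finally have "ap g x * w = ap (- (a * e) - b * d * c0) x + ap (a * d * c2 - b * e - b * d * c1) x * y"
        by (simp add: iota.peval_mult iota.peval_add iota.peval_diff iota.peval_uminus algebra_simps)
      then show ?thesis using \<open>g \<noteq> 0\<close> by blast
    qed
    then have "quadratic_over x y" unfolding quadratic_over_def using y_irr by blast
    then show False using not_quadratic[OF x y] by blast
  qed
  show "\<forall>w\<in>K. \<exists>a b c d. d \<noteq> 0 \<and> ap d x * w = ap a x + ap b x * y + ap c x * y ^ 2"
  proof
    fix w assume w: "w \<in> K"
    obtain a b c d where abcd: "\<not> (a = 0 \<and> b = 0 \<and> c = 0 \<and> d = 0)"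
      "ap a x * 1 + ap b x * y + ap c x * y ^ 2 + ap d x * w = 0"
      using four_dependent[OF x le3 K_rg(2) y K_rg(7)[OF y] w] by blast
    have "d \<noteq> 0" using abcd indep3D[OF ind, of a b c] by auto
    moreover have "ap d x * w = ap (- a) x + ap (- b) x * y + ap (- c) x * y ^ 2"
      using abcd(2) by (simp add: iota.peval_uminus algebra_simps eq_neg_iff_add_eq_0)
    ultimately show "\<exists>a b c d. d \<noteq> 0 \<and> ap d x * w = ap a x + ap b x * y + ap c x * y ^ 2" by blast
  qed
  obtain d0 d1 d2 where d: "y ^ 3 + ap d2 x * y ^ 2 + ap d1 x * y + ap d0 x = 0"
    using monic_cubic[OF x y le3 ind reg] by blast
  \<comment> \<open>Over \<open>\<complex>[1 / x]\<close> the function \<open>y / x ^ 3\<close> is in the same situation as \<open>y\<close> over \<open>\<complex>[x]\<close>.\<close>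
  define y' where "y' = y * inverse x ^ 3"
  define x' where "x' = inverse x"
  have x': "x' \<in> K" "x' \<notin> range \<iota>" "x' \<noteq> 0"
    using K_inverse[OF x(1)] inverse_nonconstant[OF x(2)] nz by (auto simp: x'_def)
  have y'K: "y' \<in> K" using y x' K_rg by (simp add: y'_def x'_def)
  have xx: "x * x' = 1" using nz by (simp add: x'_def)
  have y_y': "y = x ^ 3 * y'" using nz by (simp add: y'_def field_simps)
  have x6: "x ^ 6 = x ^ 3 * x ^ 3" and x9: "x ^ 9 = x ^ 3 * x ^ 3 * x ^ 3" by (simp_all flip: power_add)
  have ind': "indep3 x' y'"
    unfolding indep3_def
  proof (intro allI impI)
    fix a b c assume rel: "ap a x' + ap b x' * y' + ap c x' * y' ^ 2 = 0"
    define n where "n = Polynomial.degree a + Polynomial.degree b + Polynomial.degree c"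
    have dg: "Polynomial.degree a \<le> n" "Polynomial.degree b \<le> n" "Polynomial.degree c \<le> n"
      by (simp_all add: n_def)
    have rvx: "ap (reversal n p) x = x ^ n * ap p x'" if "Polynomial.degree p \<le> n" for p
      using ap_reversal[OF nz that] by (simp add: x'_def)
    have "ap (Polynomial.monom 1 6 * reversal n a) x + ap (Polynomial.monom 1 3 * reversal n b) x * y + ap (reversal n c) x * y ^ 2
        = x ^ n * x ^ 6 * (ap a x' + ap b x' * y' + ap c x' * y' ^ 2)"
      unfolding y_y' by (simp add: iota.peval_mult iota.peval_monom rvx dg x6 power2_eq_square power3_eq_cube algebra_simps)
    also have "\<dots> = 0" using rel by simp
    finally have "Polynomial.monom 1 6 * reversal n a = 0 \<and> Polynomial.monom 1 3 * reversal n b = 0 \<and> reversal n c = 0"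
      by (rule indep3D[OF ind])
    then have "reversal n a = 0" "reversal n b = 0" "reversal n c = 0" by auto
    then show "a = 0 \<and> b = 0 \<and> c = 0" using reversal_eq_0 dg by blast
  qed
  have le3': "pole_number x' \<le> 3" using le3 pole_number_inverse[OF x] by (simp add: x'_def)
  obtain e0 e1 e2 where e: "y' ^ 3 + ap e2 x' * y' ^ 2 + ap e1 x' * y' + ap e0 x' = 0"
    using monic_cubic[OF x'(1,2) y'K le3' ind'] reg' by (auto simp: x'_def y'_def)
  define n where "n = Polynomial.degree e0 + Polynomial.degree e1 + Polynomial.degree e2"
  have dg: "Polynomial.degree e0 \<le> n" "Polynomial.degree e1 \<le> n" "Polynomial.degree e2 \<le> n"
    by (simp_all add: n_def)
  have rvx: "ap (reversal n p) x = x ^ n * ap p x'" if "Polynomial.degree p \<le> n" for p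
    using ap_reversal[OF nz that] by (simp add: x'_def)
  define M :: "nat \<Rightarrow> complex poly" where "M = Polynomial.monom 1"
  have Mx: "ap (M k) x = x ^ k" for k by (simp add: M_def iota.peval_monom)
  \<comment> \<open>The difference of the two equations for \<open>y\<close> has degree at most 2, so its coefficients vanish.\<close>
  have "x ^ n * (y ^ 3 + ap d2 x * y ^ 2 + ap d1 x * y + ap d0 x)
      - x ^ n * x ^ 9 * (y' ^ 3 + ap e2 x' * y' ^ 2 + ap e1 x' * y' + ap e0 x') = 0"
    using d e by simp
  moreover have "x ^ n * (y ^ 3 + ap d2 x * y ^ 2 + ap d1 x * y + ap d0 x)
      - x ^ n * x ^ 9 * (y' ^ 3 + ap e2 x' * y' ^ 2 + ap e1 x' * y' + ap e0 x')
    = ap (M n * d0 - M 9 * reversal n e0) x + ap (M n * d1 - M 6 * reversal n e1) x * y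
      + ap (M n * d2 - M 3 * reversal n e2) x * y ^ 2"
    unfolding y_y'
    by (simp add: iota.peval_mult iota.peval_diff Mx rvx dg x6 x9 power2_eq_square power3_eq_cube algebra_simps)
  ultimately have "M n * d0 - M 9 * reversal n e0 = 0 \<and> M n * d1 - M 6 * reversal n e1 = 0 \<and> M n * d2 - M 3 * reversal n e2 = 0"
    using indep3D[OF ind] by metis
  then have eqs: "M n * d0 = M 9 * reversal n e0" "M n * d1 = M 6 * reversal n e1" "M n * d2 = M 3 * reversal n e2" by auto
  have bound: "Polynomial.degree p \<le> k" if "M n * p = M k * reversal n q" for p q k
  proof (cases "p = 0")
    case False
    have "n + Polynomial.degree p = Polynomial.degree (M n * p)"
      using False by (simp add: M_def degree_mult_eq degree_monom_eq)
    also have "\<dots> \<le> k + n"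
      unfolding that using degree_mult_le[of "M k" "reversal n q"] degree_reversal[of n q] by (simp add: M_def degree_monom_eq)
    finally show ?thesis by simp
  qed auto
  show "\<exists>d0 d1 d2. Polynomial.degree d2 \<le> 3 \<and> Polynomial.degree d1 \<le> 6 \<and> Polynomial.degree d0 \<le> 9 \<and>
      y ^ 3 + ap d2 x * y ^ 2 + ap d1 x * y + ap d0 x = 0"
    using d bound[OF eqs(1)] bound[OF eqs(2)] bound[OF eqs(3)] by blast
qed

end

unbundle no fps_syntax

section \<open>Forms\<close>

lemma finite_multi_indices: "finite {m :: 'n::finite \<Rightarrow> nat. (\<Sum>i\<in>UNIV. m i) = d}"
proof (rule finite_subset)
  show "{m :: 'n \<Rightarrow> nat. (\<Sum>i\<in>UNIV. m i) = d} \<subseteq> PiE UNIV (\<lambda>_. {..d})"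
    by (auto simp: PiE_def extensional_def intro: member_le_sum)
qed (simp add: finite_PiE)

lemma monomial_form:
  fixes m :: "'n::finite \<Rightarrow> nat"
  assumes "(\<Sum>i\<in>UNIV. m i) = d"
  shows "(\<lambda>v. a * (\<Prod>i\<in>UNIV. (vec_nth v i) ^ m i)) \<in> forms d"
proof -
  have "(\<Sum>m'\<in>{m'. (\<Sum>i\<in>UNIV. m' i) = d}. (if m' = m then a else 0) * (\<Prod>i\<in>UNIV. (vec_nth v i) ^ m' i))
      = a * (\<Prod>i\<in>UNIV. (vec_nth v i) ^ m i)" for v
    using assms by (subst sum.remove[OF finite_multi_indices, of m]) (auto intro!: sum.neutral)
  then show ?thesis unfolding forms_def by (intro CollectI exI[of _ "\<lambda>m'. if m' = m then a else 0"]) auto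
qed

lemma zero_form: "(\<lambda>v. 0) \<in> forms d"
  unfolding forms_def by (intro CollectI exI[of _ "\<lambda>_. 0"]) simp

lemma form_add: "F \<in> forms d \<Longrightarrow> G \<in> forms d \<Longrightarrow> (\<lambda>v. F v + G v) \<in> forms d"
  unfolding forms_def
  by clarify (rule exI[of _ "\<lambda>m. c m + ca m" for c ca], simp add: distrib_right sum.distrib)

lemma form_scale: "F \<in> forms d \<Longrightarrow> (\<lambda>v. a * F v) \<in> forms d"
  unfolding forms_def
  by clarify (rule exI[of _ "\<lambda>m. a * c m" for c], simp add: sum_distrib_left mult.assoc)

lemma form_sum: "(\<And>i. i \<in> A \<Longrightarrow> F i \<in> forms d) \<Longrightarrow> (\<lambda>v. \<Sum>i\<in>A. F i v) \<in> forms d"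
  by (induction A rule: infinite_finite_induct) (auto simp: zero_form form_add)

lemma form_mult:
  assumes "F \<in> forms d" "G \<in> forms e"
  shows "(\<lambda>v. F v * G v) \<in> forms (d + e)"
proof -
  obtain a b where F: "F = (\<lambda>v. \<Sum>m\<in>{m. (\<Sum>i\<in>UNIV. m i) = d}. a m * (\<Prod>i\<in>UNIV. (vec_nth v i) ^ m i))"
    and G: "G = (\<lambda>v. \<Sum>m\<in>{m. (\<Sum>i\<in>UNIV. m i) = e}. b m * (\<Prod>i\<in>UNIV. (vec_nth v i) ^ m i))"
    using assms unfolding forms_def by auto
  have "F v * G v = (\<Sum>m\<in>{m. (\<Sum>i\<in>UNIV. m i) = d}. \<Sum>m'\<in>{m. (\<Sum>i\<in>UNIV. m i) = e}.
      a m * b m' * (\<Prod>i\<in>UNIV. (vec_nth v i) ^ (m i + m' i)))" for v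
    unfolding F G sum_product by (simp add: power_add prod.distrib mult_ac)
  then have eq: "(\<lambda>v. F v * G v) = (\<lambda>v. \<Sum>m\<in>{m. (\<Sum>i\<in>UNIV. m i) = d}. \<Sum>m'\<in>{m. (\<Sum>i\<in>UNIV. m i) = e}.
      a m * b m' * (\<Prod>i\<in>UNIV. (vec_nth v i) ^ (m i + m' i)))" by auto
  show ?thesis unfolding eq
    by (intro form_sum monomial_form) (auto simp: sum.distrib)
qed

lemma const_form: "(\<lambda>v. c) \<in> forms 0"
  using monomial_form[of "\<lambda>_. 0" 0 c] by simp

lemma coordinate_form: "(\<lambda>v :: complex ^ 'n::finite. vec_nth v i) \<in> forms 1"
proof -
  have "(\<Prod>j\<in>UNIV. vec_nth v j ^ (if j = i then 1 else 0)) = vec_nth v i" for v :: "complex ^ 'n::finite"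
    by (subst prod.remove[of _ i]) (auto intro!: prod.neutral)
  then show ?thesis using monomial_form[of "\<lambda>j. if j = i then 1 else 0" 1 1] by simp
qed

lemma form_prod: "(\<And>i. i \<in> A \<Longrightarrow> F i \<in> forms (d i)) \<Longrightarrow> (\<lambda>v. \<Prod>i\<in>A. F i v) \<in> forms (\<Sum>i\<in>A. d i)"
  by (induction A rule: infinite_finite_induct) (auto simp: const_form form_mult)

lemma form_power: "F \<in> forms d \<Longrightarrow> (\<lambda>v. F v ^ n) \<in> forms (n * d)"
  by (induction n) (auto simp: const_form form_mult)

lemma form_compose:
  fixes F :: "complex ^ 'm::finite \<Rightarrow> complex" and G :: "'m \<Rightarrow> complex ^ 'n::finite \<Rightarrow> complex"
  assumes "F \<in> forms d" "\<And>k. G k \<in> forms e"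
  shows "(\<lambda>v. F (\<chi> k. G k v)) \<in> forms (d * e)"
proof -
  obtain a where F: "F = (\<lambda>v. \<Sum>m\<in>{m. (\<Sum>i\<in>UNIV. m i) = d}. a m * (\<Prod>i\<in>UNIV. (vec_nth v i) ^ m i))"
    using assms(1) unfolding forms_def by auto
  have "(\<lambda>v. a m * (\<Prod>i\<in>UNIV. G i v ^ m i)) \<in> forms (d * e)" if "(\<Sum>i\<in>UNIV. m i) = d" for m
  proof -
    have "(\<lambda>v. \<Prod>i\<in>UNIV. G i v ^ m i) \<in> forms (\<Sum>i\<in>UNIV. m i * e)"
      by (intro form_prod form_power assms(2))
    then show ?thesis using that by (intro form_scale) (simp flip: sum_distrib_right)
  qed
  then show ?thesis unfolding F by (intro form_sum) simp
qed

lemma form_homogeneous: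
  assumes "F \<in> forms d" shows "F (c *s v) = c ^ d * F v"
proof -
  obtain a where F: "F = (\<lambda>v. \<Sum>m\<in>{m. (\<Sum>i\<in>UNIV. m i) = d}. a m * (\<Prod>i\<in>UNIV. (vec_nth v i) ^ m i))"
    using assms unfolding forms_def by auto
  show ?thesis unfolding F sum_distrib_left
    by (intro sum.cong refl) (auto simp: power_mult_distrib prod.distrib power_sum mult_ac)
qed

section \<open>Projective varieties\<close>

lemma in_ppoint: "v \<in> ppoint v"
  unfolding ppoint_def by (intro CollectI exI[of _ 1]) simp

lemma ppoint_scale:
  assumes "c \<noteq> 0" shows "ppoint (c *s v) = ppoint v"
proof (rule Set.set_eqI, rule iffI)
  fix w assume "w \<in> ppoint (c *s v)"
  then obtain d where "w = d *s (c *s v)" "d \<noteq> 0" unfolding ppoint_def by auto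
  then show "w \<in> ppoint v" unfolding ppoint_def
    using assms by (intro CollectI exI[of _ "d * c"]) auto
next
  fix w assume "w \<in> ppoint v"
  then obtain d where "w = d *s v" "d \<noteq> 0" unfolding ppoint_def by auto
  then show "w \<in> ppoint (c *s v)" unfolding ppoint_def
    using assms by (intro CollectI exI[of _ "d / c"]) auto
qed

lemma proj_spaceD:
  assumes "P \<in> proj_space" "v \<in> P"
  shows "v \<noteq> 0" "P = ppoint v"
proof -
  obtain w c where "P = ppoint w" "w \<noteq> 0" "v = c *s w" "c \<noteq> 0"
    using assms unfolding proj_space_def ppoint_def by auto
  then show "v \<noteq> 0" "P = ppoint v" using ppoint_scale[of c w] by auto
qed

lemma ex_in_point: "P \<in> proj_space \<Longrightarrow> \<exists>v. v \<in> P"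
  unfolding proj_space_def using in_ppoint by auto

lemma ppoint_in: "v \<noteq> 0 \<Longrightarrow> ppoint v \<in> proj_space"
  unfolding proj_space_def by auto

lemma point_scaled:
  assumes "P \<in> proj_space" "v \<in> P" "w \<in> P"
  obtains c where "c \<noteq> 0" "w = c *s v"
proof -
  have "w \<in> ppoint v"
    by (rule subst[where P = "\<lambda>A. w \<in> A", OF proj_spaceD(2)[OF assms(1,2)] assms(3)])
  then obtain c where "w = c *s v" "c \<noteq> 0" unfolding ppoint_def mem_Collect_eq by (elim exE conjE)
  then show thesis by (intro that[of c])
qed

text \<open>
  The coordinate vectors of a point are proportional, and forms are homogeneous.
\<close>

lemma form_nonzero_iff:
  assumes "F \<in> forms d" "P \<in> proj_space" "v \<in> P"
  shows "(\<forall>w\<in>P. F w \<noteq> 0) \<longleftrightarrow> F v \<noteq> 0" "(\<forall>w\<in>P. F w = 0) \<longleftrightarrow> F v = 0"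
proof -
  have "F w = 0 \<longleftrightarrow> F v = 0" if w: "w \<in> P" for w
  proof -
    obtain c where c: "c \<noteq> 0" "w = c *s v" using point_scaled[OF assms(2,3) w] .
    have "F w = c ^ d * F v" unfolding c(2) by (rule form_homogeneous[OF assms(1)])
    then show ?thesis using c(1) by simp
  qed
  then show "(\<forall>w\<in>P. F w \<noteq> 0) \<longleftrightarrow> F v \<noteq> 0" "(\<forall>w\<in>P. F w = 0) \<longleftrightarrow> F v = 0"
    using assms(3) by blast+
qed

locale projective_variety =
  fixes C :: "('n::finite) ppoint set"
  assumes closed: "zclosed C" and irreducible: "zirreducible C"
begin

lemma C_proj: "P \<in> C \<Longrightarrow> P \<in> proj_space"
  using closed unfolding zclosed_def by auto

lemma C_nonempty: "C \<noteq> {}"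
  using irreducible unfolding zirreducible_def by auto

text \<open>
  Open sets are unions of sets where a form does not vanish. This description is local, which makes
  intersections and unions immediate.
\<close>

lemma zopen_iff:
  "zopen C U \<longleftrightarrow> U \<subseteq> C \<and> (\<forall>P\<in>U. \<exists>d. \<exists>G\<in>forms d. (\<forall>v\<in>P. G v \<noteq> 0) \<and> (\<forall>Q\<in>C. (\<forall>v\<in>Q. G v \<noteq> 0) \<longrightarrow> Q \<in> U))"
proof
  assume "zopen C U"
  then obtain T where T: "T \<subseteq> (\<Union>d. forms d)" "U = C - {P \<in> proj_space. \<forall>F\<in>T. \<forall>v\<in>P. F v = 0}"
    unfolding zopen_def zclosed_def by auto
  have "\<exists>d. \<exists>G\<in>forms d. (\<forall>v\<in>P. G v \<noteq> 0) \<and> (\<forall>Q\<in>C. (\<forall>v\<in>Q. G v \<noteq> 0) \<longrightarrow> Q \<in> U)" if P: "P \<in> U" for P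
  proof -
    have PC: "P \<in> C" "P \<in> proj_space" using P T(2) C_proj by auto
    then obtain F v where F: "F \<in> T" "v \<in> P" "F v \<noteq> 0" using P T(2) by auto
    then obtain d where d: "F \<in> forms d" using T(1) by auto
    have "\<forall>w\<in>P. F w \<noteq> 0" using form_nonzero_iff(1)[OF d PC(2) F(2)] F(3) by simp
    moreover have "Q \<in> U" if QC: "Q \<in> C" and ne: "\<forall>v\<in>Q. F v \<noteq> 0" for Q
    proof -
      obtain w where "w \<in> Q" using ex_in_point[OF C_proj[OF QC]] by auto
      then show ?thesis using QC ne F(1) T(2) by auto
    qed
    ultimately show ?thesis using d by blast
  qed
  then show "U \<subseteq> C \<and> (\<forall>P\<in>U. \<exists>d. \<exists>G\<in>forms d. (\<forall>v\<in>P. G v \<noteq> 0) \<and> (\<forall>Q\<in>C. (\<forall>v\<in>Q. G v \<noteq> 0) \<longrightarrow> Q \<in> U))"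
    using T(2) by auto
next
  assume A: "U \<subseteq> C \<and> (\<forall>P\<in>U. \<exists>d. \<exists>G\<in>forms d. (\<forall>v\<in>P. G v \<noteq> 0) \<and> (\<forall>Q\<in>C. (\<forall>v\<in>Q. G v \<noteq> 0) \<longrightarrow> Q \<in> U))"
  define T where "T = {F \<in> (\<Union>d. forms d). \<forall>P\<in>C - U. \<forall>v\<in>P. F v = 0}"
  define Z where "Z = {P \<in> proj_space. \<forall>F\<in>T. \<forall>v\<in>P. F v = 0}"
  have "zclosed Z" unfolding zclosed_def Z_def by (intro exI[of _ T]) (auto simp: T_def)
  moreover have "U = C - Z"
  proof (rule Set.set_eqI, rule iffI)
    fix P assume P: "P \<in> U"
    from bspec[OF conjunct2[OF A] this]
    obtain d G where G: "G \<in> forms d" "\<forall>v\<in>P. G v \<noteq> 0" "\<forall>Q\<in>C. (\<forall>v\<in>Q. G v \<noteq> 0) \<longrightarrow> Q \<in> U"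
      by blast
    have "G v = 0" if "Q \<in> C - U" "v \<in> Q" for Q v
      using G(3) that form_nonzero_iff(1)[OF G(1) C_proj, of Q v] by auto
    then have "G \<in> T" using G(1) by (auto simp: T_def)
    moreover have "P \<in> C" using P conjunct1[OF A] by blast
    moreover obtain v where "v \<in> P" using ex_in_point[OF C_proj[OF calculation(2)]] by blast
    ultimately show "P \<in> C - Z" using G(2) by (auto simp: Z_def)
  next
    fix P assume "P \<in> C - Z"
    then show "P \<in> U" using C_proj by (auto simp: Z_def T_def)
  qed
  ultimately show "zopen C U" unfolding zopen_def by auto
qed

lemma zopen_sub: "zopen C U \<Longrightarrow> U \<subseteq> C"
  unfolding zopen_def by auto

lemma zopen_nonvanishing:
  assumes "G \<in> forms d" shows "zopen C {P \<in> C. \<forall>v\<in>P. G v \<noteq> 0}"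
  unfolding zopen_iff by (intro conjI ballI exI[of _ d] bexI[OF _ assms]) auto

lemma zopen_C: "zopen C C"
  using zopen_nonvanishing[OF const_form[of 1]] by simp

lemma zopen_local:
  assumes "\<And>P. P \<in> U \<Longrightarrow> \<exists>W. zopen C W \<and> P \<in> W \<and> W \<subseteq> U"
  shows "zopen C U"
  unfolding zopen_iff
proof (intro conjI ballI subsetI)
  show "P \<in> C" if "P \<in> U" for P using assms[OF that] zopen_sub by auto
  fix P assume "P \<in> U"
  then obtain W where W: "zopen C W" "P \<in> W" "W \<subseteq> U" using assms by blast
  then obtain d G where "G \<in> forms d" "\<forall>v\<in>P. G v \<noteq> 0" "\<forall>Q\<in>C. (\<forall>v\<in>Q. G v \<noteq> 0) \<longrightarrow> Q \<in> W"
    unfolding zopen_iff by blast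
  then show "\<exists>d. \<exists>G\<in>forms d. (\<forall>v\<in>P. G v \<noteq> 0) \<and> (\<forall>Q\<in>C. (\<forall>v\<in>Q. G v \<noteq> 0) \<longrightarrow> Q \<in> U)"
    using W(3) by blast
qed

lemma zopen_Int:
  assumes "zopen C U" "zopen C V" shows "zopen C (U \<inter> V)"
  unfolding zopen_iff
proof (intro conjI ballI)
  show "U \<inter> V \<subseteq> C" using zopen_sub[OF assms(1)] by auto
  fix P assume P: "P \<in> U \<inter> V"
  obtain d G where G: "G \<in> forms d" "\<forall>v\<in>P. G v \<noteq> 0" "\<forall>Q\<in>C. (\<forall>v\<in>Q. G v \<noteq> 0) \<longrightarrow> Q \<in> U"
    using assms(1) P unfolding zopen_iff by blast
  obtain e H where H: "H \<in> forms e" "\<forall>v\<in>P. H v \<noteq> 0" "\<forall>Q\<in>C. (\<forall>v\<in>Q. H v \<noteq> 0) \<longrightarrow> Q \<in> V"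
    using assms(2) P unfolding zopen_iff by blast
  show "\<exists>d. \<exists>G\<in>forms d. (\<forall>v\<in>P. G v \<noteq> 0) \<and> (\<forall>Q\<in>C. (\<forall>v\<in>Q. G v \<noteq> 0) \<longrightarrow> Q \<in> U \<inter> V)"
    by (intro exI[of _ "d + e"] bexI[OF _ form_mult[OF G(1) H(1)]]) (use G H in auto)
qed

lemma zopen_meet:
  assumes "zopen C U" "zopen C V" "U \<noteq> {}" "V \<noteq> {}" shows "U \<inter> V \<noteq> {}"
proof
  assume e: "U \<inter> V = {}"
  obtain Z1 Z2 where Z: "zclosed Z1" "U = C - Z1" "zclosed Z2" "V = C - Z2"
    using assms(1,2) unfolding zopen_def by auto
  have "C \<subseteq> Z1 \<union> Z2" using e Z by auto
  then have "C \<subseteq> Z1 \<or> C \<subseteq> Z2" using irreducible Z unfolding zirreducible_def by blast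
  then show False using Z assms by auto
qed

subsection \<open>The generic point\<close>

text \<open>
  The nonempty open sets of an irreducible variety form a filter base. Reasoning along this filter replaces
  the bookkeeping of domains: rational functions are treated as total functions up to eventual
  equality.
\<close>

definition gen :: "'n ppoint filter" where
  "gen = Abs_filter (\<lambda>Q. \<exists>U. zopen C U \<and> U \<noteq> {} \<and> (\<forall>P\<in>U. Q P))"

lemma eventually_gen: "eventually Q gen \<longleftrightarrow> (\<exists>U. zopen C U \<and> U \<noteq> {} \<and> (\<forall>P\<in>U. Q P))"
  unfolding gen_def
proof (rule eventually_Abs_filter, unfold_locales)
  show "\<exists>U. zopen C U \<and> U \<noteq> {} \<and> (\<forall>P\<in>U. True)" using zopen_C C_nonempty by auto
next
  fix Q R assume "\<exists>U. zopen C U \<and> U \<noteq> {} \<and> (\<forall>P\<in>U. Q P)" "\<exists>U. zopen C U \<and> U \<noteq> {} \<and> (\<forall>P\<in>U. R P)"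
  then obtain U V where "zopen C U" "U \<noteq> {}" "\<forall>P\<in>U. Q P" "zopen C V" "V \<noteq> {}" "\<forall>P\<in>V. R P" by auto
  then show "\<exists>U. zopen C U \<and> U \<noteq> {} \<and> (\<forall>P\<in>U. Q P \<and> R P)"
    using zopen_Int zopen_meet by (intro exI[of _ "U \<inter> V"]) auto
next
  fix Q R assume "\<forall>x. Q x \<longrightarrow> R x" "\<exists>U. zopen C U \<and> U \<noteq> {} \<and> (\<forall>P\<in>U. Q P)"
  then show "\<exists>U. zopen C U \<and> U \<noteq> {} \<and> (\<forall>P\<in>U. R P)" by blast
qed

lemma gen_open: "zopen C U \<Longrightarrow> P \<in> U \<Longrightarrow> eventually (\<lambda>Q. Q \<in> U) gen"
  unfolding eventually_gen by blast

lemma gen_ne_bot: "gen \<noteq> bot"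
  unfolding trivial_limit_def eventually_gen by auto

lemma gen_ex: "eventually Q gen \<Longrightarrow> zopen C U \<Longrightarrow> U \<noteq> {} \<Longrightarrow> \<exists>P\<in>U. Q P"
  unfolding eventually_gen using zopen_meet by blast

lemma gen_const [simp]: "eventually (\<lambda>P. Q) gen \<longleftrightarrow> Q"
  using gen_ne_bot by (simp add: eventually_const_iff)

subsection \<open>Regular functions\<close>

lemma regular_on_zopen: "regular_on C U f \<Longrightarrow> zopen C U"
  by (simp add: regular_on_def)

definition fraction_on :: "'n ppoint set \<Rightarrow> nat \<Rightarrow> (complex ^ 'n \<Rightarrow> complex) \<Rightarrow> (complex ^ 'n \<Rightarrow> complex) \<Rightarrow>
    ('n ppoint \<Rightarrow> complex) \<Rightarrow> bool" where
  "fraction_on W d F G f \<longleftrightarrow> F \<in> forms d \<and> G \<in> forms d \<and> zopen C W \<and>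
     (\<forall>Q\<in>W. \<forall>v\<in>Q. G v \<noteq> 0 \<and> f Q = F v / G v)"

lemma fraction_onD:
  assumes "fraction_on W d F G f"
  shows "F \<in> forms d" "G \<in> forms d" "zopen C W"
    "Q \<in> W \<Longrightarrow> v \<in> Q \<Longrightarrow> G v \<noteq> 0" "Q \<in> W \<Longrightarrow> v \<in> Q \<Longrightarrow> f Q = F v / G v"
  using assms unfolding fraction_on_def by blast+

lemma fraction_onI:
  assumes "F \<in> forms d" "G \<in> forms d" "zopen C W"
    "\<And>Q v. Q \<in> W \<Longrightarrow> v \<in> Q \<Longrightarrow> G v \<noteq> 0" "\<And>Q v. Q \<in> W \<Longrightarrow> v \<in> Q \<Longrightarrow> f Q = F v / G v"
  shows "fraction_on W d F G f"
  unfolding fraction_on_def using assms by blast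

lemma fraction_on_subset:
  assumes "fraction_on W d F G f" "zopen C V" "V \<subseteq> W"
  shows "fraction_on V d F G f"
  using assms unfolding fraction_on_def by blast

lemma regular_on_iff:
  "regular_on C U f \<longleftrightarrow> (\<forall>P\<in>U. \<exists>W. P \<in> W \<and> W \<subseteq> U \<and> (\<exists>d F G. fraction_on W d F G f))"
proof
  assume r: "regular_on C U f"
  show "\<forall>P\<in>U. \<exists>W. P \<in> W \<and> W \<subseteq> U \<and> (\<exists>d F G. fraction_on W d F G f)"
  proof
    fix P assume "P \<in> U"
    from bspec[OF conjunct2[OF r[unfolded regular_on_def]] this] obtain W d F G
      where "F \<in> forms d" "G \<in> forms d" "zopen C W" "P \<in> W" "W \<subseteq> U"
        "\<forall>Q\<in>W. \<forall>v\<in>Q. G v \<noteq> 0 \<and> f Q = F v / G v" by (elim exE bexE conjE)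
    note W = this
    have "fraction_on W d F G f" unfolding fraction_on_def by (intro conjI W)
    then show "\<exists>W. P \<in> W \<and> W \<subseteq> U \<and> (\<exists>d F G. fraction_on W d F G f)"
      using W(4,5) by blast
  qed
next
  assume r: "\<forall>P\<in>U. \<exists>W. P \<in> W \<and> W \<subseteq> U \<and> (\<exists>d F G. fraction_on W d F G f)"
  have "zopen C U"
  proof (rule zopen_local)
    fix P assume "P \<in> U"
    from bspec[OF r this] obtain W d F G where W: "P \<in> W" "W \<subseteq> U" "fraction_on W d F G f"
      by (elim exE conjE)
    then show "\<exists>W. zopen C W \<and> P \<in> W \<and> W \<subseteq> U" using fraction_onD(3)[OF W(3)] by blast
  qed
  moreover have "\<exists>W d. \<exists>F\<in>forms d. \<exists>G\<in>forms d. zopen C W \<and> P \<in> W \<and> W \<subseteq> U \<and>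
    (\<forall>Q\<in>W. \<forall>v\<in>Q. G v \<noteq> 0 \<and> f Q = F v / G v)" if P: "P \<in> U" for P
  proof -
    from bspec[OF r P] obtain W d F G where "P \<in> W" "W \<subseteq> U" "fraction_on W d F G f"
      by (elim exE conjE)
    then show ?thesis unfolding fraction_on_def
      by (intro exI[of _ W] exI[of _ d] bexI[of _ F] bexI[of _ G]) simp_all
  qed
  ultimately show "regular_on C U f" unfolding regular_on_def by (intro conjI ballI)
qed

lemma regular_onI:
  assumes "\<And>P. P \<in> U \<Longrightarrow> \<exists>W d F G. P \<in> W \<and> W \<subseteq> U \<and> fraction_on W d F G f"
  shows "regular_on C U f"
  unfolding regular_on_iff
proof
  fix P assume "P \<in> U"
  from assms[OF this] show "\<exists>W. P \<in> W \<and> W \<subseteq> U \<and> (\<exists>d F G. fraction_on W d F G f)"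
    by (elim exE conjE) (intro exI conjI)
qed

lemma regular_onE:
  assumes "regular_on C U f" "P \<in> U"
  obtains W d F G where "P \<in> W" "W \<subseteq> U" "fraction_on W d F G f"
  using bspec[OF assms(1)[unfolded regular_on_iff] assms(2)] by (elim exE conjE) (rule that)

lemma regular_on_fraction: "fraction_on U d F G f \<Longrightarrow> regular_on C U f"
  by (rule regular_onI) (intro exI conjI, assumption, rule order_refl)

lemma regular_on_subset:
  assumes "regular_on C U f" "zopen C V" "V \<subseteq> U" shows "regular_on C V f"
proof (rule regular_onI)
  fix P assume P: "P \<in> V"
  then have "P \<in> U" using assms(3) by blast
  then obtain W d F G where W: "P \<in> W" "W \<subseteq> U" "fraction_on W d F G f"
    using regular_onE[OF assms(1)] by metis
  have "fraction_on (W \<inter> V) d F G f"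
    using fraction_on_subset[OF W(3) zopen_Int[OF fraction_onD(3)[OF W(3)] assms(2)]] by blast
  then show "\<exists>W d F G. P \<in> W \<and> W \<subseteq> V \<and> fraction_on W d F G f" using P W(1) by blast
qed

lemma regular_on_local:
  assumes "\<And>P. P \<in> U \<Longrightarrow> \<exists>W. P \<in> W \<and> W \<subseteq> U \<and> regular_on C W f"
  shows "regular_on C U f"
proof (rule regular_onI)
  fix P assume P: "P \<in> U"
  then obtain V where V: "P \<in> V" "V \<subseteq> U" "regular_on C V f" using assms by blast
  obtain W d F G where "P \<in> W" "W \<subseteq> V" "fraction_on W d F G f"
    using regular_onE[OF V(3,1)] .
  then show "\<exists>W d F G. P \<in> W \<and> W \<subseteq> U \<and> fraction_on W d F G f" using V(2) by blast
qed

lemma regular_on_cong: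
  assumes "regular_on C U f" "\<And>P. P \<in> U \<Longrightarrow> f P = g P" shows "regular_on C U g"
proof (rule regular_onI)
  fix P assume P: "P \<in> U"
  obtain W d F G where W: "P \<in> W" "W \<subseteq> U" "fraction_on W d F G f"
    using regular_onE[OF assms(1) P] .
  have "fraction_on W d F G g"
  proof (rule fraction_onI[OF fraction_onD(1-4)[OF W(3)]])
    fix Q v assume "Q \<in> W" "v \<in> Q"
    then show "g Q = F v / G v" using fraction_onD(5)[OF W(3)] assms(2)[of Q] W(2) by auto
  qed
  then show "\<exists>W d F G. P \<in> W \<and> W \<subseteq> U \<and> fraction_on W d F G g" using W by blast
qed

lemma regular_on_const: "zopen C U \<Longrightarrow> regular_on C U (\<lambda>_. c)"
  by (rule regular_on_fraction[OF fraction_onI[OF const_form[of c] const_form[of 1]]]) auto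

lemma regular_on_add:
  assumes f: "regular_on C U f" and g: "regular_on C U g"
  shows "regular_on C U (\<lambda>P. f P + g P)"
proof (rule regular_onI)
  fix P assume P: "P \<in> U"
  obtain W d F G where W: "P \<in> W" "W \<subseteq> U" "fraction_on W d F G f" using regular_onE[OF f P] .
  obtain W' d' F' G' where W': "P \<in> W'" "W' \<subseteq> U" "fraction_on W' d' F' G' g" using regular_onE[OF g P] .
  note D = fraction_onD[OF W(3)] and D' = fraction_onD[OF W'(3)]
  have "fraction_on (W \<inter> W') (d + d') (\<lambda>v. F v * G' v + G v * F' v) (\<lambda>v. G v * G' v) (\<lambda>P. f P + g P)"
  proof (rule fraction_onI)
    fix Q v assume Q: "Q \<in> W \<inter> W'" "v \<in> Q"
    then have "G v \<noteq> 0" "G' v \<noteq> 0" "f Q = F v / G v" "g Q = F' v / G' v"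
      using D(4,5)[of Q v] D'(4,5)[of Q v] by blast+
    then show "G v * G' v \<noteq> 0" "f Q + g Q = (F v * G' v + G v * F' v) / (G v * G' v)"
      by (simp_all add: field_simps)
  qed (intro form_add form_mult zopen_Int D D')+
  then show "\<exists>W d F G. P \<in> W \<and> W \<subseteq> U \<and> fraction_on W d F G (\<lambda>P. f P + g P)" using W(1,2) W'(1) by blast
qed

lemma regular_on_mult:
  assumes f: "regular_on C U f" and g: "regular_on C U g"
  shows "regular_on C U (\<lambda>P. f P * g P)"
proof (rule regular_onI)
  fix P assume P: "P \<in> U"
  obtain W d F G where W: "P \<in> W" "W \<subseteq> U" "fraction_on W d F G f" using regular_onE[OF f P] .
  obtain W' d' F' G' where W': "P \<in> W'" "W' \<subseteq> U" "fraction_on W' d' F' G' g" using regular_onE[OF g P] .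
  note D = fraction_onD[OF W(3)] and D' = fraction_onD[OF W'(3)]
  have "fraction_on (W \<inter> W') (d + d') (\<lambda>v. F v * F' v) (\<lambda>v. G v * G' v) (\<lambda>P. f P * g P)"
  proof (rule fraction_onI)
    fix Q v assume Q: "Q \<in> W \<inter> W'" "v \<in> Q"
    then have "G v \<noteq> 0" "G' v \<noteq> 0" "f Q = F v / G v" "g Q = F' v / G' v"
      using D(4,5)[of Q v] D'(4,5)[of Q v] by blast+
    then show "G v * G' v \<noteq> 0" "f Q * g Q = (F v * F' v) / (G v * G' v)" by simp_all
  qed (intro form_mult zopen_Int D D')+
  then show "\<exists>W d F G. P \<in> W \<and> W \<subseteq> U \<and> fraction_on W d F G (\<lambda>P. f P * g P)" using W(1,2) W'(1) by blast
qed

lemma regular_on_uminus: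
  assumes "regular_on C U f" shows "regular_on C U (\<lambda>P. - f P)"
  using regular_on_mult[OF regular_on_const[OF regular_on_zopen[OF assms], of "- 1"] assms] by simp

lemma regular_on_diff:
  assumes "regular_on C U f" "regular_on C U g" shows "regular_on C U (\<lambda>P. f P - g P)"
  using regular_on_add[OF assms(1) regular_on_uminus[OF assms(2)]] by simp

lemma zopen_regular_nonzero:
  assumes "regular_on C U f" shows "zopen C {P \<in> U. f P \<noteq> 0}"
proof (rule zopen_local)
  fix P assume P: "P \<in> {P \<in> U. f P \<noteq> 0}"
  then have "P \<in> U" by simp
  then obtain W d F G where W: "P \<in> W" "W \<subseteq> U" "fraction_on W d F G f"
    using regular_onE[OF assms] by metis
  note D = fraction_onD[OF W(3)]
  have "W \<inter> {P \<in> C. \<forall>v\<in>P. F v \<noteq> 0} \<subseteq> {P \<in> U. f P \<noteq> 0}"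
  proof
    fix Q assume Q: "Q \<in> W \<inter> {P \<in> C. \<forall>v\<in>P. F v \<noteq> 0}"
    then obtain v where v: "v \<in> Q" using ex_in_point[OF C_proj] by blast
    have "f Q = F v / G v" "G v \<noteq> 0" "F v \<noteq> 0" using D(4,5)[of Q v] Q v by blast+
    then show "Q \<in> {P \<in> U. f P \<noteq> 0}" using Q W(2) by auto
  qed
  moreover have "P \<in> W \<inter> {P \<in> C. \<forall>v\<in>P. F v \<noteq> 0}"
  proof -
    have "F v \<noteq> 0" if "v \<in> P" for v using D(5)[OF W(1) that] P by auto
    then show ?thesis using W(1) zopen_sub[OF D(3)] by blast
  qed
  ultimately show "\<exists>W. zopen C W \<and> P \<in> W \<and> W \<subseteq> {P \<in> U. f P \<noteq> 0}"
    using zopen_Int[OF D(3) zopen_nonvanishing[OF D(1)]] by blast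
qed

lemma regular_on_inverse:
  assumes "regular_on C U f" "\<And>P. P \<in> U \<Longrightarrow> f P \<noteq> 0" shows "regular_on C U (\<lambda>P. inverse (f P))"
proof (rule regular_onI)
  fix P assume P: "P \<in> U"
  obtain W d F G where W: "P \<in> W" "W \<subseteq> U" "fraction_on W d F G f" using regular_onE[OF assms(1) P] .
  note D = fraction_onD[OF W(3)]
  have "fraction_on W d G F (\<lambda>P. inverse (f P))"
  proof (rule fraction_onI[OF D(2,1,3)])
    fix Q v assume Q: "Q \<in> W" "v \<in> Q"
    then have "f Q = F v / G v" "f Q \<noteq> 0" using D(5)[of Q v] assms(2)[of Q] W(2) by blast+
    then show "F v \<noteq> 0" "inverse (f Q) = G v / F v" by auto
  qed
  then show "\<exists>W d F G. P \<in> W \<and> W \<subseteq> U \<and> fraction_on W d F G (\<lambda>P. inverse (f P))" using W by blast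
qed

text \<open>
  The set where two regular functions differ is open; if it were nonempty, it would meet every nonempty
  open set.
\<close>

lemma regular_on_eqI:
  assumes "regular_on C U f" "regular_on C U g" "eventually (\<lambda>P. f P = g P) gen" "P \<in> U"
  shows "f P = g P"
proof (rule ccontr)
  assume ne: "f P \<noteq> g P"
  have op: "zopen C {P \<in> U. f P - g P \<noteq> 0}"
    by (intro zopen_regular_nonzero regular_on_diff assms(1,2))
  have "P \<in> {P \<in> U. f P - g P \<noteq> 0}" using ne assms(4) by simp
  then have "{P \<in> U. f P - g P \<noteq> 0} \<noteq> {}" by (metis empty_iff)
  from gen_ex[OF assms(3) op this] obtain Q where "Q \<in> {P \<in> U. f P - g P \<noteq> 0}" "f Q = g Q" by (elim bexE)
  then show False by simp
qed

end

section \<open>The function field\<close>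

context projective_variety
begin

abbreviation FF :: "'n rat_fun ring" where "FF \<equiv> function_field C"

definition Rat :: "('n ppoint \<Rightarrow> complex) set" where
  "Rat = {f. \<exists>U. U \<noteq> {} \<and> regular_on C U f}"

abbreviation geq :: "('n ppoint \<Rightarrow> complex) \<Rightarrow> ('n ppoint \<Rightarrow> complex) \<Rightarrow> bool" (infix "\<asymp>" 50) where
  "f \<asymp> g \<equiv> eventually (\<lambda>P. f P = g P) gen"

lemma geq_sym: "f \<asymp> g \<Longrightarrow> g \<asymp> f"
  by (auto elim: eventually_mono)

lemma geq_trans: assumes "f \<asymp> g" "g \<asymp> h" shows "f \<asymp> h"
  using assms by eventually_elim simp

lemma RatE:
  assumes "f \<in> Rat" obtains U where "U \<noteq> {}" "regular_on C U f"
  using assms unfolding Rat_def by auto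

lemma RatI: "regular_on C U f \<Longrightarrow> P \<in> U \<Longrightarrow> f \<in> Rat"
  unfolding Rat_def by auto

lemma Rat_two:
  assumes "f \<in> Rat" "g \<in> Rat"
  obtains U where "U \<noteq> {}" "regular_on C U f" "regular_on C U g"
proof -
  obtain U V where UV: "U \<noteq> {}" "regular_on C U f" "V \<noteq> {}" "regular_on C V g"
    using RatE[OF assms(1)] RatE[OF assms(2)] by metis
  note o = regular_on_zopen[OF UV(2)] regular_on_zopen[OF UV(4)]
  show thesis
    by (rule that[OF zopen_meet[OF o UV(1,3)]])
      (auto intro: regular_on_subset[OF UV(2) zopen_Int[OF o]] regular_on_subset[OF UV(4) zopen_Int[OF o]])
qed

lemma Rat_cong:
  assumes "f \<in> Rat" "f \<asymp> g" shows "g \<in> Rat"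
proof -
  obtain U where U: "U \<noteq> {}" "regular_on C U f" using RatE[OF assms(1)] .
  obtain W where W: "zopen C W" "W \<noteq> {}" "\<forall>P\<in>W. f P = g P" using assms(2) eventually_gen by auto
  have o: "zopen C (U \<inter> W)" "U \<inter> W \<noteq> {}"
    using zopen_Int zopen_meet regular_on_zopen[OF U(2)] U(1) W(1,2) by auto
  have "regular_on C (U \<inter> W) g"
    by (rule regular_on_cong[OF regular_on_subset[OF U(2) o(1)]]) (use W(3) in auto)
  with o(2) show ?thesis unfolding Rat_def by (intro CollectI exI[of _ "U \<inter> W"] conjI)
qed

lemma Rat_const: "(\<lambda>_. c) \<in> Rat"
  unfolding Rat_def using regular_on_const[OF zopen_C] C_nonempty by auto

lemma Rat_add: "f \<in> Rat \<Longrightarrow> g \<in> Rat \<Longrightarrow> (\<lambda>P. f P + g P) \<in> Rat"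
  by (erule (1) Rat_two) (auto simp: Rat_def intro: regular_on_add)

lemma Rat_mult: "f \<in> Rat \<Longrightarrow> g \<in> Rat \<Longrightarrow> (\<lambda>P. f P * g P) \<in> Rat"
  by (erule (1) Rat_two) (auto simp: Rat_def intro: regular_on_mult)

lemma Rat_uminus: "f \<in> Rat \<Longrightarrow> (\<lambda>P. - f P) \<in> Rat"
  using Rat_mult[OF Rat_const[of "- 1"], of f] by simp

lemma Rat_diff: "f \<in> Rat \<Longrightarrow> g \<in> Rat \<Longrightarrow> (\<lambda>P. f P - g P) \<in> Rat"
  using Rat_add[OF _ Rat_uminus, of f g] by simp

lemma Rat_power: "f \<in> Rat \<Longrightarrow> (\<lambda>P. f P ^ n) \<in> Rat"
  by (induction n) (auto simp: Rat_const intro: Rat_mult)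

lemma Rat_sum: "(\<And>i. i \<in> A \<Longrightarrow> f i \<in> Rat) \<Longrightarrow> (\<lambda>P. \<Sum>i\<in>A. f i P) \<in> Rat"
  by (induction A rule: infinite_finite_induct) (auto simp: Rat_const intro: Rat_add)

lemma Rat_poly: "f \<in> Rat \<Longrightarrow> (\<lambda>P. poly p (f P)) \<in> Rat"
  unfolding poly_altdef by (intro Rat_sum Rat_mult Rat_const Rat_power)

lemma Rat_zero_or_nonzero:
  assumes "f \<in> Rat" shows "f \<asymp> (\<lambda>_. 0) \<or> eventually (\<lambda>P. f P \<noteq> 0) gen"
proof -
  obtain U where U: "U \<noteq> {}" "regular_on C U f" using RatE[OF assms] .
  show ?thesis
  proof (cases "{P \<in> U. f P \<noteq> 0} = {}")
    case True
    then have "\<forall>P\<in>U. f P = 0" by auto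
    then show ?thesis using U regular_on_zopen unfolding eventually_gen by blast
  next
    case False
    then show ?thesis using zopen_regular_nonzero[OF U(2)] unfolding eventually_gen by blast
  qed
qed

lemma Rat_nonzero: "f \<in> Rat \<Longrightarrow> \<not> f \<asymp> (\<lambda>_. 0) \<Longrightarrow> eventually (\<lambda>P. f P \<noteq> 0) gen"
  using Rat_zero_or_nonzero by blast

lemma nonzero_not_geq_0: "eventually (\<lambda>P. f P \<noteq> 0) gen \<Longrightarrow> \<not> f \<asymp> (\<lambda>_. 0)"
proof
  assume "eventually (\<lambda>P. f P \<noteq> 0) gen" "f \<asymp> (\<lambda>_. 0)"
  then have "eventually (\<lambda>P. False) gen" by eventually_elim simp
  then show False by simp
qed

lemma Rat_inverse:
  assumes "f \<in> Rat" shows "(\<lambda>P. inverse (f P)) \<in> Rat"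
  using Rat_zero_or_nonzero[OF assms]
proof
  assume "f \<asymp> (\<lambda>_. 0)"
  then have "(\<lambda>_. 0) \<asymp> (\<lambda>P. inverse (f P))" by eventually_elim simp
  then show ?thesis by (rule Rat_cong[OF Rat_const])
next
  assume nz: "eventually (\<lambda>P. f P \<noteq> 0) gen"
  obtain U where U: "U \<noteq> {}" "regular_on C U f" using RatE[OF assms] .
  obtain Q where Q: "Q \<in> U" "f Q \<noteq> 0" using gen_ex[OF nz regular_on_zopen[OF U(2)] U(1)] by blast
  have "regular_on C {P \<in> U. f P \<noteq> 0} (\<lambda>P. inverse (f P))"
    by (rule regular_on_inverse[OF regular_on_subset[OF U(2) zopen_regular_nonzero[OF U(2)]]]) auto
  then show ?thesis by (rule RatI[of _ _ Q]) (use Q in simp)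
qed

lemma Rat_divide: "f \<in> Rat \<Longrightarrow> g \<in> Rat \<Longrightarrow> (\<lambda>P. f P / g P) \<in> Rat"
  unfolding divide_inverse by (intro Rat_mult Rat_inverse)

text \<open>
  The class of a function up to equality at the generic point, for which no domain has to be mentioned.
\<close>

definition cls :: "('n ppoint \<Rightarrow> complex) \<Rightarrow> 'n rat_fun" where
  "cls f = {(V, g). V \<noteq> {} \<and> regular_on C V g \<and> f \<asymp> g}"

lemma rat_eq_cls:
  assumes U: "regular_on C U f" "U \<noteq> {}"
  shows "rat C U f = cls f"
proof -
  have "(\<forall>P\<in>U \<inter> V. f P = g P) \<longleftrightarrow> f \<asymp> g" if V: "V \<noteq> {}" "regular_on C V g" for V g
  proof -
    note o = regular_on_zopen[OF U(1)] regular_on_zopen[OF V(2)]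
    note UV = zopen_Int[OF o] zopen_meet[OF o U(2) V(1)]
    show ?thesis
    proof
      assume "\<forall>P\<in>U \<inter> V. f P = g P"
      then show "f \<asymp> g" using UV unfolding eventually_gen by blast
    next
      assume fg: "f \<asymp> g"
      have f': "regular_on C (U \<inter> V) f" by (rule regular_on_subset[OF U(1) UV(1)]) auto
      have g': "regular_on C (U \<inter> V) g" by (rule regular_on_subset[OF V(2) UV(1)]) auto
      show "\<forall>P\<in>U \<inter> V. f P = g P" using regular_on_eqI[OF f' g' fg] by blast
    qed
  qed
  then show ?thesis unfolding rat_def cls_def by blast
qed

lemma cls_eq_iff:
  assumes "f \<in> Rat" "g \<in> Rat" shows "cls f = cls g \<longleftrightarrow> f \<asymp> g"
proof
  assume eq: "cls f = cls g"
  obtain U where U: "U \<noteq> {}" "regular_on C U f" using RatE[OF assms(1)] .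
  have "(U, f) \<in> cls f" using U by (simp add: cls_def)
  then have "(U, f) \<in> cls g" using eq by simp
  then have "g \<asymp> f" by (simp add: cls_def)
  then show "f \<asymp> g" by (rule geq_sym)
next
  assume "f \<asymp> g"
  then have "f \<asymp> h \<longleftrightarrow> g \<asymp> h" for h using geq_sym geq_trans by blast
  then show "cls f = cls g" unfolding cls_def by auto
qed

lemma cls_cong: "f \<asymp> g \<Longrightarrow> f \<in> Rat \<Longrightarrow> cls f = cls g"
  using cls_eq_iff Rat_cong by blast

lemma carrier_FF: "carrier FF = cls ` Rat"
proof
  show "carrier FF \<subseteq> cls ` Rat"
  proof
    fix a assume "a \<in> carrier FF"
    then obtain U f where U: "U \<noteq> {}" "regular_on C U f" "a = rat C U f"
      unfolding function_field_def by auto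
    then have "f \<in> Rat" unfolding Rat_def by (intro CollectI exI[of _ U] conjI)
    then show "a \<in> cls ` Rat" using rat_eq_cls[OF U(2,1)] U(3) by simp
  qed
  show "cls ` Rat \<subseteq> carrier FF"
  proof
    fix a assume "a \<in> cls ` Rat"
    then obtain f where f: "f \<in> Rat" "a = cls f" by auto
    obtain U where U: "U \<noteq> {}" "regular_on C U f" using RatE[OF f(1)] .
    then have "a = rat C U f" using f rat_eq_cls by simp
    then show "a \<in> carrier FF" unfolding function_field_def using U by auto
  qed
qed

lemma cls_in_carrier: "f \<in> Rat \<Longrightarrow> cls f \<in> carrier FF"
  by (simp add: carrier_FF)

lemma cls_combine:
  assumes f: "f \<in> Rat" and g: "g \<in> Rat" and h: "\<And>f g. f \<in> Rat \<Longrightarrow> g \<in> Rat \<Longrightarrow> (\<lambda>P. h (f P) (g P)) \<in> Rat"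
    and reg: "\<And>U f g. regular_on C U f \<Longrightarrow> regular_on C U g \<Longrightarrow> regular_on C U (\<lambda>P. h (f P) (g P))"
  shows "(\<Union>(U, f)\<in>cls f. \<Union>(V, g)\<in>cls g. rat C (U \<inter> V) (\<lambda>P. h (f P) (g P))) = cls (\<lambda>P. h (f P) (g P))"
proof -
  have *: "rat C (U \<inter> V) (\<lambda>P. h (f' P) (g' P)) = cls (\<lambda>P. h (f P) (g P))"
    if "(U, f') \<in> cls f" "(V, g') \<in> cls g" for U f' V g'
  proof -
    have U: "U \<noteq> {}" "regular_on C U f'" "f \<asymp> f'" and V: "V \<noteq> {}" "regular_on C V g'" "g \<asymp> g'"
      using that by (auto simp: cls_def)
    note o = regular_on_zopen[OF U(2)] regular_on_zopen[OF V(2)]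
    have r: "regular_on C (U \<inter> V) (\<lambda>P. h (f' P) (g' P))"
      by (intro reg regular_on_subset[OF U(2) zopen_Int[OF o]] regular_on_subset[OF V(2) zopen_Int[OF o]]) auto
    have "(\<lambda>P. h (f P) (g P)) \<asymp> (\<lambda>P. h (f' P) (g' P))" using U(3) V(3) by eventually_elim simp
    then show ?thesis
      using rat_eq_cls[OF r zopen_meet[OF o U(1) V(1)]] cls_cong[OF _ h[OF f g]] by simp
  qed
  obtain U where "U \<noteq> {}" "regular_on C U f" using RatE[OF f] .
  then have "(U, f) \<in> cls f" by (simp add: cls_def)
  moreover obtain V where "V \<noteq> {}" "regular_on C V g" using RatE[OF g] .
  then have "(V, g) \<in> cls g" by (simp add: cls_def)
  ultimately show ?thesis using * by fast
qed

lemma mult_FF: "f \<in> Rat \<Longrightarrow> g \<in> Rat \<Longrightarrow> cls f \<otimes>\<^bsub>FF\<^esub> cls g = cls (\<lambda>P. f P * g P)"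
  using cls_combine[of f g "(*)"] Rat_mult regular_on_mult by (simp add: function_field_def)

lemma add_FF: "f \<in> Rat \<Longrightarrow> g \<in> Rat \<Longrightarrow> cls f \<oplus>\<^bsub>FF\<^esub> cls g = cls (\<lambda>P. f P + g P)"
  using cls_combine[of f g "(+)"] Rat_add regular_on_add by (simp add: function_field_def)

lemma const_FF: "const C c = cls (\<lambda>_. c)"
  unfolding const_def by (rule rat_eq_cls[OF regular_on_const[OF zopen_C] C_nonempty])

lemma one_FF: "\<one>\<^bsub>FF\<^esub> = cls (\<lambda>_. 1)" and zero_FF: "\<zero>\<^bsub>FF\<^esub> = cls (\<lambda>_. 0)"
  using const_FF[of 1] const_FF[of 0] by (simp_all add: function_field_def const_def)

lemma FF_cases:
  assumes "a \<in> carrier FF" obtains f where "f \<in> Rat" "a = cls f"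
  using assms carrier_FF by auto

lemma FF_cring: "cring FF"
proof (rule cringI)
  show "abelian_group FF"
  proof (rule abelian_groupI)
    show "\<zero>\<^bsub>FF\<^esub> \<in> carrier FF" by (simp add: zero_FF cls_in_carrier Rat_const)
  next
    fix a b assume "a \<in> carrier FF" "b \<in> carrier FF"
    then show "a \<oplus>\<^bsub>FF\<^esub> b \<in> carrier FF" "a \<oplus>\<^bsub>FF\<^esub> b = b \<oplus>\<^bsub>FF\<^esub> a"
      by (elim FF_cases; simp add: add_FF Rat_add cls_in_carrier add.commute)+
  next
    fix a b c assume "a \<in> carrier FF" "b \<in> carrier FF" "c \<in> carrier FF"
    then show "(a \<oplus>\<^bsub>FF\<^esub> b) \<oplus>\<^bsub>FF\<^esub> c = a \<oplus>\<^bsub>FF\<^esub> (b \<oplus>\<^bsub>FF\<^esub> c)"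
      by (elim FF_cases) (simp add: add_FF Rat_add add.assoc)
  next
    fix a assume "a \<in> carrier FF"
    then obtain f where f: "f \<in> Rat" "a = cls f" by (rule FF_cases)
    then show "\<zero>\<^bsub>FF\<^esub> \<oplus>\<^bsub>FF\<^esub> a = a" by (simp add: zero_FF add_FF Rat_const)
    show "\<exists>b\<in>carrier FF. b \<oplus>\<^bsub>FF\<^esub> a = \<zero>\<^bsub>FF\<^esub>"
      using f by (intro bexI[of _ "cls (\<lambda>P. - f P)"]) (auto simp: zero_FF add_FF Rat_uminus cls_in_carrier)
  qed
  show "comm_monoid FF"
  proof (rule comm_monoidI)
    show "\<one>\<^bsub>FF\<^esub> \<in> carrier FF" by (simp add: one_FF cls_in_carrier Rat_const)
  next
    fix a b assume "a \<in> carrier FF" "b \<in> carrier FF"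
    then show "a \<otimes>\<^bsub>FF\<^esub> b \<in> carrier FF" "a \<otimes>\<^bsub>FF\<^esub> b = b \<otimes>\<^bsub>FF\<^esub> a"
      by (elim FF_cases; simp add: mult_FF Rat_mult cls_in_carrier mult.commute)+
  next
    fix a b c assume "a \<in> carrier FF" "b \<in> carrier FF" "c \<in> carrier FF"
    then show "(a \<otimes>\<^bsub>FF\<^esub> b) \<otimes>\<^bsub>FF\<^esub> c = a \<otimes>\<^bsub>FF\<^esub> (b \<otimes>\<^bsub>FF\<^esub> c)"
      by (elim FF_cases) (simp add: mult_FF Rat_mult mult.assoc)
  next
    fix a assume "a \<in> carrier FF"
    then show "\<one>\<^bsub>FF\<^esub> \<otimes>\<^bsub>FF\<^esub> a = a" by (elim FF_cases) (simp add: one_FF mult_FF Rat_const)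
  qed
  fix a b c assume "a \<in> carrier FF" "b \<in> carrier FF" "c \<in> carrier FF"
  then show "(a \<oplus>\<^bsub>FF\<^esub> b) \<otimes>\<^bsub>FF\<^esub> c = a \<otimes>\<^bsub>FF\<^esub> c \<oplus>\<^bsub>FF\<^esub> b \<otimes>\<^bsub>FF\<^esub> c"
    by (elim FF_cases) (simp add: mult_FF add_FF Rat_mult Rat_add distrib_right)
qed

lemma cls_eq_zero_iff: "f \<in> Rat \<Longrightarrow> cls f = \<zero>\<^bsub>FF\<^esub> \<longleftrightarrow> f \<asymp> (\<lambda>_. 0)"
  by (simp add: zero_FF cls_eq_iff Rat_const)

lemma mult_inverse_FF:
  assumes "f \<in> Rat" "\<not> f \<asymp> (\<lambda>_. 0)"
  shows "cls f \<otimes>\<^bsub>FF\<^esub> cls (\<lambda>P. inverse (f P)) = \<one>\<^bsub>FF\<^esub>"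
proof -
  have "(\<lambda>P. f P * inverse (f P)) \<asymp> (\<lambda>_. 1)"
    using Rat_nonzero[OF assms] by eventually_elim simp
  then show ?thesis using assms(1)
    by (simp add: mult_FF Rat_inverse one_FF cls_eq_iff Rat_mult Rat_const)
qed

lemma FF_field: "field FF"
proof (rule cring.cring_fieldI2[OF FF_cring])
  show "\<zero>\<^bsub>FF\<^esub> \<noteq> \<one>\<^bsub>FF\<^esub>" by (simp add: zero_FF one_FF cls_eq_iff Rat_const)
  fix a assume "a \<in> carrier FF" "a \<noteq> \<zero>\<^bsub>FF\<^esub>"
  then show "\<exists>b\<in>carrier FF. a \<otimes>\<^bsub>FF\<^esub> b = \<one>\<^bsub>FF\<^esub>"
    by (elim FF_cases) (use mult_inverse_FF cls_eq_zero_iff cls_in_carrier Rat_inverse in blast)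
qed

sublocale FF: field FF by (rule FF_field)

lemma inv_FF: "f \<in> Rat \<Longrightarrow> \<not> f \<asymp> (\<lambda>_. 0) \<Longrightarrow> inv\<^bsub>FF\<^esub> (cls f) = cls (\<lambda>P. inverse (f P))"
  by (intro FF.comm_inv_char mult_inverse_FF cls_in_carrier Rat_inverse)

lemma uminus_FF: "f \<in> Rat \<Longrightarrow> \<ominus>\<^bsub>FF\<^esub> (cls f) = cls (\<lambda>P. - f P)"
  by (rule FF.sum_zero_eq_neg[symmetric])
    (simp_all add: cls_in_carrier Rat_uminus add_FF zero_FF)

lemma pow_FF: "f \<in> Rat \<Longrightarrow> cls f [^]\<^bsub>FF\<^esub> (n::nat) = cls (\<lambda>P. f P ^ n)"
  by (induction n) (simp_all add: one_FF mult_FF Rat_power mult.commute)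

lemma int_pow_FF:
  assumes f: "f \<in> Rat" "\<not> f \<asymp> (\<lambda>_. 0)"
  shows "cls f [^]\<^bsub>FF\<^esub> (k::int) = cls (\<lambda>P. f P powi k)"
proof (cases "k < 0")
  case True
  have "eventually (\<lambda>P. f P ^ nat (- k) \<noteq> 0) gen"
    using Rat_nonzero[OF f] by eventually_elim simp
  then have nz: "\<not> (\<lambda>P. f P ^ nat (- k)) \<asymp> (\<lambda>_. 0)" by (rule nonzero_not_geq_0)
  have "cls f [^]\<^bsub>FF\<^esub> k = inv\<^bsub>FF\<^esub> (cls f [^]\<^bsub>FF\<^esub> nat (- k))"
    using True by (simp only: int_pow_def2 if_True)
  also have "\<dots> = cls (\<lambda>P. inverse (f P ^ nat (- k)))"
    unfolding pow_FF[OF f(1)] by (rule inv_FF[OF Rat_power[OF f(1)] nz])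
  also have "(\<lambda>P. inverse (f P ^ nat (- k))) = (\<lambda>P. f P powi k)"
    using True by (intro ext) (simp add: power_int_def power_inverse)
  finally show ?thesis .
next
  case False
  have "cls f [^]\<^bsub>FF\<^esub> k = cls f [^]\<^bsub>FF\<^esub> nat k"
    using False by (simp only: int_pow_def2 if_False)
  also have "\<dots> = cls (\<lambda>P. f P ^ nat k)" by (rule pow_FF[OF f(1)])
  also have "(\<lambda>P. f P ^ nat k) = (\<lambda>P. f P powi k)"
    using False by (intro ext) (simp add: power_int_def)
  finally show ?thesis .
qed

lemma Rat_powi: "f \<in> Rat \<Longrightarrow> (\<lambda>P. f P powi k) \<in> Rat"
  using Rat_power[of f "nat k"] Rat_power[OF Rat_inverse, of f "nat (- k)"]
  unfolding power_int_def by (cases "k \<ge> 0") simp_all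

lemma poly_at_FF:
  assumes f: "f \<in> Rat" shows "poly_at C p (cls f) = cls (\<lambda>P. poly p (f P))"
proof -
  define T where "T i = cls (\<lambda>P. poly.coeff p i * f P ^ i)" for i
  have T: "const C (poly.coeff p i) \<otimes>\<^bsub>FF\<^esub> cls f [^]\<^bsub>FF\<^esub> i = T i" for i
    unfolding const_FF pow_FF[OF f] T_def by (rule mult_FF[OF Rat_const Rat_power[OF f]])
  have R: "(\<lambda>P. poly.coeff p i * f P ^ i) \<in> Rat" for i
    by (intro Rat_mult Rat_const Rat_power f)
  have Tc: "T \<in> A \<rightarrow> carrier FF" for A
    unfolding T_def using cls_in_carrier[OF R] by blast
  have "(\<Oplus>\<^bsub>FF\<^esub> i\<in>{..n}. T i) = cls (\<lambda>P. \<Sum>i\<le>n. poly.coeff p i * f P ^ i)" for n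
  proof (induction n)
    case 0
    show ?case by (subst FF.finsum_0[OF Tc]) (simp add: T_def)
  next
    case (Suc n)
    show ?case
      unfolding FF.finsum_Suc[OF Tc] Suc.IH unfolding T_def
      by (subst add_FF) (simp_all add: R Rat_sum add.commute del: power_Suc)
  qed
  then show ?thesis unfolding poly_at_def T by (simp add: poly_altdef)
qed

end

section \<open>Algebraic relations\<close>

lemma fraction_sum: "q \<noteq> 0 \<Longrightarrow> b \<noteq> 0 \<Longrightarrow> p / q * y + s / b = (q * s + p * b * y) / (q * b)"
  for q b p y s :: complex
  by (simp add: add_frac_eq ac_simps)

lemma poly_eq_sum_le:
  fixes p :: "complex poly"
  assumes "Polynomial.degree p \<le> n" shows "poly p x = (\<Sum>i\<le>n. poly.coeff p i * x ^ i)"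
proof -
  have "poly p x = poly (\<Sum>i\<le>n. Polynomial.monom (poly.coeff p i) i) x"
    using poly_as_sum_of_monoms'[OF assms] by simp
  then show ?thesis by (simp add: poly_sum poly_monom)
qed

text \<open>
  Each further factor \<open>c a\<close> raises the powers of \<open>a\<close> by one, and the equation brings \<open>a ^ Suc d\<close> back to lower
  powers at the cost of degree \<open>M\<close> in \<open>x\<close>. What matters is that the degrees grow only linearly in \<open>n\<close>.
\<close>

lemma powers_reduce:
  fixes x a :: "'p \<Rightarrow> complex"
  assumes "\<And>P. P \<in> U \<Longrightarrow> poly c (x P) * a P ^ Suc d = (\<Sum>i\<le>d. poly (p i) (x P) * a P ^ i)"
    and "Polynomial.degree c \<le> M" "\<And>i. i \<le> d \<Longrightarrow> Polynomial.degree (p i) \<le> M"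
  shows "\<exists>r. (\<forall>k\<le>d. Polynomial.degree (r k) \<le> M * n) \<and>
    (\<forall>P\<in>U. poly c (x P) ^ n * a P ^ n = (\<Sum>k\<le>d. poly (r k) (x P) * a P ^ k))"
proof (induction n)
  case 0
  have "(\<Sum>k\<le>d. poly (if k = 0 then 1 else 0) (x P) * a P ^ k) = 1" for P
    by (subst sum.atMost_shift) simp
  then show ?case by (intro exI[of _ "\<lambda>k. if k = 0 then 1 else 0"]) auto
next
  case (Suc n)
  then obtain r where r: "\<And>k. k \<le> d \<Longrightarrow> Polynomial.degree (r k) \<le> M * n"
    "\<And>P. P \<in> U \<Longrightarrow> poly c (x P) ^ n * a P ^ n = (\<Sum>k\<le>d. poly (r k) (x P) * a P ^ k)" by blast
  define r' where "r' k = (case k of 0 \<Rightarrow> 0 | Suc j \<Rightarrow> c * r j) + r d * p k" for k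
  have "Polynomial.degree (r' k) \<le> M * Suc n" if "k \<le> d" for k
  proof -
    have "Polynomial.degree (r d * p k) \<le> M * Suc n"
      using degree_mult_le[of "r d" "p k"] r(1)[of d] assms(3)[OF that] by simp
    moreover have "Polynomial.degree (case k of 0 \<Rightarrow> 0 | Suc j \<Rightarrow> c * r j) \<le> M * Suc n"
    proof (cases k)
      case (Suc j)
      then show ?thesis using degree_mult_le[of c "r j"] r(1)[of j] assms(2) that by simp
    qed simp
    ultimately show ?thesis unfolding r'_def by (rule degree_add_le[rotated])
  qed
  moreover have "poly c (x P) ^ Suc n * a P ^ Suc n = (\<Sum>k\<le>d. poly (r' k) (x P) * a P ^ k)" if P: "P \<in> U" for P
  proof -
    have "poly c (x P) ^ Suc n * a P ^ Suc n = poly c (x P) * a P * (\<Sum>k\<le>d. poly (r k) (x P) * a P ^ k)"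
      using r(2)[OF P] by (simp add: mult_ac)
    also have "\<dots> = (\<Sum>k\<le>d. poly (c * r k) (x P) * a P ^ Suc k)"
      unfolding sum_distrib_left by (intro sum.cong) (auto simp: mult_ac)
    also have "\<dots> = (\<Sum>k<d. poly (c * r k) (x P) * a P ^ Suc k) + poly (r d) (x P) * (poly c (x P) * a P ^ Suc d)"
      by (simp add: lessThan_Suc_atMost[symmetric] mult_ac)
    also have "(\<Sum>k<d. poly (c * r k) (x P) * a P ^ Suc k)
        = (\<Sum>k\<le>d. poly (case k of 0 \<Rightarrow> 0 | Suc j \<Rightarrow> c * r j) (x P) * a P ^ k)"
      by (subst sum.atMost_shift) simp
    also have "poly (r d) (x P) * (poly c (x P) * a P ^ Suc d) = (\<Sum>k\<le>d. poly (r d * p k) (x P) * a P ^ k)"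
      unfolding assms(1)[OF P] sum_distrib_left by (intro sum.cong) (auto simp: mult_ac)
    finally show ?thesis by (simp add: r'_def distrib_right sum.distrib)
  qed
  ultimately show ?case by blast
qed

text \<open>
  Two functions algebraic over \<open>\<complex>(x)\<close> are algebraically dependent. The \<open>(N + 1)\<^sup>2\<close> monomials \<open>a ^ i * b ^ j\<close>,
  multiplied by a common denominator, are combinations of \<open>x ^ l * a ^ k * b ^ k'\<close> with \<open>k \<le> d\<close>, \<open>k' \<le> e\<close>
  and \<open>l \<le> 2 M N\<close>. The number of the latter is linear in \<open>N\<close>.
\<close>

lemma dependence_by_counting:
  fixes x a b :: "'p \<Rightarrow> complex"
  assumes a: "\<And>P. P \<in> U \<Longrightarrow> poly c (x P) * a P ^ Suc d = (\<Sum>i\<le>d. poly (p i) (x P) * a P ^ i)"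
    and b: "\<And>P. P \<in> U \<Longrightarrow> poly c' (x P) * b P ^ Suc e = (\<Sum>i\<le>e. poly (p' i) (x P) * b P ^ i)"
    and nz: "\<And>P. P \<in> U \<Longrightarrow> poly c (x P) \<noteq> 0" "\<And>P. P \<in> U \<Longrightarrow> poly c' (x P) \<noteq> 0"
  shows "\<exists>q. q \<noteq> 0 \<and> (\<forall>P\<in>U. peval (\<lambda>r. poly r (a P)) q (b P) = 0)"
proof -
  interpret cfun: vector_space "\<lambda>(c::complex) (f :: 'p \<Rightarrow> complex). (\<lambda>P. c * f P)"
    by unfold_locales (auto simp: fun_eq_iff algebra_simps)
  define M where "M = Polynomial.degree c + Polynomial.degree c' +
    (\<Sum>i\<le>d. Polynomial.degree (p i)) + (\<Sum>i\<le>e. Polynomial.degree (p' i))"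
  have M: "Polynomial.degree c \<le> M" "Polynomial.degree c' \<le> M" by (simp_all add: M_def)
  have Mp: "Polynomial.degree (p i) \<le> M" if "i \<le> d" for i
    using member_le_sum[of i "{..d}" "\<lambda>i. Polynomial.degree (p i)"] that unfolding M_def by simp
  have Mp': "Polynomial.degree (p' i) \<le> M" if "i \<le> e" for i
    using member_le_sum[of i "{..e}" "\<lambda>i. Polynomial.degree (p' i)"] that unfolding M_def by simp
  have "\<forall>n. \<exists>r. (\<forall>k\<le>d. Polynomial.degree (r k) \<le> M * n) \<and>
      (\<forall>P\<in>U. poly c (x P) ^ n * a P ^ n = (\<Sum>k\<le>d. poly (r k) (x P) * a P ^ k))"
    by (rule allI, rule powers_reduce[OF a M(1) Mp])
  from choice[OF this] obtain r where r_all: "\<forall>n. (\<forall>k\<le>d. Polynomial.degree (r n k) \<le> M * n) \<and>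
      (\<forall>P\<in>U. poly c (x P) ^ n * a P ^ n = (\<Sum>k\<le>d. poly (r n k) (x P) * a P ^ k))" by (elim exE)
  have r: "k \<le> d \<Longrightarrow> Polynomial.degree (r n k) \<le> M * n"
    "P \<in> U \<Longrightarrow> poly c (x P) ^ n * a P ^ n = (\<Sum>k\<le>d. poly (r n k) (x P) * a P ^ k)" for n k P
    using spec[OF r_all, of n] by blast+
  have "\<forall>n. \<exists>r. (\<forall>k\<le>e. Polynomial.degree (r k) \<le> M * n) \<and>
      (\<forall>P\<in>U. poly c' (x P) ^ n * b P ^ n = (\<Sum>k\<le>e. poly (r k) (x P) * b P ^ k))"
    by (rule allI, rule powers_reduce[OF b M(2) Mp'])
  from choice[OF this] obtain r' where r_all: "\<forall>n. (\<forall>k\<le>e. Polynomial.degree (r' n k) \<le> M * n) \<and>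
      (\<forall>P\<in>U. poly c' (x P) ^ n * b P ^ n = (\<Sum>k\<le>e. poly (r' n k) (x P) * b P ^ k))" by (elim exE)
  have r': "k \<le> e \<Longrightarrow> Polynomial.degree (r' n k) \<le> M * n"
    "P \<in> U \<Longrightarrow> poly c' (x P) ^ n * b P ^ n = (\<Sum>k\<le>e. poly (r' n k) (x P) * b P ^ k)" for n k P
    using spec[OF r_all, of n] by blast+
  define D where "D = Suc d * Suc e"
  \<comment> \<open>large enough for \<open>(2 M N + 1) D < (N + 1)\<^sup>2\<close>\<close>
  define N where "N = 2 * M * D + D"
  define g where "g = (\<lambda>(l::nat, k::nat, k'::nat). (\<lambda>P. if P \<in> U then x P ^ l * a P ^ k * b P ^ k' else 0))"
  define G where "G = g ` ({..2 * M * N} \<times> {..d} \<times> {..e})"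
  define f where "f = (\<lambda>(i, j). (\<lambda>P. if P \<in> U then poly c (x P) ^ N * poly c' (x P) ^ N * a P ^ i * b P ^ j else 0))"
  have finG: "finite G" by (simp add: G_def)
  have "card G \<le> card ({..2 * M * N} \<times> {..d} \<times> {..e})" unfolding G_def by (rule card_image_le) simp
  also have "\<dots> = (2 * M * N + 1) * D" by (simp add: D_def card_cartesian_product)
  also have "\<dots> = 2 * M * D * N + D" by (simp add: algebra_simps)
  also have "\<dots> \<le> N * N + D"
    using mult_right_mono[of "2 * M * D" N N] by (simp add: N_def)
  also have "\<dots> < Suc N * Suc N" by (simp add: N_def)
  finally have card: "card G < card ({..N} \<times> {..N})" by (simp add: card_cartesian_product)
  have "f (i, j) \<in> cfun.span G" if ij: "i \<le> N" "j \<le> N" for i j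
  proof -
    define R where "R k k' = c ^ (N - i) * c' ^ (N - j) * r i k * r' j k'" for k k'
    have degR: "Polynomial.degree (R k k') \<le> 2 * M * N" if "k \<le> d" "k' \<le> e" for k k'
    proof -
      have pw: "Polynomial.degree (s ^ n) \<le> M * n" if "Polynomial.degree s \<le> M" for s :: "complex poly" and n
        by (rule order_trans[OF degree_power_le mult_right_mono[OF that]]) simp
      have "Polynomial.degree (R k k') \<le> Polynomial.degree (c ^ (N - i) * c' ^ (N - j) * r i k) + Polynomial.degree (r' j k')"
        unfolding R_def by (rule degree_mult_le)
      also have "\<dots> \<le> Polynomial.degree (c ^ (N - i)) + Polynomial.degree (c' ^ (N - j)) + Polynomial.degree (r i k) + Polynomial.degree (r' j k')"
        using degree_mult_le[of "c ^ (N - i) * c' ^ (N - j)" "r i k"] degree_mult_le[of "c ^ (N - i)" "c' ^ (N - j)"]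
        by linarith
      also have "\<dots> \<le> M * (N - i) + M * (N - j) + M * i + M * j"
        by (rule add_mono[OF add_mono[OF add_mono[OF pw[OF M(1)] pw[OF M(2)]] r(1)[OF that(1)]] r'(1)[OF that(2)]])
      also have "\<dots> = M * ((N - i) + i) + M * ((N - j) + j)" by (simp add: add_mult_distrib2)
      also have "\<dots> = 2 * M * N" using ij by simp
      finally show ?thesis .
    qed
    have "f (i, j) = (\<lambda>P. \<Sum>k\<le>d. \<Sum>k'\<le>e. \<Sum>l\<le>2 * M * N. poly.coeff (R k k') l * g (l, k, k') P)"
    proof
      fix P
      show "f (i, j) P = (\<Sum>k\<le>d. \<Sum>k'\<le>e. \<Sum>l\<le>2 * M * N. poly.coeff (R k k') l * g (l, k, k') P)"
      proof (cases "P \<in> U")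
        case True
        have "poly c (x P) ^ N = poly c (x P) ^ (N - i) * poly c (x P) ^ i"
          "poly c' (x P) ^ N = poly c' (x P) ^ (N - j) * poly c' (x P) ^ j"
          using ij by (simp_all flip: power_add)
        then have "f (i, j) P = poly c (x P) ^ (N - i) * poly c' (x P) ^ (N - j)
            * (poly c (x P) ^ i * a P ^ i) * (poly c' (x P) ^ j * b P ^ j)"
          using True by (simp add: f_def mult_ac)
        also have "\<dots> = (\<Sum>k\<le>d. \<Sum>k'\<le>e. poly (R k k') (x P) * a P ^ k * b P ^ k')"
          unfolding r(2)[OF True] r'(2)[OF True]
          by (simp add: R_def sum_distrib_left sum_distrib_right mult_ac)
        also have "\<dots> = (\<Sum>k\<le>d. \<Sum>k'\<le>e. \<Sum>l\<le>2 * M * N. poly.coeff (R k k') l * g (l, k, k') P)"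
        proof (intro sum.cong refl)
          fix k k' assume "k \<in> {..d}" "k' \<in> {..e}"
          then have "poly (R k k') (x P) = (\<Sum>l\<le>2 * M * N. poly.coeff (R k k') l * x P ^ l)"
            using degR[of k k'] by (intro poly_eq_sum_le) auto
          then show "poly (R k k') (x P) * a P ^ k * b P ^ k' = (\<Sum>l\<le>2 * M * N. poly.coeff (R k k') l * g (l, k, k') P)"
            using True by (simp add: g_def sum_distrib_right sum_distrib_left mult_ac)
        qed
        finally show ?thesis .
      qed (simp add: f_def g_def)
    qed
    also have "\<dots> = (\<Sum>k\<le>d. \<Sum>k'\<le>e. \<Sum>l\<le>2 * M * N. (\<lambda>P. poly.coeff (R k k') l * g (l, k, k') P))"
    proof -
      have s: "(\<lambda>P. \<Sum>i\<in>A. h i P) = (\<Sum>i\<in>A. h i)" for A :: "nat set" and h :: "nat \<Rightarrow> 'p \<Rightarrow> complex"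
        by (induction A rule: infinite_finite_induct) (auto simp: fun_eq_iff)
      show ?thesis by (simp only: s)
    qed
    also have "\<dots> \<in> cfun.span G"
      by (intro cfun.span_sum cfun.span_scale cfun.span_base) (auto simp: G_def)
    finally show ?thesis .
  qed
  then have "f ` ({..N} \<times> {..N}) \<subseteq> cfun.span G" by auto
  then obtain \<alpha> where \<alpha>: "\<exists>i\<in>{..N} \<times> {..N}. \<alpha> i \<noteq> 0" "(\<Sum>i\<in>{..N} \<times> {..N}. (\<lambda>P. \<alpha> i * f i P)) = 0"
    using cfun.family_dependent[OF _ finG _ card, of f] by auto
  define q where "q = (\<Sum>j\<le>N. Polynomial.monom (\<Sum>i\<le>N. Polynomial.monom (\<alpha> (i, j)) i) j)"
  have "q \<noteq> 0"
  proof
    assume "q = 0"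
    have "\<alpha> (i, j) = poly.coeff (poly.coeff q j) i" if "i \<le> N" "j \<le> N" for i j
      using that by (simp add: q_def coeff_sum)
    then show False using \<alpha>(1) \<open>q = 0\<close> by auto
  qed
  moreover have "peval (\<lambda>r. poly r (a P)) q (b P) = 0" if P: "P \<in> U" for P
  proof -
    interpret h: comm_ring_map "\<lambda>r. poly r (a P)" by unfold_locales auto
    have s: "(\<Sum>i\<in>A. h i) P = (\<Sum>i\<in>A. h i P)" for A :: "(nat \<times> nat) set" and h :: "nat \<times> nat \<Rightarrow> 'p \<Rightarrow> complex"
      by (induction A rule: infinite_finite_induct) auto
    have "0 = (\<Sum>i\<in>{..N} \<times> {..N}. \<alpha> i * f i P)"
      using fun_cong[OF \<alpha>(2), of P] by (simp add: s)
    also have "\<dots> = (\<Sum>i\<le>N. \<Sum>j\<le>N. \<alpha> (i, j) * f (i, j) P)" by (simp add: sum.cartesian_product)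
    also have "\<dots> = poly c (x P) ^ N * poly c' (x P) ^ N * (\<Sum>i\<le>N. \<Sum>j\<le>N. \<alpha> (i, j) * a P ^ i * b P ^ j)"
      using P by (simp add: f_def sum_distrib_left mult_ac)
    finally have "(\<Sum>i\<le>N. \<Sum>j\<le>N. \<alpha> (i, j) * a P ^ i * b P ^ j) = 0" using nz[OF P] by simp
    moreover have "peval (\<lambda>r. poly r (a P)) q (b P) = (\<Sum>j\<le>N. \<Sum>i\<le>N. \<alpha> (i, j) * a P ^ i * b P ^ j)"
      by (simp add: q_def h.peval_sum h.peval_monom poly_sum poly_monom sum_distrib_right)
    ultimately show ?thesis by (subst (asm) sum.swap) simp
  qed
  ultimately show ?thesis by blast
qed

context projective_variety
begin

lemma generate_field_fraction:
  assumes x: "x \<in> Rat" and h: "h \<in> generate_field FF (range (const C) \<union> {cls x})"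
  shows "\<exists>p q. eventually (\<lambda>P. poly q (x P) \<noteq> 0) gen \<and> h = cls (\<lambda>P. poly p (x P) / poly q (x P))"
  using h
proof (induction rule: generate_field.induct)
  case one
  show ?case by (intro exI[of _ 1]) (simp add: one_FF)
next
  case (incl h)
  then consider c where "h = const C c" | "h = cls x" by auto
  then show ?case
  proof cases
    case 1
    then show ?thesis by (intro exI[of _ "[:c:]"] exI[of _ 1]) (simp add: const_FF)
  next
    case 2
    then show ?thesis by (intro exI[of _ "[:0, 1:]"] exI[of _ 1]) simp
  qed
next
  case (a_inv h)
  then obtain p q where pq: "eventually (\<lambda>P. poly q (x P) \<noteq> 0) gen" "h = cls (\<lambda>P. poly p (x P) / poly q (x P))" by blast
  then show ?case
    by (intro exI[of _ "- p"] exI[of _ q]) (simp add: uminus_FF Rat_divide Rat_poly x)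
next
  case (m_inv h)
  then obtain p q where pq: "eventually (\<lambda>P. poly q (x P) \<noteq> 0) gen" "h = cls (\<lambda>P. poly p (x P) / poly q (x P))" by blast
  have R: "(\<lambda>P. poly p (x P) / poly q (x P)) \<in> Rat" by (intro Rat_divide Rat_poly x)
  have nz: "\<not> (\<lambda>P. poly p (x P) / poly q (x P)) \<asymp> (\<lambda>_. 0)"
    using m_inv(2) cls_eq_zero_iff[OF R] pq(2) by simp
  have "eventually (\<lambda>P. poly p (x P) \<noteq> 0) gen"
    using Rat_nonzero[OF R nz] by eventually_elim auto
  moreover have "inv\<^bsub>FF\<^esub> h = cls (\<lambda>P. poly q (x P) / poly p (x P))"
    using inv_FF[OF R nz] pq(2) by simp
  ultimately show ?case by blast
next
  case (eng_add h1 h2)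
  then obtain p q p' q' where pq: "eventually (\<lambda>P. poly q (x P) \<noteq> 0) gen" "h1 = cls (\<lambda>P. poly p (x P) / poly q (x P))"
    "eventually (\<lambda>P. poly q' (x P) \<noteq> 0) gen" "h2 = cls (\<lambda>P. poly p' (x P) / poly q' (x P))" by blast
  have "eventually (\<lambda>P. poly (q * q') (x P) \<noteq> 0) gen" using pq(1,3) by eventually_elim simp
  moreover have "h1 \<oplus>\<^bsub>FF\<^esub> h2 = cls (\<lambda>P. poly p (x P) / poly q (x P) + poly p' (x P) / poly q' (x P))"
    unfolding pq by (intro add_FF Rat_divide Rat_poly x)
  moreover have "cls (\<lambda>P. poly p (x P) / poly q (x P) + poly p' (x P) / poly q' (x P))
    = cls (\<lambda>P. poly (p * q' + p' * q) (x P) / poly (q * q') (x P))"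
  proof (rule cls_cong)
    show "(\<lambda>P. poly p (x P) / poly q (x P) + poly p' (x P) / poly q' (x P)) \<asymp>
      (\<lambda>P. poly (p * q' + p' * q) (x P) / poly (q * q') (x P))"
      using pq(1,3) by eventually_elim (simp add: add_frac_eq)
  qed (intro Rat_add Rat_divide Rat_poly x)
  ultimately have "eventually (\<lambda>P. poly (q * q') (x P) \<noteq> 0) gen"
    "h1 \<oplus>\<^bsub>FF\<^esub> h2 = cls (\<lambda>P. poly (p * q' + p' * q) (x P) / poly (q * q') (x P))" by simp_all
  then show ?case by (intro exI conjI)
next
  case (eng_mult h1 h2)
  then obtain p q p' q' where pq: "eventually (\<lambda>P. poly q (x P) \<noteq> 0) gen" "h1 = cls (\<lambda>P. poly p (x P) / poly q (x P))"
    "eventually (\<lambda>P. poly q' (x P) \<noteq> 0) gen" "h2 = cls (\<lambda>P. poly p' (x P) / poly q' (x P))" by blast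
  have "eventually (\<lambda>P. poly (q * q') (x P) \<noteq> 0) gen" using pq(1,3) by eventually_elim simp
  moreover have "h1 \<otimes>\<^bsub>FF\<^esub> h2 = cls (\<lambda>P. poly p (x P) / poly q (x P) * (poly p' (x P) / poly q' (x P)))"
    unfolding pq by (intro mult_FF Rat_divide Rat_poly x)
  ultimately show ?case by (intro exI[of _ "p * p'"] exI[of _ "q * q'"]) simp
qed

text \<open>
  Clearing denominators turns a polynomial equation over the field \<open>\<complex>(x)\<close> into one with coefficients in
  \<open>\<complex>[x]\<close>; the third conjunct says that the leading coefficient stays nonzero.
\<close>

lemma eval_fraction:
  assumes x: "x \<in> Rat" and y: "y \<in> Rat"
    and "set ps \<subseteq> generate_field FF (range (const C) \<union> {cls x})"
  shows "\<exists>Q R. eventually (\<lambda>P. poly Q (x P) \<noteq> 0) gen \<and>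
    FF.eval ps (cls y) = cls (\<lambda>P. (\<Sum>i<length ps. poly (R i) (x P) * y P ^ i) / poly Q (x P)) \<and>
    (ps \<noteq> [] \<longrightarrow> hd ps \<noteq> \<zero>\<^bsub>FF\<^esub> \<longrightarrow> eventually (\<lambda>P. poly (R (length ps - 1)) (x P) \<noteq> 0) gen)"
  using assms(3)
proof (induction ps)
  case Nil
  show ?case by (rule exI[of _ 1]) (simp add: zero_FF)
next
  case (Cons h ps)
  then obtain Q R where QR: "eventually (\<lambda>P. poly Q (x P) \<noteq> 0) gen"
    "FF.eval ps (cls y) = cls (\<lambda>P. (\<Sum>i<length ps. poly (R i) (x P) * y P ^ i) / poly Q (x P))" by auto
  obtain p q where pq: "eventually (\<lambda>P. poly q (x P) \<noteq> 0) gen" "h = cls (\<lambda>P. poly p (x P) / poly q (x P))"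
    using generate_field_fraction[OF x, of h] Cons.prems by auto
  define R' where "R' i = (if i = length ps then p * Q else q * R i)" for i
  have Rs: "(\<lambda>P. (\<Sum>i<length ps. poly (R i) (x P) * y P ^ i) / poly Q (x P)) \<in> Rat"
    by (intro Rat_divide Rat_sum Rat_mult Rat_poly Rat_power x y)
  have Rp: "(\<lambda>P. poly p (x P) / poly q (x P)) \<in> Rat" by (intro Rat_divide Rat_poly x)
  have "FF.eval (h # ps) (cls y) = h \<otimes>\<^bsub>FF\<^esub> cls y [^]\<^bsub>FF\<^esub> length ps \<oplus>\<^bsub>FF\<^esub> FF.eval ps (cls y)" by simp
  also have "\<dots> = cls (\<lambda>P. poly p (x P) / poly q (x P) * y P ^ length ps) \<oplus>\<^bsub>FF\<^esub>
      cls (\<lambda>P. (\<Sum>i<length ps. poly (R i) (x P) * y P ^ i) / poly Q (x P))"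
    unfolding pq(2) QR(2) pow_FF[OF y] by (simp only: mult_FF[OF Rp Rat_power[OF y]])
  also have "\<dots> = cls (\<lambda>P. poly p (x P) / poly q (x P) * y P ^ length ps
      + (\<Sum>i<length ps. poly (R i) (x P) * y P ^ i) / poly Q (x P))"
    by (rule add_FF[OF Rat_mult[OF Rp Rat_power[OF y]] Rs])
  also have "\<dots> = cls (\<lambda>P. (\<Sum>i<length (h # ps). poly (R' i) (x P) * y P ^ i) / poly (q * Q) (x P))"
  proof (rule cls_cong)
    show "(\<lambda>P. poly p (x P) / poly q (x P) * y P ^ length ps
      + (\<Sum>i<length ps. poly (R i) (x P) * y P ^ i) / poly Q (x P)) \<asymp>
      (\<lambda>P. (\<Sum>i<length (h # ps). poly (R' i) (x P) * y P ^ i) / poly (q * Q) (x P))"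
      using pq(1) QR(1)
    proof eventually_elim
      case (elim P)
      have "(\<Sum>i<length (h # ps). poly (R' i) (x P) * y P ^ i)
          = poly q (x P) * (\<Sum>i<length ps. poly (R i) (x P) * y P ^ i) + poly p (x P) * poly Q (x P) * y P ^ length ps"
        by (simp add: R'_def sum_distrib_left mult.assoc)
      then show ?case using fraction_sum[OF elim] by (simp only: poly_mult)
    qed
    show "(\<lambda>P. poly p (x P) / poly q (x P) * y P ^ length ps
      + (\<Sum>i<length ps. poly (R i) (x P) * y P ^ i) / poly Q (x P)) \<in> Rat"
      by (intro Rat_add Rat_mult Rs Rp Rat_power y)
  qed
  finally have 1: "FF.eval (h # ps) (cls y)
    = cls (\<lambda>P. (\<Sum>i<length (h # ps). poly (R' i) (x P) * y P ^ i) / poly (q * Q) (x P))" .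
  have 2: "eventually (\<lambda>P. poly (q * Q) (x P) \<noteq> 0) gen" using pq(1) QR(1) by eventually_elim simp
  have 3: "eventually (\<lambda>P. poly (R' (length (h # ps) - 1)) (x P) \<noteq> 0) gen" if "hd (h # ps) \<noteq> \<zero>\<^bsub>FF\<^esub>"
  proof -
    have "\<not> (\<lambda>P. poly p (x P) / poly q (x P)) \<asymp> (\<lambda>_. 0)"
      using that cls_eq_zero_iff[OF Rp] pq(2) by simp
    from Rat_nonzero[OF Rp this] QR(1) show ?thesis
      by eventually_elim (auto simp: R'_def)
  qed
  show ?case by (intro exI[of _ "q * Q"] exI[of _ R'] conjI impI 1 2 3)
qed

end

section \<open>Smooth curves\<close>

locale smooth_curve = projective_variety C for C :: "('n::finite) ppoint set" +
  assumes dim1: "dimension_one C" and smooth: "P \<in> C \<Longrightarrow> \<exists>t. uniformizer C P t"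
begin

text \<open>
  This is what dimension one says about functions: everything is algebraic over \<open>\<complex>(x)\<close> for a nonconstant
  \<open>x\<close>.
\<close>

lemma algebraic_over_generator:
  "\<exists>x\<in>Rat. (\<forall>c. \<not> x \<asymp> (\<lambda>_. c)) \<and> (\<forall>y\<in>Rat. \<exists>d R. eventually (\<lambda>P. poly (R d) (x P) \<noteq> 0) gen \<and>
     (\<lambda>P. \<Sum>i\<le>d. poly (R i) (x P) * y P ^ i) \<asymp> (\<lambda>_. 0))"
proof -
  from dim1 obtain a where a: "a \<in> carrier FF" "FF.transcendental (range (const C)) a"
    "\<And>b. b \<in> carrier FF \<Longrightarrow> \<not> FF.transcendental (generate_field FF (range (const C) \<union> {a})) b"
    unfolding dimension_one_def by (elim bexE conjE) blast
  obtain x where x: "x \<in> Rat" "a = cls x" using FF_cases[OF a(1)] .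
  have nc: "\<not> x \<asymp> (\<lambda>_. c)" for c
  proof
    assume c: "x \<asymp> (\<lambda>_. c)"
    have eqc: "cls x = const C c" unfolding const_FF by (rule cls_cong[OF c x(1)])
    define p where "p = [\<one>\<^bsub>FF\<^esub>, const C (- c)]"
    have one: "\<one>\<^bsub>FF\<^esub> = const C 1" by (simp add: one_FF const_FF)
    have "polynomial\<^bsub>FF\<^esub> (range (const C)) p"
      unfolding polynomial_def p_def using FF.one_not_zero one by auto
    then have pc: "p \<in> carrier ((range (const C)) [X]\<^bsub>FF\<^esub>)" by (simp only: univ_poly_carrier)
    have nilc: "[] \<in> carrier ((range (const C)) [X]\<^bsub>FF\<^esub>)"
      unfolding univ_poly_carrier[symmetric] polynomial_def by simp
    have cc: "const C k \<in> carrier FF" for k unfolding const_FF by (rule cls_in_carrier[OF Rat_const])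
    have "const C c \<oplus>\<^bsub>FF\<^esub> const C (- c) = \<zero>\<^bsub>FF\<^esub>"
      unfolding const_FF by (subst add_FF[OF Rat_const Rat_const]) (simp add: zero_FF)
    then have "FF.eval p a = FF.eval [] a"
      unfolding p_def x(2) eqc by (simp add: cc)
    then have "p = []" using inj_onD[OF a(2)[unfolded FF.transcendental_def] _ pc nilc] by simp
    then show False by (simp add: p_def)
  qed
  have alg: "\<exists>d R. eventually (\<lambda>P. poly (R d) (x P) \<noteq> 0) gen \<and>
     (\<lambda>P. \<Sum>i\<le>d. poly (R i) (x P) * y P ^ i) \<asymp> (\<lambda>_. 0)" if y: "y \<in> Rat" for y
  proof -
    define G where "G = generate_field FF (range (const C) \<union> {cls x})"
    have sub: "range (const C) \<union> {cls x} \<subseteq> carrier FF"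
      using cls_in_carrier[OF x(1)] cls_in_carrier[OF Rat_const] by (auto simp: const_FF)
    have sr: "subring G FF" unfolding G_def by (rule subfieldE(1)[OF FF.generate_field_is_subfield[OF sub]])
    have "\<not> FF.transcendental G (cls y)" using a(3)[OF cls_in_carrier[OF y]] unfolding x(2) G_def .
    then obtain p where p: "p \<in> carrier (G [X]\<^bsub>FF\<^esub>)" "p \<noteq> []" "FF.eval p (cls y) = \<zero>\<^bsub>FF\<^esub>"
      using FF.algebraicE[OF sr cls_in_carrier[OF y]] unfolding over_def by metis
    then have pp: "set p \<subseteq> G" "hd p \<noteq> \<zero>\<^bsub>FF\<^esub>"
      unfolding univ_poly_carrier[symmetric] polynomial_def by auto
    from eval_fraction[OF x(1) y pp(1)[unfolded G_def]] obtain Q R where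
      QR: "eventually (\<lambda>P. poly Q (x P) \<noteq> 0) gen"
      "FF.eval p (cls y) = cls (\<lambda>P. (\<Sum>i<length p. poly (R i) (x P) * y P ^ i) / poly Q (x P))"
      "p \<noteq> [] \<longrightarrow> hd p \<noteq> \<zero>\<^bsub>FF\<^esub> \<longrightarrow> eventually (\<lambda>P. poly (R (length p - 1)) (x P) \<noteq> 0) gen"
      by (elim exE conjE)
    have Rt: "(\<lambda>P. (\<Sum>i<length p. poly (R i) (x P) * y P ^ i) / poly Q (x P)) \<in> Rat"
      by (intro Rat_divide Rat_sum Rat_mult Rat_poly Rat_power x y)
    have "(\<lambda>P. (\<Sum>i<length p. poly (R i) (x P) * y P ^ i) / poly Q (x P)) \<asymp> (\<lambda>_. 0)"
      using p(3) unfolding QR(2) by (simp only: cls_eq_zero_iff[OF Rt])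
    then have "(\<lambda>P. \<Sum>i<length p. poly (R i) (x P) * y P ^ i) \<asymp> (\<lambda>_. 0)"
      using QR(1) by eventually_elim simp
    moreover have "{..<length p} = {..length p - 1}" using p(2) by (cases p) auto
    ultimately have "(\<lambda>P. \<Sum>i\<le>length p - 1. poly (R i) (x P) * y P ^ i) \<asymp> (\<lambda>_. 0)" by simp
    moreover have "eventually (\<lambda>P. poly (R (length p - 1)) (x P) \<noteq> 0) gen" using QR(3) p(2) pp(2) by simp
    ultimately show ?thesis by (intro exI[of _ "length p - 1"] exI[of _ R] conjI)
  qed
  show ?thesis by (rule bexI[OF _ x(1)]) (intro conjI allI ballI nc alg)
qed

lemma two_variable_relation:
  assumes a: "a \<in> Rat" and b: "b \<in> Rat"
  shows "\<exists>q. q \<noteq> 0 \<and> (\<lambda>P. peval (\<lambda>r. poly r (a P)) q (b P)) \<asymp> (\<lambda>_. 0)"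
proof -
  from algebraic_over_generator obtain x where x: "x \<in> Rat" and
    alg: "\<forall>y\<in>Rat. \<exists>d R. eventually (\<lambda>P. poly (R d) (x P) \<noteq> 0) gen \<and>
     (\<lambda>P. \<Sum>i\<le>d. poly (R i) (x P) * y P ^ i) \<asymp> (\<lambda>_. 0)" by (elim bexE conjE)
  have norm: "\<exists>d c p. eventually (\<lambda>P. poly c (x P) \<noteq> 0) gen \<and>
      eventually (\<lambda>P. poly c (x P) * y P ^ Suc d = (\<Sum>i\<le>d. poly (p i) (x P) * y P ^ i)) gen"
    if y: "y \<in> Rat" for y
  proof -
    from bspec[OF alg y] obtain d R where R: "eventually (\<lambda>P. poly (R d) (x P) \<noteq> 0) gen"
      "(\<lambda>P. \<Sum>i\<le>d. poly (R i) (x P) * y P ^ i) \<asymp> (\<lambda>_. 0)" by (elim exE conjE)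
    show ?thesis
    proof (cases d)
      case 0
      have "eventually (\<lambda>P. False) gen" using R unfolding 0 by eventually_elim simp
      then show ?thesis by simp
    next
      case (Suc e)
      have "eventually (\<lambda>P. poly (R d) (x P) * y P ^ Suc e = (\<Sum>i\<le>e. poly (- R i) (x P) * y P ^ i)) gen"
        using R(2) unfolding Suc
      proof eventually_elim
        case (elim P)
        then show ?case by (simp add: sum_negf add_eq_0_iff2 add_eq_0_iff)
      qed
      then show ?thesis using R(1) by (intro exI[of _ e] exI[of _ "R d"] exI[of _ "\<lambda>i. - R i"] conjI)
    qed
  qed
  from norm[OF a] obtain d c p where A: "eventually (\<lambda>P. poly c (x P) \<noteq> 0) gen"
    "eventually (\<lambda>P. poly c (x P) * a P ^ Suc d = (\<Sum>i\<le>d. poly (p i) (x P) * a P ^ i)) gen" by (elim exE conjE)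
  from norm[OF b] obtain e c' p' where B: "eventually (\<lambda>P. poly c' (x P) \<noteq> 0) gen"
    "eventually (\<lambda>P. poly c' (x P) * b P ^ Suc e = (\<Sum>i\<le>e. poly (p' i) (x P) * b P ^ i)) gen" by (elim exE conjE)
  define U where "U = {P. poly c (x P) \<noteq> 0 \<and> poly c (x P) * a P ^ Suc d = (\<Sum>i\<le>d. poly (p i) (x P) * a P ^ i) \<and>
    poly c' (x P) \<noteq> 0 \<and> poly c' (x P) * b P ^ Suc e = (\<Sum>i\<le>e. poly (p' i) (x P) * b P ^ i)}"
  have U: "eventually (\<lambda>P. P \<in> U) gen" using A B unfolding U_def by eventually_elim blast
  have "\<exists>q. q \<noteq> 0 \<and> (\<forall>P\<in>U. peval (\<lambda>r. poly r (a P)) q (b P) = 0)"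
    by (rule dependence_by_counting[where x = x and c = c and d = d and p = p and c' = c' and e = e and p' = p'])
      (simp_all add: U_def)
  then obtain q where q: "q \<noteq> 0" "\<forall>P\<in>U. peval (\<lambda>r. poly r (a P)) q (b P) = 0" by (elim exE conjE)
  have "(\<lambda>P. peval (\<lambda>r. poly r (a P)) q (b P)) \<asymp> (\<lambda>_. 0)"
    using U by eventually_elim (use q(2) in blast)
  then show ?thesis using q(1) by (intro exI[of _ q] conjI)
qed

end

subsection \<open>Germs\<close>

context projective_variety
begin

definition germ :: "'n ppoint \<Rightarrow> ('n ppoint \<Rightarrow> complex) \<Rightarrow> bool" where
  "germ P f \<longleftrightarrow> (\<exists>U. P \<in> U \<and> regular_on C U f)"

lemma germI: "P \<in> U \<Longrightarrow> regular_on C U f \<Longrightarrow> germ P f"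
  unfolding germ_def by (intro exI conjI)

lemma germ_Rat: "germ P f \<Longrightarrow> f \<in> Rat"
  unfolding germ_def by (elim exE conjE) (rule RatI)

lemma germ_two:
  assumes "germ P f" "germ P g"
  obtains U where "P \<in> U" "regular_on C U f" "regular_on C U g"
proof -
  from assms(1) obtain U where U: "P \<in> U" "regular_on C U f" unfolding germ_def by (elim exE conjE)
  from assms(2) obtain V where V: "P \<in> V" "regular_on C V g" unfolding germ_def by (elim exE conjE)
  note o = zopen_Int[OF regular_on_zopen[OF U(2)] regular_on_zopen[OF V(2)]]
  show thesis
    by (rule that[of "U \<inter> V"]) (use U V in \<open>auto intro: regular_on_subset[OF _ o]\<close>)
qed

lemma germ_const: "P \<in> C \<Longrightarrow> germ P (\<lambda>_. c)"
  by (rule germI[OF _ regular_on_const[OF zopen_C]])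

lemma germ_add: "germ P f \<Longrightarrow> germ P g \<Longrightarrow> germ P (\<lambda>Q. f Q + g Q)"
  by (erule (1) germ_two) (rule germI, assumption, rule regular_on_add)

lemma germ_mult: "germ P f \<Longrightarrow> germ P g \<Longrightarrow> germ P (\<lambda>Q. f Q * g Q)"
  by (erule (1) germ_two) (rule germI, assumption, rule regular_on_mult)

lemma germ_diff: "germ P f \<Longrightarrow> germ P g \<Longrightarrow> germ P (\<lambda>Q. f Q - g Q)"
  by (erule (1) germ_two) (rule germI, assumption, rule regular_on_diff)

lemma germ_in_C: "germ P f \<Longrightarrow> P \<in> C"
  unfolding germ_def using regular_on_zopen zopen_sub by blast

lemma germ_inverse:
  assumes "germ P f" "f P \<noteq> 0" shows "germ P (\<lambda>Q. inverse (f Q))"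
proof -
  from assms(1) obtain U where U: "P \<in> U" "regular_on C U f" unfolding germ_def by (elim exE conjE)
  show ?thesis
  proof (rule germI)
    show "P \<in> {Q \<in> U. f Q \<noteq> 0}" using U assms(2) by simp
    show "regular_on C {Q \<in> U. f Q \<noteq> 0} (\<lambda>Q. inverse (f Q))"
      by (rule regular_on_inverse[OF regular_on_subset[OF U(2) zopen_regular_nonzero[OF U(2)]]]) auto
  qed
qed

lemma germ_eqD:
  assumes "germ P f" "germ P g" "f \<asymp> g" shows "f P = g P"
  using germ_two[OF assms(1,2)] regular_on_eqI[OF _ _ assms(3)] by metis

lemma germ_nonzero:
  assumes "germ P f" "f P \<noteq> 0" shows "eventually (\<lambda>Q. f Q \<noteq> 0) gen"
proof (rule Rat_nonzero[OF germ_Rat[OF assms(1)]])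
  show "\<not> f \<asymp> (\<lambda>_. 0)"
    using germ_eqD[OF assms(1) germ_const[OF germ_in_C[OF assms(1)]], of 0] assms(2) by auto
qed

lemma local_ring_iff: "a \<in> local_ring C P \<longleftrightarrow> (\<exists>f. germ P f \<and> a = cls f)"
proof
  assume "a \<in> local_ring C P"
  then obtain U f where U: "a = rat C U f" "P \<in> U" "regular_on C U f" unfolding local_ring_def by auto
  have "U \<noteq> {}" using U(2) by auto
  then have "a = cls f" using rat_eq_cls[OF U(3)] U(1) by simp
  then show "\<exists>f. germ P f \<and> a = cls f" using germI[OF U(2,3)] by (intro exI conjI)
next
  assume "\<exists>f. germ P f \<and> a = cls f"
  then obtain U f where U: "P \<in> U" "regular_on C U f" "a = cls f" unfolding germ_def by (elim exE conjE)
  have "U \<noteq> {}" using U(1) by auto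
  then have "a = rat C U f" using rat_eq_cls[OF U(2)] U(3) by simp
  then show "a \<in> local_ring C P" unfolding local_ring_def using U(1,2) by (intro CollectI exI[of _ U] exI[of _ f] conjI)
qed

lemma maximal_ideal_iff: "a \<in> maximal_ideal_at C P \<longleftrightarrow> (\<exists>f. germ P f \<and> f P = 0 \<and> a = cls f)"
proof
  assume "a \<in> maximal_ideal_at C P"
  then obtain U f where U: "a = rat C U f" "P \<in> U" "regular_on C U f" "f P = 0" unfolding maximal_ideal_at_def by auto
  have "U \<noteq> {}" using U(2) by auto
  then have "a = cls f" using rat_eq_cls[OF U(3)] U(1) by simp
  then show "\<exists>f. germ P f \<and> f P = 0 \<and> a = cls f" using germI[OF U(2,3)] U(4) by (intro exI conjI)
next
  assume "\<exists>f. germ P f \<and> f P = 0 \<and> a = cls f"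
  then obtain U f where U: "P \<in> U" "regular_on C U f" "a = cls f" "f P = 0" unfolding germ_def by (elim exE conjE)
  have "U \<noteq> {}" using U(1) by auto
  then have "a = rat C U f" using rat_eq_cls[OF U(2)] U(3) by simp
  then show "a \<in> maximal_ideal_at C P" unfolding maximal_ideal_at_def
    using U(1,2,4) by (intro CollectI exI[of _ U] exI[of _ f] conjI)
qed

definition representative :: "'n ppoint \<Rightarrow> complex ^ 'n" where "representative P = (SOME v. v \<in> P)"

text \<open>
  For forms of the same degree, the value is independent of the chosen coordinate vector.
\<close>

definition form_quotient :: "(complex ^ 'n \<Rightarrow> complex) \<Rightarrow> (complex ^ 'n \<Rightarrow> complex) \<Rightarrow> 'n ppoint \<Rightarrow> complex" where
  "form_quotient F G = (\<lambda>P. F (representative P) / G (representative P))"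

lemma form_quotient_eq:
  assumes "F \<in> forms d" "G \<in> forms d" "P \<in> C" "v \<in> P"
  shows "form_quotient F G P = F v / G v"
proof -
  have "representative P \<in> P" unfolding representative_def using assms(4) by (rule someI)
  then obtain c where c: "c \<noteq> 0" "representative P = c *s v" using point_scaled[OF C_proj[OF assms(3)] assms(4)] by metis
  have "F (representative P) = c ^ d * F v" "G (representative P) = c ^ d * G v"
    unfolding c(2) by (rule form_homogeneous[OF assms(1)], rule form_homogeneous[OF assms(2)])
  then show ?thesis using c(1) by (simp add: form_quotient_def)
qed

lemma form_quotient_fraction:
  assumes "F \<in> forms d" "G \<in> forms d"
  shows "fraction_on {P \<in> C. \<forall>v\<in>P. G v \<noteq> 0} d F G (form_quotient F G)"
  by (rule fraction_onI[OF assms zopen_nonvanishing[OF assms(2)]]) (auto intro: form_quotient_eq[OF assms])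

lemma form_quotient_germ:
  assumes "F \<in> forms d" "G \<in> forms d" "P \<in> C" "v \<in> P" "G v \<noteq> 0"
  shows "germ P (form_quotient F G)"
proof (rule germI[OF _ regular_on_fraction[OF form_quotient_fraction[OF assms(1,2)]]])
  show "P \<in> {P \<in> C. \<forall>v\<in>P. G v \<noteq> 0}"
    using form_nonzero_iff(1)[OF assms(2) C_proj[OF assms(3)] assms(4)] assms(3,5) by simp
qed

text \<open>
  Near some point \<open>f\<close> is a quotient \<open>F / G\<close> of forms of the same degree. If \<open>H\<close> is a power of a coordinate that
  does not vanish at \<open>P\<close>, then \<open>F / H\<close> and \<open>G / H\<close> are regular at \<open>P\<close>.
\<close>

lemma Rat_germ_quotient:
  assumes f: "f \<in> Rat" and P: "P \<in> C"
  shows "\<exists>a b. germ P a \<and> germ P b \<and> \<not> b \<asymp> (\<lambda>_. 0) \<and> (\<lambda>Q. f Q * b Q) \<asymp> a"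
proof -
  obtain U where U: "U \<noteq> {}" "regular_on C U f" using RatE[OF f] .
  then obtain Q0 where "Q0 \<in> U" by auto
  obtain W d F G where W: "Q0 \<in> W" "W \<subseteq> U" "fraction_on W d F G f" using regular_onE[OF U(2) \<open>Q0 \<in> U\<close>] .
  note D = fraction_onD[OF W(3)]
  obtain v where v: "v \<in> P" using ex_in_point[OF C_proj[OF P]] by auto
  obtain j where j: "vec_nth v j \<noteq> 0" using proj_spaceD(1)[OF C_proj[OF P] v] by (auto simp: vec_eq_iff)
  define H where "H = (\<lambda>v :: complex ^ 'n. vec_nth v j ^ d)"
  have H: "H \<in> forms d" unfolding H_def using form_power[OF coordinate_form[of j], where n = d] by simp
  have Hv: "H v \<noteq> 0" using j by (simp add: H_def)
  have o: "zopen C {P \<in> C. \<forall>v\<in>P. H v \<noteq> 0}" by (rule zopen_nonvanishing[OF H])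
  have Pin: "P \<in> {P \<in> C. \<forall>v\<in>P. H v \<noteq> 0}"
    using form_nonzero_iff(1)[OF H C_proj[OF P] v] P Hv by simp
  have evW: "eventually (\<lambda>Q. Q \<in> W) gen" by (rule gen_open[OF D(3) W(1)])
  have evH: "eventually (\<lambda>Q. Q \<in> {P \<in> C. \<forall>v\<in>P. H v \<noteq> 0}) gen" by (rule gen_open[OF o Pin])
  have key: "form_quotient G H Q \<noteq> 0 \<and> f Q * form_quotient G H Q = form_quotient F H Q" if "Q \<in> W" "Q \<in> {P \<in> C. \<forall>v\<in>P. H v \<noteq> 0}" for Q
  proof -
    have QC: "Q \<in> C" using that by simp
    obtain w where w: "w \<in> Q" using ex_in_point[OF C_proj[OF QC]] by auto
    have "H w \<noteq> 0" using that(2) w by simp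
    then show ?thesis
      using D(4,5)[OF that(1) w] form_quotient_eq[OF D(2) H QC w] form_quotient_eq[OF D(1) H QC w] by simp
  qed
  have "eventually (\<lambda>Q. form_quotient G H Q \<noteq> 0) gen" using evW evH by eventually_elim (use key in blast)
  then have "\<not> form_quotient G H \<asymp> (\<lambda>_. 0)" by (rule nonzero_not_geq_0)
  moreover have "(\<lambda>Q. f Q * form_quotient G H Q) \<asymp> form_quotient F H" using evW evH by eventually_elim (use key in blast)
  ultimately show ?thesis
    using form_quotient_germ[OF D(1) H P v Hv] form_quotient_germ[OF D(2) H P v Hv]
    by (intro exI[of _ "form_quotient F H"] exI[of _ "form_quotient G H"] conjI)
qed

text \<open>
  The definition of a uniformizer does not require it to lie in the function field, so its
  products have to be determined from the raw definition of multiplication.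
\<close>

lemma mult_unnormalised:
  assumes t: "cls (\<lambda>_. 1) \<otimes>\<^bsub>FF\<^esub> t = cls \<tau>" and \<tau>: "\<tau> \<in> Rat" and f: "f \<in> Rat"
  shows "cls f \<otimes>\<^bsub>FF\<^esub> t = cls (\<lambda>P. f P * \<tau> P)"
proof -
  have mult: "x \<in> a \<otimes>\<^bsub>FF\<^esub> t \<longleftrightarrow> (\<exists>U h V g. (U, h) \<in> a \<and> (V, g) \<in> t \<and> x \<in> rat C (U \<inter> V) (\<lambda>P. h P * g P))" for a x
    unfolding function_field_def by force
  have one: "(U, \<lambda>_. 1) \<in> cls (\<lambda>_. 1)" if "zopen C U" "U \<noteq> {}" for U
    using that by (auto simp: cls_def regular_on_const)
  have in_tau: "\<tau> \<asymp> k"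
    if "zopen C U" "U \<noteq> {}" "(V, g) \<in> t" "W \<noteq> {}" "regular_on C W k" "\<forall>P\<in>U \<inter> V \<inter> W. g P = k P" for U V g W k
  proof -
    have "(W, k) \<in> rat C (U \<inter> V) (\<lambda>P. 1 * g P)" using that(4,5,6) by (simp add: rat_def)
    then have "(W, k) \<in> cls (\<lambda>_. 1) \<otimes>\<^bsub>FF\<^esub> t"
      unfolding mult using one[OF that(1,2)] that(3) by (intro exI conjI)
    then show ?thesis unfolding t by (simp add: cls_def)
  qed
  \<comment> \<open>Were \<open>V\<close> disjoint from \<open>U\<close>, every constant would agree with \<open>g\<close> vacuously on \<open>U \<inter> V\<close>, and \<open>\<tau>\<close>
    would be equal to all of them.\<close>
  have dense: "U \<inter> V \<noteq> {}" if U: "zopen C U" "U \<noteq> {}" and V: "(V, g) \<in> t" for U V g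
  proof
    assume e: "U \<inter> V = {}"
    have "\<tau> \<asymp> (\<lambda>_. c)" for c
      using in_tau[OF U V C_nonempty regular_on_const[OF zopen_C, of c]] e by auto
    from this[of 0] this[of 1] have "eventually (\<lambda>P. False) gen" by eventually_elim simp
    then show False by simp
  qed
  have 1: "(\<lambda>P. f P * \<tau> P) \<asymp> g1"
    if a: "(U, h) \<in> cls f" "(V, g) \<in> t" "(V1, g1) \<in> rat C (U \<inter> V) (\<lambda>P. h P * g P)" for U h V g V1 g1
  proof -
    have h: "U \<noteq> {}" "regular_on C U h" "f \<asymp> h" using a(1) by (auto simp: cls_def)
    have g1: "V1 \<noteq> {}" "regular_on C V1 g1" "\<forall>P\<in>U \<inter> V \<inter> V1. h P * g P = g1 P" using a(3) by (auto simp: rat_def)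
    note oU = regular_on_zopen[OF h(2)] and oV = regular_on_zopen[OF g1(2)]
    show ?thesis
    proof (cases "f \<asymp> (\<lambda>_. 0)")
      case True
      then have h0: "h \<asymp> (\<lambda>_. 0)" using h(3) by eventually_elim simp
      have hU: "h P = 0" if "P \<in> U" for P
        by (rule regular_on_eqI[OF h(2) regular_on_const[OF oU] h0 that])
      have "g1 \<asymp> (\<lambda>_. 0)"
      proof (rule ccontr)
        assume "\<not> g1 \<asymp> (\<lambda>_. 0)"
        then have "eventually (\<lambda>P. g1 P \<noteq> 0) gen" by (rule Rat_nonzero[rotated]) (unfold Rat_def, intro CollectI exI[of _ V1] conjI g1(1,2))
        then obtain Q where Q: "Q \<in> V1" "g1 Q \<noteq> 0" using gen_ex[OF _ oV g1(1)] by blast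
        have o1: "zopen C {P \<in> V1. g1 P \<noteq> 0}" by (rule zopen_regular_nonzero[OF g1(2)])
        have "{P \<in> V1. g1 P \<noteq> 0} \<noteq> {}" using Q by blast
        then have "{P \<in> V1. g1 P \<noteq> 0} \<inter> U \<noteq> {}" by (rule zopen_meet[OF o1 oU _ h(1)])
        then have "{P \<in> V1. g1 P \<noteq> 0} \<inter> U \<inter> V \<noteq> {}" by (rule dense[OF zopen_Int[OF o1 oU] _ a(2)])
        then obtain R where R: "R \<in> V1" "g1 R \<noteq> 0" "R \<in> U" "R \<in> V" by blast
        then have "h R * g R = g1 R" using g1(3) by blast
        then show False using hU[OF R(3)] R(2) by simp
      qed
      with True show ?thesis by eventually_elim simp
    next
      case False
      then have nz: "eventually (\<lambda>P. f P \<noteq> 0) gen" by (rule Rat_nonzero[OF f])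
      then have "eventually (\<lambda>P. h P \<noteq> 0) gen" using h(3) by eventually_elim simp
      then obtain Q where "Q \<in> U" "h Q \<noteq> 0" using gen_ex[OF _ oU h(1)] by blast
      then have ne: "{P \<in> U. h P \<noteq> 0} \<noteq> {}" by blast
      define W where "W = {P \<in> U. h P \<noteq> 0} \<inter> V1"
      have oh: "zopen C {P \<in> U. h P \<noteq> 0}" by (rule zopen_regular_nonzero[OF h(2)])
      have oW: "zopen C W" "W \<noteq> {}" unfolding W_def by (rule zopen_Int[OF oh oV], rule zopen_meet[OF oh oV ne g1(1)])
      have "regular_on C W (\<lambda>P. g1 P * inverse (h P))"
        by (intro regular_on_mult regular_on_inverse regular_on_subset[OF g1(2) oW(1)] regular_on_subset[OF h(2) oW(1)])
          (auto simp: W_def)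
      moreover have "\<forall>P\<in>W \<inter> V \<inter> W. g P = g1 P * inverse (h P)"
      proof
        fix P assume P: "P \<in> W \<inter> V \<inter> W"
        then have "h P * g P = g1 P" "h P \<noteq> 0" using g1(3) by (auto simp: W_def)
        then show "g P = g1 P * inverse (h P)" by (auto simp: divide_inverse[symmetric] eq_divide_eq mult.commute)
      qed
      ultimately have "\<tau> \<asymp> (\<lambda>P. g1 P * inverse (h P))" by (rule in_tau[OF oW a(2) oW(2)])
      with nz h(3) show ?thesis by eventually_elim simp
    qed
  qed
  have 2: "\<exists>U V g. (U, f) \<in> cls f \<and> (V, g) \<in> t \<and> (V1, g1) \<in> rat C (U \<inter> V) (\<lambda>P. f P * g P)"
    if V1: "V1 \<noteq> {}" "regular_on C V1 g1" "(\<lambda>P. f P * \<tau> P) \<asymp> g1" for V1 g1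
  proof -
    obtain U\<^sub>\<tau> where "U\<^sub>\<tau> \<noteq> {}" "regular_on C U\<^sub>\<tau> \<tau>" using RatE[OF \<tau>] .
    then have "(U\<^sub>\<tau>, \<tau>) \<in> cls \<tau>" by (simp add: cls_def)
    then have "(U\<^sub>\<tau>, \<tau>) \<in> cls (\<lambda>_. 1) \<otimes>\<^bsub>FF\<^esub> t" unfolding t .
    then obtain U0 h0 V g where *: "(U0, h0) \<in> cls (\<lambda>_. 1)" "(V, g) \<in> t" "(U\<^sub>\<tau>, \<tau>) \<in> rat C (U0 \<inter> V) (\<lambda>P. h0 P * g P)"
      unfolding mult by (elim exE conjE)
    have h0: "U0 \<noteq> {}" "regular_on C U0 h0" "(\<lambda>_. 1) \<asymp> h0" using *(1) by (auto simp: cls_def)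
    have g: "U\<^sub>\<tau> \<noteq> {}" "regular_on C U\<^sub>\<tau> \<tau>" "\<forall>P\<in>U0 \<inter> V \<inter> U\<^sub>\<tau>. h0 P * g P = \<tau> P" using *(3) by (auto simp: rat_def)
    have h01: "h0 P = 1" if "P \<in> U0" for P
      using regular_on_eqI[OF regular_on_const[OF regular_on_zopen[OF h0(2)]] h0(2,3) that] by simp
    obtain Uf where Uf: "Uf \<noteq> {}" "regular_on C Uf f" using RatE[OF f] .
    note o1 = zopen_Int[OF regular_on_zopen[OF h0(2)] regular_on_zopen[OF g(2)]]
    note n1 = zopen_meet[OF regular_on_zopen[OF h0(2)] regular_on_zopen[OF g(2)] h0(1) g(1)]
    define U where "U = U0 \<inter> U\<^sub>\<tau> \<inter> Uf"
    have oU: "zopen C U" "U \<noteq> {}" unfolding U_def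
      by (rule zopen_Int[OF o1 regular_on_zopen[OF Uf(2)]], rule zopen_meet[OF o1 regular_on_zopen[OF Uf(2)] n1 Uf(1)])
    have rf: "regular_on C U f" by (rule regular_on_subset[OF Uf(2) oU(1)]) (auto simp: U_def)
    have rt: "regular_on C U \<tau>" by (rule regular_on_subset[OF g(2) oU(1)]) (auto simp: U_def)
    note oUV = zopen_Int[OF oU(1) regular_on_zopen[OF V1(2)]]
    have r1: "regular_on C (U \<inter> V1) (\<lambda>P. f P * \<tau> P)" by (rule regular_on_subset[OF regular_on_mult[OF rf rt] oUV]) auto
    have r2: "regular_on C (U \<inter> V1) g1" by (rule regular_on_subset[OF V1(2) oUV]) auto
    have "f P * g P = g1 P" if "P \<in> U \<inter> V \<inter> V1" for P
    proof -
      have "f P * \<tau> P = g1 P" using that by (intro regular_on_eqI[OF r1 r2 V1(3)]) auto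
      moreover have "h0 P * g P = \<tau> P" using g(3) that unfolding U_def by blast
      then have "g P = \<tau> P" using h01[of P] that unfolding U_def by simp
      ultimately show ?thesis by simp
    qed
    then have "(V1, g1) \<in> rat C (U \<inter> V) (\<lambda>P. f P * g P)" using V1 by (simp add: rat_def)
    moreover have "(U, f) \<in> cls f" using oU rf by (simp add: cls_def)
    ultimately show ?thesis using *(2) by (intro exI conjI)
  qed
  show ?thesis
  proof (rule Set.set_eqI, clarify, rule iffI)
    fix V1 g1 assume "(V1, g1) \<in> cls f \<otimes>\<^bsub>FF\<^esub> t"
    then obtain U h V g where *: "(U, h) \<in> cls f" "(V, g) \<in> t" "(V1, g1) \<in> rat C (U \<inter> V) (\<lambda>P. h P * g P)"
      unfolding mult by (elim exE conjE)
    then show "(V1, g1) \<in> cls (\<lambda>P. f P * \<tau> P)" using 1[OF *] by (simp add: cls_def rat_def)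
  next
    fix V1 g1 assume "(V1, g1) \<in> cls (\<lambda>P. f P * \<tau> P)"
    then have "V1 \<noteq> {}" "regular_on C V1 g1" "(\<lambda>P. f P * \<tau> P) \<asymp> g1" by (auto simp: cls_def)
    from 2[OF this] show "(V1, g1) \<in> cls f \<otimes>\<^bsub>FF\<^esub> t" unfolding mult by (elim exE conjE) (intro exI conjI)
  qed
qed

text \<open>
  A generator of the maximal ideal of the local ring at \<open>P\<close>, as a function.
\<close>

definition local_parameter :: "'n ppoint \<Rightarrow> ('n ppoint \<Rightarrow> complex) \<Rightarrow> bool" where
  "local_parameter P \<tau> \<longleftrightarrow> germ P \<tau> \<and> \<tau> P = 0 \<and>
     (\<forall>f. germ P f \<longrightarrow> f P = 0 \<longrightarrow> (\<exists>a. germ P a \<and> f \<asymp> (\<lambda>Q. a Q * \<tau> Q)))"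

lemma uniformizerD:
  assumes P: "P \<in> C" and t: "uniformizer C P t"
  shows "\<exists>\<tau>. local_parameter P \<tau> \<and> (\<forall>f\<in>Rat. cls f \<otimes>\<^bsub>FF\<^esub> t = cls (\<lambda>Q. f Q * \<tau> Q))"
proof -
  have eq: "maximal_ideal_at C P = {a \<otimes>\<^bsub>FF\<^esub> t | a. a \<in> local_ring C P}" using t unfolding uniformizer_def .
  have "cls (\<lambda>_. 1) \<in> local_ring C P" unfolding local_ring_iff using germ_const[OF P] by (intro exI conjI) auto
  then have "cls (\<lambda>_. 1) \<otimes>\<^bsub>FF\<^esub> t \<in> maximal_ideal_at C P" unfolding eq by blast
  then obtain \<tau> where \<tau>: "germ P \<tau>" "\<tau> P = 0" "cls (\<lambda>_. 1) \<otimes>\<^bsub>FF\<^esub> t = cls \<tau>"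
    unfolding maximal_ideal_iff by (elim exE conjE)
  note \<tau>R = germ_Rat[OF \<tau>(1)]
  note m = mult_unnormalised[OF \<tau>(3) \<tau>R]
  have "\<exists>a. germ P a \<and> f \<asymp> (\<lambda>Q. a Q * \<tau> Q)" if f: "germ P f" "f P = 0" for f
  proof -
    have "cls f \<in> maximal_ideal_at C P" unfolding maximal_ideal_iff using f by (intro exI conjI) auto
    then obtain b where "b \<in> local_ring C P" "cls f = b \<otimes>\<^bsub>FF\<^esub> t" unfolding eq by blast
    then obtain a where a: "germ P a" "cls f = cls a \<otimes>\<^bsub>FF\<^esub> t" unfolding local_ring_iff by blast
    then have "cls f = cls (\<lambda>Q. a Q * \<tau> Q)" using m[OF germ_Rat[OF a(1)]] by simp
    then have "f \<asymp> (\<lambda>Q. a Q * \<tau> Q)"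
      using cls_eq_iff[OF germ_Rat[OF f(1)] Rat_mult[OF germ_Rat[OF a(1)] \<tau>R]] by simp
    then show ?thesis using a(1) by (intro exI[of _ a] conjI)
  qed
  then have "local_parameter P \<tau>" unfolding local_parameter_def using \<tau>(1,2) by (intro conjI allI impI)
  then show ?thesis using m by (intro exI[of _ \<tau>] conjI ballI)
qed

end

context smooth_curve
begin

text \<open>
  If the maximal ideal were 0, all germs at \<open>P\<close> would be constant, and with them all rational functions.
\<close>

lemma local_parameter_nonzero:
  assumes "local_parameter P \<tau>" shows "\<not> \<tau> \<asymp> (\<lambda>_. 0)"
proof
  assume \<tau>0: "\<tau> \<asymp> (\<lambda>_. 0)"
  have g: "germ P \<tau>" using assms by (simp add: local_parameter_def)
  note P = germ_in_C[OF g]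
  have const: "f \<asymp> (\<lambda>_. f P)" if f: "germ P f" for f
  proof -
    have "germ P (\<lambda>Q. f Q - f P)" by (rule germ_diff[OF f germ_const[OF P]])
    then obtain a where "(\<lambda>Q. f Q - f P) \<asymp> (\<lambda>Q. a Q * \<tau> Q)"
      using assms unfolding local_parameter_def by fastforce
    with \<tau>0 show ?thesis by eventually_elim simp
  qed
  from algebraic_over_generator obtain x where x: "x \<in> Rat" "\<forall>c. \<not> x \<asymp> (\<lambda>_. c)" by (elim bexE conjE)
  from Rat_germ_quotient[OF x(1) P] obtain a b where ab: "germ P a" "germ P b" "\<not> b \<asymp> (\<lambda>_. 0)"
    "(\<lambda>Q. x Q * b Q) \<asymp> a" by (elim exE conjE)
  have "b P \<noteq> 0" using const[OF ab(2)] ab(3) by auto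
  have "x \<asymp> (\<lambda>_. a P / b P)"
    using const[OF ab(1)] const[OF ab(2)] ab(4)
    by eventually_elim (use \<open>b P \<noteq> 0\<close> in \<open>simp add: eq_divide_eq\<close>)
  then show False using x(2) by blast
qed

text \<open>
  This replaces Krull's intersection theorem. Let \<open>f\<close> be divisible by all powers of \<open>\<tau>\<close>. An algebraic
  relation between \<open>\<tau>\<close> and \<open>f\<close> has the form \<open>s0(\<tau>) = - f * \<dots>\<close> with \<open>s0 \<noteq> 0\<close>. Its left side is a unit times
  \<open>\<tau> ^ k\<close> for some \<open>k\<close>, while its right side is divisible by \<open>\<tau> ^ Suc k\<close>.
\<close>

lemma germ_order:
  assumes \<tau>: "local_parameter P \<tau>" and f: "germ P f" "\<not> f \<asymp> (\<lambda>_. 0)"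
  shows "\<exists>n u. germ P u \<and> u P \<noteq> 0 \<and> f \<asymp> (\<lambda>Q. u Q * \<tau> Q ^ n)"
proof (rule ccontr)
  assume none: "\<not> ?thesis"
  have g: "germ P \<tau>" and \<tau>P: "\<tau> P = 0"
    and div: "\<And>f. germ P f \<Longrightarrow> f P = 0 \<Longrightarrow> \<exists>a. germ P a \<and> f \<asymp> (\<lambda>Q. a Q * \<tau> Q)"
    using \<tau> unfolding local_parameter_def by auto
  note P = germ_in_C[OF g]
  have dvd: "\<exists>a. germ P a \<and> f \<asymp> (\<lambda>Q. a Q * \<tau> Q ^ n)" for n
  proof (induction n)
    case 0
    show ?case using f(1) by (intro exI[of _ f]) simp
  next
    case (Suc n)
    then obtain a where a: "germ P a" "f \<asymp> (\<lambda>Q. a Q * \<tau> Q ^ n)" by (elim exE conjE)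
    have "a P = 0"
    proof (rule ccontr)
      assume "a P \<noteq> 0"
      then have "\<exists>n u. germ P u \<and> u P \<noteq> 0 \<and> f \<asymp> (\<lambda>Q. u Q * \<tau> Q ^ n)"
        using a by (intro exI[of _ n] exI[of _ a] conjI)
      then show False using none by (rule notE[rotated])
    qed
    from div[OF a(1) this] obtain b where b: "germ P b" "a \<asymp> (\<lambda>Q. b Q * \<tau> Q)" by (elim exE conjE)
    have "f \<asymp> (\<lambda>Q. b Q * \<tau> Q ^ Suc n)" using a(2) b(2) by eventually_elim (simp add: mult.assoc)
    then show ?case using b(1) by (intro exI[of _ b] conjI)
  qed
  from two_variable_relation[OF germ_Rat[OF g] germ_Rat[OF f(1)]] obtain q where
    q: "q \<noteq> 0" "(\<lambda>Q. peval (\<lambda>r. poly r (\<tau> Q)) q (f Q)) \<asymp> (\<lambda>_. 0)" by (elim exE conjE)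
  have h: "comm_ring_map (\<lambda>r. poly r z)" for z :: complex by unfold_locales auto
  obtain q' where q': "q = [:- 0, 1:] ^ Polynomial.order 0 q * q'" "\<not> [:- 0, 1:] dvd q'"
    using order_decomp[OF q(1)] by blast
  obtain s0 s where s: "q' = pCons s0 s" by (metis pCons_cases)
  have s0: "s0 \<noteq> 0" using q'(2) unfolding s poly_eq_0_iff_dvd[symmetric] by simp
  have rel: "(\<lambda>Q. poly s0 (\<tau> Q)) \<asymp> (\<lambda>Q. - (f Q * peval (\<lambda>r. poly r (\<tau> Q)) s (f Q)))"
    using q(2) Rat_nonzero[OF germ_Rat[OF f(1)] f(2)]
  proof eventually_elim
    case (elim Q)
    interpret hQ: comm_ring_map "\<lambda>r. poly r (\<tau> Q)" by (rule h)
    have "peval (\<lambda>r. poly r (\<tau> Q)) q (f Q) = f Q ^ Polynomial.order 0 q * peval (\<lambda>r. poly r (\<tau> Q)) q' (f Q)"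
      by (subst q'(1)) (simp add: hQ.peval_mult hQ.peval_power)
    then have "peval (\<lambda>r. poly r (\<tau> Q)) q' (f Q) = 0" using elim by simp
    then show ?case unfolding s by (simp add: comm_ring_map.peval_pCons[OF h] eq_neg_iff_add_eq_0)
  qed
  obtain r where r: "s0 = [:- 0, 1:] ^ Polynomial.order 0 s0 * r" "\<not> [:- 0, 1:] dvd r"
    using order_decomp[OF s0] by blast
  define k where "k = Polynomial.order 0 s0"
  have r0: "poly r 0 \<noteq> 0" using r(2) by (simp add: poly_eq_0_iff_dvd)
  from dvd[of "Suc k"] obtain a where a: "germ P a" "f \<asymp> (\<lambda>Q. a Q * \<tau> Q ^ Suc k)" by (elim exE conjE)
  have gp: "germ P (\<lambda>Q. poly p (g Q))" if g': "germ P g" for p g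
  proof (induction p)
    case 0 show ?case using germ_const[OF P, of 0] by simp
  next
    case (pCons c p)
    show ?case unfolding poly_pCons by (rule germ_add[OF germ_const[OF P] germ_mult[OF g' pCons(2)]])
  qed
  have gs: "germ P (\<lambda>Q. peval (\<lambda>r. poly r (\<tau> Q)) s (f Q))"
  proof (induction s)
    case 0 show ?case using germ_const[OF P, of 0] by (simp add: comm_ring_map.peval_0[OF h])
  next
    case (pCons c p)
    show ?case unfolding comm_ring_map.peval_pCons[OF h]
      by (rule germ_add[OF gp[OF g] germ_mult[OF f(1) pCons(2)]])
  qed
  define w where "w Q = poly r (\<tau> Q) + a Q * \<tau> Q * peval (\<lambda>r. poly r (\<tau> Q)) s (f Q)" for Q
  have "germ P w" unfolding w_def by (intro germ_add germ_mult gp g a(1) gs)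
  moreover have "w P \<noteq> 0" using r0 by (simp add: w_def \<tau>P)
  ultimately have "eventually (\<lambda>Q. w Q \<noteq> 0) gen" by (rule germ_nonzero)
  moreover have "eventually (\<lambda>Q. \<tau> Q ^ k * w Q = 0) gen"
    using rel a(2)
  proof eventually_elim
    case (elim Q)
    have s0r: "\<tau> Q ^ k * poly r (\<tau> Q) = poly s0 (\<tau> Q)" by (subst r(1)) (simp add: k_def poly_power)
    have "\<tau> Q ^ k * w Q = \<tau> Q ^ k * poly r (\<tau> Q)
        + (a Q * \<tau> Q ^ Suc k) * peval (\<lambda>r. poly r (\<tau> Q)) s (f Q)"
      by (simp add: w_def algebra_simps)
    also have "\<dots> = poly s0 (\<tau> Q) + f Q * peval (\<lambda>r. poly r (\<tau> Q)) s (f Q)"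
      using elim(2) s0r by metis
    finally show ?case using elim(1) by simp
  qed
  ultimately have "\<tau> \<asymp> (\<lambda>_. 0)" by eventually_elim simp
  then show False using local_parameter_nonzero[OF \<tau>] by simp
qed

end

section \<open>Expansion at a point\<close>

context smooth_curve
begin

text \<open>
  The function field \<open>function_field C\<close> consists of sets and carries its operations in a record. Laurent
  expansion at a point, which may be any point of \<open>C\<close>, embeds it into a type of class \<open>field\<close>.
\<close>

definition base :: "'n ppoint" where "base = (SOME P. P \<in> C)"

lemma base_in_C: "base \<in> C"
  unfolding base_def using C_nonempty by (simp add: some_in_eq)

definition parameter :: "'n ppoint \<Rightarrow> 'n ppoint \<Rightarrow> complex" where
  "parameter P = (SOME \<tau>. local_parameter P \<tau>)"

lemma parameter: "P \<in> C \<Longrightarrow> local_parameter P (parameter P)"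
  unfolding parameter_def using uniformizerD smooth by (metis someI_ex)

lemma parameterD:
  assumes "P \<in> C"
  shows "germ P (parameter P)" "parameter P P = 0" "eventually (\<lambda>Q. parameter P Q \<noteq> 0) gen"
    "germ P f \<Longrightarrow> f P = 0 \<Longrightarrow> \<exists>a. germ P a \<and> f \<asymp> (\<lambda>Q. a Q * parameter P Q)"
proof -
  note l = parameter[OF assms]
  show g: "germ P (parameter P)" and "parameter P P = 0"
    "germ P f \<Longrightarrow> f P = 0 \<Longrightarrow> \<exists>a. germ P a \<and> f \<asymp> (\<lambda>Q. a Q * parameter P Q)"
    using l unfolding local_parameter_def by simp_all
  show "eventually (\<lambda>Q. parameter P Q \<noteq> 0) gen"
    by (rule Rat_nonzero[OF germ_Rat[OF g] local_parameter_nonzero[OF l]])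
qed

text \<open>
  The function \<open>(f - f(base)) / t\<close> for the local parameter \<open>t\<close>. Iterating it produces the coefficients of
  the expansion of \<open>f\<close>.
\<close>

definition shift :: "('n ppoint \<Rightarrow> complex) \<Rightarrow> 'n ppoint \<Rightarrow> complex" where
  "shift f = (SOME g. germ base g \<and> (\<lambda>Q. f Q - f base) \<asymp> (\<lambda>Q. g Q * parameter base Q))"

lemma shift:
  assumes "germ base f"
  shows "germ base (shift f)" "(\<lambda>Q. f Q - f base) \<asymp> (\<lambda>Q. shift f Q * parameter base Q)"
proof -
  have "\<exists>g. germ base g \<and> (\<lambda>Q. f Q - f base) \<asymp> (\<lambda>Q. g Q * parameter base Q)"
    by (rule parameterD(4)[OF base_in_C]) (simp_all add: germ_diff germ_const base_in_C assms)
  from someI_ex[OF this] show "germ base (shift f)" "(\<lambda>Q. f Q - f base) \<asymp> (\<lambda>Q. shift f Q * parameter base Q)"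
    unfolding shift_def by simp_all
qed

lemma shift_unique:
  assumes f: "germ base f" and eq: "(\<lambda>Q. f Q - f base) \<asymp> (\<lambda>Q. g Q * parameter base Q)"
  shows "shift f \<asymp> g"
  using shift(2)[OF f] eq parameterD(3)[OF base_in_C] by eventually_elim simp

primrec expansion_coeff :: "nat \<Rightarrow> ('n ppoint \<Rightarrow> complex) \<Rightarrow> complex" where
  "expansion_coeff 0 f = f base"
| "expansion_coeff (Suc n) f = expansion_coeff n (shift f)"

lemma expansion_coeff_cong:
  "germ base f \<Longrightarrow> germ base g \<Longrightarrow> f \<asymp> g \<Longrightarrow> expansion_coeff n f = expansion_coeff n g"
proof (induction n arbitrary: f g)
  case 0 then show ?case using germ_eqD by simp
next
  case (Suc n)
  have f0: "f base = g base" by (rule germ_eqD[OF Suc.prems])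
  have "(\<lambda>Q. f Q - f base) \<asymp> (\<lambda>Q. shift g Q * parameter base Q)"
    using Suc.prems(3) shift(2)[OF Suc.prems(2)] by eventually_elim (simp add: f0)
  then have "shift f \<asymp> shift g" by (rule shift_unique[OF Suc.prems(1)])
  then show ?case using Suc.IH[OF shift(1)[OF Suc.prems(1)] shift(1)[OF Suc.prems(2)]] by simp
qed

lemma expansion_coeff_add:
  "germ base f \<Longrightarrow> germ base g \<Longrightarrow>
    expansion_coeff n (\<lambda>Q. f Q + g Q) = expansion_coeff n f + expansion_coeff n g"
proof (induction n arbitrary: f g)
  case (Suc n)
  note s = shift[OF Suc.prems(1)] and s' = shift[OF Suc.prems(2)] and fg = germ_add[OF Suc.prems]
  have "shift (\<lambda>Q. f Q + g Q) \<asymp> (\<lambda>Q. shift f Q + shift g Q)"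
    by (rule shift_unique[OF fg], use s(2) s'(2) in eventually_elim) (simp add: algebra_simps)
  then show ?case
    using expansion_coeff_cong[OF shift(1)[OF fg] germ_add[OF s(1) s'(1)]] Suc.IH[OF s(1) s'(1)] by simp
qed simp

lemma expansion_coeff_scale:
  "germ base f \<Longrightarrow> expansion_coeff n (\<lambda>Q. c * f Q) = c * expansion_coeff n f"
proof (induction n arbitrary: f)
  case (Suc n)
  note s = shift[OF Suc.prems] and cf = germ_mult[OF germ_const[OF base_in_C] Suc.prems]
  have "shift (\<lambda>Q. c * f Q) \<asymp> (\<lambda>Q. c * shift f Q)"
    by (rule shift_unique[OF cf], use s(2) in eventually_elim) (simp add: algebra_simps)
  then show ?case
    using expansion_coeff_cong[OF shift(1)[OF cf] germ_mult[OF germ_const[OF base_in_C] s(1)]] Suc.IH[OF s(1)] by simp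
qed simp

lemma expansion_coeff_mult:
  "germ base f \<Longrightarrow> germ base g \<Longrightarrow>
    expansion_coeff n (\<lambda>Q. f Q * g Q) = (\<Sum>i\<le>n. expansion_coeff i f * expansion_coeff (n - i) g)"
proof (induction n arbitrary: f)
  case (Suc n)
  note s = shift[OF Suc.prems(1)] and s' = shift[OF Suc.prems(2)] and fg = germ_mult[OF Suc.prems]
  note g1 = germ_mult[OF germ_const[OF base_in_C] s'(1), of "f base"] and g2 = germ_mult[OF s(1) Suc.prems(2)]
  have "shift (\<lambda>Q. f Q * g Q) \<asymp> (\<lambda>Q. f base * shift g Q + shift f Q * g Q)"
  proof (rule shift_unique[OF fg], use s(2) s'(2) in eventually_elim)
    case (elim Q)
    have "f Q * g Q - f base * g base = f base * (g Q - g base) + (f Q - f base) * g Q" by (simp add: algebra_simps)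
    also have "\<dots> = (f base * shift g Q + shift f Q * g Q) * parameter base Q"
      unfolding elim by (simp add: algebra_simps)
    finally show ?case .
  qed
  then have "expansion_coeff (Suc n) (\<lambda>Q. f Q * g Q)
      = f base * expansion_coeff n (shift g) + (\<Sum>i\<le>n. expansion_coeff i (shift f) * expansion_coeff (n - i) g)"
    using expansion_coeff_cong[OF shift(1)[OF fg] germ_add[OF g1 g2]] Suc.IH[OF s(1) Suc.prems(2)]
      expansion_coeff_add[OF g1 g2] expansion_coeff_scale[OF s'(1)] by simp
  also have "\<dots> = (\<Sum>i\<le>Suc n. expansion_coeff i f * expansion_coeff (Suc n - i) g)"
    by (subst sum.atMost_Suc_shift) simp
  finally show ?case .
qed simp

definition expand :: "('n ppoint \<Rightarrow> complex) \<Rightarrow> complex fls" where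
  "expand f = fps_to_fls (Abs_fps (\<lambda>n. expansion_coeff n f))"

lemma expand_cong:
  assumes "germ base f" "germ base g" "f \<asymp> g" shows "expand f = expand g"
  unfolding expand_def expansion_coeff_cong[OF assms] ..

lemma expand_add: "germ base f \<Longrightarrow> germ base g \<Longrightarrow> expand (\<lambda>Q. f Q + g Q) = expand f + expand g"
  unfolding expand_def fps_to_fls_plus[symmetric]
  by (rule arg_cong[of _ _ fps_to_fls]) (simp add: fps_eq_iff expansion_coeff_add)

lemma expand_mult: "germ base f \<Longrightarrow> germ base g \<Longrightarrow> expand (\<lambda>Q. f Q * g Q) = expand f * expand g"
  unfolding expand_def fls_times_fps_to_fls[symmetric]
  by (rule arg_cong[of _ _ fps_to_fls]) (simp add: fps_eq_iff expansion_coeff_mult fps_mult_nth atMost_atLeast0)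

lemma expand_const: "expand (\<lambda>_. c) = fls_const c"
proof -
  have z: "expansion_coeff n (\<lambda>_. 0) = 0" for n
    using expansion_coeff_scale[OF germ_const[OF base_in_C], of n 0] by simp
  have "shift (\<lambda>_. c) \<asymp> (\<lambda>_. 0)"
    by (rule shift_unique[OF germ_const[OF base_in_C]]) simp
  then have "expansion_coeff n (shift (\<lambda>_. c)) = 0" for n
    using expansion_coeff_cong[OF shift(1)[OF germ_const[OF base_in_C]] germ_const[OF base_in_C]] z by metis
  then have "expansion_coeff n (\<lambda>_. c) = (if n = 0 then c else 0)" for n by (cases n) simp_all
  then have "Abs_fps (\<lambda>n. expansion_coeff n (\<lambda>_. c)) = fps_const c" by (simp add: fps_eq_iff)
  then show ?thesis by (simp add: expand_def)
qed

lemma divisible_if_coeffs_vanish: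
  "germ base f \<Longrightarrow> (\<And>i. i < n \<Longrightarrow> expansion_coeff i f = 0) \<Longrightarrow>
    \<exists>g. germ base g \<and> f \<asymp> (\<lambda>Q. g Q * parameter base Q ^ n)"
proof (induction n arbitrary: f)
  case 0 then show ?case by (intro exI[of _ f]) simp
next
  case (Suc n)
  note s = shift[OF Suc.prems(1)]
  have z: "expansion_coeff i (shift f) = 0" if "i < n" for i using Suc.prems(2)[of "Suc i"] that by simp
  have "\<exists>g. germ base g \<and> shift f \<asymp> (\<lambda>Q. g Q * parameter base Q ^ n)"
    by (rule Suc.IH[OF s(1)]) (rule z)
  then obtain g where g: "germ base g" "shift f \<asymp> (\<lambda>Q. g Q * parameter base Q ^ n)"
    by (elim exE conjE)
  have f0: "f base = 0" using Suc.prems(2)[of 0] by simp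
  have "f \<asymp> (\<lambda>Q. g Q * parameter base Q ^ Suc n)"
    using s(2) g(2) by eventually_elim (simp add: f0)
  then show ?case using g(1) by (intro exI[of _ g] conjI)
qed

text \<open>
  A germ with vanishing expansion is divisible by every power of the local parameter, but the order of a
  nonzero germ is finite.
\<close>

lemma expand_eq_0:
  assumes f: "germ base f" and "expand f = 0" shows "f \<asymp> (\<lambda>_. 0)"
proof (rule ccontr)
  assume nz: "\<not> f \<asymp> (\<lambda>_. 0)"
  from germ_order[OF parameter[OF base_in_C] f nz] obtain n u where
    u: "germ base u" "u base \<noteq> 0" "f \<asymp> (\<lambda>Q. u Q * parameter base Q ^ n)" by (elim exE conjE)
  have z: "expansion_coeff i f = 0" for i
    using assms(2) by (simp add: expand_def fps_eq_iff)
  have "\<exists>g. germ base g \<and> f \<asymp> (\<lambda>Q. g Q * parameter base Q ^ Suc n)"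
    by (rule divisible_if_coeffs_vanish[OF f]) (rule z)
  then obtain g where
    g: "germ base g" "f \<asymp> (\<lambda>Q. g Q * parameter base Q ^ Suc n)" by (elim exE conjE)
  have "u \<asymp> (\<lambda>Q. g Q * parameter base Q)"
    using u(3) g(2) parameterD(3)[OF base_in_C] by eventually_elim simp
  from germ_eqD[OF u(1) germ_mult[OF g(1) parameterD(1)[OF base_in_C]] this]
  show False using u(2) parameterD(2)[OF base_in_C] by simp
qed

text \<open>
  Every rational function is a quotient of germs at the base point, so the expansion extends to all of them.
\<close>

definition \<Phi> :: "('n ppoint \<Rightarrow> complex) \<Rightarrow> complex fls" where
  "\<Phi> f = (SOME k. \<exists>a b. germ base a \<and> germ base b \<and> \<not> b \<asymp> (\<lambda>_. 0) \<and> (\<lambda>Q. f Q * b Q) \<asymp> a \<and>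
     k = expand a / expand b)"

lemma \<Phi>_eq:
  assumes ab: "germ base a" "germ base b" "\<not> b \<asymp> (\<lambda>_. 0)" "(\<lambda>Q. f Q * b Q) \<asymp> a"
  shows "\<Phi> f = expand a / expand b" "expand b \<noteq> 0"
proof -
  show nz: "expand b \<noteq> 0" using expand_eq_0 ab by blast
  have "k = expand a / expand b"
    if k: "\<exists>a b. germ base a \<and> germ base b \<and> \<not> b \<asymp> (\<lambda>_. 0) \<and> (\<lambda>Q. f Q * b Q) \<asymp> a \<and> k = expand a / expand b" for k
  proof -
    from k obtain c d where cd: "germ base c" "germ base d" "\<not> d \<asymp> (\<lambda>_. 0)" "(\<lambda>Q. f Q * d Q) \<asymp> c" "k = expand c / expand d"
      by (elim exE conjE)
    have "(\<lambda>Q. c Q * b Q) \<asymp> (\<lambda>Q. a Q * d Q)" using cd(4) ab(4)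
    proof eventually_elim
      case (elim Q)
      show ?case unfolding elim[symmetric] by (simp only: mult_ac)
    qed
    then have "expand c * expand b = expand a * expand d"
      using expand_cong[OF germ_mult[OF cd(1) ab(2)] germ_mult[OF ab(1) cd(2)]]
      by (simp add: expand_mult ab cd)
    moreover have "expand d \<noteq> 0" using expand_eq_0 cd by blast
    ultimately show ?thesis using nz cd(5) by (simp add: frac_eq_eq)
  qed
  then show "\<Phi> f = expand a / expand b"
    unfolding \<Phi>_def using ab by (intro some_equality) blast+
qed

lemma \<Phi>_rep:
  assumes "f \<in> Rat"
  obtains a b where "germ base a" "germ base b" "eventually (\<lambda>Q. b Q \<noteq> 0) gen" "(\<lambda>Q. f Q * b Q) \<asymp> a"
    "\<Phi> f = expand a / expand b" "expand b \<noteq> 0"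
proof -
  from Rat_germ_quotient[OF assms base_in_C] obtain a b where
    ab: "germ base a" "germ base b" "\<not> b \<asymp> (\<lambda>_. 0)" "(\<lambda>Q. f Q * b Q) \<asymp> a" by (elim exE conjE)
  show thesis
    by (rule that[OF ab(1,2) Rat_nonzero[OF germ_Rat[OF ab(2)] ab(3)] ab(4) \<Phi>_eq[OF ab]])
qed

lemma \<Phi>_eqI:
  assumes "germ base a" "germ base b" "eventually (\<lambda>Q. b Q \<noteq> 0) gen" "(\<lambda>Q. f Q * b Q) \<asymp> a"
  shows "\<Phi> f = expand a / expand b"
  by (rule \<Phi>_eq(1)[OF assms(1,2) nonzero_not_geq_0[OF assms(3)] assms(4)])

lemma \<Phi>_add:
  assumes "f \<in> Rat" "g \<in> Rat" shows "\<Phi> (\<lambda>P. f P + g P) = \<Phi> f + \<Phi> g"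
proof -
  obtain a b where ab: "germ base a" "germ base b" "eventually (\<lambda>Q. b Q \<noteq> 0) gen" "(\<lambda>Q. f Q * b Q) \<asymp> a"
    "\<Phi> f = expand a / expand b" "expand b \<noteq> 0" using \<Phi>_rep[OF assms(1)] .
  obtain c d where cd: "germ base c" "germ base d" "eventually (\<lambda>Q. d Q \<noteq> 0) gen" "(\<lambda>Q. g Q * d Q) \<asymp> c"
    "\<Phi> g = expand c / expand d" "expand d \<noteq> 0" using \<Phi>_rep[OF assms(2)] .
  have "\<Phi> (\<lambda>P. f P + g P) = expand (\<lambda>P. a P * d P + c P * b P) / expand (\<lambda>P. b P * d P)"
  proof (rule \<Phi>_eqI)
    show "germ base (\<lambda>P. a P * d P + c P * b P)" "germ base (\<lambda>P. b P * d P)"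
      by (intro germ_add germ_mult ab cd)+
    show "eventually (\<lambda>Q. b Q * d Q \<noteq> 0) gen" using ab(3) cd(3) by eventually_elim simp
    show "(\<lambda>Q. (f Q + g Q) * (b Q * d Q)) \<asymp> (\<lambda>P. a P * d P + c P * b P)"
      using ab(4) cd(4)
    proof eventually_elim
      case (elim Q)
      have "(f Q + g Q) * (b Q * d Q) = (f Q * b Q) * d Q + (g Q * d Q) * b Q" by (simp add: algebra_simps)
      then show ?case unfolding elim .
    qed
  qed
  also have "\<dots> = \<Phi> f + \<Phi> g"
    using ab(6) cd(6) unfolding ab(5) cd(5)
    by (simp add: expand_add expand_mult germ_mult ab(1,2) cd(1,2) add_frac_eq)
  finally show ?thesis .
qed

lemma \<Phi>_mult:
  assumes "f \<in> Rat" "g \<in> Rat" shows "\<Phi> (\<lambda>P. f P * g P) = \<Phi> f * \<Phi> g"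
proof -
  obtain a b where ab: "germ base a" "germ base b" "eventually (\<lambda>Q. b Q \<noteq> 0) gen" "(\<lambda>Q. f Q * b Q) \<asymp> a"
    "\<Phi> f = expand a / expand b" "expand b \<noteq> 0" using \<Phi>_rep[OF assms(1)] .
  obtain c d where cd: "germ base c" "germ base d" "eventually (\<lambda>Q. d Q \<noteq> 0) gen" "(\<lambda>Q. g Q * d Q) \<asymp> c"
    "\<Phi> g = expand c / expand d" "expand d \<noteq> 0" using \<Phi>_rep[OF assms(2)] .
  have "\<Phi> (\<lambda>P. f P * g P) = expand (\<lambda>P. a P * c P) / expand (\<lambda>P. b P * d P)"
  proof (rule \<Phi>_eqI)
    show "germ base (\<lambda>P. a P * c P)" "germ base (\<lambda>P. b P * d P)" by (intro germ_mult ab cd)+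
    show "eventually (\<lambda>Q. b Q * d Q \<noteq> 0) gen" using ab(3) cd(3) by eventually_elim simp
    show "(\<lambda>Q. f Q * g Q * (b Q * d Q)) \<asymp> (\<lambda>P. a P * c P)"
      using ab(4) cd(4)
    proof eventually_elim
      case (elim Q)
      have "f Q * g Q * (b Q * d Q) = (f Q * b Q) * (g Q * d Q)" by (simp add: mult_ac)
      then show ?case unfolding elim .
    qed
  qed
  also have "\<dots> = \<Phi> f * \<Phi> g"
    unfolding ab(5) cd(5) by (simp add: expand_mult ab(1,2) cd(1,2))
  finally show ?thesis .
qed

lemma \<Phi>_const: "\<Phi> (\<lambda>_. c) = fls_const c"
proof -
  have "\<Phi> (\<lambda>_. c) = expand (\<lambda>_. c) / expand (\<lambda>_. 1)"
    by (rule \<Phi>_eqI[OF germ_const[OF base_in_C] germ_const[OF base_in_C]]) simp_all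
  then show ?thesis by (simp add: expand_const)
qed

lemma \<Phi>_uminus: "f \<in> Rat \<Longrightarrow> \<Phi> (\<lambda>P. - f P) = - \<Phi> f"
  using \<Phi>_add[of f "\<lambda>P. - f P"] \<Phi>_const[of 0] by (simp add: Rat_uminus eq_neg_iff_add_eq_0 add.commute)

lemma \<Phi>_diff: "f \<in> Rat \<Longrightarrow> g \<in> Rat \<Longrightarrow> \<Phi> (\<lambda>P. f P - g P) = \<Phi> f - \<Phi> g"
  using \<Phi>_add[of f "\<lambda>P. - g P"] by (simp add: Rat_uminus \<Phi>_uminus)

lemma \<Phi>_eq_0_iff: assumes "f \<in> Rat" shows "\<Phi> f = 0 \<longleftrightarrow> f \<asymp> (\<lambda>_. 0)"
proof -
  obtain a b where ab: "germ base a" "germ base b" "eventually (\<lambda>Q. b Q \<noteq> 0) gen" "(\<lambda>Q. f Q * b Q) \<asymp> a"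
    "\<Phi> f = expand a / expand b" "expand b \<noteq> 0" using \<Phi>_rep[OF assms] .
  have "\<Phi> f = 0 \<longleftrightarrow> expand a = 0" using ab(5,6) by simp
  also have "\<dots> \<longleftrightarrow> a \<asymp> (\<lambda>_. 0)"
    using expand_eq_0[OF ab(1)] expand_cong[OF ab(1) germ_const[OF base_in_C, of 0]] expand_const[of 0] by auto
  also have "\<dots> \<longleftrightarrow> f \<asymp> (\<lambda>_. 0)"
  proof
    assume "a \<asymp> (\<lambda>_. 0)" then show "f \<asymp> (\<lambda>_. 0)" using ab(3,4) by eventually_elim simp
  next
    assume "f \<asymp> (\<lambda>_. 0)" then show "a \<asymp> (\<lambda>_. 0)" using ab(4) by eventually_elim simp
  qed
  finally show ?thesis .
qed

lemma \<Phi>_eq_iff: assumes "f \<in> Rat" "g \<in> Rat" shows "\<Phi> f = \<Phi> g \<longleftrightarrow> f \<asymp> g"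
  using \<Phi>_eq_0_iff[OF Rat_diff[OF assms]] \<Phi>_diff[OF assms] by simp

lemma \<Phi>_inverse: assumes "f \<in> Rat" shows "\<Phi> (\<lambda>P. inverse (f P)) = inverse (\<Phi> f)"
proof (cases "f \<asymp> (\<lambda>_. 0)")
  case True
  then have "(\<lambda>P. inverse (f P)) \<asymp> (\<lambda>_. 0)" by eventually_elim simp
  then show ?thesis using \<Phi>_eq_0_iff[OF assms] \<Phi>_eq_0_iff[OF Rat_inverse[OF assms]] True by simp
next
  case False
  have "(\<lambda>P. f P * inverse (f P)) \<asymp> (\<lambda>_. 1)" using Rat_nonzero[OF assms False] by eventually_elim simp
  then have "\<Phi> (\<lambda>P. f P * inverse (f P)) = \<Phi> (\<lambda>_. 1)"
    by (simp only: \<Phi>_eq_iff[OF Rat_mult[OF assms Rat_inverse[OF assms]] Rat_const])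
  then have "\<Phi> f * \<Phi> (\<lambda>P. inverse (f P)) = 1"
    unfolding \<Phi>_mult[OF assms Rat_inverse[OF assms]] \<Phi>_const by simp
  then show ?thesis by (metis inverse_unique)
qed

lemma \<Phi>_power: "f \<in> Rat \<Longrightarrow> \<Phi> (\<lambda>P. f P ^ n) = \<Phi> f ^ n"
  using \<Phi>_const[of 1] by (induction n) (simp_all add: \<Phi>_mult Rat_power)

lemma \<Phi>_powi: assumes "f \<in> Rat" shows "\<Phi> (\<lambda>P. f P powi k) = \<Phi> f powi k"
  unfolding power_int_def
  using \<Phi>_power[OF assms] \<Phi>_power[OF Rat_inverse[OF assms]] \<Phi>_inverse[OF assms] by (cases "k \<ge> 0") simp_all

lemma \<Phi>_peval: "f \<in> Rat \<Longrightarrow> \<Phi> (\<lambda>P. poly p (f P)) = peval fls_const p (\<Phi> f)"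
proof (induction p)
  case 0 then show ?case using \<Phi>_const[of 0] by (simp add: peval_def)
next
  case (pCons a p)
  have "\<Phi> (\<lambda>P. poly (pCons a p) (f P)) = \<Phi> (\<lambda>P. a + f P * poly p (f P))" by simp
  also have "\<dots> = fls_const a + \<Phi> f * peval fls_const p (\<Phi> f)"
    using pCons by (subst \<Phi>_add) (simp_all add: Rat_const Rat_mult Rat_poly \<Phi>_const \<Phi>_mult)
  finally show ?case by (simp add: peval_def map_poly_pCons)
qed

lemma fls_const_map: "comm_ring_map (fls_const :: complex \<Rightarrow> complex fls)"
  by unfold_locales (simp_all add: fls_const_mult_const fls_plus_const)

end

context smooth_curve
begin

lemma Rat_peval2: "f \<in> Rat \<Longrightarrow> g \<in> Rat \<Longrightarrow> (\<lambda>P. peval (\<lambda>r. poly r (f P)) p (g P)) \<in> Rat"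
proof (induction p)
  case 0 show ?case using Rat_const[of 0] by (simp add: peval_def)
next
  case (pCons a p)
  have h: "comm_ring_map (\<lambda>r. poly r z)" for z :: complex by unfold_locales auto
  show ?case unfolding comm_ring_map.peval_pCons[OF h]
    by (intro Rat_add Rat_mult Rat_poly pCons)
qed

lemma \<Phi>_peval2:
  "f \<in> Rat \<Longrightarrow> g \<in> Rat \<Longrightarrow>
    \<Phi> (\<lambda>P. peval (\<lambda>r. poly r (f P)) p (g P)) = peval (\<lambda>c. peval fls_const c (\<Phi> f)) p (\<Phi> g)"
proof (induction p)
  case 0 show ?case using \<Phi>_const[of 0] by (simp add: peval_def)
next
  case (pCons a p)
  have h: "comm_ring_map (\<lambda>r. poly r z)" for z :: complex by unfold_locales auto
  interpret I: comm_ring_map "\<lambda>c. peval fls_const c (\<Phi> f)"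
    by (rule comm_ring_map.comm_ring_map_peval[OF fls_const_map])
  note R = Rat_peval2[OF pCons(3,4)]
  show ?case unfolding comm_ring_map.peval_pCons[OF h] I.peval_pCons
    by (subst \<Phi>_add[OF Rat_poly[OF pCons(3)] Rat_mult[OF pCons(4) R]])
      (simp only: \<Phi>_mult[OF pCons(4) R] \<Phi>_peval[OF pCons(3)] pCons(2)[OF pCons(3,4)])
qed

text \<open>
  A rational function is a quotient of germs at \<open>P\<close>, and these are units times powers of \<open>\<tau>\<close>.
\<close>

lemma Rat_order:
  assumes f: "f \<in> Rat" "\<not> f \<asymp> (\<lambda>_. 0)" and \<tau>: "local_parameter P \<tau>"
  shows "\<exists>k. \<exists>u. germ P u \<and> u P \<noteq> 0 \<and> f \<asymp> (\<lambda>Q. u Q * \<tau> Q powi k)"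
proof -
  have g: "germ P \<tau>" using \<tau> unfolding local_parameter_def by simp
  note P = germ_in_C[OF g] and \<tau>nz = Rat_nonzero[OF germ_Rat[OF g] local_parameter_nonzero[OF \<tau>]]
  from Rat_germ_quotient[OF f(1) P] obtain a b where
    ab: "germ P a" "germ P b" "\<not> b \<asymp> (\<lambda>_. 0)" "(\<lambda>Q. f Q * b Q) \<asymp> a" by (elim exE conjE)
  note bnz = Rat_nonzero[OF germ_Rat[OF ab(2)] ab(3)]
  have "eventually (\<lambda>Q. a Q \<noteq> 0) gen" using Rat_nonzero[OF f] bnz ab(4) by eventually_elim auto
  note anz = nonzero_not_geq_0[OF this]
  from germ_order[OF \<tau> ab(1) anz] obtain n u where
    u: "germ P u" "u P \<noteq> 0" "a \<asymp> (\<lambda>Q. u Q * \<tau> Q ^ n)" by (elim exE conjE)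
  from germ_order[OF \<tau> ab(2,3)] obtain m w where
    w: "germ P w" "w P \<noteq> 0" "b \<asymp> (\<lambda>Q. w Q * \<tau> Q ^ m)" by (elim exE conjE)
  have "f \<asymp> (\<lambda>Q. (u Q * inverse (w Q)) * \<tau> Q powi (int n - int m))"
    using ab(4) u(3) w(3) bnz \<tau>nz germ_nonzero[OF w(1,2)]
  proof eventually_elim
    case (elim Q)
    have "f Q = a Q / b Q" using elim(1,4) by (simp add: eq_divide_eq)
    also have "\<dots> = (u Q * inverse (w Q)) * (\<tau> Q ^ n / \<tau> Q ^ m)"
      unfolding elim(2,3) by (simp add: divide_inverse mult_ac)
    also have "\<tau> Q ^ n / \<tau> Q ^ m = \<tau> Q powi (int n - int m)"
      using elim(5) by (simp add: power_int_diff)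
    finally show ?case .
  qed
  moreover have "germ P (\<lambda>Q. u Q * inverse (w Q))" by (intro germ_mult germ_inverse u w)
  moreover have "u P * inverse (w P) \<noteq> 0" using u(2) w(2) by simp
  ultimately show ?thesis
    by (intro exI[of _ "int n - int m"] exI[of _ "\<lambda>Q. u Q * inverse (w Q)"] conjI)
qed

definition value_at :: "'n ppoint \<Rightarrow> complex fls \<Rightarrow> complex" where
  "value_at P k = (THE c. \<exists>f. germ P f \<and> \<Phi> f = k \<and> c = f P)"

lemma value_at: assumes "germ P f" shows "value_at P (\<Phi> f) = f P"
  unfolding value_at_def
proof (rule the_equality)
  show "\<exists>g. germ P g \<and> \<Phi> g = \<Phi> f \<and> f P = g P" using assms by (intro exI[of _ f]) simp
  fix c assume "\<exists>g. germ P g \<and> \<Phi> g = \<Phi> f \<and> c = g P"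
  then obtain g where g: "germ P g" "\<Phi> g = \<Phi> f" "c = g P" by (elim exE conjE)
  then have "g \<asymp> f" using \<Phi>_eq_iff[OF germ_Rat[OF g(1)] germ_Rat[OF assms]] by simp
  then show "c = f P" using germ_eqD[OF g(1) assms] g(3) by simp
qed

end

subsection \<open>Separation of points\<close>

lemma linear_form: "(\<lambda>v :: complex ^ 'n::finite. \<Sum>i\<in>UNIV. a i * vec_nth v i) \<in> forms 1"
  by (intro form_sum form_scale coordinate_form)

text \<open>
  A nonzero vector \<open>v\<close> defines a nonzero polynomial with the coordinates of \<open>v\<close> as coefficients. A number
  \<open>a\<close> that is not a root of any of the finitely many polynomials yields the form with coefficients
  \<open>1, a, a\<^sup>2, \<dots>\<close>.
\<close>

lemma linear_form_avoiding:
  assumes "finite S" "\<And>v. v \<in> S \<Longrightarrow> v \<noteq> (0 :: complex ^ 'n::finite)"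
  shows "\<exists>F\<in>forms 1. \<forall>v\<in>S. F v \<noteq> 0"
proof -
  obtain \<phi> :: "'n \<Rightarrow> nat" where \<phi>: "inj \<phi>"
    using finite_imp_inj_to_nat_seg[OF finite[of UNIV]] by blast
  define p where "p v = (\<Sum>i\<in>UNIV. Polynomial.monom (vec_nth v i) (\<phi> i))" for v :: "complex ^ 'n"
  have "p v \<noteq> 0" if "v \<in> S" for v
  proof
    assume p0: "p v = 0"
    have "vec_nth v j = poly.coeff (p v) (\<phi> j)" for j
    proof -
      have "poly.coeff (p v) (\<phi> j) = (\<Sum>i\<in>UNIV. if i = j then vec_nth v i else 0)"
        unfolding p_def coeff_sum by (intro sum.cong refl) (auto dest: injD[OF \<phi>])
      then show ?thesis by simp
    qed
    then have "v = 0" unfolding p0 by (simp add: vec_eq_iff)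
    then show False using assms(2)[OF that] by simp
  qed
  then have "finite (\<Union>v\<in>S. {a. poly (p v) a = 0})" using assms(1) by (auto intro: poly_roots_finite)
  then obtain a where a: "a \<notin> (\<Union>v\<in>S. {a. poly (p v) a = 0})"
    using ex_new_if_finite[OF infinite_UNIV_char_0] by blast
  have "poly (p v) a = (\<Sum>i\<in>UNIV. a ^ \<phi> i * vec_nth v i)" for v
    by (simp add: p_def poly_sum poly_monom mult.commute)
  then show ?thesis using a
    by (intro bexI[OF _ linear_form[of "\<lambda>i. a ^ \<phi> i"]]) auto
qed

lemma linear_form_separating:
  fixes v w :: "complex ^ 'n::finite"
  assumes "v \<noteq> 0" "w \<noteq> 0" "ppoint v \<noteq> ppoint w"
  shows "\<exists>F\<in>forms 1. F v = 0 \<and> F w \<noteq> 0"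
proof -
  obtain i where i: "vec_nth v i \<noteq> 0" using assms(1) by (auto simp: vec_eq_iff)
  have "\<exists>j. vec_nth v i * vec_nth w j \<noteq> vec_nth v j * vec_nth w i"
  proof (rule ccontr)
    assume "\<not> ?thesis"
    then have "vec_nth w j = (vec_nth w i / vec_nth v i) * vec_nth v j" for j
      using i by (simp add: nonzero_eq_divide_eq mult.commute)
    then obtain k where k: "\<And>j. vec_nth w j = k * vec_nth v j" by blast
    have w: "w = k *s v" using k by (simp add: vec_eq_iff)
    have "k \<noteq> 0"
    proof
      assume "k = 0"
      then have "w = 0" using k by (simp add: vec_eq_iff)
      then show False using assms(2) by contradiction
    qed
    then have "ppoint w = ppoint v" unfolding w by (rule ppoint_scale)
    then show False using assms(3) by simp
  qed
  then obtain j where j: "vec_nth v i * vec_nth w j \<noteq> vec_nth v j * vec_nth w i" by blast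
  define F where "F u = vec_nth v i * vec_nth u j + (- vec_nth v j) * vec_nth u i" for u :: "complex ^ 'n"
  have "F \<in> forms 1" unfolding F_def by (intro form_add form_scale coordinate_form)
  moreover have "F v = 0" "F w \<noteq> 0" using j by (simp_all add: F_def)
  ultimately show ?thesis by (intro bexI[of _ F] conjI)
qed

context projective_variety
begin

text \<open>
  The numerator is a product of linear forms, one through each of the other points but not through \<open>P\<close>; the
  denominator is a power of a linear form that vanishes at none of the points.
\<close>

lemma germ_separation:
  assumes S: "finite S" "S \<subseteq> C" and P: "P \<in> S"
  shows "\<exists>f. \<forall>Q\<in>S. germ Q f \<and> f Q = (if Q = P then 1 else 0)"
proof -
  have pk: "representative Q \<in> Q" "representative Q \<noteq> 0" "Q = ppoint (representative Q)" if "Q \<in> S" for Q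
  proof -
    have Q: "Q \<in> proj_space" using that S C_proj by blast
    show 1: "representative Q \<in> Q" unfolding representative_def by (rule someI_ex[OF ex_in_point[OF Q]])
    show "representative Q \<noteq> 0" "Q = ppoint (representative Q)" by (rule proj_spaceD[OF Q 1])+
  qed
  have "\<exists>F\<in>forms 1. \<forall>v\<in>representative ` S. F v \<noteq> 0"
    by (rule linear_form_avoiding) (use S(1) pk(2) in auto)
  then obtain L :: "complex ^ 'n \<Rightarrow> complex" where L: "L \<in> forms 1" "\<forall>v\<in>representative ` S. L v \<noteq> 0"
    by (elim bexE)
  have "\<exists>F. F \<in> forms 1 \<and> F (representative Q) = 0 \<and> F (representative P) \<noteq> 0" if Q: "Q \<in> S - {P}" for Q
  proof -
    have "ppoint (representative Q) \<noteq> ppoint (representative P)" using pk(3)[of Q] pk(3)[OF P] Q by auto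
    from linear_form_separating[OF pk(2) pk(2)[OF P] this] Q show ?thesis by (auto simp: Bex_def)
  qed
  then have "\<forall>Q\<in>S - {P}. \<exists>F. F \<in> forms 1 \<and> F (representative Q) = 0 \<and> F (representative P) \<noteq> 0" by (intro ballI)
  from bchoice[OF this] obtain M where M: "\<forall>Q\<in>S - {P}. M Q \<in> forms 1 \<and> M Q (representative Q) = 0 \<and> M Q (representative P) \<noteq> 0"
    by (elim exE)
  define n where "n = card (S - {P})"
  define F where "F v = (\<Prod>Q\<in>S - {P}. M Q v)" for v
  have F: "F \<in> forms n" unfolding F_def n_def using form_prod[of "S - {P}" M "\<lambda>_. 1"] M by simp
  define G where "G v = L v ^ n" for v
  have G: "G \<in> forms n" unfolding G_def using form_power[OF L(1), of n] by simp
  have FP: "F (representative P) \<noteq> 0" using M S(1) by (simp add: F_def)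
  have GQ: "G (representative Q) \<noteq> 0" if "Q \<in> S" for Q using L(2) that by (simp add: G_def)
  define c where "c = G (representative P) / F (representative P)"
  have cF: "(\<lambda>v. c * F v) \<in> forms n" by (rule form_scale[OF F])
  have "germ Q (form_quotient (\<lambda>v. c * F v) G) \<and> form_quotient (\<lambda>v. c * F v) G Q = (if Q = P then 1 else 0)" if Q: "Q \<in> S" for Q
  proof
    have QC: "Q \<in> C" using Q S by auto
    show "germ Q (form_quotient (\<lambda>v. c * F v) G)" by (rule form_quotient_germ[OF cF G QC pk(1)[OF Q] GQ[OF Q]])
    show "form_quotient (\<lambda>v. c * F v) G Q = (if Q = P then 1 else 0)"
    proof (cases "Q = P")
      case True
      then show ?thesis using FP GQ[OF P] by (simp add: form_quotient_def c_def)
    next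
      case False
      then have "F (representative Q) = 0" using M Q S(1) by (auto simp: F_def intro!: prod_zero)
      then show ?thesis using False by (simp add: form_quotient_def)
    qed
  qed
  then show ?thesis by (intro exI ballI)
qed

end

subsection \<open>Centres of valuation rings\<close>

context smooth_curve
begin

text \<open>
  The valuative criterion of properness for projective space. Among the ratios of coordinates one can
  choose the denominator \<open>j\<close> so that all \<open>x\<^sub>i / x\<^sub>j\<close> lie in the valuation ring; their residues are the
  coordinates of the centre \<open>P\<close>. The equations of \<open>C\<close> pass to the residues, so \<open>P\<close> is on \<open>C\<close>, and so do
  quotients of forms whose denominator does not vanish at \<open>P\<close>.
\<close>

lemma center_exists:
  assumes V: "subrg V" "V \<subseteq> \<Phi> ` Rat" "range fls_const \<subseteq> V"
    and val: "\<And>z. z \<in> \<Phi> ` Rat \<Longrightarrow> z \<in> V \<or> inverse z \<in> V"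
    and c_const: "\<And>a. c (fls_const a) = a"
    and c_hom: "\<And>a b. a \<in> V \<Longrightarrow> b \<in> V \<Longrightarrow> c (a + b) = c a + c b \<and> c (a * b) = c a * c b"
    and c_unit: "\<And>z. z \<in> V \<Longrightarrow> c z \<noteq> 0 \<Longrightarrow> inverse z \<in> V"
  shows "\<exists>P\<in>C. \<forall>f. germ P f \<longrightarrow> \<Phi> f \<in> V \<and> c (\<Phi> f) = f P"
proof -
  define coord where "coord i j = form_quotient (\<lambda>v. vec_nth v i) (\<lambda>v :: complex ^ 'n. vec_nth v j)" for i j
  \<comment> \<open>the coordinates that do not vanish identically on \<open>C\<close>\<close>
  define act where "act = {j. \<exists>P\<in>C. \<exists>v\<in>P. vec_nth v j \<noteq> 0}"
  have pickP: "representative P \<in> P" "representative P \<noteq> 0" if "P \<in> C" for P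
  proof -
    show 1: "representative P \<in> P" unfolding representative_def by (rule someI_ex[OF ex_in_point[OF C_proj[OF that]]])
    show "representative P \<noteq> 0" by (rule proj_spaceD(1)[OF C_proj[OF that] 1])
  qed
  have act_ev: "eventually (\<lambda>P. P \<in> C \<and> vec_nth (representative P) j \<noteq> 0) gen" if j: "j \<in> act" for j
  proof -
    from j obtain P v where P: "P \<in> C" "v \<in> P" "vec_nth v j \<noteq> 0" unfolding act_def by blast
    have "P \<in> {P \<in> C. \<forall>v\<in>P. vec_nth v j \<noteq> 0}"
      using form_nonzero_iff(1)[OF coordinate_form C_proj[OF P(1)] P(2), of j] P by simp
    from gen_open[OF zopen_nonvanishing[OF coordinate_form] this] show ?thesis
      by eventually_elim (use pickP(1) in blast)
  qed
  have coord_Rat: "coord i j \<in> Rat" if j: "j \<in> act" for i j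
  proof -
    from j obtain P v where P: "P \<in> C" "v \<in> P" "vec_nth v j \<noteq> 0" unfolding act_def by blast
    show ?thesis unfolding coord_def
      by (rule germ_Rat[OF form_quotient_germ[OF coordinate_form coordinate_form P]])
  qed
  have inactive: "\<Phi> (coord i j) = 0" if "i \<notin> act" "j \<in> act" for i j
  proof -
    have "coord i j \<asymp> (\<lambda>_. 0)"
      using act_ev[OF that(2)] by eventually_elim (use that(1) pickP(1) in \<open>auto simp: coord_def form_quotient_def act_def\<close>)
    then show ?thesis using \<Phi>_eq_0_iff[OF coord_Rat[OF that(2)]] by simp
  qed
  have coord_mult: "\<Phi> (coord i k) = \<Phi> (coord i j) * \<Phi> (coord j k)" if "j \<in> act" "k \<in> act" for i j k
  proof -
    have "coord i k \<asymp> (\<lambda>P. coord i j P * coord j k P)"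
      using act_ev[OF that(1)] by eventually_elim (simp add: coord_def form_quotient_def)
    then have "\<Phi> (coord i k) = \<Phi> (\<lambda>P. coord i j P * coord j k P)"
      using \<Phi>_eq_iff coord_Rat that Rat_mult by simp
    then show ?thesis using \<Phi>_mult[OF coord_Rat[OF that(1)] coord_Rat[OF that(2)]] by simp
  qed
  have coord_self: "\<Phi> (coord j j) = 1" if "j \<in> act" for j
  proof -
    have "coord j j \<asymp> (\<lambda>_. 1)" using act_ev[OF that] by eventually_elim (simp add: coord_def form_quotient_def)
    then have "\<Phi> (coord j j) = \<Phi> (\<lambda>_. 1)" using \<Phi>_eq_iff[OF coord_Rat[OF that] Rat_const] by simp
    then show ?thesis by (simp add: \<Phi>_const)
  qed
  \<comment> \<open>divisibility in a valuation ring is a total preorder, so there is a coordinate of least order\<close>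
  have max: "A \<noteq> {} \<Longrightarrow> A \<subseteq> act \<Longrightarrow> \<exists>j\<in>A. \<forall>i\<in>A. \<Phi> (coord i j) \<in> V" if "finite A" for A
    using that
  proof (induction A)
    case (insert a A)
    have aact: "a \<in> act" using insert.prems by simp
    have aa: "\<Phi> (coord a a) \<in> V" using coord_self[OF aact] subrgD(2)[OF V(1)] by simp
    show ?case
    proof (cases "A = {}")
      case True then show ?thesis using aa by simp
    next
      case False
      then obtain j where j: "j \<in> A" "\<forall>i\<in>A. \<Phi> (coord i j) \<in> V" using insert by auto
      have jact: "j \<in> act" using j insert.prems by auto
      show ?thesis
      proof (cases "\<Phi> (coord a j) \<in> V")
        case True then show ?thesis using j by auto
      next
        case False
        have "\<Phi> (coord a j) * \<Phi> (coord j a) = 1"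
          using coord_mult[OF jact aact, of a] coord_self[OF aact] by simp
        then have "inverse (\<Phi> (coord a j)) = \<Phi> (coord j a)" by (rule inverse_unique)
        then have ja: "\<Phi> (coord j a) \<in> V" using val[of "\<Phi> (coord a j)"] False coord_Rat[OF jact] by auto
        have "\<Phi> (coord i a) \<in> V" if "i \<in> A" for i
          unfolding coord_mult[OF jact aact, of i] using subrgD(6)[OF V(1)] j(2) that ja by blast
        then show ?thesis using aa by auto
      qed
    qed
  qed simp
  obtain P1 where P1: "P1 \<in> C" using C_nonempty by auto
  have "act \<noteq> {}"
  proof
    assume "act = {}"
    then have "representative P1 = 0" using P1 pickP(1)[OF P1] by (auto simp: act_def vec_eq_iff)
    then show False using pickP(2)[OF P1] by simp
  qed
  then obtain j where j: "j \<in> act" "\<forall>i\<in>act. \<Phi> (coord i j) \<in> V" using max[of act] by auto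
  have cV: "\<Phi> (coord i j) \<in> V" for i
    using j inactive[of i j] subrgD(1)[OF V(1)] by (cases "i \<in> act") auto
  define w where "w = (\<chi> i. c (\<Phi> (coord i j)))"
  have "vec_nth w j = 1" using coord_self[OF j(1)] c_const[of 1] by (simp add: w_def)
  then have w0: "w \<noteq> 0" by auto
  define P where "P = ppoint w"
  have Pproj: "P \<in> proj_space" and wP: "w \<in> P" unfolding P_def by (rule ppoint_in[OF w0], rule in_ppoint)
  \<comment> \<open>\<open>f\<close> lies in the valuation ring and has residue \<open>r\<close>\<close>
  define good where "good f r \<longleftrightarrow> f \<in> Rat \<and> \<Phi> f \<in> V \<and> c (\<Phi> f) = r" for f r
  have g_const: "good (\<lambda>_. a) a" for a
    unfolding good_def using Rat_const V(3) c_const by (auto simp: \<Phi>_const)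
  have g_add: "good (\<lambda>P. f P + g P) (r + s)" if "good f r" "good g s" for f g r s
    using that c_hom subrgD(3)[OF V(1)] unfolding good_def by (simp add: Rat_add \<Phi>_add)
  have g_mult: "good (\<lambda>P. f P * g P) (r * s)" if "good f r" "good g s" for f g r s
    using that c_hom subrgD(6)[OF V(1)] unfolding good_def by (simp add: Rat_mult \<Phi>_mult)
  have g_pow: "good (\<lambda>P. f P ^ n) (r ^ n)" if "good f r" for f r n
    by (induction n) (simp_all add: g_const g_mult that)
  have g_prod: "good (\<lambda>P. \<Prod>i\<in>A. f i P) (\<Prod>i\<in>A. r i)" if "\<And>i. good (f i) (r i)" for A :: "'n set" and f r
    by (induction A rule: infinite_finite_induct) (simp_all add: g_const g_mult that)
  have g_sum: "good (\<lambda>P. \<Sum>i\<in>A. f i P) (\<Sum>i\<in>A. r i)" if "\<And>i. good (f i) (r i)" for A :: "('n \<Rightarrow> nat) set" and f r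
    by (induction A rule: infinite_finite_induct) (simp_all add: g_const g_add that)
  have g_coord: "good (coord i j) (vec_nth w i)" for i
    unfolding good_def using coord_Rat[OF j(1)] cV by (simp add: w_def)
  have g_form: "good (\<lambda>P. F (\<chi> i. coord i j P)) (F w)" if F: "F \<in> forms d" for F d
  proof -
    obtain a where Fa: "F = (\<lambda>v. \<Sum>m\<in>{m. (\<Sum>i\<in>UNIV. m i) = d}. a m * (\<Prod>i\<in>UNIV. (vec_nth v i) ^ m i))"
      using F unfolding forms_def by auto
    show ?thesis unfolding Fa by (intro g_sum g_mult g_const) (simp add: g_prod g_pow g_coord)
  qed
  have form_dehom: "F (\<chi> i. coord i j Q) = F (representative Q) / vec_nth (representative Q) j ^ d"
    if F: "F \<in> forms d" and Q: "vec_nth (representative Q) j \<noteq> 0" for F d Q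
  proof -
    have "(\<chi> i. coord i j Q) = inverse (vec_nth (representative Q) j) *s representative Q"
      by (simp add: vec_eq_iff coord_def form_quotient_def divide_inverse mult.commute)
    then have "F (\<chi> i. coord i j Q) = inverse (vec_nth (representative Q) j) ^ d * F (representative Q)"
      using form_homogeneous[OF F] by simp
    then show ?thesis by (simp add: divide_inverse power_inverse mult.commute)
  qed
  obtain T where T: "T \<subseteq> (\<Union>d. forms d)" "C = {P \<in> proj_space. \<forall>F\<in>T. \<forall>v\<in>P. F v = 0}"
    using closed unfolding zclosed_def by auto
  have "P \<in> C"
  proof -
    have "F v = 0" if F: "F \<in> T" and v: "v \<in> P" for F v
    proof -
      obtain d where d: "F \<in> forms d" using F T(1) by auto
      have "(\<lambda>Q. F (\<chi> i. coord i j Q)) \<asymp> (\<lambda>_. 0)"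
        using act_ev[OF j(1)]
      proof eventually_elim
        case (elim Q)
        then have "F (representative Q) = 0" using T(2) F pickP(1) by blast
        then show ?case using form_dehom[OF d] elim by simp
      qed
      moreover have "good (\<lambda>Q. F (\<chi> i. coord i j Q)) (F w)" by (rule g_form[OF d])
      ultimately have "F w = c 0" unfolding good_def using \<Phi>_eq_0_iff by metis
      then have "F w = 0" using c_const[of 0] by simp
      then show ?thesis using form_nonzero_iff(2)[OF d Pproj wP] v by blast
    qed
    then show ?thesis using T(2) Pproj by blast
  qed
  moreover have "\<Phi> f \<in> V \<and> c (\<Phi> f) = f P" if f: "germ P f" for f
  proof -
    from f obtain U where U: "P \<in> U" "regular_on C U f" unfolding germ_def by (elim exE conjE)
    obtain W d F G where W: "P \<in> W" "W \<subseteq> U" "fraction_on W d F G f" using regular_onE[OF U(2,1)] .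
    note D = fraction_onD[OF W(3)]
    define N where "N H = (\<lambda>Q. H (\<chi> i. coord i j Q))" for H :: "complex ^ 'n \<Rightarrow> complex"
    have gF: "good (N F) (F w)" and gG: "good (N G) (G w)" unfolding N_def by (rule g_form[OF D(1)], rule g_form[OF D(2)])
    have Gw: "G w \<noteq> 0" and fP: "f P = F w / G w" using D(4,5)[OF W(1) wP] by auto
    have "(\<lambda>Q. f Q * N G Q) \<asymp> N F"
      using act_ev[OF j(1)] gen_open[OF D(3) W(1)]
    proof eventually_elim
      case (elim Q)
      have "G (representative Q) \<noteq> 0" "f Q = F (representative Q) / G (representative Q)"
        using D(4,5)[OF elim(2)] pickP(1) elim(1) by blast+
      then show ?case using elim(1) by (simp add: N_def form_dehom[OF D(1)] form_dehom[OF D(2)])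
    qed
    moreover have NR: "N F \<in> Rat" "N G \<in> Rat" using gF gG unfolding good_def by simp_all
    ultimately have "\<Phi> (\<lambda>Q. f Q * N G Q) = \<Phi> (N F)"
      by (simp only: \<Phi>_eq_iff[OF Rat_mult[OF germ_Rat[OF f] NR(2)] NR(1)])
    then have eq: "\<Phi> f * \<Phi> (N G) = \<Phi> (N F)" by (simp only: \<Phi>_mult[OF germ_Rat[OF f] NR(2)])
    have nz: "\<Phi> (N G) \<noteq> 0"
    proof
      assume "\<Phi> (N G) = 0"
      then have "G w = c 0" using gG unfolding good_def by simp
      then show False using Gw c_const[of 0] by simp
    qed
    have F': "\<Phi> (N F) \<in> V" "c (\<Phi> (N F)) = F w" and G': "\<Phi> (N G) \<in> V" "c (\<Phi> (N G)) = G w"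
      using gF gG unfolding good_def by simp_all
    have iV: "inverse (\<Phi> (N G)) \<in> V" by (rule c_unit[OF G'(1)]) (simp add: G'(2) Gw)
    have "\<Phi> f = \<Phi> f * \<Phi> (N G) * inverse (\<Phi> (N G))" using nz by simp
    then have "\<Phi> f = \<Phi> (N F) * inverse (\<Phi> (N G))" unfolding eq .
    then have fV: "\<Phi> f \<in> V" using subrgD(6)[OF V(1) F'(1) iV] by simp
    have "c (\<Phi> f * \<Phi> (N G)) = c (\<Phi> f) * G w" using c_hom[OF fV G'(1)] G'(2) by simp
    then have "c (\<Phi> f) * G w = F w" unfolding eq F'(2) by simp
    then have "c (\<Phi> f) = f P" unfolding fP using Gw by (simp add: eq_divide_eq)
    then show ?thesis using fV by (intro conjI)
  qed
  ultimately show ?thesis by blast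
qed

text \<open>
  The charts are the usual affine ones, where the quotients of the coordinates determine the point.
\<close>

lemma coordinate_charts:
  "\<exists>Xs. finite Xs \<and> C = \<Union>Xs \<and> (\<forall>Y\<in>Xs. \<exists>\<Xi>. finite \<Xi> \<and> \<Xi> \<subseteq> Rat \<and>
      (\<forall>P\<in>Y. \<forall>f\<in>\<Xi>. germ P f) \<and> (\<forall>P\<in>Y. \<forall>Q\<in>Y. (\<forall>f\<in>\<Xi>. f P = f Q) \<longrightarrow> P = Q))"
proof -
  define Y where "Y j = {P \<in> C. \<forall>v\<in>P. vec_nth v j \<noteq> 0}" for j :: 'n
  have pickP: "representative P \<in> P" "representative P \<noteq> 0" if "P \<in> C" for P
  proof -
    show 1: "representative P \<in> P" unfolding representative_def by (rule someI_ex[OF ex_in_point[OF C_proj[OF that]]])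
    show "representative P \<noteq> 0" by (rule proj_spaceD(1)[OF C_proj[OF that] 1])
  qed
  define crd where "crd j i = form_quotient (\<lambda>v. vec_nth v i) (\<lambda>v :: complex ^ 'n. vec_nth v j)" for i j
  have gm: "germ P (crd j i)" if "P \<in> Y j" for P i j
  proof -
    have P: "P \<in> C" "vec_nth (representative P) j \<noteq> 0" using that pickP(1) by (auto simp: Y_def)
    show ?thesis unfolding crd_def by (rule form_quotient_germ[OF coordinate_form coordinate_form P(1) pickP(1)[OF P(1)] P(2)])
  qed
  have eqP: "P = Q" if PQ: "P \<in> Y j" "Q \<in> Y j" "\<forall>f\<in>range (crd j). f P = f Q" for P Q j
  proof -
    have PC: "P \<in> C" "vec_nth (representative P) j \<noteq> 0" and QC: "Q \<in> C" "vec_nth (representative Q) j \<noteq> 0"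
      using PQ pickP(1) by (auto simp: Y_def)
    define b where "b = vec_nth (representative P) j / vec_nth (representative Q) j"
    have "vec_nth (representative P) i = b * vec_nth (representative Q) i" for i
    proof -
      have "crd j i P = crd j i Q" using PQ(3) by blast
      then have "vec_nth (representative P) i / vec_nth (representative P) j = vec_nth (representative Q) i / vec_nth (representative Q) j"
        by (simp only: crd_def form_quotient_def)
      then have "vec_nth (representative P) i / vec_nth (representative P) j * vec_nth (representative P) j
          = vec_nth (representative Q) i / vec_nth (representative Q) j * vec_nth (representative P) j" by (simp only:)
      then show ?thesis using PC(2) by (simp add: b_def mult.commute)
    qed
    then have "representative P = b *s representative Q" by (simp add: vec_eq_iff)
    moreover have "b \<noteq> 0" using PC(2) QC(2) by (simp add: b_def)
    ultimately have "ppoint (representative P) = ppoint (representative Q)" using ppoint_scale by metis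
    then show ?thesis
      using proj_spaceD(2)[OF C_proj[OF PC(1)] pickP(1)[OF PC(1)]] proj_spaceD(2)[OF C_proj[OF QC(1)] pickP(1)[OF QC(1)]]
      by metis
  qed
  have cov: "C = \<Union>(Y ` UNIV)"
  proof
    show "C \<subseteq> \<Union>(Y ` UNIV)"
    proof
      fix P assume P: "P \<in> C"
      obtain j where "vec_nth (representative P) j \<noteq> 0" using pickP(2)[OF P] by (auto simp: vec_eq_iff)
      then have "P \<in> Y j"
        unfolding Y_def using form_nonzero_iff(1)[OF coordinate_form C_proj[OF P] pickP(1)[OF P], of j] P by simp
      then show "P \<in> \<Union>(Y ` UNIV)" by blast
    qed
  qed (auto simp: Y_def)
  have "\<exists>\<Xi>. finite \<Xi> \<and> \<Xi> \<subseteq> Rat \<and> (\<forall>P\<in>Y j. \<forall>f\<in>\<Xi>. germ P f) \<and>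
      (\<forall>P\<in>Y j. \<forall>Q\<in>Y j. (\<forall>f\<in>\<Xi>. f P = f Q) \<longrightarrow> P = Q)" for j
  proof (cases "Y j = {}")
    case True
    then show ?thesis by (intro exI[of _ "{}"]) auto
  next
    case False
    then have "range (crd j) \<subseteq> Rat" using gm germ_Rat by blast
    then show ?thesis using gm eqP by (intro exI[of _ "range (crd j)"] conjI) (simp, assumption, blast, blast)
  qed
  then show ?thesis using cov by (intro exI[of _ "Y ` UNIV"]) auto
qed

sublocale PF: point_field "\<Phi> ` Rat" fls_const C "\<lambda>P. \<Phi> ` Collect (germ P)" value_at "\<lambda>P. \<Phi> (parameter P)"
proof (rule point_field.intro)
  show "comm_ring_map (fls_const :: complex \<Rightarrow> complex fls)" by (rule fls_const_map)
  show "subrg (\<Phi> ` Rat)"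
    unfolding subrg_def
    by (auto simp flip: \<Phi>_diff \<Phi>_mult intro: Rat_diff Rat_mult)
      (metis Rat_const \<Phi>_const fls_const_1 image_eqI)
  show "inverse a \<in> \<Phi> ` Rat" if "a \<in> \<Phi> ` Rat" for a
    using that Rat_inverse by (auto simp flip: \<Phi>_inverse)
  show "\<exists>p. p \<noteq> 0 \<and> peval (\<lambda>c. peval fls_const c a) p b = 0" if ab: "a \<in> \<Phi> ` Rat" "b \<in> \<Phi> ` Rat" for a b
  proof -
    obtain f g where fg: "f \<in> Rat" "g \<in> Rat" "a = \<Phi> f" "b = \<Phi> g" using ab by blast
    from two_variable_relation[OF fg(1,2)] obtain q where q: "q \<noteq> 0"
      "(\<lambda>P. peval (\<lambda>r. poly r (f P)) q (g P)) \<asymp> (\<lambda>_. 0)" by (elim exE conjE)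
    then have "\<Phi> (\<lambda>P. peval (\<lambda>r. poly r (f P)) q (g P)) = 0" using \<Phi>_eq_0_iff[OF Rat_peval2[OF fg(1,2)]] by simp
    then show ?thesis using q(1) unfolding \<Phi>_peval2[OF fg(1,2)] fg(3,4) by (intro exI[of _ q] conjI)
  qed
  show "C \<noteq> {}" by (rule C_nonempty)
  fix P assume P: "P \<in> C"
  show "subrg (\<Phi> ` Collect (germ P))"
    unfolding subrg_def
  proof (intro conjI ballI)
    show "1 \<in> \<Phi> ` Collect (germ P)" using germ_const[OF P, of 1] \<Phi>_const[of 1] by (metis fls_const_1 image_eqI mem_Collect_eq)
    fix a b assume "a \<in> \<Phi> ` Collect (germ P)" "b \<in> \<Phi> ` Collect (germ P)"
    then obtain f g where fg: "germ P f" "germ P g" "a = \<Phi> f" "b = \<Phi> g" by blast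
    show "a - b \<in> \<Phi> ` Collect (germ P)"
      unfolding fg \<Phi>_diff[OF germ_Rat[OF fg(1)] germ_Rat[OF fg(2)], symmetric] using germ_diff[OF fg(1,2)] by blast
    show "a * b \<in> \<Phi> ` Collect (germ P)"
      unfolding fg \<Phi>_mult[OF germ_Rat[OF fg(1)] germ_Rat[OF fg(2)], symmetric] using germ_mult[OF fg(1,2)] by blast
  qed
  show "\<Phi> ` Collect (germ P) \<subseteq> \<Phi> ` Rat" using germ_Rat by blast
  show "fls_const c \<in> \<Phi> ` Collect (germ P)" for c
    unfolding \<Phi>_const[symmetric] using germ_const[OF P] by blast
  show "value_at P (fls_const c) = c" for c
    unfolding \<Phi>_const[symmetric] by (rule value_at[OF germ_const[OF P]])
  show "\<Phi> (parameter P) \<in> \<Phi> ` Collect (germ P)" using parameterD(1)[OF P] by blast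
  show "\<Phi> (parameter P) \<noteq> 0"
    using \<Phi>_eq_0_iff[OF germ_Rat[OF parameterD(1)[OF P]]] nonzero_not_geq_0[OF parameterD(3)[OF P]] by simp
  show "value_at P (\<Phi> (parameter P)) = 0" using value_at[OF parameterD(1)[OF P]] parameterD(2)[OF P] by simp
  show "value_at P (a + b) = value_at P a + value_at P b" "value_at P (a * b) = value_at P a * value_at P b"
    if ab: "a \<in> \<Phi> ` Collect (germ P)" "b \<in> \<Phi> ` Collect (germ P)" for a b
  proof -
    obtain f g where fg: "germ P f" "germ P g" "a = \<Phi> f" "b = \<Phi> g" using ab by blast
    show "value_at P (a + b) = value_at P a + value_at P b" unfolding fg
      by (simp only: \<Phi>_add[OF germ_Rat[OF fg(1)] germ_Rat[OF fg(2)], symmetric] value_at fg(1,2) germ_add)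
    show "value_at P (a * b) = value_at P a * value_at P b" unfolding fg
      by (simp only: \<Phi>_mult[OF germ_Rat[OF fg(1)] germ_Rat[OF fg(2)], symmetric] value_at fg(1,2) germ_mult)
  qed
  show "inverse a \<in> \<Phi> ` Collect (germ P)" if a: "a \<in> \<Phi> ` Collect (germ P)" "value_at P a \<noteq> 0" for a
  proof -
    obtain f where f: "germ P f" "a = \<Phi> f" using a by blast
    then have "germ P (\<lambda>Q. inverse (f Q))" using a(2) value_at[OF f(1)] germ_inverse by simp
    then show ?thesis unfolding f(2) \<Phi>_inverse[OF germ_Rat[OF f(1)], symmetric] by blast
  qed
  show "\<exists>n. \<exists>u\<in>\<Phi> ` Collect (germ P). value_at P u \<noteq> 0 \<and> a = u * \<Phi> (parameter P) powi n"
    if a: "a \<in> \<Phi> ` Rat" "a \<noteq> 0" for a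
  proof -
    obtain f where f: "f \<in> Rat" "a = \<Phi> f" using a by blast
    have nz: "\<not> f \<asymp> (\<lambda>_. 0)" using \<Phi>_eq_0_iff[OF f(1)] a(2) f(2) by simp
    from Rat_order[OF f(1) nz parameter[OF P]] obtain k u where u: "germ P u" "u P \<noteq> 0" "f \<asymp> (\<lambda>Q. u Q * parameter P Q powi k)"
      by (elim exE conjE)
    note pR = germ_Rat[OF parameterD(1)[OF P]] and uR = germ_Rat[OF u(1)]
    have "a = \<Phi> u * \<Phi> (parameter P) powi k"
      using u(3) unfolding f(2) \<Phi>_powi[OF pR, symmetric] \<Phi>_mult[OF uR Rat_powi[OF pR], symmetric]
      by (simp only: \<Phi>_eq_iff[OF f(1) Rat_mult[OF uR Rat_powi[OF pR]]])
    then show ?thesis using u(1,2) value_at[OF u(1)] by (intro exI[of _ k] bexI[of _ "\<Phi> u"] conjI) auto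
  qed
next
  fix V c
  assume V: "subrg V" "V \<subseteq> \<Phi> ` Rat" "range fls_const \<subseteq> V" "\<And>z. z \<in> \<Phi> ` Rat \<Longrightarrow> z \<in> V \<or> inverse z \<in> V"
    "\<And>a. c (fls_const a) = a" "\<And>a b. a \<in> V \<Longrightarrow> b \<in> V \<Longrightarrow> c (a + b) = c a + c b \<and> c (a * b) = c a * c b"
    "\<And>z. z \<in> V \<Longrightarrow> c z \<noteq> 0 \<Longrightarrow> inverse z \<in> V"
  have "\<exists>P\<in>C. \<forall>f. germ P f \<longrightarrow> \<Phi> f \<in> V \<and> c (\<Phi> f) = f P" by (rule center_exists[OF V])
  then obtain P where P: "P \<in> C" "\<forall>f. germ P f \<longrightarrow> \<Phi> f \<in> V \<and> c (\<Phi> f) = f P" by blast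
  show "\<exists>P\<in>C. \<forall>a\<in>\<Phi> ` Collect (germ P). a \<in> V \<and> c a = value_at P a"
    using P by (intro bexI[OF _ P(1)]) (auto simp: value_at)
next
  fix S P assume S: "finite S" "S \<subseteq> C" "P \<in> S"
  from germ_separation[OF S] obtain f where f: "\<forall>Q\<in>S. germ Q f \<and> f Q = (if Q = P then 1 else 0)" by (elim exE)
  then show "\<exists>a. \<forall>Q\<in>S. a \<in> \<Phi> ` Collect (germ Q) \<and> value_at Q a = (if Q = P then 1 else 0)"
    by (intro exI[of _ "\<Phi> f"]) (auto simp: value_at)
next
  from coordinate_charts obtain Xs where Xs: "finite Xs" "C = \<Union>Xs"
    "\<forall>Y\<in>Xs. \<exists>\<Xi>. finite \<Xi> \<and> \<Xi> \<subseteq> Rat \<and> (\<forall>P\<in>Y. \<forall>f\<in>\<Xi>. germ P f) \<and>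
      (\<forall>P\<in>Y. \<forall>Q\<in>Y. (\<forall>f\<in>\<Xi>. f P = f Q) \<longrightarrow> P = Q)" by (elim exE conjE)
  have "\<exists>\<Xi>. finite \<Xi> \<and> \<Xi> \<subseteq> \<Phi> ` Rat \<and> (\<forall>P\<in>Y. \<Xi> \<subseteq> \<Phi> ` Collect (germ P)) \<and>
      (\<forall>P\<in>Y. \<forall>Q\<in>Y. (\<forall>\<xi>\<in>\<Xi>. value_at P \<xi> = value_at Q \<xi>) \<longrightarrow> P = Q)" if Y: "Y \<in> Xs" for Y
  proof -
    from bspec[OF Xs(3) Y] obtain \<Xi> where \<Xi>: "finite \<Xi>" "\<Xi> \<subseteq> Rat" "\<forall>P\<in>Y. \<forall>f\<in>\<Xi>. germ P f"
      "\<forall>P\<in>Y. \<forall>Q\<in>Y. (\<forall>f\<in>\<Xi>. f P = f Q) \<longrightarrow> P = Q" by (elim exE conjE)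
    have "P = Q" if PQ: "P \<in> Y" "Q \<in> Y" "\<forall>\<xi>\<in>\<Phi> ` \<Xi>. value_at P \<xi> = value_at Q \<xi>" for P Q
    proof -
      have "f P = f Q" if "f \<in> \<Xi>" for f
        using PQ(3) that value_at[of P f] value_at[of Q f] \<Xi>(3) PQ(1,2) by auto
      then show ?thesis using \<Xi>(4) PQ(1,2) by blast
    qed
    moreover have "\<forall>P\<in>Y. \<Phi> ` \<Xi> \<subseteq> \<Phi> ` Collect (germ P)" using \<Xi>(3) by blast
    ultimately show ?thesis using \<Xi>(1,2) by (intro exI[of _ "\<Phi> ` \<Xi>"] conjI ballI impI) auto
  qed
  then show "\<exists>Xs. finite Xs \<and> C = \<Union>Xs \<and> (\<forall>Y\<in>Xs. \<exists>\<Xi>. finite \<Xi> \<and> \<Xi> \<subseteq> \<Phi> ` Rat \<and>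
      (\<forall>P\<in>Y. \<Xi> \<subseteq> \<Phi> ` Collect (germ P)) \<and> (\<forall>P\<in>Y. \<forall>Q\<in>Y. (\<forall>\<xi>\<in>\<Xi>. value_at P \<xi> = value_at Q \<xi>) \<longrightarrow> P = Q))"
    using Xs(1,2) by (intro exI[of _ Xs] conjI ballI)
qed

end

section \<open>Orders of rational functions\<close>

context smooth_curve
begin

text \<open>
  The powers of \<open>t\<close> start from the unit of the function field, so they only involve products of \<open>t\<close> with
  elements of the field.
\<close>

lemma uniformizer_power:
  assumes t: "\<And>f. f \<in> Rat \<Longrightarrow> cls f \<otimes>\<^bsub>FF\<^esub> t = cls (\<lambda>Q. f Q * \<tau> Q)"
    and \<tau>: "\<tau> \<in> Rat" "\<not> \<tau> \<asymp> (\<lambda>_. 0)"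
  shows "t [^]\<^bsub>FF\<^esub> (k::int) = cls (\<lambda>Q. \<tau> Q powi k)"
proof -
  have pow: "t [^]\<^bsub>FF\<^esub> (n::nat) = cls \<tau> [^]\<^bsub>FF\<^esub> n" for n
  proof (induction n)
    case (Suc n)
    have "t [^]\<^bsub>FF\<^esub> Suc n = t [^]\<^bsub>FF\<^esub> n \<otimes>\<^bsub>FF\<^esub> t" by simp
    also have "\<dots> = cls (\<lambda>Q. \<tau> Q ^ n) \<otimes>\<^bsub>FF\<^esub> t" unfolding Suc.IH pow_FF[OF \<tau>(1)] ..
    also have "\<dots> = cls (\<lambda>Q. \<tau> Q ^ n * \<tau> Q)" by (rule t[OF Rat_power[OF \<tau>(1)]])
    also have "\<dots> = cls \<tau> [^]\<^bsub>FF\<^esub> Suc n" unfolding pow_FF[OF \<tau>(1)] by (simp add: mult.commute)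
    finally show ?case .
  qed simp
  have "t [^]\<^bsub>FF\<^esub> k = cls \<tau> [^]\<^bsub>FF\<^esub> k" unfolding int_pow_def2 pow ..
  then show ?thesis unfolding int_pow_FF[OF \<tau>] .
qed

lemma val_germ: "germ P u \<Longrightarrow> u P \<noteq> 0 \<Longrightarrow> PF.val P (\<Phi> u) = 0"
  by (rule PF.val_eqI[of P "\<Phi> u"]) (auto simp: germ_in_C value_at)

lemma val_local_parameter:
  assumes "local_parameter P \<tau>" shows "PF.val P (\<Phi> \<tau>) = 1"
proof -
  have g: "germ P \<tau>" "\<tau> P = 0" using assms by (simp_all add: local_parameter_def)
  note P = germ_in_C[OF g(1)]
  from parameterD(4)[OF P g] obtain a where a: "germ P a" "\<tau> \<asymp> (\<lambda>Q. a Q * parameter P Q)" by (elim exE conjE)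
  have "\<exists>b. germ P b \<and> parameter P \<asymp> (\<lambda>Q. b Q * \<tau> Q)"
    using assms parameterD(1,2)[OF P] unfolding local_parameter_def by simp
  then obtain b where b: "germ P b" "parameter P \<asymp> (\<lambda>Q. b Q * \<tau> Q)" by (elim exE conjE)
  have "(\<lambda>Q. a Q * b Q) \<asymp> (\<lambda>_. 1)"
    using a(2) b(2) Rat_nonzero[OF germ_Rat[OF g(1)] local_parameter_nonzero[OF assms]]
  proof eventually_elim
    case (elim Q)
    have "\<tau> Q = a Q * (b Q * \<tau> Q)" using elim(1) unfolding elim(2) .
    then have "(a Q * b Q) * \<tau> Q = 1 * \<tau> Q" by (simp only: mult.assoc mult_1)
    then show ?case using elim(3) by (simp only: mult_cancel_right) simp
  qed
  from germ_eqD[OF germ_mult[OF a(1) b(1)] germ_const[OF P] this] have aP: "a P \<noteq> 0" by auto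
  have "\<Phi> \<tau> = \<Phi> a * \<Phi> (parameter P)"
    using a(2) germ_Rat[OF g(1)] germ_Rat[OF a(1)] germ_Rat[OF parameterD(1)[OF P]]
    by (simp only: \<Phi>_mult[symmetric] \<Phi>_eq_iff Rat_mult)
  then show ?thesis
    using a(1) aP by (intro PF.val_eqI[OF P, of "\<Phi> a"]) (auto simp: value_at)
qed

lemma val_unit_times_power:
  assumes \<tau>: "local_parameter P \<tau>" and u: "germ P u" "u P \<noteq> 0"
  shows "PF.val P (\<Phi> u * \<Phi> \<tau> powi k) = k"
proof -
  have g: "germ P \<tau>" using \<tau> by (simp add: local_parameter_def)
  note P = germ_in_C[OF g] and \<tau>R = germ_Rat[OF g]
  have nz: "\<Phi> \<tau> \<noteq> 0" "\<Phi> u \<noteq> 0"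
    using \<Phi>_eq_0_iff[OF \<tau>R] local_parameter_nonzero[OF \<tau>]
      \<Phi>_eq_0_iff[OF germ_Rat[OF u(1)]] nonzero_not_geq_0[OF germ_nonzero[OF u]] by simp_all
  have K: "\<Phi> \<tau> \<in> \<Phi> ` Rat" "\<Phi> u \<in> \<Phi> ` Rat" using \<tau>R germ_Rat[OF u(1)] by simp_all
  have "PF.val P (\<Phi> \<tau> powi k) = k"
  proof (cases "k \<ge> 0")
    case True
    then show ?thesis using PF.val_power[OF P K(1) nz(1), of "nat k"] val_local_parameter[OF \<tau>] by (simp add: power_int_def)
  next
    case False
    then show ?thesis
      using PF.val_power[OF P PF.K_inverse[OF K(1)], of "nat (- k)"] PF.val_inverse[OF P K(1) nz(1)] nz(1) val_local_parameter[OF \<tau>]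
      by (simp add: power_int_def)
  qed
  then show ?thesis using PF.val_mult[OF P K(2) PF.K_powi[OF K(1)]] nz val_germ[OF u] by simp
qed

text \<open>
  Both sides are the exponent in a presentation as a unit times a power of a uniformizer. The uniformizers
  may differ, but all have valuation 1.
\<close>

lemma ord_at_eq_val:
  assumes f: "f \<in> Rat" "\<not> f \<asymp> (\<lambda>_. 0)" and P: "P \<in> C"
  shows "ord_at C P (cls f) = PF.val P (\<Phi> f)"
  unfolding ord_at_def
proof (rule the_equality)
  from smooth[OF P] obtain t where t: "uniformizer C P t" by (elim exE)
  from uniformizerD[OF P t] obtain \<tau> where
    \<tau>: "local_parameter P \<tau>" "\<forall>f\<in>Rat. cls f \<otimes>\<^bsub>FF\<^esub> t = cls (\<lambda>Q. f Q * \<tau> Q)" by (elim exE conjE)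
  have \<tau>R: "\<tau> \<in> Rat" using \<tau>(1) unfolding local_parameter_def by (elim conjE) (rule germ_Rat)
  from Rat_order[OF f \<tau>(1)] obtain k u where u: "germ P u" "u P \<noteq> 0" "f \<asymp> (\<lambda>Q. u Q * \<tau> Q powi k)" by (elim exE conjE)
  note uR = germ_Rat[OF u(1)] and pR = Rat_powi[OF \<tau>R]
  have "\<Phi> f = \<Phi> u * \<Phi> \<tau> powi k"
    unfolding \<Phi>_powi[OF \<tau>R, symmetric] \<Phi>_mult[OF uR pR, symmetric]
    using u(3) by (simp only: \<Phi>_eq_iff[OF f(1) Rat_mult[OF uR pR]])
  then have k: "PF.val P (\<Phi> f) = k" using val_unit_times_power[OF \<tau>(1) u(1,2)] by simp
  have "t [^]\<^bsub>FF\<^esub> k = cls (\<lambda>Q. \<tau> Q powi k)"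
    by (rule uniformizer_power[OF _ \<tau>R local_parameter_nonzero[OF \<tau>(1)]]) (use \<tau>(2) in blast)
  then have "cls u \<otimes>\<^bsub>FF\<^esub> t [^]\<^bsub>FF\<^esub> k = cls (\<lambda>Q. u Q * \<tau> Q powi k)" by (simp only: mult_FF[OF uR pR])
  then have eq: "cls f = cls u \<otimes>\<^bsub>FF\<^esub> t [^]\<^bsub>FF\<^esub> k" using cls_cong[OF u(3) f(1)] by simp
  have "cls u \<in> local_ring C P" unfolding local_ring_iff using u(1) by (intro exI[of _ u] conjI) auto
  moreover have "cls u \<notin> maximal_ideal_at C P"
  proof
    assume "cls u \<in> maximal_ideal_at C P"
    then obtain g where g: "germ P g" "g P = 0" "cls u = cls g" unfolding maximal_ideal_iff by (elim exE conjE)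
    then show False using germ_eqD[OF u(1) g(1)] cls_eq_iff[OF uR germ_Rat[OF g(1)]] u(2) by simp
  qed
  ultimately show "\<exists>t u. uniformizer C P t \<and> u \<in> local_ring C P - maximal_ideal_at C P \<and>
      cls f = u \<otimes>\<^bsub>FF\<^esub> t [^]\<^bsub>FF\<^esub> PF.val P (\<Phi> f)"
    unfolding k using t eq by (intro exI[of _ t] exI[of _ "cls u"] conjI DiffI)
next
  fix k :: int assume "\<exists>t u. uniformizer C P t \<and> u \<in> local_ring C P - maximal_ideal_at C P \<and>
      cls f = u \<otimes>\<^bsub>FF\<^esub> t [^]\<^bsub>FF\<^esub> k"
  then obtain t a where ta: "uniformizer C P t" "a \<in> local_ring C P" "a \<notin> maximal_ideal_at C P"
    "cls f = a \<otimes>\<^bsub>FF\<^esub> t [^]\<^bsub>FF\<^esub> k" by (elim exE conjE DiffE)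
  from ta(2) obtain u where u: "germ P u" "a = cls u" unfolding local_ring_iff by (elim exE conjE)
  have uP: "u P \<noteq> 0"
  proof
    assume "u P = 0"
    then have "a \<in> maximal_ideal_at C P" unfolding maximal_ideal_iff using u by (intro exI[of _ u] conjI)
    then show False using ta(3) by contradiction
  qed
  from uniformizerD[OF P ta(1)] obtain \<tau> where
    \<tau>: "local_parameter P \<tau>" "\<forall>f\<in>Rat. cls f \<otimes>\<^bsub>FF\<^esub> t = cls (\<lambda>Q. f Q * \<tau> Q)" by (elim exE conjE)
  have \<tau>R: "\<tau> \<in> Rat" using \<tau>(1) unfolding local_parameter_def by (elim conjE) (rule germ_Rat)
  note uR = germ_Rat[OF u(1)] and pR = Rat_powi[OF \<tau>R]
  have "t [^]\<^bsub>FF\<^esub> k = cls (\<lambda>Q. \<tau> Q powi k)"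
    by (rule uniformizer_power[OF _ \<tau>R local_parameter_nonzero[OF \<tau>(1)]]) (use \<tau>(2) in blast)
  then have "cls f = cls (\<lambda>Q. u Q * \<tau> Q powi k)" unfolding ta(4) u(2) by (simp only: mult_FF[OF uR pR])
  then have "f \<asymp> (\<lambda>Q. u Q * \<tau> Q powi k)" by (simp only: cls_eq_iff[OF f(1) Rat_mult[OF uR pR]])
  then have "\<Phi> f = \<Phi> u * \<Phi> \<tau> powi k"
    unfolding \<Phi>_powi[OF \<tau>R, symmetric] \<Phi>_mult[OF uR pR, symmetric]
    by (simp only: \<Phi>_eq_iff[OF f(1) Rat_mult[OF uR pR]])
  then show "k = PF.val P (\<Phi> f)" using val_unit_times_power[OF \<tau>(1) u(1) uP] by simp
qed

end

section \<open>Maps to the projective line\<close>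

definition hpair :: "complex \<Rightarrow> complex \<Rightarrow> complex ^ 2" where
  "hpair a b = (\<chi> k. if k = 1 then a else b)"

lemma hpair_nth [simp]: "vec_nth (hpair a b) 1 = a" "vec_nth (hpair a b) 2 = b"
  by (simp_all add: hpair_def)

lemma hpair_eq_0: "hpair a b = 0 \<longleftrightarrow> a = 0 \<and> b = 0"
  by (simp add: vec_eq_iff forall_2)

lemma hpair_scale: "c *s hpair a b = hpair (c * a) (c * b)"
  by (simp add: vec_eq_iff forall_2)

lemma ppoint_hpair_scale: "c \<noteq> 0 \<Longrightarrow> ppoint (hpair (c * a) (c * b)) = ppoint (hpair a b)"
  by (metis hpair_scale ppoint_scale)

lemma form_on_line:
  assumes "F \<in> forms d" shows "\<exists>p. \<forall>x. F (hpair x 1) = poly p x"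
proof -
  obtain a where Fa: "F = (\<lambda>v. \<Sum>m\<in>{m. (\<Sum>i\<in>UNIV. m i) = d}. a m * (\<Prod>i\<in>UNIV. (vec_nth v i) ^ m i))"
    using assms unfolding forms_def by auto
  show ?thesis
    by (rule exI[of _ "\<Sum>m\<in>{m. (\<Sum>i\<in>UNIV. m i) = d}. Polynomial.monom (a m) (m 1)"])
      (simp add: Fa poly_sum poly_monom UNIV_2 prod.insert)
qed

text \<open>
  In the affine coordinate \<open>x\<close> of the line, the forms of degree \<open>n\<close> are the polynomials of degree at most
  \<open>n\<close>.
\<close>

definition homogenise :: "nat \<Rightarrow> complex poly \<Rightarrow> complex ^ 2 \<Rightarrow> complex" where
  "homogenise n p v = (\<Sum>i\<le>n. poly.coeff p i * (vec_nth v 1 ^ i * vec_nth v 2 ^ (n - i)))"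

lemma homogenise_form: "homogenise n p \<in> forms n"
proof -
  have "(\<lambda>v :: complex ^ 2. vec_nth v 1 ^ i * vec_nth v 2 ^ (n - i)) \<in> forms n" if "i \<le> n" for i
    using form_mult[OF form_power[OF coordinate_form[of "1::2"], where n = i] form_power[OF coordinate_form[of "2::2"], where n = "n - i"]] that
    by simp
  then show ?thesis unfolding homogenise_def by (intro form_sum form_scale) auto
qed

lemma homogenise_eq: "Polynomial.degree p \<le> n \<Longrightarrow> homogenise n p (hpair x 1) = poly p x"
  by (simp add: homogenise_def poly_eq_sum_le)

context smooth_curve
begin

text \<open>
  The map \<open>(f : 1)\<close>, which has to be written as \<open>(1 : 1 / f)\<close> at the poles of \<open>f\<close>.
\<close>

definition to_line :: "('n ppoint \<Rightarrow> complex) \<Rightarrow> 'n ppoint \<Rightarrow> 2 ppoint" where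
  "to_line f P = ppoint (if \<Phi> f \<in> \<Phi> ` Collect (germ P) then hpair (value_at P (\<Phi> f)) 1
     else hpair 1 (value_at P (inverse (\<Phi> f))))"

lemma in_germ_image: "germ P a \<Longrightarrow> f \<in> Rat \<Longrightarrow> f \<asymp> a \<Longrightarrow> \<Phi> f \<in> \<Phi> ` Collect (germ P) \<and> value_at P (\<Phi> f) = a P"
  using \<Phi>_eq_iff[of f a] germ_Rat[of P a] value_at[of P a] by auto

lemma to_line_finite:
  assumes "f \<in> Rat" "germ P a" "f \<asymp> a" shows "to_line f P = ppoint (hpair (a P) 1)"
  using in_germ_image[OF assms(2,1,3)] by (simp add: to_line_def)

lemma to_line_infinite:
  assumes f: "f \<in> Rat" "\<not> f \<asymp> (\<lambda>_. 0)" and b: "germ P b" "(\<lambda>Q. inverse (f Q)) \<asymp> b"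
  shows "to_line f P = ppoint (hpair 1 (b P))"
proof (cases "\<Phi> f \<in> \<Phi> ` Collect (germ P)")
  case True
  then obtain a where a: "germ P a" "\<Phi> f = \<Phi> a" by blast
  have fa: "f \<asymp> a" using a(2) by (simp only: \<Phi>_eq_iff[OF f(1) germ_Rat[OF a(1)]])
  have "(\<lambda>Q. a Q * b Q) \<asymp> (\<lambda>_. 1)"
    using fa b(2) Rat_nonzero[OF f]
  proof eventually_elim
    case (elim Q)
    show ?case unfolding elim(1,2)[symmetric] using elim(3) by simp
  qed
  from germ_eqD[OF germ_mult[OF a(1) b(1)] germ_const[OF germ_in_C[OF a(1)]] this]
  have ab: "a P * b P = 1" .
  then have "a P \<noteq> 0" by auto
  from ppoint_hpair_scale[OF this, of 1 "b P"] ab have "ppoint (hpair (a P) 1) = ppoint (hpair 1 (b P))" by simp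
  then show ?thesis using to_line_finite[OF f(1) a(1) fa] by simp
next
  case False
  have "\<Phi> (\<lambda>Q. inverse (f Q)) = \<Phi> b" using b(2) by (simp only: \<Phi>_eq_iff[OF Rat_inverse[OF f(1)] germ_Rat[OF b(1)]])
  then have "inverse (\<Phi> f) = \<Phi> b" by (simp only: \<Phi>_inverse[OF f(1)])
  then show ?thesis using False value_at[OF b(1)] by (simp add: to_line_def)
qed

lemma to_line_local:
  assumes f: "f \<in> Rat" "\<not> f \<asymp> (\<lambda>_. 0)" and P: "P \<in> C"
  shows "\<exists>W d A B. P \<in> W \<and> zopen C W \<and> A \<in> forms d \<and> B \<in> forms d \<and>
    (\<forall>Q\<in>W. \<forall>v\<in>Q. hpair (A v) (B v) \<noteq> 0 \<and> to_line f Q = ppoint (hpair (A v) (B v)))"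
proof (cases "\<Phi> f \<in> \<Phi> ` Collect (germ P)")
  case True
  then obtain a where a: "germ P a" "\<Phi> f = \<Phi> a" by blast
  have fa: "f \<asymp> a" using a(2) by (simp only: \<Phi>_eq_iff[OF f(1) germ_Rat[OF a(1)]])
  from a(1) obtain U where U: "P \<in> U" "regular_on C U a" unfolding germ_def by (elim exE conjE)
  obtain W d F G where W: "P \<in> W" "W \<subseteq> U" "fraction_on W d F G a" using regular_onE[OF U(2,1)] .
  note D = fraction_onD[OF W(3)]
  have "hpair (F v) (G v) \<noteq> 0 \<and> to_line f Q = ppoint (hpair (F v) (G v))" if Q: "Q \<in> W" "v \<in> Q" for Q v
  proof
    show "hpair (F v) (G v) \<noteq> 0" using D(4)[OF Q] by (simp add: hpair_eq_0)
    have "germ Q a" by (rule germI[OF _ U(2)]) (use Q(1) W(2) in blast)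
    then have "to_line f Q = ppoint (hpair (F v / G v) 1)" using to_line_finite[OF f(1) _ fa] D(5)[OF Q] by simp
    then show "to_line f Q = ppoint (hpair (F v) (G v))"
      using ppoint_hpair_scale[OF D(4)[OF Q], of "F v / G v" 1] D(4)[OF Q] by simp
  qed
  then show ?thesis using W(1) D(1-3) by (intro exI[of _ W] exI[of _ d] exI[of _ F] exI[of _ G] conjI ballI) blast+
next
  case False
  have "inverse (\<Phi> f) \<in> \<Phi> ` Collect (germ P)"
    using PF.not_Loc[OF P _ False] f(1) by simp
  then obtain b where b: "germ P b" "inverse (\<Phi> f) = \<Phi> b" by blast
  have fb: "(\<lambda>Q. inverse (f Q)) \<asymp> b"
    using b(2) unfolding \<Phi>_inverse[OF f(1), symmetric] by (simp only: \<Phi>_eq_iff[OF Rat_inverse[OF f(1)] germ_Rat[OF b(1)]])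
  from b(1) obtain U where U: "P \<in> U" "regular_on C U b" unfolding germ_def by (elim exE conjE)
  obtain W d F G where W: "P \<in> W" "W \<subseteq> U" "fraction_on W d F G b" using regular_onE[OF U(2,1)] .
  note D = fraction_onD[OF W(3)]
  have "hpair (G v) (F v) \<noteq> 0 \<and> to_line f Q = ppoint (hpair (G v) (F v))" if Q: "Q \<in> W" "v \<in> Q" for Q v
  proof
    show "hpair (G v) (F v) \<noteq> 0" using D(4)[OF Q] by (simp add: hpair_eq_0)
    have "germ Q b" by (rule germI[OF _ U(2)]) (use Q(1) W(2) in blast)
    then have "to_line f Q = ppoint (hpair 1 (F v / G v))" using to_line_infinite[OF f _ fb] D(5)[OF Q] by simp
    then show "to_line f Q = ppoint (hpair (G v) (F v))"
      using ppoint_hpair_scale[OF D(4)[OF Q], of 1 "F v / G v"] D(4)[OF Q] by simp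
  qed
  then show ?thesis using W(1) D(1-3) by (intro exI[of _ W] exI[of _ d] exI[of _ G] exI[of _ F] conjI ballI) blast+
qed

lemma to_line_in_proj: "to_line f P \<in> proj_space"
  unfolding to_line_def by (rule ppoint_in) (simp add: hpair_eq_0)

lemma to_line_morphism:
  assumes f: "f \<in> Rat" "\<not> f \<asymp> (\<lambda>_. 0)"
  shows "morphism C proj_space (to_line f)"
  unfolding morphism_def
proof (intro conjI ballI)
  show "to_line f ` C \<subseteq> proj_space" using to_line_in_proj by auto
  fix P assume "P \<in> C"
  from to_line_local[OF f this] obtain W d A B where W: "P \<in> W" "zopen C W" "A \<in> forms d" "B \<in> forms d"
    "\<forall>Q\<in>W. \<forall>v\<in>Q. hpair (A v) (B v) \<noteq> 0 \<and> to_line f Q = ppoint (hpair (A v) (B v))" by (elim exE conjE)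
  have pr: "(\<chi> k. (if k = 1 then A else B) v) = hpair (A v) (B v)" for v
    by (simp add: vec_eq_iff hpair_def)
  show "\<exists>W d F. zopen C W \<and> P \<in> W \<and> (\<forall>k. F k \<in> forms d) \<and>
        (\<forall>Q\<in>W. \<forall>v\<in>Q. (\<chi> k. F k v) \<noteq> 0 \<and> to_line f Q = ppoint (\<chi> k. F k v))"
    by (rule exI[of _ W], rule exI[of _ d], rule exI[of _ "\<lambda>k. if k = 1 then A else B"])
      (use W in \<open>simp add: pr\<close>)
qed

text \<open>
  Composition with \<open>(f : 1)\<close> turns a local quotient of forms on the line into a quotient of forms on the
  curve, and generically into a quotient of polynomials in \<open>f\<close>.
\<close>

lemma pullback_regular:
  assumes f: "f \<in> Rat" "\<not> f \<asymp> (\<lambda>_. 0)" and k: "regular_on proj_space V k" and P0: "P0 \<in> C" "to_line f P0 \<in> V"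
  shows "regular_on C {P \<in> C. to_line f P \<in> V} (k \<circ> to_line f)"
    and "\<exists>p q. eventually (\<lambda>P. poly q (f P) \<noteq> 0) gen \<and> (k \<circ> to_line f) \<asymp> (\<lambda>P. poly p (f P) / poly q (f P))"
proof -
  have loc: "\<exists>W d F G W' e H J. P \<in> W \<and> W \<subseteq> {P \<in> C. to_line f P \<in> V} \<and> fraction_on W d F G (k \<circ> to_line f) \<and>
      H \<in> forms e \<and> J \<in> forms e \<and> (\<forall>Q\<in>W. to_line f Q \<in> W') \<and>
      (\<forall>Q\<in>W'. \<forall>v\<in>Q. J v \<noteq> 0 \<and> k Q = H v / J v)"
    if P: "P \<in> C" "to_line f P \<in> V" for P
  proof -
    from bspec[OF conjunct2[OF k[unfolded regular_on_def]] P(2)] obtain W' e H J where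
      W': "H \<in> forms e" "J \<in> forms e" "zopen proj_space W'" "to_line f P \<in> W'" "W' \<subseteq> V"
      "\<forall>Q\<in>W'. \<forall>v\<in>Q. J v \<noteq> 0 \<and> k Q = H v / J v" by (elim exE bexE conjE)
    from W'(3) obtain T where T: "T \<subseteq> (\<Union>d. forms d)" "W' = proj_space - {P \<in> proj_space. \<forall>F\<in>T. \<forall>v\<in>P. F v = 0}"
      unfolding zopen_def zclosed_def by auto
    then obtain M w where M: "M \<in> T" "w \<in> to_line f P" "M w \<noteq> 0" using W'(4) by auto
    obtain b where b: "M \<in> forms b" using M(1) T(1) by auto
    from to_line_local[OF f P(1)] obtain W d A B where W: "P \<in> W" "zopen C W" "A \<in> forms d" "B \<in> forms d"
      "\<forall>Q\<in>W. \<forall>v\<in>Q. hpair (A v) (B v) \<noteq> 0 \<and> to_line f Q = ppoint (hpair (A v) (B v))" by (elim exE conjE)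
    have pr: "(\<chi> k. (if k = 1 then A else B) v) = hpair (A v) (B v)" for v
      by (simp add: vec_eq_iff hpair_def)
    have comp: "(\<lambda>v. E (hpair (A v) (B v))) \<in> forms (n * d)" if "E \<in> forms n" for E n
      using form_compose[OF that, of "\<lambda>k. if k = 1 then A else B" d] W(3,4) unfolding pr by simp
    define N where "N = W \<inter> {Q \<in> C. \<forall>v\<in>Q. M (hpair (A v) (B v)) \<noteq> 0}"
    have oN: "zopen C N" unfolding N_def by (rule zopen_Int[OF W(2) zopen_nonvanishing[OF comp[OF b]]])
    have img: "to_line f Q \<in> W'" if Q: "Q \<in> N" for Q
    proof -
      have QC: "Q \<in> C" "Q \<in> W" using Q by (auto simp: N_def)
      obtain v where v: "v \<in> Q" using ex_in_point[OF C_proj[OF QC(1)]] by auto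
      have l: "to_line f Q = ppoint (hpair (A v) (B v))" using W(5) QC(2) v by blast
      have "hpair (A v) (B v) \<in> to_line f Q" unfolding l by (rule in_ppoint)
      moreover have "M (hpair (A v) (B v)) \<noteq> 0" using Q v by (auto simp: N_def)
      ultimately show ?thesis unfolding T(2) using M(1) to_line_in_proj by blast
    qed
    have PN: "P \<in> N"
    proof -
      have "M (hpair (A v) (B v)) \<noteq> 0" if v: "v \<in> P" for v
      proof -
        have l: "to_line f P = ppoint (hpair (A v) (B v))" using W(1,5) v by blast
        have "hpair (A v) (B v) \<in> to_line f P" unfolding l by (rule in_ppoint)
        then show ?thesis
          using form_nonzero_iff(1)[OF b to_line_in_proj M(2)] M(3) by blast
      qed
      then show ?thesis using W(1) P(1) by (simp add: N_def)
    qed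
    have fr: "fraction_on N (e * d) (\<lambda>v. H (hpair (A v) (B v))) (\<lambda>v. J (hpair (A v) (B v))) (k \<circ> to_line f)"
    proof (rule fraction_onI[OF comp[OF W'(1)] comp[OF W'(2)] oN])
      fix Q v assume Q: "Q \<in> N" "v \<in> Q"
      have l: "to_line f Q = ppoint (hpair (A v) (B v))" using W(5) Q by (auto simp: N_def)
      have "hpair (A v) (B v) \<in> to_line f Q" unfolding l by (rule in_ppoint)
      then have "J (hpair (A v) (B v)) \<noteq> 0 \<and> k (to_line f Q) = H (hpair (A v) (B v)) / J (hpair (A v) (B v))"
        using W'(6) img[OF Q(1)] by blast
      then show "J (hpair (A v) (B v)) \<noteq> 0" "(k \<circ> to_line f) Q = H (hpair (A v) (B v)) / J (hpair (A v) (B v))"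
        by simp_all
    qed
    have sub: "N \<subseteq> {P \<in> C. to_line f P \<in> V}" using img W'(5) zopen_sub[OF oN] by blast
    show ?thesis
      by (rule exI[of _ N], rule exI[of _ "e * d"], rule exI[of _ "\<lambda>v. H (hpair (A v) (B v))"],
          rule exI[of _ "\<lambda>v. J (hpair (A v) (B v))"], rule exI[of _ W'], rule exI[of _ e], rule exI[of _ H], rule exI[of _ J])
        (intro conjI PN sub fr W'(1,2,6) ballI img)
  qed
  show "regular_on C {P \<in> C. to_line f P \<in> V} (k \<circ> to_line f)"
  proof (rule regular_onI)
    fix P assume "P \<in> {P \<in> C. to_line f P \<in> V}"
    then have "P \<in> C" "to_line f P \<in> V" by auto
    from loc[OF this] show "\<exists>W d F G. P \<in> W \<and> W \<subseteq> {P \<in> C. to_line f P \<in> V} \<and> fraction_on W d F G (k \<circ> to_line f)"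
      by (elim exE conjE) (intro exI conjI)
  qed
  from loc[OF P0] obtain W d F G W' e H J where W: "P0 \<in> W" "W \<subseteq> {P \<in> C. to_line f P \<in> V}"
    "fraction_on W d F G (k \<circ> to_line f)" "H \<in> forms e" "J \<in> forms e" "\<forall>Q\<in>W. to_line f Q \<in> W'"
    "\<forall>Q\<in>W'. \<forall>v\<in>Q. J v \<noteq> 0 \<and> k Q = H v / J v" by (elim exE conjE)
  obtain p where p: "\<forall>x. H (hpair x 1) = poly p x" using form_on_line[OF W(4)] by (elim exE)
  obtain q where q: "\<forall>x. J (hpair x 1) = poly q x" using form_on_line[OF W(5)] by (elim exE)
  obtain U where U: "U \<noteq> {}" "regular_on C U f" using RatE[OF f(1)] .
  then obtain P1 where P1: "P1 \<in> U" by auto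
  have key: "poly q (f Q) \<noteq> 0 \<and> (k \<circ> to_line f) Q = poly p (f Q) / poly q (f Q)" if Q: "Q \<in> W" "Q \<in> U" for Q
  proof -
    have l: "to_line f Q = ppoint (hpair (f Q) 1)"
      by (rule to_line_finite[OF f(1) germI[OF Q(2) U(2)]]) simp
    have "hpair (f Q) 1 \<in> to_line f Q" unfolding l by (rule in_ppoint)
    then have "J (hpair (f Q) 1) \<noteq> 0 \<and> k (to_line f Q) = H (hpair (f Q) 1) / J (hpair (f Q) 1)"
      using W(6,7) Q(1) by blast
    then show ?thesis using p q by simp
  qed
  have ev: "eventually (\<lambda>Q. Q \<in> W) gen" "eventually (\<lambda>Q. Q \<in> U) gen"
    by (rule gen_open[OF fraction_onD(3)[OF W(3)] W(1)], rule gen_open[OF regular_on_zopen[OF U(2)] P1])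
  have "eventually (\<lambda>Q. poly q (f Q) \<noteq> 0) gen" using ev by eventually_elim (use key in blast)
  moreover have "(k \<circ> to_line f) \<asymp> (\<lambda>Q. poly p (f Q) / poly q (f Q))" using ev by eventually_elim (use key in blast)
  ultimately show "\<exists>p q. eventually (\<lambda>P. poly q (f P) \<noteq> 0) gen \<and> (k \<circ> to_line f) \<asymp> (\<lambda>P. poly p (f P) / poly q (f P))"
    by (intro exI conjI)
qed

text \<open>
  The pullback of the function field of the line is \<open>\<complex>(f)\<close>: conversely to the previous lemma, a quotient of
  polynomials is made into a quotient of forms of the same degree by homogenising.
\<close>

lemma pullback_field_eq:
  assumes f: "f \<in> Rat" "\<not> f \<asymp> (\<lambda>_. 0)"
  shows "pullback_field C proj_space (to_line f)
    = {cls (\<lambda>P. poly p (f P) / poly q (f P)) | p q. eventually (\<lambda>P. poly q (f P) \<noteq> 0) gen}" (is "?L = ?R")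
proof
  show "?L \<subseteq> ?R"
  proof
    fix a assume "a \<in> ?L"
    then obtain V k where Vk: "a = rat C {P \<in> C. to_line f P \<in> V} (k \<circ> to_line f)" "regular_on proj_space V k"
      "\<exists>P\<in>C. to_line f P \<in> V" unfolding pullback_field_def by auto
    from Vk(3) obtain P0 where P0: "P0 \<in> C" "to_line f P0 \<in> V" by blast
    note r = pullback_regular[OF f Vk(2) P0]
    have ne: "{P \<in> C. to_line f P \<in> V} \<noteq> {}" using P0 by blast
    have a: "a = cls (k \<circ> to_line f)" unfolding Vk(1) by (rule rat_eq_cls[OF r(1) ne])
    have kR: "k \<circ> to_line f \<in> Rat" by (rule RatI[OF r(1)]) (use P0 in simp)
    from r(2) obtain p q where pq: "eventually (\<lambda>P. poly q (f P) \<noteq> 0) gen"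
      "(k \<circ> to_line f) \<asymp> (\<lambda>P. poly p (f P) / poly q (f P))" by (elim exE conjE)
    have "a = cls (\<lambda>P. poly p (f P) / poly q (f P))" unfolding a by (rule cls_cong[OF pq(2) kR])
    then show "a \<in> ?R" using pq(1) by (intro CollectI exI conjI)
  qed
  show "?R \<subseteq> ?L"
  proof
    fix a assume "a \<in> ?R"
    then obtain p q where pq: "a = cls (\<lambda>P. poly p (f P) / poly q (f P))" "eventually (\<lambda>P. poly q (f P) \<noteq> 0) gen" by blast
    define n where "n = max (Polynomial.degree p) (Polynomial.degree q)"
    define A where "A = homogenise n p"
    define B where "B = homogenise n q"
    have AB: "A \<in> forms n" "B \<in> forms n" unfolding A_def B_def by (rule homogenise_form)+
    have AB': "A (hpair x 1) = poly p x" "B (hpair x 1) = poly q x" for x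
      unfolding A_def B_def by (rule homogenise_eq; simp add: n_def)+
    define V :: "2 ppoint set" where "V = {Q \<in> proj_space. \<forall>v\<in>Q. B v \<noteq> 0}"
    define k where "k Q = A (SOME v. v \<in> Q) / B (SOME v. v \<in> Q)" for Q :: "2 ppoint"
    have keq: "k Q = A v / B v" if Q: "Q \<in> proj_space" "v \<in> Q" for Q v
    proof -
      have "(SOME v. v \<in> Q) \<in> Q" using Q(2) by (rule someI)
      from point_scaled[OF Q this] obtain c where c: "c \<noteq> 0" "(SOME v. v \<in> Q) = c *s v" .
      show ?thesis unfolding k_def c(2) form_homogeneous[OF AB(1)] form_homogeneous[OF AB(2)] using c(1) by simp
    qed
    have Veq: "V = proj_space - {Q \<in> proj_space. \<forall>F\<in>{B}. \<forall>v\<in>Q. F v = 0}"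
    proof (rule Set.set_eqI)
      fix Q :: "2 ppoint"
      show "Q \<in> V \<longleftrightarrow> Q \<in> proj_space - {Q \<in> proj_space. \<forall>F\<in>{B}. \<forall>v\<in>Q. F v = 0}"
      proof (cases "Q \<in> proj_space")
        case True
        then obtain v where v: "v \<in> Q" using ex_in_point by blast
        show ?thesis using form_nonzero_iff[OF AB(2) True v] True by (auto simp: V_def)
      qed (simp add: V_def)
    qed
    have oV: "zopen proj_space V"
      unfolding zopen_def zclosed_def Veq using AB(2) by (intro exI[of _ "{Q \<in> proj_space. \<forall>F\<in>{B}. \<forall>v\<in>Q. F v = 0}"] exI[of _ "{B}"] conjI) auto
    have rV: "regular_on proj_space V k"
      unfolding regular_on_def
    proof (intro conjI ballI oV)
      fix Q assume "Q \<in> V"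
      then show "\<exists>W d. \<exists>F\<in>forms d. \<exists>G\<in>forms d. zopen proj_space W \<and> Q \<in> W \<and> W \<subseteq> V \<and> (\<forall>Q\<in>W. \<forall>v\<in>Q. G v \<noteq> 0 \<and> k Q = F v / G v)"
        using oV keq by (intro exI[of _ V] exI[of _ n] bexI[OF _ AB(1)] bexI[OF _ AB(2)] conjI ballI) (auto simp: V_def)
    qed
    obtain U where U: "U \<noteq> {}" "regular_on C U f" using RatE[OF f(1)] .
    then obtain P1 where P1: "P1 \<in> U" by auto
    have key: "to_line f Q \<in> V \<and> (k \<circ> to_line f) Q = poly p (f Q) / poly q (f Q)" if Q: "Q \<in> U" "poly q (f Q) \<noteq> 0" for Q
    proof -
      have l: "to_line f Q = ppoint (hpair (f Q) 1)"
        by (rule to_line_finite[OF f(1) germI[OF Q(1) U(2)]]) simp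
      have i: "hpair (f Q) 1 \<in> to_line f Q" unfolding l by (rule in_ppoint)
      have "B (hpair (f Q) 1) \<noteq> 0" using Q(2) AB' by simp
      then have "to_line f Q \<in> V" unfolding V_def using form_nonzero_iff(1)[OF AB(2) to_line_in_proj i] to_line_in_proj by blast
      then show ?thesis using keq[OF to_line_in_proj i] AB' by simp
    qed
    have evU: "eventually (\<lambda>Q. Q \<in> U) gen" by (rule gen_open[OF regular_on_zopen[OF U(2)] P1])
    obtain P0 where P0: "P0 \<in> U" "poly q (f P0) \<noteq> 0" using gen_ex[OF pq(2) regular_on_zopen[OF U(2)] U(1)] by blast
    have P0C: "P0 \<in> C" using P0(1) zopen_sub[OF regular_on_zopen[OF U(2)]] by blast
    have P0V: "to_line f P0 \<in> V" using key[OF P0] by blast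
    note r = pullback_regular[OF f rV P0C P0V]
    have ne: "{P \<in> C. to_line f P \<in> V} \<noteq> {}" using P0C P0V by blast
    have kR: "k \<circ> to_line f \<in> Rat" by (rule RatI[OF r(1)]) (use P0C P0V in simp)
    have "(k \<circ> to_line f) \<asymp> (\<lambda>P. poly p (f P) / poly q (f P))"
      using evU pq(2) by eventually_elim (use key in blast)
    from cls_cong[OF this kR] have "a = cls (k \<circ> to_line f)" unfolding pq(1) by simp
    also have "\<dots> = rat C {P \<in> C. to_line f P \<in> V} (k \<circ> to_line f)" by (rule rat_eq_cls[OF r(1) ne, symmetric])
    finally show "a \<in> ?L" unfolding pullback_field_def using rV P0C P0V by (intro CollectI exI[of _ V] exI[of _ k] conjI) auto
  qed
qed

text \<open>
  If \<open>K\<close> is quadratic over \<open>\<complex>(z)\<close>, then the map to the line given by \<open>z\<close> has degree 2.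
\<close>

lemma hyperelliptic_if_quadratic:
  assumes z: "z \<in> \<Phi> ` Rat" "z \<notin> range fls_const" and u: "u \<in> \<Phi> ` Rat" and quad: "PF.quadratic_over z u"
    and genus: "genus C \<ge> 2"
  shows "hyperelliptic C"
proof -
  obtain f g where f: "f \<in> Rat" "z = \<Phi> f" and g: "g \<in> Rat" "u = \<Phi> g" using z(1) u by blast
  have f0: "\<not> f \<asymp> (\<lambda>_. 0)" using PF.nonzero_if_nonconstant[OF z(2)] \<Phi>_eq_0_iff[OF f(1)] f(2) by simp
  have polynz: "eventually (\<lambda>P. poly q (f P) \<noteq> 0) gen" if "q \<noteq> 0" for q
  proof (rule Rat_nonzero[OF Rat_poly[OF f(1)]])
    show "\<not> (\<lambda>P. poly q (f P)) \<asymp> (\<lambda>_. 0)"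
      using PF.transcendental[OF z(2) that] \<Phi>_eq_0_iff[OF Rat_poly[OF f(1)], of q] \<Phi>_peval[OF f(1), of q] f(2) by simp
  qed
  define F where "F = pullback_field C proj_space (to_line f)"
  have F: "F = {cls (\<lambda>P. poly p (f P) / poly q (f P)) | p q. eventually (\<lambda>P. poly q (f P) \<noteq> 0) gen}"
    unfolding F_def by (rule pullback_field_eq[OF f(1) f0])
  have R: "(\<lambda>P. poly p (f P) / poly q (f P)) \<in> Rat" for p q by (intro Rat_divide Rat_poly f(1))
  have Fc: "F \<subseteq> carrier FF" unfolding F using cls_in_carrier[OF R] by blast
  have gF: "cls g \<notin> F"
  proof
    assume "cls g \<in> F"
    then obtain p q where pq: "cls g = cls (\<lambda>P. poly p (f P) / poly q (f P))" "eventually (\<lambda>P. poly q (f P) \<noteq> 0) gen"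
      unfolding F by blast
    have "g \<asymp> (\<lambda>P. poly p (f P) / poly q (f P))" using pq(1) by (simp only: cls_eq_iff[OF g(1) R])
    then have "(\<lambda>P. poly q (f P) * g P) \<asymp> (\<lambda>P. poly p (f P))" using pq(2) by eventually_elim simp
    then have "\<Phi> (\<lambda>P. poly q (f P) * g P) = \<Phi> (\<lambda>P. poly p (f P))"
      by (simp only: \<Phi>_eq_iff[OF Rat_mult[OF Rat_poly[OF f(1)] g(1)] Rat_poly[OF f(1)]])
    then have "PF.ap q z * u = PF.ap p z" unfolding f(2) g(2)
      by (simp only: \<Phi>_mult[OF Rat_poly[OF f(1)] g(1)] \<Phi>_peval[OF f(1)])
    moreover have "q \<noteq> 0" using pq(2) by auto
    ultimately show False using quad unfolding PF.quadratic_over_def by blast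
  qed
  have z0: "\<zero>\<^bsub>FF\<^esub> \<in> carrier FF" by simp
  have E1: "FF.line_extension F \<one>\<^bsub>FF\<^esub> {\<zero>\<^bsub>FF\<^esub>} = F"
  proof (rule Set.set_eqI)
    fix a show "a \<in> FF.line_extension F \<one>\<^bsub>FF\<^esub> {\<zero>\<^bsub>FF\<^esub>} \<longleftrightarrow> a \<in> F"
      unfolding FF.line_extension_mem_iff using Fc by force
  qed
  have d1: "FF.dimension 1 F F"
    using FF.Suc_dim[OF FF.one_closed _ FF.zero_dim[of F]] FF.one_not_zero unfolding E1 by simp
  have E2: "FF.line_extension F (cls g) F = carrier FF"
  proof
    show "FF.line_extension F (cls g) F \<subseteq> carrier FF"
    proof
      fix a assume "a \<in> FF.line_extension F (cls g) F"
      then obtain k v where kv: "k \<in> F" "v \<in> F" "a = k \<otimes>\<^bsub>FF\<^esub> cls g \<oplus>\<^bsub>FF\<^esub> v"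
        unfolding FF.line_extension_mem_iff by (elim bexE)
      show "a \<in> carrier FF" unfolding kv(3)
        by (intro FF.a_closed FF.m_closed cls_in_carrier[OF g(1)] subsetD[OF Fc kv(1)] subsetD[OF Fc kv(2)])
    qed
    show "carrier FF \<subseteq> FF.line_extension F (cls g) F"
    proof
      fix a assume "a \<in> carrier FF"
      then obtain w where w: "w \<in> Rat" "a = cls w" by (rule FF_cases)
      have "\<Phi> w \<in> \<Phi> ` Rat" using w(1) by simp
      then obtain p q r where pqr: "r \<noteq> 0" "PF.ap r z * \<Phi> w = PF.ap p z + PF.ap q z * u"
        using quad unfolding PF.quadratic_over_def by blast
      note P = Rat_poly[OF f(1)]
      have "\<Phi> (\<lambda>P. poly r (f P) * w P) = \<Phi> (\<lambda>P. poly p (f P) + poly q (f P) * g P)"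
        using pqr(2) unfolding f(2) g(2)
        by (simp only: \<Phi>_mult[OF P w(1)] \<Phi>_add[OF P Rat_mult[OF P g(1)]] \<Phi>_mult[OF P g(1)] \<Phi>_peval[OF f(1)])
      then have eq: "(\<lambda>P. poly r (f P) * w P) \<asymp> (\<lambda>P. poly p (f P) + poly q (f P) * g P)"
        by (simp only: \<Phi>_eq_iff[OF Rat_mult[OF P w(1)] Rat_add[OF P Rat_mult[OF P g(1)]]])
      have "w \<asymp> (\<lambda>P. poly q (f P) / poly r (f P) * g P + poly p (f P) / poly r (f P))"
        using eq polynz[OF pqr(1)]
      proof eventually_elim
        case (elim P)
        have "w P = (poly p (f P) + poly q (f P) * g P) / poly r (f P)"
          unfolding elim(1)[symmetric] using elim(2) by simp
        then show ?case by (simp add: add_divide_distrib)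
      qed
      from cls_cong[OF this w(1)] have "a = cls (\<lambda>P. poly q (f P) / poly r (f P) * g P + poly p (f P) / poly r (f P))"
        unfolding w(2) .
      also have "\<dots> = cls (\<lambda>P. poly q (f P) / poly r (f P)) \<otimes>\<^bsub>FF\<^esub> cls g \<oplus>\<^bsub>FF\<^esub> cls (\<lambda>P. poly p (f P) / poly r (f P))"
        by (simp only: mult_FF[OF R g(1)] add_FF[OF Rat_mult[OF R g(1)] R])
      finally have "a = cls (\<lambda>P. poly q (f P) / poly r (f P)) \<otimes>\<^bsub>FF\<^esub> cls g \<oplus>\<^bsub>FF\<^esub> cls (\<lambda>P. poly p (f P) / poly r (f P))" .
      moreover have "cls (\<lambda>P. poly s (f P) / poly r (f P)) \<in> F" for s
        unfolding F using polynz[OF pqr(1)] by (intro CollectI exI conjI) auto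
      ultimately show "a \<in> FF.line_extension F (cls g) F" unfolding FF.line_extension_mem_iff by blast
    qed
  qed
  have "FF.dimension (Suc 1) F (carrier FF)"
    using FF.Suc_dim[OF cls_in_carrier[OF g(1)] gF d1] unfolding E2 .
  then have "FF.dimension 2 (pullback_field C proj_space (to_line f)) (carrier FF)"
    by (simp add: F_def numeral_2_eq_2)
  then show ?thesis unfolding hyperelliptic_def using genus to_line_morphism[OF f(1) f0]
    by (intro conjI exI[of _ "to_line f"])
qed

section \<open>Equations and generators in the function field\<close>

text \<open>
  The hypothesis writes every function as a quotient of a polynomial in \<open>x\<close> and \<open>y\<close> by a nonzero polynomial in
  \<open>x\<close>.
\<close>

lemma generate_field_eq_carrier:
  assumes x: "x \<in> Rat" and y: "y \<in> Rat" and nc: "\<Phi> x \<notin> range fls_const"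
    and gen: "\<And>w. w \<in> \<Phi> ` Rat \<Longrightarrow> \<exists>a b c d. d \<noteq> 0 \<and>
      PF.ap d (\<Phi> x) * w = PF.ap a (\<Phi> x) + PF.ap b (\<Phi> x) * \<Phi> y + PF.ap c (\<Phi> x) * \<Phi> y ^ 2"
  shows "generate_field FF (range (const C) \<union> {cls x, cls y}) = carrier FF"
proof
  have sub: "range (const C) \<union> {cls x, cls y} \<subseteq> carrier FF"
    using cls_in_carrier[OF x] cls_in_carrier[OF y] cls_in_carrier[OF Rat_const] by (auto simp: const_FF)
  show "generate_field FF (range (const C) \<union> {cls x, cls y}) \<subseteq> carrier FF" by (rule FF.generate_field_incl[OF sub])
  define G where "G = generate_field FF (range (const C) \<union> {cls x, cls y})"
  have G: "cls x \<in> G" "cls y \<in> G" "\<And>c. cls (\<lambda>_. c) \<in> G"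
    unfolding G_def const_FF[symmetric] by (intro generate_field.incl; simp)+
  have Ga: "cls (\<lambda>P. h P + k P) \<in> G" if "h \<in> Rat" "k \<in> Rat" "cls h \<in> G" "cls k \<in> G" for h k
    using generate_field.eng_add[of "cls h" FF _ "cls k"] that unfolding G_def add_FF[OF that(1,2)] by blast
  have Gm: "cls (\<lambda>P. h P * k P) \<in> G" if "h \<in> Rat" "k \<in> Rat" "cls h \<in> G" "cls k \<in> G" for h k
    using generate_field.eng_mult[of "cls h" FF _ "cls k"] that unfolding G_def mult_FF[OF that(1,2)] by blast
  have Gp: "cls (\<lambda>P. poly p (x P)) \<in> G" for p
  proof (induction p)
    case 0 show ?case using G(3)[of 0] by simp
  next
    case (pCons a p)
    show ?case unfolding poly_pCons
      by (rule Ga[OF Rat_const Rat_mult[OF x Rat_poly[OF x]] G(3) Gm[OF x Rat_poly[OF x] G(1) pCons(2)]])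
  qed
  show "carrier FF \<subseteq> generate_field FF (range (const C) \<union> {cls x, cls y})"
  proof
    fix e assume "e \<in> carrier FF"
    then obtain w where w: "w \<in> Rat" "e = cls w" by (rule FF_cases)
    obtain a b c d where abcd: "d \<noteq> 0"
      "PF.ap d (\<Phi> x) * \<Phi> w = PF.ap a (\<Phi> x) + PF.ap b (\<Phi> x) * \<Phi> y + PF.ap c (\<Phi> x) * \<Phi> y ^ 2"
      using gen[of "\<Phi> w"] w(1) by blast
    define h where "h P = poly a (x P) + poly b (x P) * y P + poly c (x P) * y P ^ 2" for P
    note P = Rat_poly[OF x] and y2 = Rat_power[OF y, of 2]
    note m1 = Rat_mult[OF P y] and m2 = Rat_mult[OF P y2]
    have hR: "h \<in> Rat" unfolding h_def by (intro Rat_add Rat_mult P y y2)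
    have "\<Phi> (\<lambda>P. poly d (x P) * w P) = \<Phi> h"
      using abcd(2) unfolding h_def
      by (simp only: \<Phi>_mult[OF P w(1)] \<Phi>_add[OF Rat_add[OF P m1] m2] \<Phi>_add[OF P m1] \<Phi>_mult[OF P y] \<Phi>_mult[OF P y2]
          \<Phi>_power[OF y] \<Phi>_peval[OF x])
    then have eq: "(\<lambda>P. poly d (x P) * w P) \<asymp> h" by (simp only: \<Phi>_eq_iff[OF Rat_mult[OF P w(1)] hR])
    have d0: "\<not> (\<lambda>P. poly d (x P)) \<asymp> (\<lambda>_. 0)"
      using PF.transcendental[OF nc abcd(1)] \<Phi>_eq_0_iff[OF P, of d] \<Phi>_peval[OF x, of d] by simp
    have hG: "cls h \<in> G"
    proof -
      have "cls (\<lambda>P. y P ^ 2) \<in> G" unfolding power2_eq_square by (rule Gm[OF y y G(2,2)])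
      then show ?thesis unfolding h_def
        by (intro Ga Gm Gp G Rat_add Rat_mult P y y2)
    qed
    have "inv\<^bsub>FF\<^esub> (cls (\<lambda>P. poly d (x P))) \<in> G"
      unfolding G_def
    proof (rule generate_field.m_inv)
      show "cls (\<lambda>P. poly d (x P)) \<in> generate_field FF (range (const C) \<union> {cls x, cls y})" using Gp unfolding G_def .
      show "cls (\<lambda>P. poly d (x P)) \<noteq> \<zero>\<^bsub>FF\<^esub>" using cls_eq_zero_iff[OF P] d0 by simp
    qed
    then have iG: "cls (\<lambda>P. inverse (poly d (x P))) \<in> G" unfolding inv_FF[OF P d0] .
    have "w \<asymp> (\<lambda>P. inverse (poly d (x P)) * h P)"
      using eq Rat_nonzero[OF P d0]
    proof eventually_elim
      case (elim Q)
      show ?case unfolding elim(1)[symmetric] using elim(2) by simp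
    qed
    from cls_cong[OF this w(1)] Gm[OF Rat_inverse[OF P] hR iG hG]
    show "e \<in> generate_field FF (range (const C) \<union> {cls x, cls y})" unfolding w(2) G_def by simp
  qed
qed

lemma cubic_in_function_field:
  assumes x: "x \<in> Rat" and y: "y \<in> Rat"
    and eq: "\<Phi> y ^ 3 + PF.ap d2 (\<Phi> x) * \<Phi> y ^ 2 + PF.ap d1 (\<Phi> x) * \<Phi> y + PF.ap d0 (\<Phi> x) = 0"
  shows "cls y [^]\<^bsub>FF\<^esub> (3::nat)
         \<oplus>\<^bsub>FF\<^esub> cls y [^]\<^bsub>FF\<^esub> (2::nat) \<otimes>\<^bsub>FF\<^esub> poly_at C d2 (cls x)
         \<oplus>\<^bsub>FF\<^esub> cls y \<otimes>\<^bsub>FF\<^esub> poly_at C d1 (cls x)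
         \<oplus>\<^bsub>FF\<^esub> poly_at C d0 (cls x) = \<zero>\<^bsub>FF\<^esub>"
proof -
  note P = Rat_poly[OF x] and y2 = Rat_power[OF y, of 2] and y3 = Rat_power[OF y, of 3]
  note m2 = Rat_mult[OF y2 P] and m1 = Rat_mult[OF y P]
  note s1 = Rat_add[OF y3 m2]
  note s2 = Rat_add[OF s1 m1]
  note s3 = Rat_add[OF s2 P]
  have "\<Phi> (\<lambda>P. y P ^ 3 + y P ^ 2 * poly d2 (x P) + y P * poly d1 (x P) + poly d0 (x P)) =
      \<Phi> y ^ 3 + \<Phi> y ^ 2 * PF.ap d2 (\<Phi> x) + \<Phi> y * PF.ap d1 (\<Phi> x) + PF.ap d0 (\<Phi> x)"
    by (simp only: \<Phi>_add[OF s2 P] \<Phi>_add[OF s1 m1] \<Phi>_add[OF y3 m2] \<Phi>_mult[OF y2 P] \<Phi>_mult[OF y P]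
      \<Phi>_power[OF y] \<Phi>_peval[OF x])
  also have "\<dots> = 0" using eq by (simp only: mult.commute)
  finally have "(\<lambda>P. y P ^ 3 + y P ^ 2 * poly d2 (x P) + y P * poly d1 (x P) + poly d0 (x P)) \<asymp> (\<lambda>_. 0)"
    by (simp only: \<Phi>_eq_0_iff[OF s3])
  then have "cls (\<lambda>P. y P ^ 3 + y P ^ 2 * poly d2 (x P) + y P * poly d1 (x P) + poly d0 (x P)) = \<zero>\<^bsub>FF\<^esub>"
    by (simp only: cls_eq_zero_iff[OF s3])
  then show ?thesis
    by (simp only: poly_at_FF[OF x] pow_FF[OF y] mult_FF[OF y2 P] mult_FF[OF y P] add_FF[OF y3 m2] add_FF[OF s1 m1] add_FF[OF s2 P])
qed

end

section \<open>Sections of line bundles\<close>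

lemma in_chart: "is_line_bundle C L \<Longrightarrow> P \<in> C \<Longrightarrow> P \<in> cover L (chart_at L P)"
  unfolding chart_at_def is_line_bundle_def by (metis UN_E someI)

lemma cover_tensor_power [simp]: "cover (tensor_power L k) = cover L"
  by (simp add: tensor_power_def)

lemma chart_at_tensor_power [simp]: "chart_at (tensor_power L k) P = chart_at L P"
  by (simp add: chart_at_def)

lemma section_power [simp]:
  fixes s :: "'i \<Rightarrow> 'p \<Rightarrow> complex"
  shows "(s ^ n) i P = s i P ^ n"
  by (induction n) simp_all

lemma H0D:
  assumes "s \<in> H0 C L"
  shows "regular_on C (cover L i) (s i)" "P \<notin> cover L i \<Longrightarrow> s i P = 0"
    "P \<in> cover L i \<Longrightarrow> P \<in> cover L j \<Longrightarrow> s i P = transition L i j P * s j P"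
  using assms unfolding H0_def by blast+

lemma bundleD:
  assumes "is_line_bundle C L"
  shows "zopen C (cover L i)" "cover L i \<noteq> {}" "P \<in> cover L i \<Longrightarrow> P \<in> C"
    "regular_on C (cover L i \<inter> cover L j) (transition L i j)"
    "P \<in> cover L i \<Longrightarrow> P \<in> cover L j \<Longrightarrow> transition L i j P \<noteq> 0"
    "P \<in> cover L i \<Longrightarrow> P \<in> cover L j \<Longrightarrow> P \<in> cover L l \<Longrightarrow>
      transition L i l P = transition L i j P * transition L j l P"
  using assms unfolding is_line_bundle_def by blast+

context projective_variety
begin

lemma regular_on_power: "regular_on C U f \<Longrightarrow> regular_on C U (\<lambda>P. f P ^ n)"
  by (induction n) (simp_all add: regular_on_const regular_on_zopen regular_on_mult)

lemma tensor_power_bundle: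
  assumes "is_line_bundle C L" shows "is_line_bundle C (tensor_power L k)"
  unfolding is_line_bundle_def tensor_power_def line_bundle.select_convs
proof (intro conjI allI ballI)
  fix i j l P
  show "zopen C (cover L i)" "cover L i \<noteq> {}" by (rule bundleD[OF assms])+
  show "(\<Union>i. cover L i) = C" using assms unfolding is_line_bundle_def by (elim conjE)
  show "regular_on C (cover L i \<inter> cover L j) (\<lambda>P. transition L i j P ^ k)"
    by (rule regular_on_power[OF bundleD(4)[OF assms]])
  show "transition L i j P ^ k \<noteq> 0" if "P \<in> cover L i \<inter> cover L j"
    using bundleD(5)[OF assms] that by simp
  show "transition L i l P ^ k = transition L i j P ^ k * transition L j l P ^ k"
    if "P \<in> cover L i \<inter> cover L j \<inter> cover L l"
    using bundleD(6)[OF assms, of P i j l] that by (simp add: power_mult_distrib)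
qed

text \<open>
  The function that represents \<open>section_quotient\<close>. At every point it uses the chosen chart; near a given
  point it may be computed in a fixed one, since the transition factors cancel.
\<close>

definition quotient_fun :: "('i, 'n) line_bundle \<Rightarrow> ('i \<Rightarrow> 'n ppoint \<Rightarrow> complex) \<Rightarrow>
    ('i \<Rightarrow> 'n ppoint \<Rightarrow> complex) \<Rightarrow> 'n ppoint \<Rightarrow> complex" where
  "quotient_fun L a b = (\<lambda>P. a (chart_at L P) P / b (chart_at L P) P)"

context
  fixes L :: "('i, 'n) line_bundle"
  assumes B: "is_line_bundle C L"
begin

lemma gen_cover: "eventually (\<lambda>P. P \<in> cover L i) gen"
proof -
  from bundleD(2)[OF B] obtain P where "P \<in> cover L i" by blast
  then show ?thesis by (rule gen_open[OF bundleD(1)[OF B]])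
qed

lemma cover_overlap: "cover L i \<inter> cover L j \<noteq> {}"
  using zopen_meet[OF bundleD(1)[OF B] bundleD(1)[OF B]] bundleD(2)[OF B] by blast

lemma section_Rat: assumes "s \<in> H0 C L" shows "s i \<in> Rat"
  unfolding Rat_def using H0D(1)[OF assms] bundleD(2)[OF B] by (intro CollectI exI conjI)

lemma section_germ: "s \<in> H0 C L \<Longrightarrow> P \<in> cover L i \<Longrightarrow> germ P (s i)"
  by (rule germI[OF _ H0D(1)])

lemma section_germ_chart: "s \<in> H0 C L \<Longrightarrow> P \<in> C \<Longrightarrow> germ P (s (chart_at L P))"
  by (rule section_germ[OF _ in_chart[OF B]])

text \<open>
  A section is nonzero in one chart at some point, hence generically; the transition functions are
  invertible and carry this to the other charts.
\<close>

lemma section_nonzero: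
  assumes s: "s \<in> H0 C L" "s \<noteq> 0" shows "eventually (\<lambda>P. s j P \<noteq> 0) gen"
proof -
  from s(2) obtain i P where P: "s i P \<noteq> 0" by (auto simp: fun_eq_iff)
  have "P \<in> cover L i" using P H0D(2)[OF s(1)] by blast
  from germ_nonzero[OF section_germ[OF s(1) this] P] have "eventually (\<lambda>P. s i P \<noteq> 0) gen" .
  then show ?thesis using gen_cover[of i] gen_cover[of j]
  proof eventually_elim
    case (elim Q)
    then show ?case using H0D(3)[OF s(1) elim(2,3)] by auto
  qed
qed

lemma section_not_geq_0: "s \<in> H0 C L \<Longrightarrow> s \<noteq> 0 \<Longrightarrow> \<not> s j \<asymp> (\<lambda>_. 0)"
  by (rule nonzero_not_geq_0[OF section_nonzero])

lemma chart_functions_eqI: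
  assumes "\<And>i. regular_on C (cover L i) (f i)" "\<And>i. regular_on C (cover L i) (g i)"
    and "\<And>i. f i \<asymp> g i" and "\<And>i P. P \<notin> cover L i \<Longrightarrow> f i P = 0" "\<And>i P. P \<notin> cover L i \<Longrightarrow> g i P = 0"
  shows "f = g"
proof (rule ext, rule ext)
  fix i P
  show "f i P = g i P"
    using regular_on_eqI[OF assms(1) assms(2) assms(3)] assms(4,5)[of P i] by (cases "P \<in> cover L i") auto
qed

lemma quotient_fun_eq:
  assumes a: "a \<in> H0 C L" and b: "b \<in> H0 C L" and P: "P \<in> cover L i" "b i P \<noteq> 0"
  shows "b (chart_at L P) P \<noteq> 0" "quotient_fun L a b P = a i P * inverse (b i P)"
proof -
  note c = in_chart[OF B bundleD(3)[OF B P(1)]]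
  note g = bundleD(5)[OF B P(1) c] and ae = H0D(3)[OF a P(1) c] and be = H0D(3)[OF b P(1) c]
  show "b (chart_at L P) P \<noteq> 0" using be P(2) by auto
  then show "quotient_fun L a b P = a i P * inverse (b i P)"
    unfolding quotient_fun_def ae be using g by (simp add: divide_inverse)
qed

lemma quotient_regular:
  assumes a: "a \<in> H0 C L" and b: "b \<in> H0 C L"
  shows "regular_on C {P \<in> C. b (chart_at L P) P \<noteq> 0} (quotient_fun L a b)"
proof (rule regular_on_local)
  fix P assume P: "P \<in> {P \<in> C. b (chart_at L P) P \<noteq> 0}"
  define i where "i = chart_at L P"
  define W where "W = {Q \<in> cover L i. b i Q \<noteq> 0}"
  have W: "zopen C W" "W \<subseteq> cover L i" unfolding W_def using zopen_regular_nonzero[OF H0D(1)[OF b]] by auto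
  have "regular_on C W (\<lambda>Q. a i Q * inverse (b i Q))"
    by (intro regular_on_mult regular_on_inverse regular_on_subset[OF H0D(1)[OF a] W] regular_on_subset[OF H0D(1)[OF b] W])
      (simp add: W_def)
  then have "regular_on C W (quotient_fun L a b)"
  proof (rule regular_on_cong)
    fix Q assume "Q \<in> W"
    then have "Q \<in> cover L i" "b i Q \<noteq> 0" by (simp_all add: W_def)
    from quotient_fun_eq(2)[OF a b this] show "a i Q * inverse (b i Q) = quotient_fun L a b Q" by (rule sym)
  qed
  moreover have "P \<in> W" using P in_chart[OF B] by (simp add: W_def i_def)
  moreover have "W \<subseteq> {P \<in> C. b (chart_at L P) P \<noteq> 0}"
    using quotient_fun_eq(1)[OF a b] bundleD(3)[OF B] unfolding W_def by blast
  ultimately show "\<exists>W. P \<in> W \<and> W \<subseteq> {P \<in> C. b (chart_at L P) P \<noteq> 0} \<and> regular_on C W (quotient_fun L a b)"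
    by (intro exI conjI)
qed

lemma quotient_domain_nonempty:
  assumes b: "b \<in> H0 C L" "b \<noteq> 0" shows "{P \<in> C. b (chart_at L P) P \<noteq> 0} \<noteq> {}"
proof -
  from b(2) obtain i P where P: "b i P \<noteq> 0" by (auto simp: fun_eq_iff)
  have Pi: "P \<in> cover L i" using P H0D(2)[OF b(1)] by blast
  show ?thesis using quotient_fun_eq(1)[OF b(1) b(1) Pi P] bundleD(3)[OF B Pi] by blast
qed

lemma quotient_Rat:
  assumes "a \<in> H0 C L" "b \<in> H0 C L" "b \<noteq> 0" shows "quotient_fun L a b \<in> Rat"
  unfolding Rat_def
  using quotient_regular[OF assms(1,2)] quotient_domain_nonempty[OF assms(2,3)] by (intro CollectI exI conjI)

lemma section_quotient_eq:
  assumes "a \<in> H0 C L" "b \<in> H0 C L" "b \<noteq> 0"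
  shows "section_quotient C L a b = cls (quotient_fun L a b)"
  unfolding section_quotient_def
  using rat_eq_cls[OF quotient_regular[OF assms(1,2)] quotient_domain_nonempty[OF assms(2,3)]]
  by (simp only: quotient_fun_def)

lemma quotient_times:
  assumes "a \<in> H0 C L" "b \<in> H0 C L" "b \<noteq> 0"
  shows "(\<lambda>P. quotient_fun L a b P * b i P) \<asymp> a i"
  using gen_cover[of i] section_nonzero[OF assms(2,3), of i]
proof eventually_elim
  case (elim P)
  show ?case unfolding quotient_fun_eq(2)[OF assms(1,2) elim] using elim(2) by simp
qed

end

end

section \<open>The degree of a line bundle\<close>

context smooth_curve
begin

text \<open>
  From \<open>a * b = c\<close> with \<open>c\<close> regular it follows that the poles of \<open>a\<close> are bounded by the zeros of \<open>b\<close>.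
\<close>

lemma vge_quotient:
  assumes a: "a \<in> Rat" and b: "germ P b" "\<not> b \<asymp> (\<lambda>_. 0)" and c: "germ P c"
    and eq: "(\<lambda>Q. a Q * b Q) \<asymp> c"
  shows "PF.vge P (- PF.val P (\<Phi> b)) (\<Phi> a)"
proof (cases "\<Phi> a = 0")
  case True
  then show ?thesis using PF.vge_zero[OF germ_in_C[OF b(1)]] by simp
next
  case False
  note P = germ_in_C[OF b(1)] and bR = germ_Rat[OF b(1)] and cR = germ_Rat[OF c]
  have b0: "\<Phi> b \<noteq> 0" using b(2) \<Phi>_eq_0_iff[OF bR] by simp
  have e: "\<Phi> c = \<Phi> a * \<Phi> b"
    using \<Phi>_eq_iff[OF Rat_mult[OF a bR] cR] eq \<Phi>_mult[OF a bR] by simp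
  have c0: "\<Phi> c \<noteq> 0" using e False b0 by simp
  have v: "PF.val P (\<Phi> c) = PF.val P (\<Phi> a) + PF.val P (\<Phi> b)"
    unfolding e by (rule PF.val_mult[OF P imageI[OF a] imageI[OF bR] False b0])
  have "\<Phi> c \<in> \<Phi> ` Collect (germ P)" using c by simp
  then have "0 \<le> PF.val P (\<Phi> c)" using PF.Loc_iff_val[OF P imageI[OF cR] c0] by simp
  then show ?thesis unfolding PF.vge_def[OF P] using v imageI[OF a, of \<Phi>] by simp
qed

text \<open>
  The divisor of zeros of a section.
\<close>

definition zero_order :: "('i, 'n) line_bundle \<Rightarrow> ('i \<Rightarrow> 'n ppoint \<Rightarrow> complex) \<Rightarrow> 'n ppoint \<Rightarrow> nat" where
  "zero_order L s P = nat (PF.val P (\<Phi> (s (chart_at L P))))"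

lemma int_zero_order:
  assumes B: "is_line_bundle C L" and s: "s \<in> H0 C L" "s \<noteq> 0" and P: "P \<in> C"
  shows "int (zero_order L s P) = PF.val P (\<Phi> (s (chart_at L P)))"
proof -
  note g = section_germ_chart[OF B s(1) P]
  have n0: "\<Phi> (s (chart_at L P)) \<noteq> 0"
    using \<Phi>_eq_0_iff[OF germ_Rat[OF g]] section_not_geq_0[OF B s] by simp
  have "\<Phi> (s (chart_at L P)) \<in> \<Phi> ` Collect (germ P)" using g by simp
  then show ?thesis
    unfolding zero_order_def using PF.Loc_iff_val[OF P imageI[OF germ_Rat[OF g]] n0] by simp
qed

lemma section_rational_section:
  assumes B: "is_line_bundle C L" and s: "s \<in> H0 C L" "s \<noteq> 0"
  shows "nonzero_rational_section C L (\<lambda>i. cls (s i))"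
  unfolding nonzero_rational_section_def
proof (intro conjI allI)
  fix i j
  note R = section_Rat[OF B s(1)]
  show "cls (s i) \<in> carrier FF" by (rule cls_in_carrier[OF R])
  show "cls (s i) \<noteq> \<zero>\<^bsub>FF\<^esub>" using cls_eq_zero_iff[OF R] section_not_geq_0[OF B s] by simp
  have ne: "cover L i \<inter> cover L j \<noteq> {}" by (rule cover_overlap[OF B])
  have gR: "transition L i j \<in> Rat"
    unfolding Rat_def using bundleD(4)[OF B] ne by (intro CollectI exI conjI)
  have "s i \<asymp> (\<lambda>P. transition L i j P * s j P)"
    using gen_cover[OF B, of i] gen_cover[OF B, of j]
    by eventually_elim (rule H0D(3)[OF s(1)])
  then show "cls (s i) = rat C (cover L i \<inter> cover L j) (transition L i j) \<otimes>\<^bsub>FF\<^esub> cls (s j)"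
    unfolding rat_eq_cls[OF bundleD(4)[OF B] ne] mult_FF[OF gR R] by (rule cls_cong[OF _ R])
qed

text \<open>
  The quotient of two rational sections is the same function in all charts.
\<close>

lemma rational_section_ratio:
  assumes B: "is_line_bundle C L" and s: "s \<in> H0 C L" "s \<noteq> 0"
    and \<sigma>: "nonzero_rational_section C L \<sigma>"
  shows "\<exists>f\<in>Rat. \<not> f \<asymp> (\<lambda>_. 0) \<and> (\<forall>i. \<sigma> i = cls (\<lambda>P. f P * s i P))"
proof -
  fix i0
  note R = section_Rat[OF B s(1)]
  have c: "\<sigma> i \<in> carrier FF" "\<sigma> i \<noteq> \<zero>\<^bsub>FF\<^esub>" and
    tr: "\<sigma> i = rat C (cover L i \<inter> cover L j) (transition L i j) \<otimes>\<^bsub>FF\<^esub> \<sigma> j" for i j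
    using \<sigma> unfolding nonzero_rational_section_def by blast+
  obtain \<phi> where \<phi>: "\<phi> \<in> Rat" "\<sigma> i0 = cls \<phi>" using FF_cases[OF c(1)] .
  define f where "f = (\<lambda>P. \<phi> P * inverse (s i0 P))"
  have fR: "f \<in> Rat" unfolding f_def by (rule Rat_mult[OF \<phi>(1) Rat_inverse[OF R]])
  have ef: "(\<lambda>P. f P * s i0 P) \<asymp> \<phi>"
    using section_nonzero[OF B s, of i0] by eventually_elim (simp add: f_def)
  have "\<not> f \<asymp> (\<lambda>_. 0)"
  proof
    assume "f \<asymp> (\<lambda>_. 0)"
    then have "\<phi> \<asymp> (\<lambda>_. 0)" using ef by eventually_elim simp
    then show False using cls_eq_zero_iff[OF \<phi>(1)] c(2)[of i0] \<phi>(2) by simp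
  qed
  moreover have "\<sigma> i = cls (\<lambda>P. f P * s i P)" for i
  proof -
    have ne: "cover L i \<inter> cover L i0 \<noteq> {}" by (rule cover_overlap[OF B])
    have gR: "transition L i i0 \<in> Rat"
      unfolding Rat_def using bundleD(4)[OF B] ne by (intro CollectI exI conjI)
    have "\<sigma> i = cls (\<lambda>P. transition L i i0 P * \<phi> P)"
      unfolding tr[of i i0] \<phi>(2) rat_eq_cls[OF bundleD(4)[OF B] ne] by (rule mult_FF[OF gR \<phi>(1)])
    moreover have "(\<lambda>P. transition L i i0 P * \<phi> P) \<asymp> (\<lambda>P. f P * s i P)"
      using gen_cover[OF B, of i] gen_cover[OF B, of i0] ef
    proof eventually_elim
      case (elim P)
      show ?case unfolding H0D(3)[OF s(1) elim(1,2)] elim(3)[symmetric] by (simp only: mult_ac)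
    qed
    ultimately show ?thesis using cls_cong[OF _ Rat_mult[OF gR \<phi>(1)]] by simp
  qed
  ultimately show ?thesis using fR by (intro bexI[of _ f] conjI allI)
qed

text \<open>
  The degree refers to an arbitrary rational section; it differs from \<open>s\<close> by a rational function, which has
  as many zeros as poles.
\<close>

lemma degree_eq_sum_zero_order:
  assumes B: "is_line_bundle C L" and s: "s \<in> H0 C L" "s \<noteq> 0"
    and deg: "line_bundle_degree C L = int d" "d \<noteq> 0"
  shows "finite {P \<in> C. zero_order L s P \<noteq> 0}"
    and "(\<Sum>P | P \<in> C \<and> zero_order L s P \<noteq> 0. zero_order L s P) = d"
proof -
  define \<sigma> where "\<sigma> = (SOME \<sigma>. nonzero_rational_section C L \<sigma>)"
  have \<sigma>: "nonzero_rational_section C L \<sigma>"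
    unfolding \<sigma>_def by (rule someI[of "nonzero_rational_section C L", OF section_rational_section[OF B s]])
  from rational_section_ratio[OF B s \<sigma>] obtain f where f: "f \<in> Rat" "\<not> f \<asymp> (\<lambda>_. 0)"
    "\<forall>i. \<sigma> i = cls (\<lambda>P. f P * s i P)" by (elim bexE conjE)
  define v where "v P = PF.val P (\<Phi> f)" for P
  define o' where "o' P = ord_at C P (\<sigma> (chart_at L P))" for P
  note R = section_Rat[OF B s(1)]
  have f0: "\<Phi> f \<noteq> 0" using f(2) \<Phi>_eq_0_iff[OF f(1)] by simp
  have s0: "\<Phi> (s i) \<noteq> 0" for i using \<Phi>_eq_0_iff[OF R] section_not_geq_0[OF B s] by simp
  have ord: "o' P = v P + int (zero_order L s P)" if P: "P \<in> C" for P
  proof -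
    note fs = Rat_mult[OF f(1) R[of "chart_at L P"]]
    have e: "\<Phi> (\<lambda>Q. f Q * s (chart_at L P) Q) = \<Phi> f * \<Phi> (s (chart_at L P))" by (rule \<Phi>_mult[OF f(1) R])
    have "\<not> (\<lambda>Q. f Q * s (chart_at L P) Q) \<asymp> (\<lambda>_. 0)"
      using \<Phi>_eq_0_iff[OF fs] e f0 s0 by simp
    from ord_at_eq_val[OF fs this P] have "o' P = PF.val P (\<Phi> f * \<Phi> (s (chart_at L P)))"
      unfolding o'_def spec[OF f(3), of "chart_at L P"] e .
    then show ?thesis
      using PF.val_mult[OF P imageI[OF f(1)] imageI[OF R] f0 s0] int_zero_order[OF B s P] unfolding v_def by simp
  qed
  have so: "(\<Sum>P\<in>{P \<in> C. o' P \<noteq> 0}. o' P) = int d"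
    using deg(1) unfolding line_bundle_degree_def divisor_degree_def o'_def \<sigma>_def .
  \<comment> \<open>a sum over an infinite set is 0, so a nonzero degree forces the support to be finite\<close>
  have fin1: "finite {P \<in> C. o' P \<noteq> 0}"
  proof (rule ccontr)
    assume "infinite {P \<in> C. o' P \<noteq> 0}"
    from sum.infinite[OF this, of o'] show False using so deg(2) by simp
  qed
  have fin2: "finite {P \<in> C. v P \<noteq> 0}" unfolding v_def by (rule PF.finite_val_nonzero[OF imageI[OF f(1)] f0])
  have sv: "(\<Sum>P\<in>{P \<in> C. v P \<noteq> 0}. v P) = 0"
    using PF.sum_val_eq_0[OF imageI[OF f(1)] f0] unfolding v_def .
  define T where "T = {P \<in> C. o' P \<noteq> 0} \<union> {P \<in> C. v P \<noteq> 0}"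
  have T: "finite T" "T \<subseteq> C" using fin1 fin2 by (auto simp: T_def)
  have sub: "{P \<in> C. zero_order L s P \<noteq> 0} \<subseteq> T" using ord by (auto simp: T_def)
  show "finite {P \<in> C. zero_order L s P \<noteq> 0}" by (rule finite_subset[OF sub T(1)])
  have "int (\<Sum>P | P \<in> C \<and> zero_order L s P \<noteq> 0. zero_order L s P) = (\<Sum>P\<in>T. int (zero_order L s P))"
    unfolding of_nat_sum by (rule sum.mono_neutral_left[OF T(1) sub]) (use T(2) in auto)
  also have "\<dots> = (\<Sum>P\<in>T. o' P - v P)" using ord T(2) by (intro sum.cong) auto
  also have "\<dots> = (\<Sum>P\<in>T. o' P) - (\<Sum>P\<in>T. v P)" by (rule sum_subtractf)
  also have "(\<Sum>P\<in>T. o' P) = (\<Sum>P\<in>{P \<in> C. o' P \<noteq> 0}. o' P)"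
    by (rule sum.mono_neutral_right[OF T(1)]) (use T(2) in \<open>auto simp: T_def\<close>)
  also note so
  also have "(\<Sum>P\<in>T. v P) = (\<Sum>P\<in>{P \<in> C. v P \<noteq> 0}. v P)"
    by (rule sum.mono_neutral_right[OF T(1)]) (use T(2) in \<open>auto simp: T_def\<close>)
  also note sv
  finally show "(\<Sum>P | P \<in> C \<and> zero_order L s P \<noteq> 0. zero_order L s P) = d"
    by (simp only: diff_0_right of_nat_eq_iff)
qed

text \<open>
  A constant quotient means \<open>a = c b\<close> in every chart.
\<close>

lemma quotient_not_constant:
  assumes B: "is_line_bundle C L" and a: "a \<in> H0 C L" and b: "b \<in> H0 C L" "b \<noteq> 0"
    and ind: "a \<notin> fvs.span {b}"
  shows "\<Phi> (quotient_fun L a b) \<notin> range fls_const"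
proof
  assume "\<Phi> (quotient_fun L a b) \<in> range fls_const"
  then obtain c where "\<Phi> (quotient_fun L a b) = \<Phi> (\<lambda>_. c)" using \<Phi>_const by auto
  then have c: "quotient_fun L a b \<asymp> (\<lambda>_. c)"
    by (simp only: \<Phi>_eq_iff[OF quotient_Rat[OF B a b] Rat_const])
  have "a = fscale c b"
  proof (rule chart_functions_eqI[OF B])
    fix i
    show "regular_on C (cover L i) (a i)" by (rule H0D(1)[OF a])
    show "regular_on C (cover L i) (fscale c b i)" unfolding fscale_def
      by (rule regular_on_mult[OF regular_on_const[OF bundleD(1)[OF B]] H0D(1)[OF b(1)]])
    show "a i \<asymp> fscale c b i" using quotient_times[OF B a b, of i] c
      by eventually_elim (simp add: fscale_def)
    show "a i P = 0" if "P \<notin> cover L i" for P by (rule H0D(2)[OF a that])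
    show "fscale c b i P = 0" if "P \<notin> cover L i" for P using H0D(2)[OF b(1) that] by (simp add: fscale_def)
  qed
  then show False using ind fvs.span_scale[OF fvs.span_base, of b "{b}" c] by simp
qed

text \<open>
  Multiplying \<open>t / b\<^sup>3 = q(a / b)\<close> by \<open>b\<^sup>3\<close> in every chart writes \<open>t\<close> as a combination of the cubic monomials
  in \<open>a\<close> and \<open>b\<close>.
\<close>

lemma quotient_not_cubic_polynomial:
  assumes B: "is_line_bundle C L" and a: "a \<in> H0 C L" and b: "b \<in> H0 C L" "b \<noteq> 0"
    and t: "t \<in> H0 C (tensor_power L 3)" and b3: "b ^ 3 \<in> H0 C (tensor_power L 3)" "b ^ 3 \<noteq> 0"
    and ind: "t \<notin> fvs.span {a ^ 3, a ^ 2 * b, a * b ^ 2, b ^ 3}"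
    and q: "Polynomial.degree q \<le> 3"
  shows "\<Phi> (quotient_fun (tensor_power L 3) t (b ^ 3)) \<noteq> PF.ap q (\<Phi> (quotient_fun L a b))"
proof
  note B3 = tensor_power_bundle[OF B, of 3]
  note xR = quotient_Rat[OF B a b] and yR = quotient_Rat[OF B3 t b3]
  assume "\<Phi> (quotient_fun (tensor_power L 3) t (b ^ 3)) = PF.ap q (\<Phi> (quotient_fun L a b))"
  then have e: "quotient_fun (tensor_power L 3) t (b ^ 3) \<asymp> (\<lambda>P. poly q (quotient_fun L a b P))"
    unfolding \<Phi>_peval[OF xR, symmetric] by (simp only: \<Phi>_eq_iff[OF yR Rat_poly[OF xR]])
  define r where "r = (\<lambda>i P. poly.coeff q 3 * a i P ^ 3 + poly.coeff q 2 * (a i P ^ 2 * b i P) +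
    poly.coeff q 1 * (a i P * b i P ^ 2) + poly.coeff q 0 * b i P ^ 3)"
  have pq: "poly q z = poly.coeff q 0 + poly.coeff q 1 * z + poly.coeff q 2 * z ^ 2 + poly.coeff q 3 * z ^ 3" for z
    using poly_eq_sum_le[OF q, of z] by (simp add: eval_nat_numeral)
  have tr: "t = r"
  proof (rule chart_functions_eqI[OF B])
    fix i
    note ra = H0D(1)[OF a, of i] and rb = H0D(1)[OF b(1), of i]
    show "regular_on C (cover L i) (t i)" using H0D(1)[OF t, of i] by simp
    show "regular_on C (cover L i) (r i)" unfolding r_def
      by (intro regular_on_add regular_on_mult regular_on_power regular_on_const ra rb bundleD(1)[OF B])
    show "t i \<asymp> r i"
      using quotient_times[OF B a b, of i] quotient_times[OF B3 t b3, of i] e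
    proof eventually_elim
      case (elim P)
      define z where "z = quotient_fun L a b P"
      have "t i P = poly q z * b i P ^ 3" using elim(2,3) by (simp add: z_def)
      also have "\<dots> = r i P" unfolding pq r_def elim(1)[symmetric] z_def[symmetric]
        by (simp add: algebra_simps power2_eq_square power3_eq_cube)
      finally show ?case .
    qed
    show "t i P = 0" if "P \<notin> cover L i" for P using H0D(2)[OF t, of P i] that by simp
    show "r i P = 0" if "P \<notin> cover L i" for P
      using H0D(2)[OF a that] H0D(2)[OF b(1) that] by (simp add: r_def)
  qed
  have "r = fscale (poly.coeff q 3) (a ^ 3) + fscale (poly.coeff q 2) (a ^ 2 * b) +
      fscale (poly.coeff q 1) (a * b ^ 2) + fscale (poly.coeff q 0) (b ^ 3)"
    by (simp add: r_def fscale_def fun_eq_iff)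
  also have "\<dots> \<in> fvs.span {a ^ 3, a ^ 2 * b, a * b ^ 2, b ^ 3}"
    by (intro fvs.span_add fvs.span_scale fvs.span_base) auto
  finally show False using ind tr by simp
qed

end

section \<open>The equation of a trigonal curve\<close>

theorem proposition10p10:
  fixes C :: "('n::finite) ppoint set"
    and L :: "('i, 'n) line_bundle"
    and s1 s2 t :: "'i \<Rightarrow> 'n ppoint \<Rightarrow> complex"
    and x y :: "'n rat_fun"
  assumes "smooth_projective_curve C"
    and "genus C = 7"
    and "\<not> hyperelliptic C"
    and "trigonal_line_bundle C L"
    and "maroni_degree C L = 1"
    and "is_basis [s1, s2] (H0 C L)"
    and "is_basis [s1 ^ 3, s1 ^ 2 * s2, s1 * s2 ^ 2, s2 ^ 3, t] (H0 C (tensor_power L 3))"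
    and "x = section_quotient C L s1 s2"
    and "y = section_quotient C (tensor_power L 3) t (s2 ^ 3)"
  shows "generate_field (function_field C) (range (const C) \<union> {x, y}) = carrier (function_field C) \<and>
    (\<exists>\<psi>3 \<psi>6 \<psi>9 :: complex poly.
       Polynomial.degree \<psi>3 \<le> 3 \<and> Polynomial.degree \<psi>6 \<le> 6 \<and> Polynomial.degree \<psi>9 \<le> 9 \<and>
       y [^]\<^bsub>function_field C\<^esub> (3::nat)
         \<oplus>\<^bsub>function_field C\<^esub> y [^]\<^bsub>function_field C\<^esub> (2::nat) \<otimes>\<^bsub>function_field C\<^esub> poly_at C \<psi>3 x
         \<oplus>\<^bsub>function_field C\<^esub> y \<otimes>\<^bsub>function_field C\<^esub> poly_at C \<psi>6 x
         \<oplus>\<^bsub>function_field C\<^esub> poly_at C \<psi>9 x = \<zero>\<^bsub>function_field C\<^esub>)"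
proof -
  interpret smooth_curve C
    using assms(1) unfolding smooth_projective_curve_def
    by (intro smooth_curve.intro projective_variety.intro smooth_curve_axioms.intro) blast+
  have B: "is_line_bundle C L" and deg: "line_bundle_degree C L = int 3"
    using assms(4) unfolding trigonal_line_bundle_def by auto
  note B3 = tensor_power_bundle[OF B, of 3]
  have sp: "fvs.span {s1, s2} = H0 C L" and i2: "fvs.independent {s1, s2}" "s1 \<noteq> s2"
    using assms(6) unfolding is_basis_def by auto
  have s1: "s1 \<in> H0 C L" and s2: "s2 \<in> H0 C L"
    unfolding sp[symmetric] by (simp_all add: fvs.span_base)
  have s20: "s2 \<noteq> 0" using i2(1) fvs.dependent_zero by auto
  have ind: "s1 \<notin> fvs.span {s2}" using i2 fvs.independent_insert[of s1 "{s2}"] by auto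
  have sp3: "fvs.span {s1 ^ 3, s1 ^ 2 * s2, s1 * s2 ^ 2, s2 ^ 3, t} = H0 C (tensor_power L 3)"
    and i3: "fvs.independent {s1 ^ 3, s1 ^ 2 * s2, s1 * s2 ^ 2, s2 ^ 3, t}"
    and d3: "t \<notin> {s1 ^ 3, s1 ^ 2 * s2, s1 * s2 ^ 2, s2 ^ 3}"
    using assms(7) unfolding is_basis_def by auto
  have t: "t \<in> H0 C (tensor_power L 3)" and s23: "s2 ^ 3 \<in> H0 C (tensor_power L 3)"
    unfolding sp3[symmetric] by (simp_all add: fvs.span_base)
  have s230: "s2 ^ 3 \<noteq> 0"
  proof
    assume "s2 ^ 3 = 0"
    then have "0 \<in> {s1 ^ 3, s1 ^ 2 * s2, s1 * s2 ^ 2, s2 ^ 3, t}" by simp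
    from fvs.dependent_zero[OF this] i3 show False by contradiction
  qed
  have "insert t {s1 ^ 3, s1 ^ 2 * s2, s1 * s2 ^ 2, s2 ^ 3} = {s1 ^ 3, s1 ^ 2 * s2, s1 * s2 ^ 2, s2 ^ 3, t}" by blast
  then have ind3: "t \<notin> fvs.span {s1 ^ 3, s1 ^ 2 * s2, s1 * s2 ^ 2, s2 ^ 3}"
    using i3 d3 fvs.independent_insert[of t "{s1 ^ 3, s1 ^ 2 * s2, s1 * s2 ^ 2, s2 ^ 3}"] by simp
  define fx where "fx = quotient_fun L s1 s2"
  define fy where "fy = quotient_fun (tensor_power L 3) t (s2 ^ 3)"
  have fx: "fx \<in> Rat" "x = cls fx"
    unfolding fx_def assms(8) by (rule quotient_Rat[OF B s1 s2 s20], rule section_quotient_eq[OF B s1 s2 s20])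
  have fy: "fy \<in> Rat" "y = cls fy"
    unfolding fy_def assms(9) by (rule quotient_Rat[OF B3 t s23 s230], rule section_quotient_eq[OF B3 t s23 s230])
  have nc: "\<Phi> fx \<notin> range fls_const" unfolding fx_def by (rule quotient_not_constant[OF B s1 s2 s20 ind])
  have vx: "PF.vge P (- int (zero_order L s2 P)) (\<Phi> fx)" if P: "P \<in> C" for P
    unfolding int_zero_order[OF B s2 s20 P] fx_def
    by (rule vge_quotient[OF quotient_Rat[OF B s1 s2 s20] section_germ_chart[OF B s2 P] section_not_geq_0[OF B s2 s20]
      section_germ_chart[OF B s1 P] quotient_times[OF B s1 s2 s20]])
  have vy: "PF.vge P (- 3 * int (zero_order L s2 P)) (\<Phi> fy)" if P: "P \<in> C" for P
  proof -
    define c where "c = chart_at L P"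
    have ch: "germ P (s c)" if "s \<in> H0 C (tensor_power L 3)" for s
      using section_germ_chart[OF B3 that P] by (simp add: c_def)
    have n0: "\<Phi> (s2 c) \<noteq> 0" using \<Phi>_eq_0_iff[OF section_Rat[OF B s2]] section_not_geq_0[OF B s2 s20] by simp
    have cube: "(s2 ^ 3) c = (\<lambda>Q. s2 c Q ^ 3)" by (rule ext) simp
    have "PF.vge P (- PF.val P (\<Phi> ((s2 ^ 3) c))) (\<Phi> fy)" unfolding fy_def
      by (rule vge_quotient[OF quotient_Rat[OF B3 t s23 s230] ch[OF s23] section_not_geq_0[OF B3 s23 s230]
        ch[OF t] quotient_times[OF B3 t s23 s230]])
    moreover have z: "int (zero_order L s2 P) = PF.val P (\<Phi> (s2 c))"
      unfolding c_def by (rule int_zero_order[OF B s2 s20 P])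
    have "PF.val P (\<Phi> ((s2 ^ 3) c)) = int 3 * int (zero_order L s2 P)"
      unfolding cube \<Phi>_power[OF section_Rat[OF B s2]] PF.val_power[OF P imageI[OF section_Rat[OF B s2]] n0] z ..
    ultimately show ?thesis by simp
  qed
  have np: "\<Phi> fy \<noteq> PF.ap q (\<Phi> fx)" if "Polynomial.degree q \<le> 3" for q
    unfolding fx_def fy_def by (rule quotient_not_cubic_polynomial[OF B s1 s2 s20 t s23 s230 ind3 that])
  have nq: "\<not> PF.quadratic_over z u"
    if "z \<in> \<Phi> ` Rat" "z \<notin> range fls_const" "u \<in> \<Phi> ` Rat" for z u
    using hyperelliptic_if_quadratic[OF that] assms(2,3) by auto
  have d: "finite {P \<in> C. zero_order L s2 P \<noteq> 0}"
    "(\<Sum>P | P \<in> C \<and> zero_order L s2 P \<noteq> 0. zero_order L s2 P) = 3"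
    using degree_eq_sum_zero_order[OF B s2 s20 deg] by simp_all
  have main: "\<forall>w\<in>\<Phi> ` Rat. \<exists>a b c d. d \<noteq> 0 \<and>
      PF.ap d (\<Phi> fx) * w = PF.ap a (\<Phi> fx) + PF.ap b (\<Phi> fx) * \<Phi> fy + PF.ap c (\<Phi> fx) * \<Phi> fy ^ 2"
    "\<exists>d0 d1 d2. Polynomial.degree d2 \<le> 3 \<and> Polynomial.degree d1 \<le> 6 \<and> Polynomial.degree d0 \<le> 9 \<and>
      \<Phi> fy ^ 3 + PF.ap d2 (\<Phi> fx) * \<Phi> fy ^ 2 + PF.ap d1 (\<Phi> fx) * \<Phi> fy + PF.ap d0 (\<Phi> fx) = 0"
    by (rule PF.trigonal_cubic_equation[OF imageI[OF fx(1)] nc imageI[OF fy(1)] d vx vy np nq]; assumption)+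
  have "generate_field FF (range (const C) \<union> {x, y}) = carrier FF"
    unfolding fx(2) fy(2) by (rule generate_field_eq_carrier[OF fx(1) fy(1) nc]) (rule bspec[OF main(1)])
  moreover from main(2) obtain d0 d1 d2 where
    "Polynomial.degree d0 \<le> 9" "Polynomial.degree d1 \<le> 6" "Polynomial.degree d2 \<le> 3"
    "\<Phi> fy ^ 3 + PF.ap d2 (\<Phi> fx) * \<Phi> fy ^ 2 + PF.ap d1 (\<Phi> fx) * \<Phi> fy + PF.ap d0 (\<Phi> fx) = 0"
    by (elim exE conjE)
  ultimately show ?thesis
    unfolding fx(2) fy(2) using cubic_in_function_field[OF fx(1) fy(1), of d2 d1 d0]
    by (intro conjI exI[of _ d2] exI[of _ d1] exI[of _ d0])
qed

end
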